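(* Let $n\ge1$ be an integer and $\check n:=\frac{n-1}{2}$. (i) It holds that $$\det(\Delta_n)=e^{f_{n,1}(\check{n})}\prod^{n-1}_{l=1}\bigl(\Gamma_l(n)\Gamma_l(1)\bigr)^{-1}\cdot\bigl(\Gamma_n(n)\Gamma_n(1)\bigr)^{-2}=\begin{cases}4\pi^2&(n=1),\\ \dfrac{1}{n-1}\,e^{f_{n,1}(\check n)+\sum_{k=0}^{n-1}d_n(k)\zeta'(-k)}&(n\ge2).\end{cases}$$ Here, for $0\le k\le n-1$, $d_n(k)$ is the rational number defined by the generating function $$\sum_{k=0}^{n-1}d_n(k)z^k=-\binom{z+n-2}{n-1}\frac{n+2z-1}{z}+(-1)^n\binom{-z+n-2}{n-1}\frac{n-2z-1}{-z}.$$ In particular, $d_n(k)=0$ if $k$ and $n$ have the same parity. (ii) It holds that $$\det(Y_n)=\Bigl(\frac{n(n-2)}{4}\Bigr)^{\delta_{n\ge 3}}e^{f_{n,1}(\frac12)}\prod^{n-1}_{l=1}\Bigl(\Gamma_l\bigl(\tfrac n2+1\bigr)\Gamma_l\bigl(\tfrac n2\bigr)\Bigr)^{-1}\cdot\Bigl(\Gamma_n\bigl(\tfrac n2+1\bigr)\Gamma_n\bigl(\tfrac n2\bigr)\Bigr)^{-2}$$ $$=\begin{cases}16&(n=1),\\ e^{\frac12-4\zeta'(-1)}&(n=2),\\ 2^{\frac{(-1)^{m+1}(2m-3)!!}{2^{2m-1}(2m)!!}}\,e^{\sum_{k=0}^{2m}(2^{-k}-1)y_{2m+1}(k)\zeta'(-k)}&(n=2m+1,\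 m\ge1),\\ e^{f_{2m,1}(\frac12)+\sum_{k=0}^{2m-1}y_{2m}(k)\zeta'(-k)}&(n=2m,\ m\ge2),\end{cases}$$ where $\delta_{n\ge3}:=1$ if $n\ge3$ and $0$ otherwise. Here, for $n\ge 3$ and $0\le k\le n-1$, $y_n(k)$ is the rational number defined by the generating function $$\sum_{k=0}^{2m}y_{2m+1}(k)z^k=(-1)^m\binom{2m-2}{m-1}^{-1}\binom{z+m-\frac32}{m-1}\binom{-z+m-\frac32}{m-1}+4(-1)^{m+1}\binom{2m}{m}^{-1}\binom{z+m-\frac12}{m}\binom{-z+m-\frac12}{m}$$ if $n=2m+1$ with $m\ge1$, and $$\sum_{k=0}^{2m-1}y_{2m}(k)z^k=\frac{(-1)^m(2m-2)}{z}\binom{2m-2}{m-1}^{-1}\binom{z+m-2}{m-1}\binom{-z+m-2}{m-1}+4\,\frac{(-1)^{m+1}2m}{z}\binom{2m}{m}^{-1}\binom{z+m-1}{m}\binom{-z+m-1}{m}$$ if $n=2m$ with $m\ge2$. In particular, $y_n(k)=0$ if $k$ and $n$ have the same parity.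
   Context: $\Delta_n$ denotes the (nonnegative) Laplacian on the unit sphere $S^n\subset\mathbb{R}^{n+1}$ with the standard metric: its eigenvalues are $k(k+n-1)$, $k=0,1,2,\dots$, where $0$ has multiplicity $1$ and, for $k\ge1$, $k(k+n-1)$ has multiplicity $\binom{n+k}{n}-\binom{n+k-2}{n}$. $Y_n:=\Delta_n+\frac{n(n-2)}{4}$ is the conformal Laplacian. For an operator $A$ with real discrete spectrum, $\zeta_A(w):=\sum_{\lambda}\lambda^{-w}$, the sum being over all (strictly) positive eigenvalues counted with multiplicity, and $\det(A):=\exp(-\zeta_A'(0))$, using the meromorphic continuation of $\zeta_A$ (for $A=\Delta_n,Y_n$ it exists and is holomorphic at $0$). $\zeta(w)$ is the Riemann zeta function. The Barnes multiple gamma function is $\Gamma_l(z):=\exp\bigl(\frac{\partial}{\partial w}\zeta_l(w,z)\big|_{w=0}\bigr)$, where $\zeta_l(w,z):=\sum_{m_1,\dots,m_l\ge0}(m_1+\cdots+m_l+z)^{-w}$ ($\mathrm{Re}(w)>l$), continued meromorphically in $w$. The polynomial $f_{n,1}$ is $$f_{n,1}(s):=\sum_{d=1}^{n-1}\frac{(-1)^{1+d}}{2(d+1)}\Bigl(\sum_{j=1}^{d}\frac1j\Bigr)(2s)^{d+1}T_{n,d}(s),$$ where the polynomials $T_{n,d}(s)$ ($0\le d\le n-1$) are determined by $P_n(z)=\sum_{d=0}^{n-1}T_{n,d}(s)(z-s)^d$ with $P_n(z):=\binom{z+\check n+1}{n}-\binom{z+\check n-1}{n}$. Binomial coefficients $\binom{x}{j}=x(x-1)\cdots(x-j+1)/j!$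 are polynomials in $x$. Double factorials: $(2m)!!=2\cdot4\cdots(2m)$, $(2m-3)!!=1\cdot3\cdots(2m-3)$, with $(-1)!!=1$. A quantity raised to the power $\delta_{n\ge3}=0$ is read as $1$. *)

theory Defs
  imports "HOL-Complex_Analysis.Complex_Analysis" "HOL-Library.Function_Algebras"
begin

text \<open>
  Meromorphic continuation to the whole plane of \<open>w \<mapsto> \<Sum>i\<in>I. t i w\<close>, where the sum converges
  absolutely for all \<open>w\<close> with sufficiently large real part. Such a continuation is unique by the
  identity theorem; \<^const>\<open>nicely_meromorphic_on\<close> only fixes the (irrelevant) values at poles.
\<close>

definition continued_sum :: "('i \<Rightarrow> complex \<Rightarrow> complex) \<Rightarrow> 'i set \<Rightarrow> complex \<Rightarrow> complex" where
  "continued_sum t I = (THE F. F nicely_meromorphic_on UNIV \<and>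
     (\<exists>c::real. \<forall>w. Re w > c \<longrightarrow> ((\<lambda>i. t i w) has_sum F w) I))"

definition riemann_zeta :: "complex \<Rightarrow> complex" where
  "riemann_zeta = continued_sum (\<lambda>m w. of_nat m powr (- w)) {1::nat..}"

definition barnes_zeta :: "nat \<Rightarrow> complex \<Rightarrow> complex \<Rightarrow> complex" where
  "barnes_zeta l z =
     continued_sum (\<lambda>ms w. (of_nat (sum_list ms) + z) powr (- w)) {ms :: nat list. length ms = l}"

definition barnes_Gamma :: "nat \<Rightarrow> complex \<Rightarrow> complex" where
  "barnes_Gamma l z = exp (deriv (barnes_zeta l z) 0)"


text \<open>
  An operator is a map \<open>A\<close> on functions together with its domain \<open>V\<close>, a linear space of
  real-valued functions. The multiplicity of an eigenvalue is the dimension of its eigenspace.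
\<close>

definition eigenspace :: "('a \<Rightarrow> real) set \<Rightarrow> (('a \<Rightarrow> real) \<Rightarrow> 'a \<Rightarrow> real) \<Rightarrow> real \<Rightarrow> ('a \<Rightarrow> real) set"
  where "eigenspace V A \<mu> = {f \<in> V. A f = (\<lambda>x. \<mu> * f x)}"

definition eigenvalues :: "('a \<Rightarrow> real) set \<Rightarrow> (('a \<Rightarrow> real) \<Rightarrow> 'a \<Rightarrow> real) \<Rightarrow> real set" where
  "eigenvalues V A = {\<mu>. \<exists>f\<in>eigenspace V A \<mu>. f \<noteq> (\<lambda>_. 0)}"

definition eigen_mult :: "('a \<Rightarrow> real) set \<Rightarrow> (('a \<Rightarrow> real) \<Rightarrow> 'a \<Rightarrow> real) \<Rightarrow> real \<Rightarrow> nat" where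
  "eigen_mult V A \<mu> = vector_space.dim (\<lambda>(c::real) f x. c * f x) (eigenspace V A \<mu>)"

text \<open>The scaling used above makes the function space a vector space, so its \<open>dim\<close> is meaningful.\<close>

lemma vector_space_fun_scale: "vector_space (\<lambda>(c::real) f (x::'a). c * f x)"
  by unfold_locales (auto simp: fun_eq_iff algebra_simps)

definition spectral_zeta ::
  "('a \<Rightarrow> real) set \<Rightarrow> (('a \<Rightarrow> real) \<Rightarrow> 'a \<Rightarrow> real) \<Rightarrow> complex \<Rightarrow> complex" where
  "spectral_zeta V A =
     continued_sum (\<lambda>\<mu> w. of_nat (eigen_mult V A \<mu>) * of_real \<mu> powr (- w)) (eigenvalues V A \<inter> {0<..})"

definition zeta_det :: "('a \<Rightarrow> real) set \<Rightarrow> (('a \<Rightarrow> real) \<Rightarrow> 'a \<Rightarrow> real) \<Rightarrow> complex" where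
  "zeta_det V A = exp (- deriv (spectral_zeta V A) 0)"


fun iter_partial :: "'a list \<Rightarrow> ('a::euclidean_space \<Rightarrow> real) \<Rightarrow> 'a \<Rightarrow> real" where
  "iter_partial [] f = f"
| "iter_partial (b # bs) f = (\<lambda>x. frechet_derivative (iter_partial bs f) (at x) b)"

definition smooth_real_on :: "'a::euclidean_space set \<Rightarrow> ('a \<Rightarrow> real) \<Rightarrow> bool" where
  "smooth_real_on S f \<longleftrightarrow> (\<forall>bs\<in>lists Basis. \<forall>x\<in>S. iter_partial bs f differentiable at x)"

text \<open>
  A function on the unit sphere is represented by a function on the ambient Euclidean space that
  vanishes off the sphere. It is smooth iff its extension to the punctured space that is constant
  on rays is smooth, and its Laplace-Beltrami operator is the restriction to the sphere of the
  Euclidean Laplacian of that extension. The sign makes the operator nonnegative.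
\<close>

definition radial_extension :: "('a::euclidean_space \<Rightarrow> real) \<Rightarrow> 'a \<Rightarrow> real" where
  "radial_extension f x = f (x /\<^sub>R norm x)"

definition smooth_sphere_functions :: "('a::euclidean_space \<Rightarrow> real) set" where
  "smooth_sphere_functions =
     {f. (\<forall>x. x \<notin> sphere 0 1 \<longrightarrow> f x = 0) \<and> smooth_real_on (- {0}) (radial_extension f)}"

definition sphere_laplacian :: "('a::euclidean_space \<Rightarrow> real) \<Rightarrow> 'a \<Rightarrow> real" where
  "sphere_laplacian f x =
     (if x \<in> sphere 0 1 then - (\<Sum>b\<in>Basis. iter_partial [b, b] (radial_extension f) x) else 0)"

text \<open>Here \<open>n\<close> is the dimension of the sphere, i.e. one less than that of the ambient space.\<close>

definition conformal_laplacian :: "nat \<Rightarrow> ('a::euclidean_space \<Rightarrow> real) \<Rightarrow> 'a \<Rightarrow> real" where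
  "conformal_laplacian n f = (\<lambda>x. sphere_laplacian f x + real n * (real n - 2) / 4 * f x)"


definition n_check :: "nat \<Rightarrow> real" where
  "n_check n = (real n - 1) / 2"

definition P_fun :: "nat \<Rightarrow> real \<Rightarrow> real" where
  "P_fun n z = ((z + n_check n + 1) gchoose n) - ((z + n_check n - 1) gchoose n)"

definition T_coeff :: "nat \<Rightarrow> real \<Rightarrow> nat \<Rightarrow> real" where
  "T_coeff n s = (THE T. (\<forall>d\<ge>n. T d = 0) \<and> (\<forall>z. P_fun n z = (\<Sum>d=0..n-1. T d * (z - s) ^ d)))"

definition f1 :: "nat \<Rightarrow> real \<Rightarrow> real" where
  "f1 n s = (\<Sum>d=1..n-1. (-1) ^ (1 + d) / (2 * (real d + 1)) * (\<Sum>j=1..d. 1 / real j)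
                           * (2 * s) ^ (d + 1) * T_coeff n s d)"


text \<open>
  The generating functions below are given by expressions with a removable singularity at
  \<open>z = 0\<close>, so the defining identity is required for \<open>z \<noteq> 0\<close>. Working over the rationals
  loses nothing, since both sides are rational functions of \<open>z\<close>.
\<close>

definition genfun_coeffs :: "nat \<Rightarrow> (rat \<Rightarrow> rat) \<Rightarrow> nat \<Rightarrow> rat" where
  "genfun_coeffs n G =
     (THE c. (\<forall>k\<ge>n. c k = 0) \<and> (\<forall>z. z \<noteq> 0 \<longrightarrow> (\<Sum>k=0..n-1. c k * z ^ k) = G z))"

definition d_genfun :: "nat \<Rightarrow> rat \<Rightarrow> rat" where
  "d_genfun n z =
     - ((z + of_nat n - 2) gchoose (n - 1)) * ((of_nat n + 2 * z - 1) / z)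
     + (-1) ^ n * ((- z + of_nat n - 2) gchoose (n - 1)) * ((of_nat n - 2 * z - 1) / (- z))"

definition d_coeff :: "nat \<Rightarrow> nat \<Rightarrow> rat" where
  "d_coeff n = genfun_coeffs n (d_genfun n)"

definition y_genfun_odd :: "nat \<Rightarrow> rat \<Rightarrow> rat" where
  "y_genfun_odd m z =
     (-1) ^ m * inverse (of_nat ((2 * m - 2) choose (m - 1)))
       * ((z + of_nat m - 3 / 2) gchoose (m - 1)) * ((- z + of_nat m - 3 / 2) gchoose (m - 1))
     + 4 * (-1) ^ (m + 1) * inverse (of_nat ((2 * m) choose m))
       * ((z + of_nat m - 1 / 2) gchoose m) * ((- z + of_nat m - 1 / 2) gchoose m)"

definition y_genfun_even :: "nat \<Rightarrow> rat \<Rightarrow> rat" where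
  "y_genfun_even m z =
     (-1) ^ m * (2 * of_nat m - 2) / z * inverse (of_nat ((2 * m - 2) choose (m - 1)))
       * ((z + of_nat m - 2) gchoose (m - 1)) * ((- z + of_nat m - 2) gchoose (m - 1))
     + 4 * ((-1) ^ (m + 1) * (2 * of_nat m) / z) * inverse (of_nat ((2 * m) choose m))
       * ((z + of_nat m - 1) gchoose m) * ((- z + of_nat m - 1) gchoose m)"

definition y_genfun :: "nat \<Rightarrow> rat \<Rightarrow> rat" where
  "y_genfun n = (if odd n then y_genfun_odd (n div 2) else y_genfun_even (n div 2))"

definition y_coeff :: "nat \<Rightarrow> nat \<Rightarrow> rat" where
  "y_coeff n = genfun_coeffs n (y_genfun n)"

text \<open>Over the integers, so that \<open>(-1)!! = 1\<close> is the empty product.\<close>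

definition double_fact :: "int \<Rightarrow> int" where
  "double_fact k = \<Prod>{i. 1 \<le> i \<and> i \<le> k \<and> even (k - i)}"

end

theory Submission
  imports Defs
begin

text \<open>
  Orthogonality and density of the harmonic polynomials on the sphere identify the spectrum: the
  eigenvalue with number \<open>k\<close> is a product \<open>x * (x + 2 * s)\<close>, where \<open>x\<close> runs through an arithmetic
  progression, and its multiplicity is \<open>P_fun n (x + s)\<close>. Comparing the zeta function of the products
  with those of the factors \<open>x\<close> and \<open>x + 2 * s\<close>, all expanded in powers of \<open>s\<close>, the derivatives at \<open>0\<close>
  differ by \<open>f1 n s\<close>: a zero of a binomial coefficient at \<open>w = 0\<close> cancels a pole of the Hurwitz zeta
  function. For a single factor, the binomial coefficients in the multiplicity are those that count
  the lattice points in Barnes zeta functions. Shifting both factors to the same progression instead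
  adds the two multiplicity polynomials, whose sum is minus the generating function of the
  \<open>d_coeff\<close> or \<open>y_coeff\<close>, and leaves values of Hurwitz zeta functions at \<open>1\<close> or \<open>1 / 2\<close>.
\<close>

section \<open>Regularised sums\<close>

text \<open>The expansions in powers of \<open>s\<close> contain values and remainders without
  closed form. They are never evaluated: the factor \<open>x + 2 * s\<close> and the product
  \<open>x * (x + 2 * s)\<close> share them, so they cancel. Only residue terms survive, because a
  zero at \<open>w = 0\<close> meeting the pole \<open>1 / (p * w)\<close> contributes
  \<open>1 / p\<close>, which is not linear in the number \<open>p\<close> of factors. An eigenspace
  consists of all smooth eigenfunctions, so completeness is needed, not only the eigenvalue
  equation. Surface measure is replaced by a volume integral with weight supported in an annulus:
  integration by parts takes place in Euclidean space, and the origin, where radial extensions are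
  singular, is cut out. The shift leaves logarithms: \<open>ln (n - 1)\<close> for the Laplacian,
  and for the conformal one with \<open>n \<ge> 3\<close> two whose sum is the logarithm of
  \<open>n * (n - 2) / 4\<close>, which cancels the prefactor. The power of 2 for odd
  \<open>n \<ge> 3\<close> comes from differentiating \<open>2 powr w - 1\<close>: zeta vanishes at
  the negative even integers, the coefficients with odd index vanish, and only the value
  \<open>-1 / 2\<close> at 0 is left.\<close>

text \<open>The difference, freed of removable singularities, is zero on \<open>B\<close> and hence
  on \<open>A\<close>. This gives equality near each point but not at it; there \<open>F\<close> and
  \<open>G\<close> share their limit, or both have a pole and the normalisation assigns 0 to
  both.\<close>

lemma nicely_meromorphic_eqI:
  assumes F: "F nicely_meromorphic_on A" and G: "G nicely_meromorphic_on A"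
    and A: "open A" "connected A"
    and B: "open B" "B \<noteq> {}" "B \<subseteq> A" and eq: "\<And>w. w \<in> B \<Longrightarrow> F w = G w"
    and w: "w \<in> A"
  shows "F w = G w"
proof -
  let ?D = "remove_sings (\<lambda>w. F w - G w)"
  have mero: "(\<lambda>w. F w - G w) meromorphic_on A"
    using F G by (auto simp: nicely_meromorphic_on_def intro!: meromorphic_intros)
  have D: "?D nicely_meromorphic_on A"
    by (rule remove_sings_nicely_meromorphic[OF mero])
  have D0: "?D z = 0" if "z \<in> B" for z
  proof (rule remove_sings_eqI)
    have "eventually (\<lambda>u. u \<in> B) (at z)"
      using B(1) that by (rule eventually_at_in_open')
    then have "eventually (\<lambda>u. F u - G u = 0) (at z)"
      by eventually_elim (auto simp: eq)
    then show "(\<lambda>u. F u - G u) \<midarrow>z\<rightarrow> 0"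
      by (rule tendsto_eventually)
  qed
  obtain z0 where z0: "z0 \<in> B" using B(2) by auto
  have "eventually (\<lambda>u. u \<in> B) (at z0)"
    using B(1) z0 by (rule eventually_at_in_open')
  then have "eventually (\<lambda>u. ?D u = 0) (at z0)"
    by eventually_elim (auto simp: D0)
  then have "frequently (\<lambda>u. ?D u = 0) (at z0)"
    by (intro eventually_frequently) auto
  then have DA: "?D u = 0" if "u \<in> A" for u
    using frequently_eq_meromorphic_imp_constant[OF _ D A _ that] z0 B(3) by auto
  have "isolated_singularity_at (\<lambda>w. F w - G w) w"
    using mero w by (auto simp: meromorphic_on_altdef)
  then have "eventually (\<lambda>u. ?D u = F u - G u) (at w)"
    by (rule eventually_remove_sings_eq_at)
  moreover have "eventually (\<lambda>u. u \<in> A) (at w)"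
    using A(1) w by (rule eventually_at_in_open')
  ultimately have ev: "eventually (\<lambda>u. F u = G u) (at w)"
    by eventually_elim (auto simp: DA)
  have pole: "is_pole F w \<longleftrightarrow> is_pole G w"
    using ev by (intro is_pole_cong) auto
  have lim: "F \<midarrow>w\<rightarrow> l \<longleftrightarrow> G \<midarrow>w\<rightarrow> l" for l
    using ev by (intro tendsto_cong)
  have np: "\<not> is_pole f w" if "f \<midarrow>w\<rightarrow> l" for f :: "complex \<Rightarrow> complex" and l
    using that unfolding is_pole_def
    by (meson at_neq_bot not_tendsto_and_filterlim_at_infinity)
  from F G w have "is_pole F w \<and> F w = 0 \<or> F \<midarrow>w\<rightarrow> F w" "is_pole G w \<and> G w = 0 \<or> G \<midarrow>w\<rightarrow> G w"
    by (auto simp: nicely_meromorphic_on_def)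
  then show ?thesis
    using pole lim np[of F] np[of G] tendsto_unique[of "at w" F] by (metis at_neq_bot)
qed

lemma connected_Re_gt: "connected {w. Re w > c}"
  by (intro convex_connected convex_halfspace_Re_gt)

lemma nonempty_Re_gt: "{w. Re w > c} \<noteq> {}"
proof -
  have "of_real (c + 1) \<in> {w. Re w > c}" by simp
  then show ?thesis by blast
qed

text \<open>Two candidates agree on a half-plane where both are the sum of the series, so the
  identity theorem leaves one object for the definite description.\<close>

lemma continued_sum_eqI:
  assumes F: "F nicely_meromorphic_on UNIV"
    and sum: "\<And>w. Re w > c \<Longrightarrow> ((\<lambda>i. t i w) has_sum F w) I"
  shows "continued_sum t I = F"
  unfolding continued_sum_def
proof (rule the_equality)
  show "F nicely_meromorphic_on UNIV \<and> (\<exists>c. \<forall>w. c < Re w \<longrightarrow> ((\<lambda>i. t i w) has_sum F w) I)"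
    using assms by blast
next
  fix G assume "G nicely_meromorphic_on UNIV \<and> (\<exists>c. \<forall>w. c < Re w \<longrightarrow> ((\<lambda>i. t i w) has_sum G w) I)"
  then obtain c' where G: "G nicely_meromorphic_on UNIV"
    and c': "\<And>w. c' < Re w \<Longrightarrow> ((\<lambda>i. t i w) has_sum G w) I" by blast
  show "G = F"
  proof
    fix w
    show "G w = F w"
      by (rule nicely_meromorphic_eqI[OF G F, of "{w. Re w > max c c'}"])
         (use nonempty_Re_gt[of "max c c'"] in \<open>auto simp del: max_less_iff_conj intro!: open_halfspace_Re_gt intro: has_sum_unique[OF c' sum]\<close>)
  qed
qed

section \<open>A calculus of regularised derivatives at 0\<close>

text \<open>\<open>D\<close> is the derivative at 0 of the continued sum, that is, minus the
  logarithm of a regularised product. A relation with an arbitrary continuation \<open>F\<close> is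
  easier to combine than \<open>continued_sum\<close>, whose values at poles are normalised.
  Analyticity on the half-plane ensures that normalising \<open>F\<close> does not disturb the sum
  there.\<close>

definition zeta_reg :: "('i \<Rightarrow> complex \<Rightarrow> complex) \<Rightarrow> 'i set \<Rightarrow> complex \<Rightarrow> bool" where
  "zeta_reg t I D \<longleftrightarrow> (\<exists>F c. F meromorphic_on UNIV \<and> F analytic_on {0} \<and>
     F analytic_on {w. Re w > c} \<and> (\<forall>w. Re w > (c::real) \<longrightarrow> ((\<lambda>i. t i w) has_sum F w) I) \<and>
     deriv F 0 = D)"

lemma zeta_regI:
  assumes "F meromorphic_on UNIV" "F analytic_on {0}" "F analytic_on {w. Re w > c}"
    "\<And>w. Re w > c \<Longrightarrow> ((\<lambda>i. t i w) has_sum F w) I" "deriv F 0 = D"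
  shows "zeta_reg t I D"
  using assms unfolding zeta_reg_def by blast

text \<open>The half-plane may be shrunk at will, so that two continuations are analytic on a common
  one when they are added.\<close>

lemma zeta_regE:
  assumes "zeta_reg t I D"
  obtains F c where "F meromorphic_on UNIV" "F analytic_on {0}"
    "\<And>c'. c' \<ge> c \<Longrightarrow> F analytic_on {w. Re w > c'}"
    "\<And>w. Re w > c \<Longrightarrow> ((\<lambda>i. t i w) has_sum F w) I" "deriv F 0 = D"
proof -
  from assms obtain F c where F: "F meromorphic_on UNIV" "F analytic_on {0}"
    "F analytic_on {w. Re w > c}"
    "\<And>w. Re w > c \<Longrightarrow> ((\<lambda>i. t i w) has_sum F w) I" "deriv F 0 = D"
    unfolding zeta_reg_def by blast
  have "F analytic_on {w. Re w > c'}" if "c' \<ge> c" for c'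
    using F(3) by (rule analytic_on_subset) (use that in auto)
  then show ?thesis using that F by blast
qed

text \<open>\<open>remove_sings F\<close> is the normalised continuation; it coincides with
  \<open>F\<close> near 0 and on the half-plane. The resulting uniqueness of \<open>D\<close> later
  turns two evaluations of one series into an equation.\<close>

lemma zeta_reg_continued_sum:
  assumes "zeta_reg t I D"
  shows "deriv (continued_sum t I) 0 = D"
proof -
  from assms obtain F c where F: "F meromorphic_on UNIV" "F analytic_on {0}"
    "\<And>c'. c' \<ge> c \<Longrightarrow> F analytic_on {w. Re w > c'}"
    and s: "\<And>w. Re w > c \<Longrightarrow> ((\<lambda>i. t i w) has_sum F w) I" and D: "deriv F 0 = D"
    by (rule zeta_regE) blast
  have "F analytic_on {w}" if "Re w > c" for w
    using F(3)[of c] by (rule analytic_on_subset) (use that in auto)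
  then have "continued_sum t I = remove_sings F"
    using s by (intro continued_sum_eqI[of _ c] remove_sings_nicely_meromorphic F) auto
  then show ?thesis
    using F(2) D by simp
qed

lemma zeta_reg_unique:
  assumes "zeta_reg t I D" "zeta_reg t I D'"
  shows "D = D'"
  using assms[THEN zeta_reg_continued_sum] by simp

lemma zeta_reg_cong:
  assumes "\<And>i w. i \<in> I \<Longrightarrow> t i w = t' i w" "I = J" "D = D'"
  shows "zeta_reg t I D \<longleftrightarrow> zeta_reg t' J D'"
proof -
  have "((\<lambda>i. t i w) has_sum x) I \<longleftrightarrow> ((\<lambda>i. t' i w) has_sum x) I" for w x
    by (intro has_sum_cong assms)
  then show ?thesis using assms(2,3) unfolding zeta_reg_def by simp
qed

lemma zeta_reg_add:
  assumes "zeta_reg t I D" "zeta_reg t' I D'"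
  shows "zeta_reg (\<lambda>i w. t i w + t' i w) I (D + D')"
proof -
  from assms(1) obtain F c where F: "F meromorphic_on UNIV" "F analytic_on {0}"
    "\<And>c'. c' \<ge> c \<Longrightarrow> F analytic_on {w. Re w > c'}"
    "\<And>w. Re w > c \<Longrightarrow> ((\<lambda>i. t i w) has_sum F w) I" "deriv F 0 = D"
    by (rule zeta_regE) blast
  from assms(2) obtain F' c' where F': "F' meromorphic_on UNIV" "F' analytic_on {0}"
    "\<And>c''. c'' \<ge> c' \<Longrightarrow> F' analytic_on {w. Re w > c''}"
    "\<And>w. Re w > c' \<Longrightarrow> ((\<lambda>i. t' i w) has_sum F' w) I" "deriv F' 0 = D'"
    by (rule zeta_regE) blast
  show ?thesis
  proof (rule zeta_regI[where F = "\<lambda>w. F w + F' w" and c = "max c c'"])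
    show "deriv (\<lambda>w. F w + F' w) 0 = D + D'"
      using F(2,5) F'(2,5) by (simp add: deriv_add analytic_on_imp_differentiable_at)
  qed (use F F' in \<open>auto simp del: max_less_iff_conj intro!: meromorphic_intros analytic_intros has_sum_add\<close>)
qed

lemma zeta_reg_cmult:
  assumes "zeta_reg t I D"
  shows "zeta_reg (\<lambda>i w. x * t i w) I (x * D)"
proof -
  from assms(1) obtain F c where F: "F meromorphic_on UNIV" "F analytic_on {0}"
    "\<And>c'. c' \<ge> c \<Longrightarrow> F analytic_on {w. Re w > c'}"
    "\<And>w. Re w > c \<Longrightarrow> ((\<lambda>i. t i w) has_sum F w) I" "deriv F 0 = D"
    by (rule zeta_regE) blast
  show ?thesis
  proof (rule zeta_regI[where F = "\<lambda>w. x * F w" and c = c])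
    show "deriv (\<lambda>w. x * F w) 0 = x * D"
      using F(2,5) by (simp add: deriv_cmult analytic_on_imp_differentiable_at)
  qed (use F in \<open>auto intro!: meromorphic_intros analytic_intros has_sum_cmult_right\<close>)
qed

lemma zeta_reg_zero: "zeta_reg (\<lambda>i w. 0) I 0"
  by (rule zeta_regI[where F = "\<lambda>w. 0" and c = 0]) (auto intro!: meromorphic_intros)

lemma zeta_reg_sum:
  assumes "\<And>x. x \<in> X \<Longrightarrow> zeta_reg (t x) I (D x)"
  shows "zeta_reg (\<lambda>i w. \<Sum>x\<in>X. t x i w) I (\<Sum>x\<in>X. D x)"
  using assms by (induction X rule: infinite_finite_induct) (auto intro: zeta_reg_zero zeta_reg_add)

lemma zeta_reg_reindex:
  assumes "bij_betw h J I"
  shows "zeta_reg (\<lambda>j w. t (h j) w) J D \<longleftrightarrow> zeta_reg t I D"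
  unfolding zeta_reg_def by (subst has_sum_reindex_bij_betw[OF assms]) (rule refl)

lemma zeta_reg_Un_disjoint:
  assumes "zeta_reg t I D" "zeta_reg t J D'" "I \<inter> J = {}"
  shows "zeta_reg t (I \<union> J) (D + D')"
proof -
  from assms(1) obtain F c where F: "F meromorphic_on UNIV" "F analytic_on {0}"
    "\<And>c'. c' \<ge> c \<Longrightarrow> F analytic_on {w. Re w > c'}"
    "\<And>w. Re w > c \<Longrightarrow> ((\<lambda>i. t i w) has_sum F w) I" "deriv F 0 = D"
    by (rule zeta_regE) blast
  from assms(2) obtain F' c' where F': "F' meromorphic_on UNIV" "F' analytic_on {0}"
    "\<And>c''. c'' \<ge> c' \<Longrightarrow> F' analytic_on {w. Re w > c''}"
    "\<And>w. Re w > c' \<Longrightarrow> ((\<lambda>i. t i w) has_sum F' w) J" "deriv F' 0 = D'"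
    by (rule zeta_regE) blast
  show ?thesis
  proof (rule zeta_regI[where F = "\<lambda>w. F w + F' w" and c = "max c c'"])
    show "deriv (\<lambda>w. F w + F' w) 0 = D + D'"
      using F(2,5) F'(2,5) by (simp add: deriv_add analytic_on_imp_differentiable_at)
  qed (use F F' assms(3) in \<open>auto simp del: max_less_iff_conj intro!: meromorphic_intros analytic_intros has_sum_Un_disjoint\<close>)
qed

text \<open>One summand is entire in \<open>w\<close>. Together with
  \<open>zeta_reg_Un_disjoint\<close> this adds finitely many terms to a series at the price of
  logarithms.\<close>

lemma zeta_reg_single:
  assumes "x > 0"
  shows "zeta_reg (\<lambda>i w. m i * of_real x powr (- w)) {i} (- (m i * of_real (ln x)))"
proof (rule zeta_regI[where F = "\<lambda>w. m i * of_real x powr (- w)" and c = 0])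
  have an: "(\<lambda>w. m i * complex_of_real x powr (- w)) analytic_on A" for A
    using assms by (auto intro!: analytic_intros simp: complex_nonpos_Reals_iff)
  show "(\<lambda>w. m i * complex_of_real x powr (- w)) meromorphic_on UNIV"
    by (rule analytic_on_imp_meromorphic_on[OF an])
  show "deriv (\<lambda>w. m i * complex_of_real x powr (- w)) 0 = - (m i * complex_of_real (ln x))"
    using assms by (auto intro!: DERIV_imp_deriv derivative_eq_intros simp: powr_def Ln_of_real)
  show "((\<lambda>j. m j * complex_of_real x powr (- w)) has_sum m i * complex_of_real x powr (- w)) {i}" for w
    using has_sum_finite[of "{i}" "\<lambda>j. m j * complex_of_real x powr (- w)"] by simp
qed (use assms in \<open>auto intro!: analytic_intros simp: complex_nonpos_Reals_iff\<close>)

text \<open>An expansion with finitely many terms reaches only a half-plane, and further left only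
  with more terms. All pieces agree with \<open>f\<close> far to the right, so by the identity
  theorem any two agree wherever both are defined.\<close>

lemma glue_halfplanes:
  fixes G :: "nat \<Rightarrow> complex \<Rightarrow> complex"
  assumes G: "\<And>K. G K nicely_meromorphic_on {w. Re w > - real K}"
    and eq: "\<And>K w. Re w > c \<Longrightarrow> G K w = f w"
  obtains H where "H nicely_meromorphic_on UNIV" "\<And>K w. Re w > - real K \<Longrightarrow> H w = G K w"
proof -
  have agree: "G K w = G L w" if "Re w > - real K" "K \<le> L" for K L w
  proof (rule nicely_meromorphic_eqI[OF G[of K], of _ "{w. Re w > max c (- real K)}"])
    show "G L nicely_meromorphic_on {w. Re w > - real K}"
      using G[of L] by (rule nicely_meromorphic_on_subset) (use \<open>K \<le> L\<close> in auto)
  qed (use that nonempty_Re_gt[of "max c (- real K)"] in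
       \<open>auto simp: eq simp del: max_less_iff_conj intro!: open_halfspace_Re_gt connected_Re_gt\<close>)
  \<comment> \<open>Any index whose half-plane contains \<open>w\<close> would give the same value;
    this one is computed from \<open>w\<close>.\<close>
  define H where "H w = G (nat \<lceil>\<bar>Re w\<bar>\<rceil> + 1) w" for w
  have H: "H w = G K w" if "Re w > - real K" for K w
  proof -
    have "Re w > - real (nat \<lceil>\<bar>Re w\<bar>\<rceil> + 1)" by linarith
    then show ?thesis
      unfolding H_def using that agree nle_le by metis
  qed
  have "H nicely_meromorphic_on UNIV"
    unfolding nicely_meromorphic_on_def
  proof (intro conjI ballI)
    fix z :: complex
    define K where "K = nat \<lceil>\<bar>Re z\<bar>\<rceil> + 1"
    have z: "z \<in> {w. Re w > - real K}" unfolding K_def by simp linarith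
    have "eventually (\<lambda>w. w \<in> {w. Re w > - real K}) (at z)"
      by (rule eventually_at_in_open'[OF open_halfspace_Re_gt z])
    then have ev: "eventually (\<lambda>w. H w = G K w) (at z)"
      by eventually_elim (auto simp: H)
    have Gz: "is_pole (G K) z \<and> G K z = 0 \<or> G K \<midarrow>z\<rightarrow> G K z"
      using G[of K] z by (auto simp: nicely_meromorphic_on_def)
    have "is_pole H z \<longleftrightarrow> is_pole (G K) z"
      using ev by (intro is_pole_cong) auto
    moreover have "H \<midarrow>z\<rightarrow> l \<longleftrightarrow> G K \<midarrow>z\<rightarrow> l" for l
      using ev by (intro tendsto_cong)
    ultimately show "is_pole H z \<and> H z = 0 \<or> H \<midarrow>z\<rightarrow> H z"
      using Gz H z by auto
  next
    show "H meromorphic_on UNIV"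
    proof (subst meromorphic_on_meromorphic_at, intro ballI)
      fix z :: complex
      define K where "K = nat \<lceil>\<bar>Re z\<bar>\<rceil> + 1"
      have z: "z \<in> {w. Re w > - real K}" unfolding K_def by simp linarith
      have "eventually (\<lambda>w. w \<in> {w. Re w > - real K}) (at z)"
        by (rule eventually_at_in_open'[OF open_halfspace_Re_gt z])
      then have ev: "eventually (\<lambda>w. H w = G K w) (at z)"
        by eventually_elim (auto simp: H)
      have "G K meromorphic_on {z}"
        using G[of K] z by (auto simp: nicely_meromorphic_on_def intro: meromorphic_on_subset)
      then show "H meromorphic_on {z}"
        using meromorphic_on_cong[of "{z}" H "G K" "{z}"] ev by auto
    qed
  qed
  then show ?thesis using that H by blast
qed

section \<open>The Hurwitz zeta function\<close>

text \<open>The M-test gives locally uniform convergence, which preserves holomorphy and allows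
  termwise differentiation. The majorant is required only for large \<open>j\<close>, since
  estimates of binomial remainders need a small argument.\<close>

lemma holomorphic_series:
  fixes t :: "nat \<Rightarrow> complex \<Rightarrow> complex"
  assumes U: "open U" and t: "\<And>j. t j holomorphic_on U"
    and M: "\<And>w. w \<in> U \<Longrightarrow> \<exists>r M. r > 0 \<and> cball w r \<subseteq> U \<and> summable M \<and>
      (\<forall>\<^sub>F j in sequentially. \<forall>u\<in>cball w r. norm (t j u) \<le> M j)"
  shows "(\<lambda>w. \<Sum>j. t j w) holomorphic_on U"
    and "w \<in> U \<Longrightarrow> ((\<lambda>j. t j w) has_sum (\<Sum>j. t j w)) UNIV"
    and "w \<in> U \<Longrightarrow> (\<lambda>j. deriv (t j) w) sums deriv (\<lambda>w. \<Sum>j. t j w) w"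
proof -
  have ul: "\<exists>r>0. cball w r \<subseteq> U \<and> summable (\<lambda>j. norm (t j w)) \<and>
      uniform_limit (cball w r) (\<lambda>n x. \<Sum>j<n. t j x) (\<lambda>x. \<Sum>j. t j x) sequentially"
    if w: "w \<in> U" for w
  proof -
    obtain r M where r: "r > 0" "cball w r \<subseteq> U" "summable M"
      and ev: "\<forall>\<^sub>F j in sequentially. \<forall>u\<in>cball w r. norm (t j u) \<le> M j"
      using M[OF w] by blast
    have "\<forall>\<^sub>F j in sequentially. norm (norm (t j w)) \<le> M j"
      using ev by eventually_elim (use r(1) in auto)
    then have "summable (\<lambda>j. norm (t j w))"
      using r(3) by (rule summable_comparison_test_ev)
    then show ?thesis
      using r Weierstrass_m_test_ev[OF ev r(3)] by blast
  qed
  show holo: "(\<lambda>w. \<Sum>j. t j w) holomorphic_on U"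
    unfolding holomorphic_on_def
  proof
    fix w assume w: "w \<in> U"
    obtain r where r: "r > 0" "cball w r \<subseteq> U"
      and lim: "uniform_limit (cball w r) (\<lambda>n x. \<Sum>j<n. t j x) (\<lambda>x. \<Sum>j. t j x) sequentially"
      using ul[OF w] by blast
    have h: "(\<lambda>x. \<Sum>j<n. t j x) holomorphic_on cball w r" for n
      by (intro holomorphic_intros holomorphic_on_subset[OF t r(2)])
    have "(\<lambda>x. \<Sum>j. t j x) holomorphic_on ball w r"
    proof (rule holomorphic_uniform_limit[OF _ lim])
      show "\<forall>\<^sub>F n in sequentially. continuous_on (cball w r) (\<lambda>x. \<Sum>j<n. t j x) \<and>
          (\<lambda>x. \<Sum>j<n. t j x) holomorphic_on ball w r"
        using h by (auto intro!: always_eventually holomorphic_on_imp_continuous_on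
            intro: holomorphic_on_subset[OF h ball_subset_cball])
    qed auto
    then have "(\<lambda>x. \<Sum>j. t j x) field_differentiable at w"
      using r(1) by (auto simp: holomorphic_on_open field_differentiable_def)
    then show "(\<lambda>x. \<Sum>j. t j x) field_differentiable at w within U"
      by (rule field_differentiable_at_within)
  qed
  assume w: "w \<in> U"
  obtain r where r: "r > 0" "cball w r \<subseteq> U" and sm: "summable (\<lambda>j. norm (t j w))"
    and lim: "uniform_limit (cball w r) (\<lambda>n x. \<Sum>j<n. t j x) (\<lambda>x. \<Sum>j. t j x) sequentially"
    using ul[OF w] by blast
  show "((\<lambda>j. t j w) has_sum (\<Sum>j. t j w)) UNIV"
    by (rule norm_summable_imp_has_sum[OF sm summable_sums[OF summable_norm_cancel[OF sm]]])
  have "(\<lambda>n. deriv (\<lambda>x. \<Sum>j<n. t j x) w) \<longlonglongrightarrow> deriv (\<lambda>x. \<Sum>j. t j x) w"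
  proof (rule deriv_complex_uniform_limit[where A = "ball w r"])
    show "uniform_limit (ball w r) (\<lambda>n x. \<Sum>j<n. t j x) (\<lambda>x. \<Sum>j. t j x) sequentially"
      using lim by (rule uniform_limit_on_subset) auto
    show "\<forall>\<^sub>F n in sequentially. (\<lambda>x. \<Sum>j<n. t j x) holomorphic_on ball w r"
      using r(2) by (intro always_eventually allI holomorphic_intros holomorphic_on_subset[OF t]) auto
  qed (use r in auto)
  moreover have "deriv (\<lambda>x. \<Sum>j<n. t j x) w = (\<Sum>j<n. deriv (t j) w)" for n
    using t[THEN holomorphic_on_imp_differentiable_at, OF U w] by (intro deriv_sum) auto
  ultimately show "(\<lambda>j. deriv (t j) w) sums deriv (\<lambda>w. \<Sum>j. t j w) w"
    by (simp add: sums_def)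
qed

section \<open>The binomial series with remainder\<close>

definition binomial_remainder :: "nat \<Rightarrow> complex \<Rightarrow> complex \<Rightarrow> complex" where
  "binomial_remainder K w z = (1 + z) powr (- w) - (\<Sum>i<K. ((- w) gchoose i) * z ^ i)"

text \<open>For \<open>norm w \<le> M\<close> the binomial coefficients of \<open>- w\<close> are
  dominated by those of \<open>- M\<close> made positive, called \<open>B\<close>. The binomial
  series of \<open>- M\<close> at \<open>-1 / 2\<close> has exactly the terms
  \<open>B i * (1 / 2) ^ i\<close>, so its convergence gives a constant that is uniform in
  \<open>w\<close> and \<open>z\<close>.\<close>

lemma binomial_remainder_bound:
  fixes M :: real
  assumes "M \<ge> 0"
  obtains C where "C \<ge> 0"
    "\<And>w z. norm w \<le> M \<Longrightarrow> norm z \<le> 1 / 2 \<Longrightarrow> norm (binomial_remainder K w z) \<le> C * norm z ^ K"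
proof -
  define B where "B i = ((- M) gchoose i) * (- 1) ^ i" for i
  have B: "B i = (\<Prod>k<i. (M + real k)) / fact i" for i
  proof -
    have "((- M) gchoose i) = (\<Prod>k<i. (- 1) * (M + real k)) / fact i"
      by (simp add: gbinomial_prod_rev atLeast0LessThan algebra_simps)
    then show ?thesis
      unfolding B_def prod.distrib by (simp add: power_mult_distrib[symmetric])
  qed
  have B0: "B i \<ge> 0" for i
    unfolding B using assms by (auto intro!: divide_nonneg_nonneg prod_nonneg)
  have bound: "norm ((- w) gchoose i) \<le> B i" if "norm w \<le> M" for w :: complex and i
  proof -
    have "norm ((- w) gchoose i) = (\<Prod>k<i. norm (- w - of_nat k)) / fact i"
      by (simp add: gbinomial_prod_rev norm_divide prod_norm atLeast0LessThan)
    also have "(\<Prod>k<i. norm (- w - of_nat k)) \<le> (\<Prod>k<i. M + real k)"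
    proof (rule prod_mono)
      fix k
      have "norm (- w - of_nat k) \<le> norm (- w) + norm (of_nat k :: complex)"
        by (rule norm_triangle_ineq4)
      then show "0 \<le> norm (- w - of_nat k) \<and> norm (- w - of_nat k) \<le> M + real k"
        using that by simp
    qed
    finally show ?thesis unfolding B by (simp add: divide_right_mono)
  qed
  have "(\<lambda>i. ((- M) gchoose i) * (- (1 / 2)) ^ i) sums (1 + - (1 / 2)) powr (- M)"
    by (rule gen_binomial_real) auto
  moreover have "((- M) gchoose i) * (- (1 / 2)) ^ i = B i * (1 / 2) ^ i" for i
    unfolding B_def by (simp add: power_mult_distrib[symmetric] mult.assoc)
  ultimately have "summable (\<lambda>i. B i * (1 / 2) ^ i)"
    by (simp add: sums_iff)
  then have "summable (\<lambda>i. B (i + K) * (1 / 2) ^ (i + K))"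
    by (subst summable_iff_shift)
  then have "summable (\<lambda>i. 2 ^ K * (B (i + K) * (1 / 2) ^ (i + K)))"
    by (rule summable_mult)
  then have sm: "summable (\<lambda>i. B (i + K) * (1 / 2) ^ i)"
    by (simp add: power_add field_simps)
  define C where "C = (\<Sum>i. B (i + K) * (1 / 2) ^ i)"
  have "C \<ge> 0"
    unfolding C_def using B0 by (intro suminf_nonneg sm) auto
  moreover have "norm (binomial_remainder K w z) \<le> C * norm z ^ K"
    if w: "norm w \<le> M" and z: "norm z \<le> 1 / 2" for w z
  proof -
    have s: "(\<lambda>i. ((- w) gchoose i) * z ^ i) sums (1 + z) powr (- w)"
      using z by (intro gen_binomial_complex) auto
    have s': "(\<lambda>i. ((- w) gchoose (i + K)) * z ^ (i + K)) sums binomial_remainder K w z"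
      unfolding binomial_remainder_def using s by (subst sums_iff_shift) simp
    have le: "norm (((- w) gchoose (i + K)) * z ^ (i + K)) \<le> norm z ^ K * (B (i + K) * (1 / 2) ^ i)" for i
    proof -
      have "norm (((- w) gchoose (i + K)) * z ^ (i + K)) =
          norm ((- w) gchoose (i + K)) * norm z ^ i * norm z ^ K"
        by (simp add: norm_mult norm_power power_add)
      also have "\<dots> \<le> B (i + K) * (1 / 2) ^ i * norm z ^ K"
        by (intro mult_mono power_mono bound w z) (auto simp: B0 intro!: mult_nonneg_nonneg)
      finally show ?thesis by (simp add: mult_ac)
    qed
    have "norm (\<Sum>i. ((- w) gchoose (i + K)) * z ^ (i + K)) \<le> (\<Sum>i. norm z ^ K * (B (i + K) * (1 / 2) ^ i))"
      by (intro norm_suminf_le le summable_mult sm)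
    then show ?thesis
      using s' suminf_mult[OF sm] by (simp add: sums_iff C_def mult.commute)
  qed
  ultimately show ?thesis using that by blast
qed

lemma powr_holomorphic:
  assumes "x > 0" "v holomorphic_on A"
  shows "(\<lambda>w. complex_of_real x powr (v w)) holomorphic_on A"
  using assms by (auto intro!: holomorphic_intros simp: complex_nonpos_Reals_iff)

lemma gbinomial_holomorphic [holomorphic_intros]:
  "v holomorphic_on A \<Longrightarrow> (\<lambda>w. v w gchoose i) holomorphic_on A"
  unfolding gbinomial_prod_rev by (auto intro!: holomorphic_intros)

lemma binomial_remainder_holomorphic:
  assumes "z > -1"
  shows "(\<lambda>w. binomial_remainder K w (of_real z)) holomorphic_on A"
proof -
  have "1 + complex_of_real z = of_real (1 + z)" by simp
  then show ?thesis
    unfolding binomial_remainder_def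
    using assms by (auto intro!: holomorphic_intros powr_holomorphic simp del: of_real_add)
qed

text \<open>The exponent \<open>v\<close> is kept general: it is \<open>w\<close> for the Hurwitz
  zeta function and \<open>p * w - d\<close> for products with polynomial weights.\<close>

definition remainder_sum :: "real \<Rightarrow> real \<Rightarrow> nat \<Rightarrow> (complex \<Rightarrow> complex) \<Rightarrow> complex \<Rightarrow> complex" where
  "remainder_sum a b K v w =
     (\<Sum>j. of_real (real j + a) powr (- v w) * binomial_remainder K w (of_real (b / (real j + a))))"

text \<open>The remainder of order \<open>K\<close> is of size \<open>(1 / j) ^ K\<close>, so the
  terms decay like \<open>j powr (- (Re (v w) + K))\<close>. Each further order moves the half-plane
  of convergence one unit to the left in terms of \<open>v\<close>.\<close>

lemma remainder_sum:
  fixes a b :: real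
  assumes a: "a > 0" and b: "a + b > 0" and v: "v holomorphic_on UNIV"
  shows "remainder_sum a b K v holomorphic_on {w. Re (v w) > 1 - real K}"
    and "Re (v w) > 1 - real K \<Longrightarrow> ((\<lambda>j. of_real (real j + a) powr (- v w) *
      binomial_remainder K w (of_real (b / (real j + a)))) has_sum remainder_sum a b K v w) UNIV"
    and "Re (v w) > 1 - real K \<Longrightarrow> (\<lambda>j. deriv (\<lambda>w. of_real (real j + a) powr (- v w) *
      binomial_remainder K w (of_real (b / (real j + a)))) w) sums deriv (remainder_sum a b K v) w"
proof -
  define t where "t j w = of_real (real j + a) powr (- v w) *
      binomial_remainder K w (of_real (b / (real j + a)))" for j w
  define U where "U = {w. Re (v w) > 1 - real K}"
  have contv: "continuous_on X v" for X
    using v by (meson holomorphic_on_imp_continuous_on holomorphic_on_subset subset_UNIV)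
  have U: "open U"
    unfolding U_def by (intro open_Collect_less continuous_intros contv)
  have t: "t j holomorphic_on U" for j
  proof -
    have "b / (real j + a) > -1" using a b by (simp add: field_simps)
    then show ?thesis
      unfolding t_def using a v
      by (intro holomorphic_intros powr_holomorphic binomial_remainder_holomorphic)
         (auto intro: holomorphic_on_subset)
  qed
  have M: "\<exists>r M. r > 0 \<and> cball w r \<subseteq> U \<and> summable M \<and>
      (\<forall>\<^sub>F j in sequentially. \<forall>u\<in>cball w r. norm (t j u) \<le> M j)" if w: "w \<in> U" for w
  proof -
    obtain r where r: "r > 0" "cball w r \<subseteq> U"
      using U w by (meson open_contains_cball)
    \<comment> \<open>The minimum of \<open>Re (v u)\<close> over the compact disc is attained in
      \<open>U\<close>, so one exponent \<open>s\<close> with \<open>s + K > 1\<close> serves the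
      whole disc.\<close>
    obtain u0 where u0: "u0 \<in> cball w r" "\<And>u. u \<in> cball w r \<Longrightarrow> Re (v u0) \<le> Re (v u)"
    proof -
      have "\<exists>x\<in>cball w r. \<forall>y\<in>cball w r. Re (v x) \<le> Re (v y)"
        using r(1) by (intro continuous_attains_inf continuous_intros contv) auto
      then show ?thesis using that by blast
    qed
    define s where "s = Re (v u0)"
    have s: "s + real K > 1" using u0(1) r(2) unfolding s_def U_def by auto
    obtain C where C: "C \<ge> 0" "\<And>u z. norm u \<le> norm w + r \<Longrightarrow> norm z \<le> 1 / 2 \<Longrightarrow>
        norm (binomial_remainder K u z) \<le> C * norm z ^ K"
      using binomial_remainder_bound[of "norm w + r"] r(1) by (metis add_nonneg_nonneg less_imp_le norm_ge_zero)
    define M where "M j = C * \<bar>b\<bar> ^ K * real j powr (- (s + real K))" for j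
    have "summable M"
      unfolding M_def using s by (intro summable_mult) (simp add: summable_real_powr_iff)
    moreover have "\<forall>\<^sub>F j in sequentially. \<forall>u\<in>cball w r. norm (t j u) \<le> M j"
      using eventually_gt_at_top[of "nat \<lceil>1 + 2 * \<bar>b\<bar>\<rceil>"]
    proof eventually_elim
      fix j :: nat assume "j > nat \<lceil>1 + 2 * \<bar>b\<bar>\<rceil>"
      then have j: "real j \<ge> 1" "real j \<ge> 2 * \<bar>b\<bar>" by linarith+
      define x where "x = real j + a"
      have x: "x \<ge> 1" "x \<ge> 2 * \<bar>b\<bar>" "x \<ge> real j" "x > 0" using j a unfolding x_def by auto
      show "\<forall>u\<in>cball w r. norm (t j u) \<le> M j"
      proof
        fix u assume u: "u \<in> cball w r"
        have nu: "norm u \<le> norm w + r"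
          using u norm_triangle_ineq2[of u w] by (simp add: dist_norm norm_minus_commute)
        have nz: "norm (complex_of_real (b / x)) = \<bar>b\<bar> / x"
          using x by (simp only: norm_of_real) (simp add: abs_divide)
        have "norm (t j u) = x powr (- Re (v u)) * norm (binomial_remainder K u (of_real (b / x)))"
          unfolding t_def x_def[symmetric] norm_mult using x by (simp add: norm_powr_real_powr)
        also have "\<dots> \<le> x powr (- s) * (C * norm (complex_of_real (b / x)) ^ K)"
          using x u0(2)[OF u] nz
          by (intro mult_mono powr_mono C(2) nu) (auto simp: s_def field_simps simp del: of_real_divide)
        also have "\<dots> = C * \<bar>b\<bar> ^ K * x powr (- (s + real K))"
          using x by (simp only: nz) (simp add: power_divide powr_add powr_minus powr_realpow field_simps powr_diff)
        also have "\<dots> \<le> M j"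
          unfolding M_def using C(1) j x s
          by (intro mult_left_mono powr_mono2') auto
        finally show "norm (t j u) \<le> M j" .
      qed
    qed
    ultimately show ?thesis using r by blast
  qed
  have rs: "remainder_sum a b K v = (\<lambda>w. \<Sum>j. t j w)"
    unfolding remainder_sum_def t_def by (rule ext) simp
  show "remainder_sum a b K v holomorphic_on {w. Re (v w) > 1 - real K}"
    using holomorphic_series(1)[OF U t M] unfolding rs U_def .
  assume "Re (v w) > 1 - real K"
  then have w: "w \<in> U" unfolding U_def by simp
  show "((\<lambda>j. of_real (real j + a) powr (- v w) *
      binomial_remainder K w (of_real (b / (real j + a)))) has_sum remainder_sum a b K v w) UNIV"
    using holomorphic_series(2)[OF U t M w] unfolding rs t_def .
  show "(\<lambda>j. deriv (\<lambda>w. of_real (real j + a) powr (- v w) *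
      binomial_remainder K w (of_real (b / (real j + a)))) w) sums deriv (remainder_sum a b K v) w"
    using holomorphic_series(3)[OF U t M w] unfolding rs t_def .
qed

text \<open>At \<open>w = 0\<close> the power and the partial sum are both 1. The point
  \<open>z = -1\<close> is excluded because \<open>0 powr 0 = 0\<close>.\<close>

lemma binomial_remainder_0: "K > 0 \<Longrightarrow> z \<noteq> -1 \<Longrightarrow> binomial_remainder K 0 z = 0"
proof -
  assume K: "K > 0" and z: "z \<noteq> -1"
  have "(\<Sum>i<K. ((0::complex) gchoose i) * z ^ i) = (\<Sum>i\<in>{0}. ((0::complex) gchoose i) * z ^ i)"
    using K by (intro sum.mono_neutral_right) (auto simp: gbinomial_0_left)
  then show ?thesis
    using z unfolding binomial_remainder_def by (auto simp: add_eq_0_iff)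
qed

lemma powr_shift_expansion:
  fixes x b :: real
  assumes "x > 0" "x + b > 0"
  shows "of_real (x + b) powr (- w) =
    (\<Sum>i<K. ((- w) gchoose i) * of_real b ^ i * of_real x powr (- (w + of_nat i))) +
    of_real x powr (- w) * binomial_remainder K w (of_real (b / x))"
proof -
  have "x + b = x * (1 + b / x)" using assms by (simp add: field_simps)
  then have "complex_of_real (x + b) powr (- w) = of_real x powr (- w) * (1 + of_real (b / x)) powr (- w)"
    using assms powr_times_real[of "of_real x" "1 + complex_of_real (b / x)" "- w"]
    by (metis (no_types, lifting) Im_complex_of_real Reals_of_real add_sign_intros(4) less_eq_real_def of_real_1 of_real_add of_real_mult powr_times_real_left Re_complex_of_real mult_pos_pos zero_less_mult_pos)
  moreover have "((- w) gchoose i) * of_real b ^ i * of_real x powr (- (w + of_nat i)) =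
      of_real x powr (- w) * (((- w) gchoose i) * of_real (b / x) ^ i)" for i
    using assms by (simp add: powr_diff powr_minus powr_nat' power_divide field_simps powr_add)
  ultimately show ?thesis
    unfolding binomial_remainder_def by (simp only: sum_distrib_left right_diff_distrib) simp
qed

lemma has_sum_Suc_shift:
  fixes f :: "nat \<Rightarrow> complex"
  assumes "(f has_sum s) UNIV"
  shows "((\<lambda>j. f (Suc j)) has_sum (s - f 0)) UNIV"
proof -
  have "(f has_sum f 0) {0}"
    using has_sum_finite[of "{0::nat}" f] by simp
  then have "(f has_sum (s - f 0)) (UNIV - {0})"
    using assms by (intro has_sum_Diff) auto
  moreover have "UNIV - {0} = range Suc"
    by (auto simp: image_iff) (metis not0_implies_Suc)
  ultimately show ?thesis
    using has_sum_reindex[of Suc UNIV f] by (simp add: o_def)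
qed

lemma gbinomial_Suc_right: "(x gchoose Suc k) = (x gchoose k) * (x - of_nat k) / of_nat (Suc k)"
  for x :: "'a::field_char_0"
  by (simp add: gbinomial_prod_rev atLeast0_lessThan_Suc mult_ac)

lemma analytic_on_Re_gt: "f holomorphic_on {w. Re w > c} \<Longrightarrow> f analytic_on {w. Re w > c}"
  by (subst analytic_on_open) (auto intro: open_halfspace_Re_gt)

lemma sum_lessThan_split2: "(\<Sum>i<K + 2. f i) = f 0 + f 1 + (\<Sum>i=2..<K + 2. f i)"
  for f :: "nat \<Rightarrow> complex"
  by (induction K) (simp_all add: numeral_2_eq_2 add_ac)

lemma has_sum_finite_sum:
  fixes f :: "'a \<Rightarrow> 'b \<Rightarrow> complex"
  assumes "\<And>x. x \<in> X \<Longrightarrow> (f x has_sum s x) I"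
  shows "((\<lambda>i. \<Sum>x\<in>X. f x i) has_sum (\<Sum>x\<in>X. s x)) I"
  using assms by (induction X rule: infinite_finite_induct) (auto intro: has_sum_add)

section \<open>Continuation of the Hurwitz zeta function\<close>

text \<open>Shifting the index changes the series \<open>Z\<close> by its first term, while
  expanding each shifted power in \<open>1 / (j + a)\<close> gives
  \<open>Z u - u * Z (u + 1)\<close> and higher terms. The leading \<open>Z u\<close> cancels, so
  \<open>u * Z (u + 1)\<close> is expressed through values of \<open>Z\<close> at
  \<open>u + i\<close> with \<open>i \<ge> 2\<close>, and these are already continued one unit
  further to the left.\<close>

lemma hurwitz_halfplane:
  fixes a :: real
  assumes a: "a > 0"
  shows "\<exists>G. G holomorphic_on {w. Re w > 1 - real K} \<and>
    (\<forall>w. Re w > 1 \<longrightarrow> ((\<lambda>j. of_real (real j + a) powr (- w)) has_sum (1 / (w - 1) + G w)) UNIV)"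
proof (induction K)
  case 0
  define Z where "Z = remainder_sum a 0 0 (\<lambda>w. w)"
  have Z: "Z holomorphic_on {w. Re w > 1}"
    "\<And>w. Re w > 1 \<Longrightarrow> ((\<lambda>j. of_real (real j + a) powr (- w)) has_sum Z w) UNIV"
    using remainder_sum[of a 0 "\<lambda>w. w" 0] a
    by (simp_all add: Z_def binomial_remainder_def)
  have "(\<lambda>w. Z w - 1 / (w - 1)) holomorphic_on {w. Re w > 1}"
    by (intro holomorphic_intros Z) auto
  then show ?case
    by (intro exI[of _ "\<lambda>w. Z w - 1 / (w - 1)"]) (use Z(2) in auto)
next
  case (Suc K)
  then obtain G where G: "G holomorphic_on {w. Re w > 1 - real K}"
    and sum: "\<And>w. Re w > 1 \<Longrightarrow> ((\<lambda>j. of_real (real j + a) powr (- w)) has_sum (1 / (w - 1) + G w)) UNIV"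
    by blast
  define Z where "Z w = 1 / (w - 1) + G w" for w
  \<comment> \<open>Order \<open>K + 2\<close> makes the remainder holomorphic for
    \<open>Re u > - 1 - K\<close>, which in terms of \<open>w = u + 1\<close> is the half-plane
    aimed at.\<close>
  define E where "E = remainder_sum a 1 (K + 2) (\<lambda>w. w)"
  have E: "E holomorphic_on {w. Re w > - 1 - real K}"
    "\<And>w. Re w > - 1 - real K \<Longrightarrow> ((\<lambda>j. of_real (real j + a) powr (- w) *
      binomial_remainder (K + 2) w (of_real (1 / (real j + a)))) has_sum E w) UNIV"
    using remainder_sum[of a 1 "\<lambda>w. w" "K + 2"] a unfolding E_def by (simp_all add: algebra_simps)
  define \<Phi> where "\<Phi> u = of_real a powr (- u) +
     (\<Sum>i=2..<K + 2. ((- u) gchoose i) * G (u + of_nat i) - ((- u) gchoose (i - 1)) / of_nat i) + E u" for u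
  have \<Phi>: "\<Phi> holomorphic_on {w. Re w > - 1 - real K}"
    unfolding \<Phi>_def using a
    by (intro holomorphic_intros powr_holomorphic E holomorphic_on_compose_gen[OF _ G, unfolded o_def]) auto
  have rec: "u * Z (u + 1) = \<Phi> u" if u: "Re u > 1" for u
  proof -
    have Zs: "((\<lambda>j. of_real (real j + a) powr (- (u + of_nat i))) has_sum Z (u + of_nat i)) UNIV" for i
      unfolding Z_def by (rule sum) (use u in auto)
    have 1: "((\<lambda>j. of_real (real (Suc j) + a) powr (- u)) has_sum (Z u - of_real a powr (- u))) UNIV"
      using has_sum_Suc_shift[OF sum[OF u]] unfolding Z_def by simp
    have 2: "of_real (real (Suc j) + a) powr (- u) =
        (\<Sum>i<K + 2. ((- u) gchoose i) * of_real (real j + a) powr (- (u + of_nat i))) +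
        of_real (real j + a) powr (- u) * binomial_remainder (K + 2) u (of_real (1 / (real j + a)))" for j
      using powr_shift_expansion[of "real j + a" 1 u "K + 2"] a
      by (simp only: of_nat_Suc of_real_1 power_one mult_1_right add.commute add.left_commute)
    have 3: "((\<lambda>j. (\<Sum>i<K + 2. ((- u) gchoose i) * of_real (real j + a) powr (- (u + of_nat i))) +
        of_real (real j + a) powr (- u) * binomial_remainder (K + 2) u (of_real (1 / (real j + a))))
        has_sum ((\<Sum>i<K + 2. ((- u) gchoose i) * Z (u + of_nat i)) + E u)) UNIV"
    proof (rule has_sum_add)
      show "((\<lambda>j. of_real (real j + a) powr (- u) * binomial_remainder (K + 2) u (of_real (1 / (real j + a))))
          has_sum E u) UNIV"
        by (rule E(2)) (use u in linarith)
    qed (intro has_sum_finite_sum has_sum_cmult_right Zs)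
    have "Z u - of_real a powr (- u) = (\<Sum>i<K + 2. ((- u) gchoose i) * Z (u + of_nat i)) + E u"
      by (rule has_sum_unique[OF 1[unfolded 2] 3])
    also have "(\<Sum>i<K + 2. ((- u) gchoose i) * Z (u + of_nat i)) =
        Z u - u * Z (u + 1) + (\<Sum>i=2..<K + 2. ((- u) gchoose i) * Z (u + of_nat i))"
      unfolding sum_lessThan_split2 by simp
    also have "(\<Sum>i=2..<K + 2. ((- u) gchoose i) * Z (u + of_nat i)) =
        (\<Sum>i=2..<K + 2. ((- u) gchoose i) * G (u + of_nat i) - ((- u) gchoose (i - 1)) / of_nat i)"
    proof (rule sum.cong)
      fix i assume i: "i \<in> {2..<K + 2}"
      then obtain k where k: "i = Suc k" by (cases i) auto
      have "u + of_nat k \<noteq> 0"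
        using u by (auto simp: complex_eq_iff)
      \<comment> \<open>The pole of \<open>Z\<close> at \<open>u + i = 1\<close> is cancelled by the
        last factor of the binomial coefficient, so \<open>\<Phi>\<close> has no poles.\<close>
      then have "((- u) gchoose i) / (u + of_nat i - 1) = - ((- u) gchoose (i - 1)) / of_nat i"
        unfolding k gbinomial_Suc_right by (simp add: divide_simps) (simp add: algebra_simps)
      then show "((- u) gchoose i) * Z (u + of_nat i) =
          ((- u) gchoose i) * G (u + of_nat i) - ((- u) gchoose (i - 1)) / of_nat i"
        unfolding Z_def by (simp add: ring_distribs)
    qed simp
    finally show ?thesis unfolding \<Phi>_def by (simp add: algebra_simps)
  qed
  \<comment> \<open>This is the residue at 1. Everything in \<open>\<Phi>\<close> except the power
    of \<open>a\<close> carries a factor that vanishes at 0, so the residue does not depend on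
    \<open>a\<close>.\<close>
  have \<Phi>0: "\<Phi> 0 = 1"
  proof -
    have "E 0 = 0"
    proof -
      have "1 / (real j + a) \<noteq> -1" for j using a by (simp add: field_simps)
      then have "complex_of_real (1 / (real j + a)) \<noteq> -1" for j
        by (metis of_real_1 of_real_eq_iff of_real_minus)
      then have "((\<lambda>j. 0) has_sum E 0) (UNIV :: nat set)"
        using E(2)[of 0] by (simp add: binomial_remainder_0 del: of_real_divide)
      then show ?thesis using has_sum_unique has_sum_0 by (metis (no_types, lifting))
    qed
    then show ?thesis
      unfolding \<Phi>_def using a by (simp add: gbinomial_0_left)
  qed
  \<comment> \<open>The difference quotient with the derivative filled in at 0: subtracting the pole
    \<open>1 / (w - 1)\<close> leaves \<open>L (w - 1)\<close>, which is holomorphic also at the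
    former pole.\<close>
  define L where "L u = (if u = 0 then deriv \<Phi> 0 else (\<Phi> u - \<Phi> 0) / (u - 0))" for u
  have L: "L holomorphic_on {w. Re w > - 1 - real K}"
    unfolding L_def by (intro pole_lemma_open \<Phi> open_halfspace_Re_gt)
  define G' where "G' w = L (w - 1)" for w
  have G': "G' holomorphic_on {w. Re w > 1 - real (Suc K)}"
    unfolding G'_def by (intro holomorphic_on_compose_gen[OF _ L, unfolded o_def] holomorphic_intros) auto
  \<comment> \<open>The recursion was derived for \<open>Re u > 1\<close>, that is
    \<open>Re w > 2\<close>; the identity theorem carries the agreement to
    \<open>Re w > 1\<close>.\<close>
  have eq2: "G' w = G w" if "Re w > 2" for w
  proof -
    have w: "w - 1 \<noteq> 0" using that by (auto simp: complex_eq_iff)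
    have "\<Phi> (w - 1) = (w - 1) * Z w" using rec[of "w - 1"] that by simp
    also have "\<dots> = 1 + (w - 1) * G w" unfolding Z_def using w by (simp add: distrib_left)
    finally show ?thesis unfolding G'_def L_def \<Phi>0 using w by simp
  qed
  have "G' w = G w" if "Re w > 1" for w
  proof (rule nicely_meromorphic_eqI[of G' "{w. Re w > 1}" G "{w. Re w > 2}"])
    show "G' nicely_meromorphic_on {w. Re w > 1}"
      by (intro analytic_on_imp_nicely_meromorphic_on analytic_on_Re_gt holomorphic_on_subset[OF G']) auto
    show "G nicely_meromorphic_on {w. Re w > 1}"
      by (intro analytic_on_imp_nicely_meromorphic_on analytic_on_Re_gt holomorphic_on_subset[OF G]) auto
    show "{w. Re w > 2} \<noteq> {}" by (rule nonempty_Re_gt)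
    show "open {w. Re w > 1}" "open {w. Re w > 2}" by (rule open_halfspace_Re_gt)+
    show "connected {w. Re w > 1}" by (rule connected_Re_gt)
  qed (use that eq2 in auto)
  then show ?case
    using G' sum by (intro exI[of _ G']) auto
qed

lemma hurwitz_exists:
  fixes a :: real
  assumes a: "a > 0"
  shows "\<exists>H. H holomorphic_on UNIV \<and>
    (\<forall>w. Re w > 1 \<longrightarrow> ((\<lambda>j. of_real (real j + a) powr (- w)) has_sum (1 / (w - 1) + H w)) UNIV)"
proof -
  from hurwitz_halfplane[OF a] obtain G where G: "\<And>K. G K holomorphic_on {w. Re w > 1 - real K}"
    and sum: "\<And>K w. Re w > 1 \<Longrightarrow> ((\<lambda>j. of_real (real j + a) powr (- w)) has_sum (1 / (w - 1) + G K w)) UNIV"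
    by metis
  have G1: "G (Suc K) holomorphic_on {w. Re w > - real K}" for K
    using G[of "Suc K"] by simp
  have eq: "G (Suc K) w = G 0 w" if "Re w > 1" for K w
    using has_sum_unique[OF sum[OF that, of "Suc K"] sum[OF that, of 0]] by simp
  obtain H where H: "\<And>K w. Re w > - real K \<Longrightarrow> H w = G (Suc K) w"
  proof (rule glue_halfplanes[of "\<lambda>K. G (Suc K)" 1 "G 0"])
    show "G (Suc K) nicely_meromorphic_on {w. Re w > - real K}" for K
      by (rule analytic_on_imp_nicely_meromorphic_on[OF analytic_on_Re_gt[OF G1]])
  qed (use eq in auto)
  have "H holomorphic_on {w. Re w > - real K}" for K
    by (rule holomorphic_transform[OF G1[of K]]) (simp add: H)
  moreover have "z \<in> {w. Re w > - real (nat \<lceil>\<bar>Re z\<bar>\<rceil> + 1)}" for z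
    by simp linarith
  ultimately have "H field_differentiable at z" for z
    using holomorphic_on_imp_differentiable_at open_halfspace_Re_gt by blast
  then have "H holomorphic_on UNIV"
    by (auto simp: holomorphic_on_def)
  moreover have "G (Suc 0) w = H w" if "Re w > 1" for w
    using H[where K = 0 and w = w] that by simp
  ultimately show ?thesis
    using sum[of _ "Suc 0"] by (intro exI[of _ H]) auto
qed

text \<open>The entire part of the Hurwitz zeta function. With the pole written out as
  \<open>1 / (w - 1)\<close>, its cancellation against zeros becomes plain algebra.\<close>

definition hurwitz_reg :: "real \<Rightarrow> complex \<Rightarrow> complex" where
  "hurwitz_reg a = (SOME H. H holomorphic_on UNIV \<and>
    (\<forall>w. Re w > 1 \<longrightarrow> ((\<lambda>j. of_real (real j + a) powr (- w)) has_sum (1 / (w - 1) + H w)) UNIV))"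

definition hurwitz_zeta :: "real \<Rightarrow> complex \<Rightarrow> complex" where
  "hurwitz_zeta a w = 1 / (w - 1) + hurwitz_reg a w"

lemma hurwitz_reg_holomorphic: "a > 0 \<Longrightarrow> hurwitz_reg a holomorphic_on A"
  and hurwitz_zeta_has_sum: "a > 0 \<Longrightarrow> Re w > 1 \<Longrightarrow>
    ((\<lambda>j. of_real (real j + a) powr (- w)) has_sum hurwitz_zeta a w) UNIV"
  using someI_ex[OF hurwitz_exists[of a], folded hurwitz_reg_def]
  unfolding hurwitz_zeta_def by (auto intro: holomorphic_on_subset)

lemma hurwitz_reg_analytic: "a > 0 \<Longrightarrow> hurwitz_reg a analytic_on A"
  by (meson analytic_on_open analytic_on_subset hurwitz_reg_holomorphic open_UNIV subset_UNIV)

lemma hurwitz_zeta_analytic: "a > 0 \<Longrightarrow> 1 \<notin> A \<Longrightarrow> hurwitz_zeta a analytic_on A"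
  unfolding hurwitz_zeta_def by (intro analytic_intros hurwitz_reg_analytic) auto

lemma hurwitz_zeta_meromorphic: "a > 0 \<Longrightarrow> hurwitz_zeta a meromorphic_on A"
  unfolding hurwitz_zeta_def
  by (intro meromorphic_intros analytic_on_imp_meromorphic_on[OF hurwitz_reg_analytic])

lemma powr_power_of_nat:
  assumes "x > 0"
  shows "complex_of_real x ^ d * complex_of_real x powr (- w) = of_real x powr (- (w - of_nat d))"
  using assms by (simp add: powr_diff powr_minus powr_nat' field_simps)

lemma zeta_reg_hurwitz:
  assumes a: "a > 0"
  shows "zeta_reg (\<lambda>j w. of_real (real j + a) ^ d * of_real (real j + a) powr (- w)) UNIV
    (deriv (hurwitz_zeta a) (- of_nat d))"
proof (rule zeta_regI[where F = "\<lambda>w. hurwitz_zeta a (w - of_nat d)" and c = "1 + real d"])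
  have ne: "- of_nat d \<noteq> (1 :: complex)"
  proof
    assume "- of_nat d = (1 :: complex)"
    then have "Re (- of_nat d) = 1" by simp
    then show False by simp
  qed
  have comp: "(\<lambda>w. hurwitz_zeta a (w - of_nat d)) analytic_on A" if "1 \<notin> (\<lambda>w. w - of_nat d) ` A" for A
    using analytic_on_compose[of "\<lambda>w. w - of_nat d" A "hurwitz_zeta a"]
      hurwitz_zeta_analytic[OF a that] by (simp add: o_def analytic_on_diff analytic_on_ident analytic_on_const)
  show "(\<lambda>w. hurwitz_zeta a (w - of_nat d)) analytic_on {0}"
    using ne by (intro comp) auto
  show "(\<lambda>w. hurwitz_zeta a (w - of_nat d)) analytic_on {w. Re w > 1 + real d}"
    by (intro comp) (auto simp: complex_eq_iff)
  show "(\<lambda>w. hurwitz_zeta a (w - of_nat d)) meromorphic_on UNIV"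
    by (rule meromorphic_on_compose[OF hurwitz_zeta_meromorphic[OF a, of UNIV]]) (auto intro!: analytic_intros)
  fix w assume "Re w > 1 + real d"
  then show "((\<lambda>j. of_real (real j + a) ^ d * of_real (real j + a) powr (- w)) has_sum hurwitz_zeta a (w - of_nat d)) UNIV"
    using hurwitz_zeta_has_sum[OF a, of "w - of_nat d"] a
    by (subst powr_power_of_nat) auto
next
  have ne: "1 \<notin> {- of_nat d :: complex}"
    by (auto simp: complex_eq_iff)
  have "hurwitz_zeta a field_differentiable at (- of_nat d)"
    using hurwitz_zeta_analytic[OF a ne] by (rule analytic_on_imp_differentiable_at) auto
  then have "(hurwitz_zeta a has_field_derivative deriv (hurwitz_zeta a) (- of_nat d)) (at (0 - of_nat d))"
    by (simp add: DERIV_deriv_iff_field_differentiable)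
  then have "((\<lambda>w. hurwitz_zeta a (w - of_nat d)) has_field_derivative
      deriv (hurwitz_zeta a) (- of_nat d) * 1) (at 0)"
    by (rule DERIV_chain2) (auto intro!: derivative_eq_intros)
  then show "deriv (\<lambda>w. hurwitz_zeta a (w - of_nat d)) 0 = deriv (hurwitz_zeta a) (- of_nat d)"
    by (intro DERIV_imp_deriv) simp
qed

section \<open>Zeta functions of products\<close>

text \<open>Exhibits the zero at \<open>w = 0\<close> that will meet the pole of the Hurwitz zeta
  function.\<close>

lemma gbinomial_neg_factor:
  "((- w) gchoose Suc k) = - w * (((- w - 1) gchoose k) / of_nat (Suc k))" for w :: complex
proof -
  have "((- w) gchoose Suc k) = (\<Prod>i<Suc k. (- w) - of_nat i) / fact (Suc k)"
    by (simp add: gbinomial_prod_rev atLeast0LessThan)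
  also have "(\<Prod>i<Suc k. (- w) - of_nat i) = - w * (\<Prod>i<k. (- w - 1) - of_nat i)"
    by (subst prod.lessThan_Suc_shift) (simp add: algebra_simps)
  finally show ?thesis
    by (simp add: gbinomial_prod_rev atLeast0LessThan)
qed

text \<open>Up to the sign \<open>(- 1) ^ d\<close> the function is the product of the
  \<open>1 + w / j\<close> for \<open>1 \<le> j \<le> d\<close>, whose derivative at 0 is the
  harmonic number. This is where the harmonic numbers in \<open>f1\<close> come from.\<close>

lemma has_field_derivative_gbinomial_neg:
  "((\<lambda>w::complex. ((- w - 1) gchoose d)) has_field_derivative (- 1) ^ d * harm d) (at 0)"
proof (induction d)
  case 0
  then show ?case by (simp add: harm_def)
next
  case (Suc d)
  have v: "((- 0 - 1 :: complex) gchoose d) = (- 1) ^ d"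
    by (simp add: gbinomial_minus binomial_gbinomial[symmetric])
  have "((\<lambda>w::complex. (- w - 1) - of_nat d) has_field_derivative -1) (at 0)"
    by (auto intro!: derivative_eq_intros)
  then have "((\<lambda>w::complex. ((- w - 1) gchoose d) * ((- w - 1) - of_nat d) / of_nat (Suc d)) has_field_derivative
     (((- 1) ^ d * harm d) * ((- 0 - 1) - of_nat d) + (- 1) * ((- 0 - 1) gchoose d)) / of_nat (Suc d)) (at 0)"
    by (intro DERIV_cdivide DERIV_mult Suc)
  also have "(((- 1) ^ d * harm d) * ((- 0 - 1) - of_nat d) + (- 1) * ((- 0 - 1 :: complex) gchoose d)) / of_nat (Suc d) =
      (- 1) ^ Suc d * harm (Suc d)"
  proof -
    define N :: complex where "N = of_nat (Suc d)"
    have N: "N \<noteq> 0" "- 0 - 1 - of_nat d = - N" unfolding N_def by (simp_all del: of_nat_Suc) simp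
    have h: "harm (Suc d) = harm d + 1 / N" unfolding harm_Suc N_def by (simp add: inverse_eq_divide)
    show ?thesis
      unfolding v h N(2) N_def[symmetric] using N(1) by (simp add: field_simps)
  qed
  finally show ?case unfolding gbinomial_Suc_right .
qed

text \<open>The exponents \<open>p \<in> {1, 2}\<close> correspond to the zeta functions of \<open>x + b\<close> and of \<open>x * (x + b)\<close>.
  They differ by the residue contribution, the only place where \<open>p\<close> enters nonlinearly: a factor
  vanishing at \<open>w = 0\<close> meets the pole of the Hurwitz zeta function at \<open>p * w + 1\<close>.\<close>

lemma zeta_reg_monomial:
  fixes a b :: real
  assumes a: "a > 0" and b: "a + b > 0"
  shows "\<exists>R. \<forall>p\<in>{1, 2 :: nat}. zeta_reg (\<lambda>j w. of_real (real j + a) ^ d *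
      (of_real (real j + a) powr (- (of_nat (p - 1) * w)) * of_real (real j + a + b) powr (- w))) UNIV
    (of_nat p * deriv (hurwitz_zeta a) (- of_nat d) + R -
      of_real b ^ (d + 1) * ((- 1) ^ d * harm d / of_nat (d + 1)) / of_nat p)"
proof -
  define H where "H = hurwitz_reg a"
  have Hh: "H holomorphic_on A" for A unfolding H_def by (rule hurwitz_reg_holomorphic[OF a])
  have HD: "(H has_field_derivative deriv H z) (at z)" for z
    by (rule holomorphic_derivI[OF Hh[of UNIV]]) auto
  define q where "q k w = ((- w - 1) gchoose k) / of_nat (Suc k)" for k and w :: complex
  \<comment> \<open>After the expansion everything is a power of \<open>x\<close>: the weight
    \<open>x ^ d\<close> and \<open>p\<close> factors \<open>x powr (- w)\<close> combine to
    exponent \<open>- v p w\<close>. The \<open>i\<close>-th term then needs the zeta function at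
    \<open>v p w + i\<close>, and only for \<open>i = d + 1\<close> does \<open>w = 0\<close> hit
    its pole.\<close>
  define v :: "nat \<Rightarrow> complex \<Rightarrow> complex" where "v p w = of_nat p * w - of_nat d" for p w
  define E where "E p K = remainder_sum a b K (v p)" for p K
  \<comment> \<open>The pole part is kept apart from \<open>H\<close>. For \<open>i = d + 1\<close>
    it is entered in the form obtained after cancelling \<open>w\<close>, which is regular at 0 and
    displays the factor \<open>1 / p\<close>.\<close>
  define tm where "tm p i w = of_real b ^ i * ((- w gchoose i) * H (v p w + of_nat i) +
      (if i = Suc d then - q d w / of_nat p else (- w gchoose i) / (v p w + of_nat i - 1)))" for p i w
  define F where "F p K w = (\<Sum>i<K. tm p i w) + E p K w" for p K w
  have vh: "v p holomorphic_on A" for p A unfolding v_def by (intro holomorphic_intros)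
  have E: "E p K holomorphic_on {w. Re (v p w) > 1 - real K}" for p K
    unfolding E_def by (intro remainder_sum a b vh)
  have Hv: "(\<lambda>w. H (v p w + of_nat i)) holomorphic_on A" for p i A
    by (intro holomorphic_on_compose[OF _ Hh, unfolded o_def] holomorphic_intros vh)
  have qh: "q k holomorphic_on A" for k A
    unfolding q_def by (intro holomorphic_intros) auto
  have bh: "(\<lambda>w. (- w) gchoose i) holomorphic_on A" for i A
    by (intro holomorphic_intros)
  have an: "f meromorphic_on A" if "\<And>B. f holomorphic_on B" for f A
    using that[of UNIV] by (metis analytic_on_imp_meromorphic_on analytic_on_open meromorphic_on_subset open_UNIV subset_UNIV)
  have tm1: "tm p i = (\<lambda>w. of_real b ^ i * ((- w gchoose i) * H (v p w + of_nat i) + (- q d w) * inverse (of_nat p)))"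
    if "i = Suc d" for p i
    unfolding tm_def using that by (simp add: fun_eq_iff divide_inverse)
  have tm2: "tm p i = (\<lambda>w. of_real b ^ i * ((- w gchoose i) * H (v p w + of_nat i) +
        (- w gchoose i) / (v p w + of_nat i - 1)))" if "i \<noteq> Suc d" for p i
    unfolding tm_def using that by (simp add: fun_eq_iff)
  have tm_mero: "tm p i meromorphic_on A" for p i A
  proof (cases "i = Suc d")
    case True
    show ?thesis
      unfolding tm1[OF True]
      by (intro meromorphic_on_mult meromorphic_on_add meromorphic_on_uminus meromorphic_on_const an[OF Hv] an[OF qh] an[OF bh])
  next
    case False
    show ?thesis
      unfolding tm2[OF False]
      by (intro meromorphic_on_mult meromorphic_on_add meromorphic_on_diff meromorphic_on_divide meromorphic_on_const
           an[OF Hv] an[OF vh] an[OF bh])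
  qed
  have tm_holo: "tm p i holomorphic_on A" if "\<And>w. w \<in> A \<Longrightarrow> i \<noteq> Suc d \<Longrightarrow> v p w + of_nat i \<noteq> 1" for p i A
  proof (cases "i = Suc d")
    case True
    show ?thesis
      unfolding tm1[OF True]
      by (intro holomorphic_on_mult holomorphic_on_add holomorphic_on_minus holomorphic_on_const Hv qh bh)
  next
    case False
    show ?thesis
      unfolding tm2[OF False]
      by (intro holomorphic_on_mult holomorphic_on_add holomorphic_on_divide holomorphic_on_diff holomorphic_on_const Hv vh bh)
         (use that False in auto)
  qed
  \<comment> \<open>The order \<open>2 * L + d + 2\<close> serves both exponents, since
    \<open>Re w > - L\<close> forces \<open>Re (v p w) > - 2 * L - d\<close> for
    \<open>p = 1\<close> as well as for \<open>p = 2\<close>.\<close>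
  have half: "{w. Re w > - real L} \<subseteq> {w. Re (v p w) > 1 - real (2 * L + d + 2)}" if "p \<in> {1, 2}" for p L
    using that unfolding v_def by (auto simp: algebra_simps)
  have F_mero: "F p (2 * L + d + 2) meromorphic_on {w. Re w > - real L}" if "p \<in> {1, 2}" for p L
    unfolding F_def
    by (intro meromorphic_intros tm_mero analytic_on_imp_meromorphic_on analytic_on_Re_gt
        holomorphic_on_subset[OF E half[OF that]])
  have F_an: "F p (2 * L + d + 2) analytic_on {w. Re w > real d + 1}" if p: "p \<in> {1, 2}" for p L
  proof (rule analytic_on_Re_gt)
    have "v p w + of_nat i \<noteq> 1" if "Re w > real d + 1" for w i
    proof -
      have "Re (v p w + of_nat i) > 1" using p that unfolding v_def by auto
      then show ?thesis by (metis less_irrefl one_complex.sel(1))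
    qed
    moreover have "{w. Re w > real d + 1} \<subseteq> {w. Re w > - real L}" by auto
    ultimately show "F p (2 * L + d + 2) holomorphic_on {w. Re w > real d + 1}"
      unfolding F_def using half[OF p, of L]
      by (intro holomorphic_on_add holomorphic_on_sum tm_holo holomorphic_on_subset[OF E]) blast+
  qed
  define x where "x j = real j + a" for j :: nat
  have x0: "x j > 0" "x j + b > 0" for j using a b unfolding x_def by auto
  have F_sum: "((\<lambda>j. of_real (x j) ^ d * (of_real (x j) powr (- (of_nat (p - 1) * w)) * of_real (x j + b) powr (- w)))
      has_sum F p (2 * L + d + 2) w) UNIV" if p: "p \<in> {1, 2}" and w: "Re w > real d + 1" for p L w
  proof -
    define K where "K = 2 * L + d + 2"
    have w0: "w \<noteq> 0" using w by auto
    have s1: "((\<lambda>j. of_real (x j) powr (- (v p w + of_nat i))) has_sum hurwitz_zeta a (v p w + of_nat i)) UNIV" for i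
      unfolding x_def using p w by (intro hurwitz_zeta_has_sum a) (auto simp: v_def)
    have s2: "((\<lambda>j. of_real (x j) powr (- v p w) * binomial_remainder K w (of_real (b / x j))) has_sum E p K w) UNIV"
      unfolding x_def E_def by (rule remainder_sum(2)[OF a b vh]) (use p w in \<open>auto simp: v_def K_def\<close>)
    have t: "((- w) gchoose i) * of_real b ^ i * hurwitz_zeta a (v p w + of_nat i) = tm p i w" for i
    proof (cases "i = Suc d")
      case True
      have "v p w + of_nat i - 1 = of_nat p * w" unfolding v_def True by simp
      moreover have "((- w) gchoose i) = - w * q d w"
        unfolding True q_def by (rule gbinomial_neg_factor)
      moreover have "of_nat p \<noteq> (0::complex)" using p by auto
      ultimately have "((- w) gchoose i) / (v p w + of_nat i - 1) = - q d w / of_nat p"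
        using w0 by (simp add: field_simps)
      then show ?thesis
        using True unfolding tm_def hurwitz_zeta_def H_def by (simp add: algebra_simps)
    next
      case False
      then show ?thesis
        unfolding tm_def hurwitz_zeta_def H_def by (simp add: algebra_simps)
    qed
    have A: "((\<lambda>j. (\<Sum>i<K. ((- w) gchoose i) * of_real b ^ i * of_real (x j) powr (- (v p w + of_nat i))) +
        of_real (x j) powr (- v p w) * binomial_remainder K w (of_real (b / x j))) has_sum
        (\<Sum>i<K. ((- w) gchoose i) * of_real b ^ i * hurwitz_zeta a (v p w + of_nat i)) + E p K w) UNIV"
      by (intro has_sum_add s2 has_sum_finite_sum has_sum_cmult_right s1)
    have B: "of_real (x j) ^ d * (of_real (x j) powr (- (of_nat (p - 1) * w)) * of_real (x j + b) powr (- w)) =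
       (\<Sum>i<K. ((- w) gchoose i) * of_real b ^ i * of_real (x j) powr (- (v p w + of_nat i))) +
        of_real (x j) powr (- v p w) * binomial_remainder K w (of_real (b / x j))" for j
    proof -
      have 1: "of_real (x j) ^ d * of_real (x j) powr (- (of_nat (p - 1) * w)) * of_real (x j) powr (- (w + s)) =
          complex_of_real (x j) powr (- (v p w + s))" for s
      proof -
        have "of_nat (p - 1) * w + (w + s) - of_nat d = v p w + s"
          using p unfolding v_def by auto
        then have "- (v p w + s) = of_nat d + (- (of_nat (p - 1) * w)) + (- (w + s))"
          by (simp add: algebra_simps)
        then show ?thesis
          using x0[of j] by (simp only: powr_add) (simp add: powr_nat')
      qed
      define X where "X = complex_of_real (x j) ^ d * of_real (x j) powr (- (of_nat (p - 1) * w))"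
      have 2: "X * of_real (x j) powr (- (w + s)) = of_real (x j) powr (- (v p w + s))" for s
        unfolding X_def by (rule 1)
      have 3: "X * of_real (x j) powr (- w) = of_real (x j) powr (- v p w)"
        using 2[of 0] by simp
      have "X * of_real (x j + b) powr (- w) =
          (\<Sum>i<K. ((- w) gchoose i) * of_real b ^ i * (X * of_real (x j) powr (- (w + of_nat i)))) +
          X * of_real (x j) powr (- w) * binomial_remainder K w (of_real (b / x j))"
        unfolding powr_shift_expansion[OF x0, of j w K]
        by (simp only: distrib_left sum_distrib_left mult_ac)
      then show ?thesis
        unfolding 2 3 unfolding X_def mult.assoc .
    qed
    show ?thesis
      using A unfolding F_def K_def[symmetric] B t .
  qed
  \<comment> \<open>The part of the derivative of the \<open>i\<close>-th term that does not involve
    \<open>p\<close>: as \<open>v p 0 = - d\<close> in both cases, it is common to them, and so is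
    \<open>R\<close>.\<close>
  define g where "g i = (if i = 0 then 0 else
      of_real b ^ i * (- q (i - 1) 0 * H (of_nat i - of_nat d) +
        (if i = Suc d then 0 else - q (i - 1) 0 / (of_nat i - of_nat d - 1))))" for i :: nat
  define R where "R = (\<Sum>i<d + 4. g i) + deriv (E 1 (d + 4)) 0"
  \<comment> \<open>The binomial remainder vanishes at \<open>w = 0\<close>, so the product rule
    leaves its derivative times the power at 0, where \<open>p\<close> no longer occurs.\<close>
  have E_deriv: "deriv (E p (d + 4)) 0 = deriv (E 1 (d + 4)) 0" for p
  proof -
    have "deriv (\<lambda>w. of_real (x j) powr (- v p w) * binomial_remainder (d + 4) w (of_real (b / x j))) 0 =
        of_real (x j) powr of_nat d * deriv (\<lambda>w. binomial_remainder (d + 4) w (of_real (b / x j))) 0" for p j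
    proof -
      let ?B = "\<lambda>w. binomial_remainder (d + 4) w (of_real (b / x j))"
      have z: "b / x j > -1" using x0[of j] by (simp add: field_simps)
      then have "complex_of_real (b / x j) \<noteq> -1"
        by (metis of_real_1 of_real_eq_iff of_real_minus less_irrefl)
      then have B0: "?B 0 = 0" by (intro binomial_remainder_0) auto
      have "(?B has_field_derivative deriv ?B 0) (at 0)"
        by (rule holomorphic_derivI[OF binomial_remainder_holomorphic[OF z, of _ UNIV]]) auto
      moreover have "((\<lambda>w. of_real (x j) powr (- v p w)) has_field_derivative
          deriv (\<lambda>w. of_real (x j) powr (- v p w)) 0) (at 0)"
        by (rule holomorphic_derivI[of _ UNIV]) (auto intro!: powr_holomorphic holomorphic_intros vh x0)
      ultimately have "((\<lambda>w. of_real (x j) powr (- v p w) * ?B w) has_field_derivative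
          deriv (\<lambda>w. of_real (x j) powr (- v p w)) 0 * ?B 0 + deriv ?B 0 * of_real (x j) powr (- v p 0)) (at 0)"
        by (rule DERIV_mult[rotated])
      then show ?thesis
        unfolding B0 by (intro DERIV_imp_deriv) (simp add: v_def mult.commute)
    qed
    then have "(\<lambda>j. of_real (x j) powr of_nat d * deriv (\<lambda>w. binomial_remainder (d + 4) w (of_real (b / x j))) 0)
        sums deriv (E p (d + 4)) 0" for p
      using remainder_sum(3)[OF a b vh, of "d + 4" p 0] unfolding E_def x_def by (simp add: v_def)
    then show ?thesis using sums_unique2 by blast
  qed
  have tm_deriv: "(tm p i has_field_derivative g i + (if i = 0 then of_nat p * deriv (hurwitz_zeta a) (- of_nat d) else 0)
      - (if i = Suc d then of_real b ^ (d + 1) * ((- 1) ^ d * harm d / of_nat (d + 1)) / of_nat p else 0)) (at 0)"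
    if p: "p \<in> {1, 2}" for p i
  proof -
    have vD: "(v p has_field_derivative of_nat p) (at 0)"
      unfolding v_def by (auto intro!: derivative_eq_intros)
    have HvD: "((\<lambda>w. H (v p w + of_nat i)) has_field_derivative deriv H (v p 0 + of_nat i) * of_nat p) (at 0)"
      by (rule DERIV_chain2[OF HD]) (auto intro!: derivative_eq_intros vD)
    have qD: "(q d has_field_derivative (- 1) ^ d * harm d / of_nat (Suc d)) (at 0)"
      unfolding q_def by (intro DERIV_cdivide has_field_derivative_gbinomial_neg)
    have ne: "v p 0 + of_nat i - 1 \<noteq> 0" if "i \<noteq> Suc d"
    proof
      assume "v p 0 + of_nat i - 1 = 0"
      then have "of_nat i = (of_nat (Suc d) :: complex)" unfolding v_def by (simp add: algebra_simps)
      then show False using that by (simp only: of_nat_eq_iff)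
    qed
    show ?thesis
    proof (cases i)
      case 0
      have "deriv (hurwitz_zeta a) (- of_nat d) = deriv H (- of_nat d) - 1 / (of_nat d + 1) ^ 2"
        unfolding hurwitz_zeta_def H_def[symmetric]
      proof (rule DERIV_imp_deriv)
        have 1: "(- of_nat d - 1 :: complex) \<noteq> 0"
          by (metis (no_types, lifting) add.commute add.inverse_distrib_swap diff_conv_add_uminus neg_equal_0_iff_equal of_nat_Suc of_nat_neq_0)
        have "((\<lambda>w. 1 / (w - 1)) has_field_derivative - 1 / (- of_nat d - 1)\<^sup>2) (at (- of_nat d :: complex))"
          using 1 by (auto intro!: derivative_eq_intros simp: power2_eq_square)
        then have "((\<lambda>w. 1 / (w - 1) + H w) has_field_derivative - 1 / (- of_nat d - 1)\<^sup>2 + deriv H (- of_nat d)) (at (- of_nat d))"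
          by (rule DERIV_add[OF _ HD])
        moreover have "(- of_nat d - 1 :: complex)\<^sup>2 = (of_nat d + 1)\<^sup>2"
          by (simp add: power2_eq_square algebra_simps)
        ultimately show "((\<lambda>w. 1 / (w - 1) + H w) has_field_derivative deriv H (- of_nat d) - 1 / (of_nat d + 1)\<^sup>2) (at (- of_nat d))"
          by simp
      qed
      note hz = this
      have n1: "v p 0 - 1 \<noteq> 0" using ne 0 by simp
      have "((\<lambda>w. 1 / (v p w - 1)) has_field_derivative - of_nat p / (v p 0 - 1)\<^sup>2) (at 0)"
        using n1 by (auto intro!: derivative_eq_intros vD simp: power2_eq_square)
      from DERIV_add[OF HvD this]
      have "((\<lambda>w. H (v p w + of_nat i) + 1 / (v p w - 1)) has_field_derivative
        deriv H (- of_nat d) * of_nat p + - of_nat p / (- of_nat d - 1)\<^sup>2) (at 0)"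
        using 0 by (simp add: v_def)
      moreover have "tm p i = (\<lambda>w. H (v p w + of_nat i) + 1 / (v p w - 1))"
        unfolding tm2[of i p, unfolded 0, simplified] 0 by simp
      moreover have "(- of_nat d - 1 :: complex)\<^sup>2 = (of_nat d + 1)\<^sup>2"
        by (simp add: power2_eq_square algebra_simps)
      ultimately show ?thesis
        unfolding hz using 0 by (simp add: g_def algebra_simps)
    next
      \<comment> \<open>For \<open>i > 0\<close> the binomial coefficient is 0 at
        \<open>w = 0\<close> and annihilates the derivative of the zeta factor, through which the
        chain rule would bring in \<open>p\<close>.\<close>
      case (Suc k)
      have bD: "((\<lambda>w. (- w) gchoose i) has_field_derivative - q k 0) (at 0)"
      proof -
        have "(q k has_field_derivative (- 1) ^ k * harm k / of_nat (Suc k)) (at 0)"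
          unfolding q_def by (intro DERIV_cdivide has_field_derivative_gbinomial_neg)
        then have "((\<lambda>w. - w * q k w) has_field_derivative - q k 0) (at 0)"
          by (auto intro!: derivative_eq_intros)
        then show ?thesis unfolding Suc gbinomial_neg_factor q_def .
      qed
      have b0: "((- 0) gchoose i :: complex) = 0" using Suc by simp
      show ?thesis
      proof (cases "i = Suc d")
        case True
        have k: "k = d" using True Suc by simp
        have "(tm p i has_field_derivative of_real b ^ i *
           ((- q k 0 * H (v p 0 + of_nat i) + deriv H (v p 0 + of_nat i) * of_nat p * ((- 0) gchoose i)) +
            (- ((- 1) ^ d * harm d / of_nat (Suc d))) * inverse (of_nat p))) (at 0)"
          unfolding tm1[OF True]
          by (intro DERIV_cmult DERIV_add DERIV_cmult_right DERIV_minus DERIV_mult HvD bD qD)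
        then show ?thesis
          unfolding b0 using True Suc
          by (simp add: g_def v_def divide_inverse algebra_simps)
      next
        case False
        have "((\<lambda>w. v p w + of_nat i - 1) has_field_derivative of_nat p) (at 0)"
          by (auto intro!: derivative_eq_intros vD)
        then have "(tm p i has_field_derivative of_real b ^ i *
           ((- q k 0 * H (v p 0 + of_nat i) + deriv H (v p 0 + of_nat i) * of_nat p * ((- 0) gchoose i)) +
            (- q k 0 * (v p 0 + of_nat i - 1) - ((- 0) gchoose i) * of_nat p) /
              ((v p 0 + of_nat i - 1) * (v p 0 + of_nat i - 1)))) (at 0)"
          unfolding tm2[OF False]
          by (intro DERIV_cmult DERIV_add DERIV_mult DERIV_divide HvD bD ne[OF False])
        then show ?thesis
          unfolding b0 using False Suc ne[OF False]
          by (simp add: g_def v_def)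
      qed
    qed
  qed
  show ?thesis
  proof (intro exI[of _ R] ballI)
    fix p :: nat assume p: "p \<in> {1, 2}"
    define Q where "Q L = remove_sings (F p (2 * L + d + 2))" for L
    have Qan: "Q L w = F p (2 * L + d + 2) w" if "F p (2 * L + d + 2) analytic_on {w}" for L w
      unfolding Q_def using that by (rule remove_sings_at_analytic)
    have Qeq: "Q L w = F p (2 * L + d + 2) w" if "Re w > real d + 1" for L w
      by (rule Qan[OF analytic_on_subset[OF F_an[OF p]]]) (use that in auto)
    obtain G where G: "G nicely_meromorphic_on UNIV" "\<And>L w. Re w > - real L \<Longrightarrow> G w = Q L w"
    proof (rule glue_halfplanes[of Q "real d + 1" "Q 0"])
      show "Q L nicely_meromorphic_on {w. Re w > - real L}" for L
        unfolding Q_def by (intro remove_sings_nicely_meromorphic F_mero p)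
      show "Q L w = Q 0 w" if "Re w > real d + 1" for L w
        unfolding Qeq[OF that] by (rule has_sum_unique[OF F_sum[OF p that] F_sum[OF p that]])
    qed blast
    \<comment> \<open>The choice \<open>L = 1\<close>, hence order \<open>d + 4\<close>, reaches
      \<open>Re w > - 1\<close> and thus a neighbourhood of 0.\<close>
    have F0: "F p (2 * 1 + d + 2) analytic_on {0}"
    proof -
      \<comment> \<open>Small enough for \<open>\<bar>p * Re w\<bar> < 1\<close>, so that no index
        other than \<open>d + 1\<close> can bring the argument to the pole.\<close>
      define r :: real where "r = 1 / 4"
      have "F p (2 * 1 + d + 2) holomorphic_on ball 0 r"
        unfolding F_def
      proof (intro holomorphic_on_add holomorphic_on_sum tm_holo holomorphic_on_subset[OF E])
        have re: "\<bar>Re w\<bar> < 1 / 4" if "w \<in> ball 0 r" for w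
          using that abs_Re_le_cmod[of w] unfolding r_def by auto
        show "ball 0 r \<subseteq> {w. Re (v p w) > 1 - real (2 * 1 + d + 2)}"
          using p re unfolding v_def by fastforce
        fix i :: nat and w :: complex assume w: "w \<in> ball 0 r" and i: "i \<noteq> Suc d"
        show "v p w + of_nat i \<noteq> 1"
        proof
          assume "v p w + of_nat i = 1"
          then have "Re (v p w + of_nat i) = 1" by simp
          then have "real p * Re w + real i = 1 + real d" unfolding v_def by simp
          moreover have "\<bar>real p * Re w\<bar> < 1" using re[OF w] p by auto
          ultimately have "\<bar>real i - (1 + real d)\<bar> < 1" by linarith
          then show False using i by linarith
        qed
      qed
      then show ?thesis unfolding analytic_at r_def
        by (intro exI[of _ "ball 0 (1 / 4)"]) auto
    qed
    have FD: "(F p (2 * 1 + d + 2) has_field_derivative (\<Sum>i<d + 4. g i + (if i = 0 then of_nat p * deriv (hurwitz_zeta a) (- of_nat d) else 0)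
      - (if i = Suc d then of_real b ^ (d + 1) * ((- 1) ^ d * harm d / of_nat (d + 1)) / of_nat p else 0)) + deriv (E 1 (d + 4)) 0) (at 0)"
    proof -
      have eq: "2 * 1 + d + 2 = d + 4" by simp
      have "(E p (d + 4) has_field_derivative deriv (E p (d + 4)) 0) (at 0)"
        by (rule holomorphic_derivI[OF holomorphic_on_subset[OF E half[OF p, of 1, unfolded eq]] open_halfspace_Re_gt])
           (auto simp: numeral_eq_Suc)
      then show ?thesis
        unfolding F_def eq E_deriv[of p] by (intro DERIV_add DERIV_sum tm_deriv p)
    qed
    show "zeta_reg (\<lambda>j w. of_real (real j + a) ^ d *
      (of_real (real j + a) powr (- (of_nat (p - 1) * w)) * of_real (real j + a + b) powr (- w))) UNIV
    (of_nat p * deriv (hurwitz_zeta a) (- of_nat d) + R -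
      of_real b ^ (d + 1) * ((- 1) ^ d * harm d / of_nat (d + 1)) / of_nat p)"
    proof (rule zeta_regI[where F = G and c = "real d + 1"])
      show "G meromorphic_on UNIV" using G(1) unfolding nicely_meromorphic_on_def by simp
      have ev1: "eventually (\<lambda>w. F p (2 * 1 + d + 2) w = G w) (nhds 0)"
      proof -
        have "eventually (\<lambda>w. remove_sings (F p (2 * 1 + d + 2)) w = F p (2 * 1 + d + 2) w) (nhds 0)"
          by (rule eventually_remove_sings_eq_nhds[OF F0])
        moreover have "eventually (\<lambda>w. w \<in> {w. Re w > - real 1}) (nhds 0)"
          by (rule eventually_nhds_in_open[OF open_halfspace_Re_gt]) simp
        ultimately show ?thesis
          by eventually_elim (use G(2)[of 1] in \<open>auto simp: Q_def\<close>)
      qed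
      show "G analytic_on {0}"
        using F0 analytic_at_cong[OF ev1 refl] by blast
      show "deriv G 0 = of_nat p * deriv (hurwitz_zeta a) (- of_nat d) + R -
        of_real b ^ (d + 1) * ((- 1) ^ d * harm d / of_nat (d + 1)) / of_nat p"
        unfolding deriv_cong_ev[OF ev1 refl, symmetric] DERIV_imp_deriv[OF FD]
        by (simp add: sum.distrib sum_subtractf R_def sum.delta)
      have GF: "G w = F p (2 * 0 + d + 2) w" if "Re w > real d + 1" for w
        using G(2)[of 0 w] Qeq[OF that, of 0] that by simp
      show "G analytic_on {w. Re w > real d + 1}"
      proof (rule analytic_on_Re_gt)
        have "F p (2 * 0 + d + 2) holomorphic_on {w. Re w > real d + 1}"
          by (rule analytic_imp_holomorphic[OF F_an[OF p]])
        then show "G holomorphic_on {w. Re w > real d + 1}"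
          by (rule holomorphic_transform) (simp add: GF)
      qed
      show "((\<lambda>j. of_real (real j + a) ^ d *
        (of_real (real j + a) powr (- (of_nat (p - 1) * w)) * of_real (real j + a + b) powr (- w))) has_sum G w) UNIV"
        if "Re w > real d + 1" for w
        using F_sum[OF p that, of 0] unfolding GF[OF that] x_def .
    qed
  qed
qed

lemma of_real_poly_mult:
  "complex_of_real (\<Sum>d<n. T d * x ^ d) * y = (\<Sum>d<n. of_real (T d) * (of_real x ^ d * y))"
  by (simp add: sum_distrib_right mult.assoc)

lemma zeta_reg_polynomial:
  fixes T :: "nat \<Rightarrow> real"
  assumes a: "a > 0"
  shows "zeta_reg (\<lambda>j w. of_real (\<Sum>d<n. T d * (real j + a) ^ d) * of_real (real j + a) powr (- w)) UNIV
    (\<Sum>d<n. of_real (T d) * deriv (hurwitz_zeta a) (- of_nat d))"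
  unfolding of_real_poly_mult by (intro zeta_reg_sum zeta_reg_cmult zeta_reg_hurwitz a)

text \<open>The multiplicative anomaly of the two factors. For one monomial write \<open>h\<close>
  for the Hurwitz derivative and \<open>e\<close> for the residue term. Then \<open>D1\<close> is
  \<open>h\<close>, \<open>p = 1\<close> gives \<open>D2 = h + R - e\<close>, and
  \<open>p = 2\<close> gives \<open>2 * h + R - e / 2\<close> for the product. The difference is
  \<open>e / 2\<close>, and \<open>R\<close> is gone.\<close>

theorem zeta_reg_product:
  fixes T :: "nat \<Rightarrow> real" and a b :: real and n :: nat
  defines "Q \<equiv> (\<lambda>x. \<Sum>d<n. T d * x ^ d)"
  assumes a: "a > 0" and b: "a + b > 0"
    and D1: "zeta_reg (\<lambda>j w. of_real (Q (real j + a)) * of_real (real j + a) powr (- w)) UNIV D1"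
    and D2: "zeta_reg (\<lambda>j w. of_real (Q (real j + a)) * of_real (real j + a + b) powr (- w)) UNIV D2"
  shows "zeta_reg (\<lambda>j w. of_real (Q (real j + a)) * of_real ((real j + a) * (real j + a + b)) powr (- w)) UNIV
    (D1 + D2 + of_real (\<Sum>d<n. T d * (b ^ (d + 1) * ((- 1) ^ d * harm d / real (d + 1)) / 2)))"
proof -
  define h where "h d = deriv (hurwitz_zeta a) (- of_nat d)" for d
  define e where "e d = complex_of_real b ^ (d + 1) * ((- 1) ^ d * harm d / of_nat (d + 1))" for d
  have "\<forall>d. \<exists>R. \<forall>p\<in>{1, 2 :: nat}. zeta_reg (\<lambda>j w. of_real (real j + a) ^ d *
      (of_real (real j + a) powr (- (of_nat (p - 1) * w)) * of_real (real j + a + b) powr (- w))) UNIV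
    (of_nat p * h d + R - e d / of_nat p)"
    unfolding h_def e_def by (rule allI, rule zeta_reg_monomial[OF a b])
  then obtain R where "\<forall>d. \<forall>p\<in>{1, 2 :: nat}. zeta_reg (\<lambda>j w. of_real (real j + a) ^ d *
      (of_real (real j + a) powr (- (of_nat (p - 1) * w)) * of_real (real j + a + b) powr (- w))) UNIV
    (of_nat p * h d + R d - e d / of_nat p)"
    by (drule_tac choice) (elim exE)
  then have R: "\<And>d p. p \<in> {1, 2 :: nat} \<Longrightarrow> zeta_reg (\<lambda>j w. of_real (real j + a) ^ d *
      (of_real (real j + a) powr (- (of_nat (p - 1) * w)) * of_real (real j + a + b) powr (- w))) UNIV
    (of_nat p * h d + R d - e d / of_nat p)"
    by (elim allE ballE) (assumption, erule notE)
  have S: "zeta_reg (\<lambda>j w. \<Sum>d<n. of_real (T d) * (of_real (real j + a) ^ d *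
      (of_real (real j + a) powr (- (of_nat (p - 1) * w)) * of_real (real j + a + b) powr (- w)))) UNIV
    (\<Sum>d<n. of_real (T d) * (of_nat p * h d + R d - e d / of_nat p))" if "p \<in> {1, 2}" for p
    by (rule zeta_reg_sum, rule zeta_reg_cmult, rule R[OF that])
  have Qx: "(\<Sum>d<n. of_real (T d) * (of_real (real j + a) ^ d * y)) = of_real (Q (real j + a)) * y" for j and y :: complex
    unfolding Q_def of_real_poly_mult ..
  have "zeta_reg (\<lambda>j w. of_real (Q (real j + a)) * of_real (real j + a) powr (- w)) UNIV (\<Sum>d<n. of_real (T d) * h d)"
    unfolding Q_def h_def by (rule zeta_reg_polynomial[OF a])
  then have D1': "D1 = (\<Sum>d<n. of_real (T d) * h d)"
    using D1 by (rule zeta_reg_unique[rotated])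
  have 1: "complex_of_real (real j + a) powr (- (of_nat (1 - 1) * w)) * y = y" for j w y
    using a by (auto simp: complex_eq_iff add_nonneg_pos)
  have "zeta_reg (\<lambda>j w. of_real (Q (real j + a)) * of_real (real j + a + b) powr (- w)) UNIV
      (\<Sum>d<n. of_real (T d) * (of_nat 1 * h d + R d - e d / of_nat 1))"
    using S[of 1, OF insertI1] unfolding Qx 1 .
  then have D2': "D2 = (\<Sum>d<n. of_real (T d) * (of_nat 1 * h d + R d - e d / of_nat 1))"
    using D2 by (rule zeta_reg_unique[rotated])
  have 2: "of_real (real j + a) powr (- (of_nat (2 - 1) * w)) * of_real (real j + a + b) powr (- w) =
      complex_of_real ((real j + a) * (real j + a + b)) powr (- w)" for j w
  proof -
    have "real j + a > 0" "real j + a + b > 0" using a b by auto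
    then show ?thesis
      unfolding of_real_mult by (subst powr_times_real) simp_all
  qed
  have "zeta_reg (\<lambda>j w. of_real (Q (real j + a)) * of_real ((real j + a) * (real j + a + b)) powr (- w)) UNIV
      (\<Sum>d<n. of_real (T d) * (of_nat 2 * h d + R d - e d / of_nat 2))"
    using S[of 2, OF insertI2[OF singletonI]] unfolding Qx 2 .
  also have "(\<Sum>d<n. of_real (T d) * (of_nat 2 * h d + R d - e d / of_nat 2)) =
      D1 + D2 + (\<Sum>d<n. of_real (T d) * (e d / 2))"
    unfolding D1' D2' by (simp add: sum.distrib[symmetric] algebra_simps)
  also have "(\<Sum>d<n. of_real (T d) * (e d / 2)) =
      complex_of_real (\<Sum>d<n. T d * (b ^ (d + 1) * ((- 1) ^ d * harm d / real (d + 1)) / 2))"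
    unfolding e_def by (simp add: harm_def)
  finally show ?thesis .
qed

section \<open>Special values of the zeta function\<close>

text \<open>\<open>hurwitz_zeta 1\<close> is the continuation except for its value at the pole,
  where division by zero leaves the regular part; \<open>remove_sings\<close> supplies the
  normalised value.\<close>

lemma riemann_zeta_eq: "riemann_zeta = remove_sings (hurwitz_zeta 1)"
  unfolding riemann_zeta_def
proof (rule continued_sum_eqI)
  show "remove_sings (hurwitz_zeta 1) nicely_meromorphic_on UNIV"
    by (intro remove_sings_nicely_meromorphic hurwitz_zeta_meromorphic) auto
  fix w assume w: "Re w > 1"
  then have "w \<noteq> 1" by auto
  then have 1: "remove_sings (hurwitz_zeta 1) w = hurwitz_zeta 1 w"
    by (intro remove_sings_at_analytic hurwitz_zeta_analytic) auto
  have 2: "((\<lambda>j. of_nat (Suc j) powr (- w)) has_sum hurwitz_zeta 1 w) UNIV"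
    using hurwitz_zeta_has_sum[OF _ w, of 1] by (simp add: add.commute)
  have "bij_betw Suc UNIV {1..}"
    by (rule bij_betwI[of _ _ _ "\<lambda>x. x - 1"]) auto
  from has_sum_reindex_bij_betw[OF this, of "\<lambda>m. of_nat m powr (- w)"] 2
  show "((\<lambda>m. of_nat m powr (- w)) has_sum remove_sings (hurwitz_zeta 1) w) {1..}"
    unfolding 1 by (simp only:)
qed

lemma neg_of_nat_neq_1: "- of_nat d \<noteq> (1 :: complex)"
proof
  assume "- of_nat d = (1 :: complex)"
  then have "Re (- of_nat d) = 1" by simp
  then show False by simp
qed

lemma deriv_riemann_zeta: "deriv riemann_zeta (- of_nat k) = deriv (hurwitz_zeta 1) (- of_nat k)"
  unfolding riemann_zeta_eq
  by (intro deriv_remove_sings_at_analytic hurwitz_zeta_analytic) (use neg_of_nat_neq_1 in auto)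

lemma meromorphic_eq_at:
  assumes F: "F meromorphic_on A" and G: "G meromorphic_on A"
    and A: "open A" "connected A"
    and B: "open B" "B \<noteq> {}" "B \<subseteq> A" and eq: "\<And>w. w \<in> B \<Longrightarrow> F w = G w"
    and w: "w \<in> A" "F analytic_on {w}" "G analytic_on {w}"
  shows "F w = G w"
proof -
  have "remove_sings F w = remove_sings G w"
  proof (rule nicely_meromorphic_eqI[OF _ _ A B _ w(1)])
    fix u assume u: "u \<in> B"
    have "eventually (\<lambda>z. z \<in> B) (at u)"
      using B(1) u by (rule eventually_at_in_open')
    then have "eventually (\<lambda>z. F z = G z) (at u)"
      by eventually_elim (rule eq)
    then show "remove_sings F u = remove_sings G u"
      by (rule remove_sings_cong) simp
  qed (intro remove_sings_nicely_meromorphic F G)+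
  then show ?thesis
    using w(2,3) by simp
qed

text \<open>For a series that defines a holomorphic function already on a half-plane around 0: its
  own derivative there, which can be found termwise, is the regularised one.\<close>

lemma zeta_reg_deriv_eq:
  assumes "zeta_reg t I D" and S: "S holomorphic_on {w. Re w > - e}" "e > 0"
    and sum: "\<And>w. Re w > c \<Longrightarrow> ((\<lambda>i. t i w) has_sum S w) I"
  shows "deriv S 0 = D"
proof -
  from assms(1) obtain F c' where F: "F meromorphic_on UNIV" "F analytic_on {0}"
    and an: "\<And>c. c \<ge> c' \<Longrightarrow> F analytic_on {w. Re w > c}"
    and Fs: "\<And>w. Re w > c' \<Longrightarrow> ((\<lambda>i. t i w) has_sum F w) I" and D: "deriv F 0 = D"
    by (rule zeta_regE) blast
  have San: "S analytic_on {w. Re w > - e}" by (rule analytic_on_Re_gt[OF S(1)])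
  have "eventually (\<lambda>w. F w = S w) (nhds 0)"
  proof -
    obtain A where A: "open A" "0 \<in> A" "F holomorphic_on A"
      using F(2) by (auto simp: analytic_at)
    have "eventually (\<lambda>w. w \<in> A \<inter> {w. Re w > - e}) (nhds 0)"
      using A S(2) by (intro eventually_nhds_in_open) (auto intro: open_halfspace_Re_gt)
    then show ?thesis
    proof eventually_elim
      case (elim w)
      show ?case
      proof (rule meromorphic_eq_at[of F "{w. Re w > - e}" S "{w. Re w > max (- e) (max c c')}"])
        show "F analytic_on {w}" using elim A analytic_at by auto
        show "S analytic_on {w}" using San by (rule analytic_on_subset) (use elim in auto)
        show "F u = S u" if "u \<in> {w. Re w > max (- e) (max c c')}" for u
          using that by (intro has_sum_unique[OF Fs sum]) auto
        show "{w. Re w > max (- e) (max c c')} \<noteq> {}" by (rule nonempty_Re_gt)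
        show "open {w. Re w > - e}" "open {w. Re w > max (- e) (max c c')}" by (rule open_halfspace_Re_gt)+
        show "connected {w. Re w > - e}" by (rule connected_Re_gt)
        show "F meromorphic_on {w. Re w > - e}" using F(1) by (rule meromorphic_on_subset) auto
        show "S meromorphic_on {w. Re w > - e}" using San by (rule analytic_on_imp_meromorphic_on)
      qed (use elim in auto)
    qed
  qed
  then have "deriv F 0 = deriv S 0"
    by (rule deriv_cong_ev) simp
  then show ?thesis using D by simp
qed

lemma hurwitz_eq_off_pole:
  assumes "a > 0" and G: "G meromorphic_on UNIV" "G analytic_on - {1}"
    and eq: "\<And>w. Re w > 1 \<Longrightarrow> hurwitz_zeta a w = G w" and w: "w \<noteq> 1"
  shows "hurwitz_zeta a w = G w"
proof (rule meromorphic_eq_at[OF hurwitz_zeta_meromorphic[OF assms(1)] G(1), of "{w. Re w > 1}"])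
  show "hurwitz_zeta a analytic_on {w}"
    using w by (intro hurwitz_zeta_analytic assms) auto
  show "G analytic_on {w}"
    using G(2) by (rule analytic_on_subset) (use w in auto)
  show "{w. Re w > 1} \<noteq> {}" by (rule nonempty_Re_gt)
  show "open {w. Re w > 1}" by (rule open_halfspace_Re_gt)
qed (use eq in auto)

lemma powr_analytic:
  assumes "x > 0" "v analytic_on A"
  shows "(\<lambda>w. complex_of_real x powr (v w)) analytic_on A"
  using assms by (auto intro!: analytic_intros simp: complex_nonpos_Reals_iff)

text \<open>Splitting the integers \<open>j + 1\<close> by parity gives \<open>2 powr (- w)\<close>
  times the zeta functions at 1 and at \<open>1 / 2\<close>.\<close>

lemma hurwitz_zeta_half:
  assumes "w \<noteq> 1"
  shows "hurwitz_zeta (1 / 2) w = (2 powr w - 1) * hurwitz_zeta 1 w"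
proof (rule hurwitz_eq_off_pole[OF _ _ _ _ assms])
  have an: "(\<lambda>w. (2::complex) powr w) analytic_on A" for A
    using powr_analytic[of 2 "\<lambda>w. w" A] by (simp add: analytic_on_ident)
  show "(\<lambda>w. (2 powr w - 1) * hurwitz_zeta 1 w) meromorphic_on UNIV"
    by (intro meromorphic_on_mult meromorphic_on_diff meromorphic_on_const
        analytic_on_imp_meromorphic_on[OF an] hurwitz_zeta_meromorphic) simp
  show "(\<lambda>w. (2 powr w - 1) * hurwitz_zeta 1 w) analytic_on - {1}"
    by (intro analytic_on_mult analytic_on_diff analytic_on_const an hurwitz_zeta_analytic) auto
  fix w :: complex assume w: "Re w > 1"
  define f where "f j = complex_of_real (real j + 1) powr (- w)" for j
  have 1: "(f has_sum hurwitz_zeta 1 w) UNIV"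
    unfolding f_def by (rule hurwitz_zeta_has_sum[OF _ w]) simp
  have f: "f (2 * j + 1) = 2 powr (- w) * of_real (real j + 1) powr (- w)"
      "f (2 * j) = 2 powr (- w) * of_real (real j + 1 / 2) powr (- w)" for j
  proof -
    have e: "real (2 * j + 1) + 1 = 2 * (real j + 1)" "real (2 * j) + 1 = 2 * (real j + 1 / 2)" by auto
    have m: "complex_of_real (2 * y) powr (- w) = 2 powr (- w) * of_real y powr (- w)" if "y > 0" for y
      using that powr_times_real[of 2 "of_real y" "- w"] by simp
    show "f (2 * j + 1) = 2 powr (- w) * of_real (real j + 1) powr (- w)"
      unfolding f_def e by (rule m) simp
    show "f (2 * j) = 2 powr (- w) * of_real (real j + 1 / 2) powr (- w)"
      unfolding f_def e by (rule m) simp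
  qed
  have inj: "inj (\<lambda>j :: nat. 2 * j + 1)" "inj (\<lambda>j :: nat. 2 * j)"
    by (auto intro: injI)
  have odd: "(f has_sum 2 powr (- w) * hurwitz_zeta 1 w) (range (\<lambda>j. 2 * j + 1))"
    unfolding has_sum_reindex[OF inj(1)] o_def f
    by (intro has_sum_cmult_right hurwitz_zeta_has_sum w) simp
  have even: "(f has_sum 2 powr (- w) * hurwitz_zeta (1 / 2) w) (range (\<lambda>j. 2 * j))"
    unfolding has_sum_reindex[OF inj(2)] o_def f
    by (intro has_sum_cmult_right hurwitz_zeta_has_sum w) simp
  have "range (\<lambda>j. 2 * j + 1) \<inter> range (\<lambda>j. 2 * j) = ({} :: nat set)"
    by (auto, presburger)
  moreover have "range (\<lambda>j. 2 * j + 1) \<union> range (\<lambda>j. 2 * j) = (UNIV :: nat set)"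
    by (auto simp: image_iff) presburger
  ultimately have "(f has_sum (2 powr (- w) * hurwitz_zeta 1 w + 2 powr (- w) * hurwitz_zeta (1 / 2) w)) UNIV"
    using has_sum_Un_disjoint[OF odd even] by simp
  then have "hurwitz_zeta 1 w = 2 powr (- w) * hurwitz_zeta 1 w + 2 powr (- w) * hurwitz_zeta (1 / 2) w"
    using 1 has_sum_unique by blast
  then show "hurwitz_zeta (1 / 2) w = (2 powr w - 1) * hurwitz_zeta 1 w"
    by (simp add: powr_minus field_simps)
qed simp

lemma hurwitz_zeta_plus1:
  assumes a: "a > 0" and "w \<noteq> 1"
  shows "hurwitz_zeta (a + 1) w = hurwitz_zeta a w - of_real a powr (- w)"
proof (rule hurwitz_eq_off_pole[OF _ _ _ _ assms(2)])
  have an: "(\<lambda>w. complex_of_real a powr (- w)) analytic_on A" for A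
    by (intro powr_analytic a analytic_intros)
  show "(\<lambda>w. hurwitz_zeta a w - of_real a powr (- w)) meromorphic_on UNIV"
    by (intro meromorphic_on_diff analytic_on_imp_meromorphic_on[OF an] hurwitz_zeta_meromorphic a)
  show "(\<lambda>w. hurwitz_zeta a w - of_real a powr (- w)) analytic_on - {1}"
    by (intro analytic_on_diff an hurwitz_zeta_analytic a) auto
  fix w :: complex assume w: "Re w > 1"
  have 1: "((\<lambda>j. of_real (real j + (a + 1)) powr (- w)) has_sum hurwitz_zeta (a + 1) w) UNIV"
    by (rule hurwitz_zeta_has_sum[OF _ w]) (use a in simp)
  have 2: "((\<lambda>j. of_real (real (Suc j) + a) powr (- w)) has_sum (hurwitz_zeta a w - of_real a powr (- w))) UNIV"
    using has_sum_Suc_shift[OF hurwitz_zeta_has_sum[OF a w]] by simp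
  have 3: "real (Suc j) + a = real j + (a + 1)" for j by simp
  show "hurwitz_zeta (a + 1) w = hurwitz_zeta a w - of_real a powr (- w)"
    by (rule has_sum_unique[OF 1 2[unfolded 3]])
qed (use a in simp)

lemma hurwitz_zeta_shift:
  assumes a: "a > 0" and b: "a + b > 0" and w: "Re w > 1"
  shows "hurwitz_zeta (a + b) w = (\<Sum>i<K. ((- w) gchoose i) * of_real b ^ i * hurwitz_zeta a (w + of_nat i)) +
    remainder_sum a b K (\<lambda>w. w) w"
proof -
  have 1: "((\<lambda>j. (\<Sum>i<K. ((- w) gchoose i) * of_real b ^ i * of_real (real j + a) powr (- (w + of_nat i))) +
      of_real (real j + a) powr (- w) * binomial_remainder K w (of_real (b / (real j + a)))) has_sum
      (\<Sum>i<K. ((- w) gchoose i) * of_real b ^ i * hurwitz_zeta a (w + of_nat i)) + remainder_sum a b K (\<lambda>w. w) w) UNIV"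
  proof (rule has_sum_add)
    show "((\<lambda>j. of_real (real j + a) powr (- w) * binomial_remainder K w (of_real (b / (real j + a)))) has_sum
      remainder_sum a b K (\<lambda>w. w) w) UNIV"
      by (rule remainder_sum(2)[OF a b]) (use w in auto)
    show "((\<lambda>j. \<Sum>i<K. ((- w) gchoose i) * of_real b ^ i * of_real (real j + a) powr (- (w + of_nat i))) has_sum
      (\<Sum>i<K. ((- w) gchoose i) * of_real b ^ i * hurwitz_zeta a (w + of_nat i))) UNIV"
      using w by (intro has_sum_finite_sum has_sum_cmult_right hurwitz_zeta_has_sum a) auto
  qed
  have 2: "(\<Sum>i<K. ((- w) gchoose i) * of_real b ^ i * of_real (real j + a) powr (- (w + of_nat i))) +
      of_real (real j + a) powr (- w) * binomial_remainder K w (of_real (b / (real j + a))) =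
      of_real (real j + (a + b)) powr (- w)" for j
  proof -
    have "real j + a > 0" "real j + a + b > 0" using a b by auto
    from powr_shift_expansion[OF this, of w K] show ?thesis by (simp only: add.assoc)
  qed
  show ?thesis
    by (rule has_sum_unique[OF hurwitz_zeta_has_sum[OF b w] 1[unfolded 2]])
qed

section \<open>Zeros at the negative even integers\<close>

lemma sum_even_terms:
  fixes f :: "nat \<Rightarrow> complex"
  assumes "\<And>i. odd i \<Longrightarrow> f i = 0"
  shows "(\<Sum>i<2 * k + 2. f i) = (\<Sum>l\<le>k. f (2 * l))"
proof (induction k)
  case 0
  show ?case using assms[of 1] by (simp add: numeral_2_eq_2)
next
  case (Suc k)
  have "(\<Sum>i<2 * Suc k + 2. f i) = (\<Sum>i<2 * k + 2. f i) + f (2 * Suc k) + f (Suc (2 * Suc k))"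
    by (simp add: numeral_2_eq_2)
  also have "f (Suc (2 * Suc k)) = 0" by (rule assms) simp
  finally show ?case using Suc by simp
qed

text \<open>The binomial theorem: the power is a polynomial of degree \<open>m\<close>, and the
  partial sum already contains all of it.\<close>

lemma binomial_remainder_neg_nat:
  assumes "m < K" "z \<noteq> -1"
  shows "binomial_remainder K (- of_nat m) z = 0"
proof -
  have "1 + z \<noteq> 0" using assms(2) by (auto simp: add_eq_0_iff)
  then have "(1 + z) powr of_nat m = (z + 1) ^ m" by (simp add: powr_nat' add.commute)
  also have "\<dots> = (\<Sum>i\<le>m. of_nat (m choose i) * z ^ i)"
    by (simp add: binomial_ring)
  also have "\<dots> = (\<Sum>i<K. of_nat (m choose i) * z ^ i)"
    using assms(1) by (intro sum.mono_neutral_left) (auto simp: binomial_eq_0)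
  finally show ?thesis
    by (simp add: binomial_remainder_def binomial_gbinomial)
qed

lemma two_powr_neg_nat: "(2 :: complex) powr (- of_nat m) = (1 / 2) ^ m"
  by (simp add: powr_minus powr_nat' power_one_over inverse_eq_divide)

text \<open>Shifting by \<open>1 / 2\<close> in both directions cancels the odd terms of the expansion, hence also
  the pole of the zeta function.\<close>

lemma zeta_even_recurrence:
  "2 * (2 powr (- of_nat (2 * k)) - 1) * hurwitz_zeta 1 (- of_nat (2 * k)) - 2 powr (- of_nat (2 * k)) =
    (\<Sum>l\<le>k. of_nat (2 * k choose (2 * l)) * 2 * (1 / 2) ^ (2 * l) * hurwitz_zeta 1 (- of_nat (2 * (k - l))))"
proof -
  \<comment> \<open>Larger than \<open>2 * k\<close>, so that the remainders vanish at
    \<open>u\<close>, and large enough for \<open>u\<close> to lie in the half-plane where they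
    converge.\<close>
  define K where "K = 2 * k + 2"
  define u :: complex where "u = - of_nat (2 * k)"
  define E where "E = (\<lambda>w. remainder_sum 1 (1 / 2) K (\<lambda>w. w) w + remainder_sum 1 (- 1 / 2) K (\<lambda>w. w) w)"
  define G where "G = (\<lambda>w. (\<Sum>l\<le>k. ((- w) gchoose (2 * l)) * 2 * (1 / 2) ^ (2 * l) * hurwitz_zeta 1 (w + of_nat (2 * l))) + E w)"
  \<comment> \<open>The shifts \<open>1 + 1 / 2\<close> and \<open>1 - 1 / 2\<close> of the base
    point 1. Both values are multiples of the zeta function at 1 up to one term, which makes the
    expansion a recurrence.\<close>
  define F where "F = (\<lambda>w. hurwitz_zeta (3 / 2) w + hurwitz_zeta (1 / 2) w)"
  have E: "E holomorphic_on {w. Re w > 1 - real K}"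
    unfolding E_def by (intro holomorphic_on_add remainder_sum(1)) (auto intro: holomorphic_on_ident)
  have hz: "(\<lambda>w. hurwitz_zeta 1 (w + of_nat i)) analytic_on {w}" if "w + of_nat i \<noteq> 1" for i w
    by (rule analytic_on_compose[unfolded o_def, where g = "hurwitz_zeta 1"])
       (use that in \<open>auto intro!: analytic_intros hurwitz_zeta_analytic\<close>)
  have hzm: "(\<lambda>w. hurwitz_zeta 1 (w + of_nat i)) meromorphic_on A" for i A
    by (rule meromorphic_on_compose[OF hurwitz_zeta_meromorphic[of 1 UNIV]]) (auto intro!: analytic_intros)
  have ga: "(\<lambda>w. (- w) gchoose i) analytic_on A" for i and A :: "complex set"
    by (rule analytic_on_subset[of _ UNIV], subst analytic_on_open) (auto intro!: holomorphic_intros)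
  have Ea: "E analytic_on {w. Re w > 1 - real K}"
    by (rule analytic_on_Re_gt[OF E])
  have u: "u \<in> {w. Re w > 1 - real K}" unfolding u_def K_def by simp
  \<comment> \<open>Parity keeps the arguments of the remaining even terms off the pole; only an odd
    term could have met it.\<close>
  have ul: "u + of_nat (2 * l) \<noteq> 1" for l
  proof
    assume "u + of_nat (2 * l) = 1"
    then have "Re (u + of_nat (2 * l)) = 1" by simp
    then have "real (2 * l) = real (2 * k + 1)" unfolding u_def by simp
    then have "2 * l = 2 * k + 1" by (simp only: of_nat_eq_iff)
    then show False by presburger
  qed
  have u1: "u \<noteq> 1" using ul[of 0] by simp
  have FG: "F u = G u"
  proof (rule meromorphic_eq_at[of F "{w. Re w > 1 - real K}" G "{w. Re w > 1}"])
    show "F meromorphic_on {w. Re w > 1 - real K}"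
      unfolding F_def by (intro meromorphic_on_add hurwitz_zeta_meromorphic) auto
    show "G meromorphic_on {w. Re w > 1 - real K}"
      unfolding G_def
      by (intro meromorphic_on_add meromorphic_on_sum meromorphic_on_mult meromorphic_on_const hzm
          analytic_on_imp_meromorphic_on[OF ga] analytic_on_imp_meromorphic_on[OF Ea])
    show "F analytic_on {u}"
      unfolding F_def using u1 by (intro analytic_on_add hurwitz_zeta_analytic) auto
    show "G analytic_on {u}"
      unfolding G_def using u
      by (intro analytic_on_add analytic_on_sum analytic_on_mult analytic_on_const hz ga ul analytic_on_subset[OF Ea]) auto
    show "{w. Re w > 1} \<noteq> {}" by (rule nonempty_Re_gt)
    show "open {w. Re w > 1}" "open {w. Re w > 1 - real K}" by (rule open_halfspace_Re_gt)+
    show "connected {w. Re w > 1 - real K}" by (rule connected_Re_gt)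
    show "{w. Re w > 1} \<subseteq> {w. Re w > 1 - real K}" by auto
    fix w assume "w \<in> {w. Re w > 1}"
    then have w: "Re w > 1" by simp
    define f where "f i = ((- w) gchoose i) * (of_real (1 / 2) ^ i + of_real (- 1 / 2) ^ i) * hurwitz_zeta 1 (w + of_nat i)" for i
    have "F w = (\<Sum>i<K. f i) + E w"
      using hurwitz_zeta_shift[of 1 "1 / 2" w K] hurwitz_zeta_shift[of 1 "- 1 / 2" w K] w
      unfolding F_def E_def f_def by (simp add: ring_distribs sum.distrib)
    also have "(\<Sum>i<K. f i) = (\<Sum>l\<le>k. f (2 * l))"
      unfolding K_def by (rule sum_even_terms) (simp add: f_def power_minus_odd)
    also have "(\<Sum>l\<le>k. f (2 * l)) = (\<Sum>l\<le>k. ((- w) gchoose (2 * l)) * 2 * (1 / 2) ^ (2 * l) * hurwitz_zeta 1 (w + of_nat (2 * l)))"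
      unfolding f_def by (intro sum.cong) auto
    finally show "F w = G w" unfolding G_def .
  qed (rule u)
  have half: "complex_of_real (1 / 2) powr (- u) = 2 powr u"
    unfolding u_def two_powr_neg_nat minus_minus by (subst powr_nat') simp_all
  have Fu: "F u = 2 * (2 powr u - 1) * hurwitz_zeta 1 u - 2 powr u"
    using hurwitz_zeta_plus1[of "1 / 2" u, unfolded half] hurwitz_zeta_half[OF u1] u1
    unfolding F_def by simp
  have Eu: "E u = 0"
  proof -
    have "remainder_sum 1 b K (\<lambda>w. w) u = 0" if "b \<in> {1 / 2, - 1 / 2}" for b
    proof -
      have "b / (real j + 1) \<noteq> -1" for j using that by (auto simp: field_simps)
      then have "complex_of_real (b / (real j + 1)) \<noteq> -1" for j
        by (metis of_real_1 of_real_eq_iff of_real_minus)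
      then have "binomial_remainder K u (complex_of_real (b / (real j + 1))) = 0" for j
        unfolding u_def by (intro binomial_remainder_neg_nat) (auto simp: K_def)
      then show ?thesis
        unfolding remainder_sum_def by (simp only: mult_zero_right suminf_zero)
    qed
    then show ?thesis unfolding E_def by simp
  qed
  have Gu: "G u = (\<Sum>l\<le>k. of_nat (2 * k choose (2 * l)) * 2 * (1 / 2) ^ (2 * l) * hurwitz_zeta 1 (- of_nat (2 * (k - l))))"
    unfolding G_def Eu add_0_right
  proof (rule sum.cong)
    fix l assume "l \<in> {..k}"
    then have "2 * l \<le> 2 * k" "2 * (k - l) = 2 * k - 2 * l" by auto
    then have "u + of_nat (2 * l) = - of_nat (2 * (k - l))"
      unfolding u_def by (simp only: of_nat_diff) simp
    moreover have "((- u) gchoose (2 * l)) = of_nat (2 * k choose (2 * l))"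
      unfolding u_def by (simp only: minus_minus binomial_gbinomial)
    ultimately show "((- u) gchoose (2 * l)) * 2 * (1 / 2) ^ (2 * l) * hurwitz_zeta 1 (u + of_nat (2 * l)) =
        of_nat (2 * k choose (2 * l)) * 2 * (1 / 2) ^ (2 * l) * hurwitz_zeta 1 (- of_nat (2 * (k - l)))"
      by (simp only:)
  qed simp
  show ?thesis
    using trans[OF trans[OF Fu[symmetric] FG] Gu] unfolding u_def .
qed

text \<open>For \<open>k = 0\<close> the factor \<open>2 powr 0 - 1\<close> removes the left zeta
  value, and the recurrence reads \<open>- 1 = 2 * hurwitz_zeta 1 0\<close>.\<close>

lemma hurwitz_zeta_1_0: "hurwitz_zeta 1 0 = - 1 / 2"
proof -
  have "- 1 = 2 * hurwitz_zeta 1 0"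
    using zeta_even_recurrence[of 0] by simp
  then show ?thesis by simp
qed

text \<open>By induction only the terms \<open>l = 0\<close> and \<open>l = k\<close> of the
  recurrence remain. The latter involves the value \<open>-1 / 2\<close> at 0 and cancels the power
  of 2 on the left, which leaves a nonzero multiple of the wanted value.\<close>

lemma hurwitz_zeta_neg_even:
  "k > 0 \<Longrightarrow> hurwitz_zeta 1 (- of_nat (2 * k)) = 0"
proof (induction k rule: less_induct)
  case (less k)
  define x :: complex where "x = (1 / 2) ^ (2 * k)"
  have x: "(2 :: complex) powr (- of_nat (2 * k)) = x"
    unfolding x_def by (rule two_powr_neg_nat)
  define f where "f l = of_nat (2 * k choose (2 * l)) * 2 * (1 / 2) ^ (2 * l) * hurwitz_zeta 1 (- of_nat (2 * (k - l)))" for l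
  have "(\<Sum>l\<le>k. f l) = (\<Sum>l\<in>{0, k}. f l)"
  proof (rule sum.mono_neutral_right)
    show "\<forall>l\<in>{..k} - {0, k}. f l = 0"
    proof
      fix l assume "l \<in> {..k} - {0, k}"
      then have "hurwitz_zeta 1 (- of_nat (2 * (k - l))) = 0"
        by (intro less.IH) auto
      then show "f l = 0" unfolding f_def by (simp only: mult_zero_right)
    qed
  qed auto
  also have "\<dots> = f 0 + f k" using less.prems by simp
  also have "f 0 = 2 * hurwitz_zeta 1 (- of_nat (2 * k))"
    unfolding f_def by simp
  also have "f k = - x"
    unfolding f_def x_def by (simp add: hurwitz_zeta_1_0)
  finally have "2 * (x - 1) * hurwitz_zeta 1 (- of_nat (2 * k)) - x = 2 * hurwitz_zeta 1 (- of_nat (2 * k)) + - x"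
    using zeta_even_recurrence[of k] unfolding x f_def by simp
  then have "(2 * x - 4) * hurwitz_zeta 1 (- of_nat (2 * k)) = 0"
    by (simp add: algebra_simps)
  moreover have "2 * x - 4 \<noteq> 0"
  proof
    assume "2 * x - 4 = 0"
    then have "norm x = 2" by simp
    moreover have "norm x = (1 / 2) ^ (2 * k)" unfolding x_def by (simp add: norm_power norm_divide)
    moreover have "(1 / 2 :: real) ^ (2 * k) \<le> 1" by (rule power_le_one) auto
    ultimately show False by simp
  qed
  ultimately show ?case by simp
qed

section \<open>Derivatives at the nonpositive integers\<close>

lemma hurwitz_zeta_has_field_derivative:
  assumes "a > 0"
  shows "(hurwitz_zeta a has_field_derivative deriv (hurwitz_zeta a) (- of_nat d)) (at (- of_nat d))"
proof -
  have "hurwitz_zeta a analytic_on {- of_nat d}"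
    using assms neg_of_nat_neq_1[of d] by (intro hurwitz_zeta_analytic) auto
  then have "hurwitz_zeta a field_differentiable at (- of_nat d)"
    by (rule analytic_on_imp_differentiable_at) simp
  then show ?thesis by (simp add: DERIV_deriv_iff_field_differentiable)
qed

lemma deriv_cong_off_pole:
  assumes "\<And>w. w \<noteq> 1 \<Longrightarrow> f w = g w" "z \<noteq> (1::complex)"
  shows "deriv f z = deriv g z"
proof (rule deriv_cong_ev)
  have "eventually (\<lambda>w. w \<in> - {1}) (nhds z)"
    using assms(2) by (intro eventually_nhds_in_open) auto
  then show "eventually (\<lambda>w. f w = g w) (nhds z)"
    by eventually_elim (use assms in auto)
qed simp

text \<open>The product rule for \<open>(2 powr w - 1) * hurwitz_zeta 1 w\<close>. The first
  summand, a zeta value and not a derivative, is the source of the power of 2 in odd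
  dimensions.\<close>

lemma deriv_hurwitz_zeta_half:
  "deriv (hurwitz_zeta (1 / 2)) (- of_nat d) =
    of_real (ln 2) * (1 / 2) ^ d * hurwitz_zeta 1 (- of_nat d) +
    ((1 / 2) ^ d - 1) * deriv (hurwitz_zeta 1) (- of_nat d)"
proof -
  have p: "(2 :: complex) powr (- of_nat d) = (1 / 2) ^ d"
    by (rule two_powr_neg_nat)
  have "((\<lambda>w. 2 powr w) has_field_derivative of_real (ln 2) * (1 / 2) ^ d) (at (- of_nat d :: complex))"
  proof -
    have "Ln 2 = complex_of_real (ln 2)" using Ln_of_real[of 2] by simp
    have "((\<lambda>w. 2 powr w) has_field_derivative Ln 2 * 2 powr (- of_nat d)) (at (- of_nat d :: complex))"
      by (rule has_field_derivative_powr_right) simp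
    then show ?thesis
      unfolding p \<open>Ln 2 = complex_of_real (ln 2)\<close> .
  qed
  then have "((\<lambda>w. 2 powr w - 1) has_field_derivative of_real (ln 2) * (1 / 2) ^ d) (at (- of_nat d :: complex))"
    using DERIV_diff[OF _ DERIV_const] by fastforce
  from DERIV_mult[OF this hurwitz_zeta_has_field_derivative[of 1 d]]
  have "deriv (\<lambda>w. (2 powr w - 1) * hurwitz_zeta 1 w) (- of_nat d) =
    of_real (ln 2) * (1 / 2) ^ d * hurwitz_zeta 1 (- of_nat d) +
    deriv (hurwitz_zeta 1) (- of_nat d) * ((1 / 2) ^ d - 1)"
    unfolding p by (intro DERIV_imp_deriv) simp
  moreover have "deriv (hurwitz_zeta (1 / 2)) (- of_nat d) = deriv (\<lambda>w. (2 powr w - 1) * hurwitz_zeta 1 w) (- of_nat d)"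
    by (intro deriv_cong_off_pole hurwitz_zeta_half neg_of_nat_neq_1)
  ultimately show ?thesis by (simp only: mult.commute)
qed

lemma powr_minus_has_field_derivative_0:
  "a > 0 \<Longrightarrow> ((\<lambda>w. complex_of_real a powr (- w)) has_field_derivative - of_real (ln a)) (at 0)"
  by (auto intro!: derivative_eq_intros simp: powr_def Ln_of_real)

lemma deriv_hurwitz_zeta_plus1:
  assumes a: "a > 0"
  shows "deriv (hurwitz_zeta (a + 1)) 0 = deriv (hurwitz_zeta a) 0 + of_real (ln a)"
proof -
  from DERIV_diff[OF hurwitz_zeta_has_field_derivative[OF a, of 0, simplified]
      powr_minus_has_field_derivative_0[OF a]]
  have "deriv (\<lambda>w. hurwitz_zeta a w - of_real a powr (- w)) 0 = deriv (hurwitz_zeta a) 0 + of_real (ln a)"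
    by (intro DERIV_imp_deriv) simp
  moreover have "deriv (hurwitz_zeta (a + 1)) 0 = deriv (\<lambda>w. hurwitz_zeta a w - of_real a powr (- w)) 0"
    by (intro deriv_cong_off_pole hurwitz_zeta_plus1 a) auto
  ultimately show ?thesis by simp
qed

lemma deriv_hurwitz_zeta_half_0:
  "deriv (hurwitz_zeta (1 / 2)) 0 = - of_real (ln 2) / 2"
  "deriv (hurwitz_zeta (3 / 2)) 0 = - (3 * of_real (ln 2) / 2)"
proof -
  show 1: "deriv (hurwitz_zeta (1 / 2)) 0 = - of_real (ln 2) / 2"
    using deriv_hurwitz_zeta_half[of 0] by (simp add: hurwitz_zeta_1_0)
  show "deriv (hurwitz_zeta (3 / 2)) 0 = - (3 * of_real (ln 2) / 2)"
    using deriv_hurwitz_zeta_plus1[of "1 / 2"] unfolding 1 by (simp add: ln_div)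
qed

text \<open>The weight is constant, so the anomaly carries \<open>harm 0 = 0\<close> and the two
  derivatives simply add.\<close>

lemma zeta_reg_half_product:
  "zeta_reg (\<lambda>j w. of_real ((real j + 1 / 2) * (real j + 3 / 2)) powr (- w)) UNIV (- (2 * of_real (ln 2)))"
proof -
  have 1: "zeta_reg (\<lambda>j w. of_real (real j + a) powr (- w)) UNIV (deriv (hurwitz_zeta a) 0)" if "a > 0" for a
    using zeta_reg_hurwitz[OF that, of 0] by simp
  have e: "real j + 1 / 2 + 1 = real j + 3 / 2" for j by simp
  have "zeta_reg (\<lambda>j w. of_real (\<Sum>d<1. 1 * (real j + 1 / 2) ^ d) * of_real ((real j + 1 / 2) * (real j + 1 / 2 + 1)) powr (- w)) UNIV
    (deriv (hurwitz_zeta (1 / 2)) 0 + deriv (hurwitz_zeta (3 / 2)) 0 +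
      of_real (\<Sum>d<1. 1 * (1 ^ (d + 1) * ((- 1) ^ d * harm d / real (d + 1)) / 2)))"
    using 1[of "1 / 2"] 1[of "3 / 2"] by (intro zeta_reg_product) (simp_all add: e del: of_real_add)
  then show ?thesis
    by (simp add: e deriv_hurwitz_zeta_half_0 harm_def field_simps del: of_real_add of_real_mult)
qed

lemma zeta_reg_square:
  "zeta_reg (\<lambda>j w. of_real ((real j + 1) * (real j + 1)) powr (- w)) UNIV (2 * deriv (hurwitz_zeta 1) 0)"
proof -
  have 1: "zeta_reg (\<lambda>j w. of_real (real j + a) powr (- w)) UNIV (deriv (hurwitz_zeta a) 0)" if "a > 0" for a
    using zeta_reg_hurwitz[OF that, of 0] by simp
  have "zeta_reg (\<lambda>j w. of_real (\<Sum>d<1. 1 * (real j + 1) ^ d) * of_real ((real j + 1) * (real j + 1 + 0)) powr (- w)) UNIV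
    (deriv (hurwitz_zeta 1) 0 + deriv (hurwitz_zeta 1) 0 +
      of_real (\<Sum>d<1. 1 * (0 ^ (d + 1) * ((- 1) ^ d * harm d / real (d + 1)) / 2)))"
    using 1[of 1] by (intro zeta_reg_product) (simp_all del: of_real_add)
  then show ?thesis by (simp del: of_real_add of_real_mult)
qed

text \<open>The zeta functions of \<open>x\<^sup>2 - 1 / 4\<close> and \<open>x\<^sup>2\<close> differ by a series that can be
  differentiated termwise at \<open>0\<close>; Wallis' product is the resulting sum.\<close>

lemma deriv_hurwitz_zeta_1_0: "deriv (hurwitz_zeta 1) 0 = - of_real (ln (2 * pi)) / 2"
proof -
  define x where "x j = real j + 1" for j :: nat
  have x: "x j \<ge> 1" "x j > 0" for j unfolding x_def by auto
  define t where "t j w = of_real ((real j + 1 / 2) * (real j + 3 / 2)) powr (- w) + (- 1) *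
      of_real (x j * x j) powr (- w)" for j and w :: complex
  have pos: "(real j + 1 / 2) * (real j + 3 / 2) > 0" "x j * x j > 0" for j
    using x[of j] by (auto intro!: mult_pos_pos add_nonneg_pos)
  \<comment> \<open>On this half-plane the power of \<open>x j\<close> is at most
    \<open>x j powr (1 / 2)\<close>. Against the remainder of size
    \<open>1 / (x j)\<twosuperior>\<close> this leaves the summable
    \<open>x j powr (- (3 / 2))\<close>.\<close>
  define U where "U = {w :: complex. Re w > - (1 / 4)}"
  have U: "open U" unfolding U_def by (rule open_halfspace_Re_gt)
  have holo: "t j holomorphic_on A" for j A
    unfolding t_def
    by (intro holomorphic_on_add holomorphic_on_mult holomorphic_on_const powr_holomorphic pos holomorphic_on_minus holomorphic_on_ident)
  \<comment> \<open>Factoring out \<open>x j * x j\<close> turns the difference into a binomial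
    remainder of order 1, which yields the decay needed for convergence beyond 0.\<close>
  have t_eq: "t j w = of_real (x j) powr (- (2 * w)) * binomial_remainder 1 w (of_real (- 1 / (4 * x j * x j)))" for j w
  proof -
    have "(real j + 1 / 2) * (real j + 3 / 2) = x j * x j - 1 / 4"
      by (simp add: x_def field_simps)
    also have "\<dots> = x j * x j * (1 + - 1 / (4 * x j * x j))"
      using x(2)[of j] by (simp add: field_simps)
    finally have "(real j + 1 / 2) * (real j + 3 / 2) = x j * x j * (1 + - 1 / (4 * x j * x j))" .
    moreover have "1 + - 1 / (4 * x j * x j) \<ge> 0"
      using mult_mono[OF x(1) x(1), of j j] x[of j] by (simp add: field_simps)
    ultimately have "of_real ((real j + 1 / 2) * (real j + 3 / 2)) powr (- w) =
        of_real (x j * x j) powr (- w) * of_real (1 + - 1 / (4 * x j * x j)) powr (- w)"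
      using x[of j] by (simp only: of_real_mult) (subst powr_times_real, auto simp: powr_times_real)
    moreover have "complex_of_real (x j) powr (- (2 * w)) = of_real (x j * x j) powr (- w)"
    proof -
      have "- (2 * w) = - w + - w" by simp
      then show ?thesis
        using x[of j] unfolding of_real_mult by (simp only: powr_add) (subst powr_times_real, auto)
    qed
    ultimately show ?thesis
      unfolding t_def binomial_remainder_def by (simp add: right_diff_distrib)
  qed
  have M: "\<exists>r M. r > 0 \<and> cball w r \<subseteq> U \<and> summable M \<and>
      (\<forall>\<^sub>F j in sequentially. \<forall>u\<in>cball w r. norm (t j u) \<le> M j)" if w: "w \<in> U" for w
  proof -
    obtain r where r: "r > 0" "cball w r \<subseteq> U"
      using U w by (meson open_contains_cball)
    obtain C where C: "C \<ge> 0" "\<And>u z. norm u \<le> norm w + r \<Longrightarrow> norm z \<le> 1 / 2 \<Longrightarrow>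
        norm (binomial_remainder 1 u z) \<le> C * norm z ^ 1"
      using binomial_remainder_bound[of "norm w + r" 1] r(1) by (metis add_nonneg_nonneg less_imp_le norm_ge_zero)
    define M where "M j = C * real j powr (- (3 / 2))" for j
    have "summable M"
      unfolding M_def by (intro summable_mult) (simp add: summable_real_powr_iff)
    moreover have "\<forall>\<^sub>F j in sequentially. \<forall>u\<in>cball w r. norm (t j u) \<le> M j"
      using eventually_gt_at_top[of 0]
    proof eventually_elim
      fix j :: nat assume j: "j > 0"
      show "\<forall>u\<in>cball w r. norm (t j u) \<le> M j"
      proof
        fix u assume u: "u \<in> cball w r"
        have nu: "norm u \<le> norm w + r"
          using u norm_triangle_ineq2[of u w] by (simp add: dist_norm norm_minus_commute)
        have xx: "x j * x j \<ge> 1" using mult_mono[OF x(1) x(1), of j j] x[of j] by simp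
        have nz: "norm (complex_of_real (- 1 / (4 * x j * x j))) = 1 / (4 * (x j * x j))"
          using x[of j] by (simp only: norm_of_real) (simp add: abs_divide abs_mult)
        have ru: "- (2 * Re u) \<le> 1 / 2" using r(2) u unfolding U_def by auto
        have "norm (t j u) = x j powr (- (2 * Re u)) * norm (binomial_remainder 1 u (of_real (- 1 / (4 * x j * x j))))"
          unfolding t_eq norm_mult using x[of j] by (simp add: norm_powr_real_powr)
        also have "\<dots> \<le> x j powr (1 / 2) * (C * norm (complex_of_real (- 1 / (4 * x j * x j))) ^ 1)"
          using x[of j] xx ru
          by (intro mult_mono powr_mono C(2) nu) (auto simp: nz field_simps simp del: of_real_divide of_real_mult of_real_minus)
        also have "\<dots> = C * x j powr (- (3 / 2)) / 4"
        proof -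
          have "x j powr (- (3 / 2)) = x j powr (1 / 2 - 2)" by simp
          also have "\<dots> = x j powr (1 / 2) / x j powr 2" by (rule powr_diff)
          also have "x j powr 2 = x j * x j" using x[of j] by (simp add: power2_eq_square)
          finally show ?thesis unfolding nz by (simp add: mult_ac)
        qed
        also have "\<dots> \<le> C * x j powr (- (3 / 2))" using C(1) mult_nonneg_nonneg[OF C(1) powr_ge_zero[of "x j" "- (3 / 2)"]] by linarith
        also have "\<dots> \<le> M j"
          unfolding M_def using C(1) j by (intro mult_left_mono powr_mono2') (auto simp: x_def)
        finally show "norm (t j u) \<le> M j" .
      qed
    qed
    ultimately show ?thesis using r by blast
  qed
  define S where "S w = (\<Sum>j. t j w)" for w
  have S: "S holomorphic_on U"
    unfolding S_def by (rule holomorphic_series(1)[OF U holo M])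
  have "zeta_reg t UNIV (- (2 * of_real (ln 2)) + (- 1) * (2 * deriv (hurwitz_zeta 1) 0))"
    unfolding t_def x_def
    by (intro zeta_reg_add zeta_reg_half_product) (rule zeta_reg_cmult[OF zeta_reg_square])
  then have 1: "deriv S 0 = - (2 * of_real (ln 2)) + (- 1) * (2 * deriv (hurwitz_zeta 1) 0)"
  proof (rule zeta_reg_deriv_eq)
    show "S holomorphic_on {w. - (1 / 4) < Re w}" using S unfolding U_def .
    show "((\<lambda>i. t i w) has_sum S w) UNIV" if "Re w > 0" for w
      unfolding S_def by (rule holomorphic_series(2)[OF U holo M]) (use that in \<open>auto simp: U_def\<close>)
  qed simp
  have "deriv (t j) 0 = of_real (ln (4 * real (Suc j) ^ 2 / (4 * real (Suc j) ^ 2 - 1)))" for j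
  proof -
    let ?p = "(real j + 1 / 2) * (real j + 3 / 2)"
    have "(t j has_field_derivative - of_real (ln ?p) + - 1 * - of_real (ln (x j * x j))) (at 0)"
      unfolding t_def by (intro DERIV_add DERIV_cmult powr_minus_has_field_derivative_0 pos)
    then have "deriv (t j) 0 = of_real (ln (x j * x j) - ln ?p)"
      by (intro DERIV_imp_deriv) simp
    also have "ln (x j * x j) - ln ?p = ln (x j * x j / ?p)"
      by (rule ln_divide_pos[OF pos(2) pos(1), symmetric])
    also have "x j * x j / ?p = 4 * real (Suc j) ^ 2 / (4 * real (Suc j) ^ 2 - 1)"
    proof -
      have "4 * real (Suc j) ^ 2 - 1 = 4 * ?p"
        by (simp add: power2_eq_square field_simps)
      moreover have "4 * real (Suc j) ^ 2 = 4 * (x j * x j)"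
        by (simp add: x_def power2_eq_square add.commute)
      ultimately show ?thesis by (simp only: mult_divide_mult_cancel_left_if) simp
    qed
    finally show ?thesis .
  qed
  moreover have "(\<lambda>j. deriv (t j) 0) sums deriv S 0"
    unfolding S_def by (rule holomorphic_series(3)[OF U holo M]) (auto simp: U_def)
  ultimately have 2: "(\<lambda>j. complex_of_real (ln (4 * real (Suc j) ^ 2 / (4 * real (Suc j) ^ 2 - 1)))) sums deriv S 0"
    by simp
  have "(\<lambda>j. ln (4 * real (Suc j) ^ 2 / (4 * real (Suc j) ^ 2 - 1))) sums ln (pi / 2)"
    unfolding sums_def
  proof -
    have p0: "4 * real (Suc j) ^ 2 / (4 * real (Suc j) ^ 2 - 1) > 0" for j
    proof -
      have "real (Suc j) ^ 2 \<ge> 1" by (rule one_le_power) simp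
      then show ?thesis by (intro divide_pos_pos) linarith+
    qed
    have "(\<lambda>n. ln (\<Prod>k = 1..n. 4 * real k ^ 2 / (4 * real k ^ 2 - 1))) \<longlonglongrightarrow> ln (pi / 2)"
      by (intro tendsto_ln wallis) auto
    moreover have "ln (\<Prod>k = 1..n. 4 * real k ^ 2 / (4 * real k ^ 2 - 1)) =
        (\<Sum>j<n. ln (4 * real (Suc j) ^ 2 / (4 * real (Suc j) ^ 2 - 1)))" for n
    proof -
      have "(\<Prod>k = 1..n. 4 * real k ^ 2 / (4 * real k ^ 2 - 1)) =
          (\<Prod>j<n. 4 * real (Suc j) ^ 2 / (4 * real (Suc j) ^ 2 - 1))"
        unfolding One_nat_def by (rule prod.atLeast1_atMost_eq)
      then show ?thesis
        using ln_prod[of "{..<n}" "\<lambda>j. 4 * real (Suc j) ^ 2 / (4 * real (Suc j) ^ 2 - 1)", OF _ less_imp_neq[OF p0, symmetric]]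
        by (simp only: finite_lessThan)
    qed
    ultimately show "(\<lambda>n. \<Sum>j<n. ln (4 * real (Suc j) ^ 2 / (4 * real (Suc j) ^ 2 - 1))) \<longlonglongrightarrow> ln (pi / 2)"
      by (simp only:)
  qed
  then have "(\<lambda>j. complex_of_real (ln (4 * real (Suc j) ^ 2 / (4 * real (Suc j) ^ 2 - 1)))) sums of_real (ln (pi / 2))"
    by (rule sums_of_real)
  note 3 = sums_unique2[OF 2 this, unfolded 1]
  \<comment> \<open>The value \<open>- (2 * ln 2)\<close> from \<open>zeta_reg_half_product\<close>
    and Wallis' \<open>ln (pi / 2)\<close> combine to \<open>- ln (2 * pi)\<close>.\<close>
  have "2 * deriv (hurwitz_zeta 1) 0 =
      - (2 * of_real (ln 2)) - (- (2 * of_real (ln 2)) + (- 1) * (2 * deriv (hurwitz_zeta 1) 0))"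
    by simp
  also have "\<dots> = - of_real (2 * ln 2 + ln (pi / 2))"
    unfolding 3 by simp
  finally have "2 * deriv (hurwitz_zeta 1) 0 = - of_real (2 * ln 2 + ln (pi / 2))" .
  moreover have "2 * ln 2 + ln (pi / 2) = ln (2 * pi)"
    by (simp add: ln_div ln_mult)
  ultimately have "2 * deriv (hurwitz_zeta 1) 0 = - of_real (ln (2 * pi))" by (simp only:)
  then show ?thesis by (simp add: field_simps)
qed

section \<open>Homogeneous and harmonic polynomials\<close>

interpretation fs: vector_space "\<lambda>(c::real) (f :: 'a \<Rightarrow> real) x. c * f x"
  by (rule vector_space_fun_scale)

text \<open>Homogeneous polynomials as functions. The zero function belongs to every degree, which
  makes each degree a subspace.\<close>

inductive hpoly :: "nat \<Rightarrow> ('a::euclidean_space \<Rightarrow> real) \<Rightarrow> bool" where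
  hpoly_const: "hpoly 0 (\<lambda>x. c)"
| hpoly_zero: "hpoly k (\<lambda>x. 0)"
| hpoly_add: "hpoly k p \<Longrightarrow> hpoly k q \<Longrightarrow> hpoly k (\<lambda>x. p x + q x)"
| hpoly_mult: "hpoly k p \<Longrightarrow> b \<in> Basis \<Longrightarrow> hpoly (Suc k) (\<lambda>x. (x \<bullet> b) * p x)"

lemma hpoly_cmult: "hpoly k p \<Longrightarrow> hpoly k (\<lambda>x. c * p x)"
proof (induction rule: hpoly.induct)
  case (hpoly_const d)
  show ?case by (rule hpoly.hpoly_const)
next
  case (hpoly_zero k)
  show ?case using hpoly.hpoly_zero by simp
next
  case (hpoly_add k p q)
  then show ?case using hpoly.hpoly_add[of k "\<lambda>x. c * p x" "\<lambda>x. c * q x"] by (simp add: distrib_left)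
next
  case (hpoly_mult k p b)
  then show ?case using hpoly.hpoly_mult[of k "\<lambda>x. c * p x" b] by (simp add: mult.left_commute)
qed

lemma hpoly_diff: "hpoly k p \<Longrightarrow> hpoly k q \<Longrightarrow> hpoly k (\<lambda>x. p x - q x)"
  using hpoly_add[OF _ hpoly_cmult[of k q "-1"], of p] by simp

lemma hpoly_sum: "(\<And>i. i \<in> I \<Longrightarrow> hpoly k (f i)) \<Longrightarrow> hpoly k (\<lambda>x. \<Sum>i\<in>I. f i x)"
  by (induction I rule: infinite_finite_induct) (auto intro: hpoly_zero hpoly_add)

lemma hpoly_times: "hpoly j p \<Longrightarrow> hpoly k q \<Longrightarrow> hpoly (j + k) (\<lambda>x. p x * q x)"
proof (induction rule: hpoly.induct)
  case (hpoly_const c)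
  then show ?case using hpoly_cmult by simp
next
  case (hpoly_zero k)
  show ?case using hpoly.hpoly_zero by simp
next
  case (hpoly_add j p p')
  then show ?case using hpoly.hpoly_add[of "j + k" "\<lambda>x. p x * q x" "\<lambda>x. p' x * q x"] by (simp add: distrib_right)
next
  case (hpoly_mult j p b)
  then show ?case using hpoly.hpoly_mult[of "j + k" "\<lambda>x. p x * q x" b] by (simp add: mult.assoc)
qed

lemma inner_self_sum: "x \<bullet> x = (\<Sum>b\<in>Basis. (x \<bullet> b) * (x \<bullet> b))" for x :: "'a::euclidean_space"
  by (rule euclidean_inner)

lemma hpoly_sq: "hpoly k p \<Longrightarrow> hpoly (k + 2) (\<lambda>x. (x \<bullet> x) * p x)"
  unfolding inner_self_sum sum_distrib_right mult.assoc
  by (auto intro!: hpoly_sum hpoly_mult)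

lemma hpoly_homogeneous: "hpoly k p \<Longrightarrow> p (t *\<^sub>R x) = t ^ k * p x"
  by (induction rule: hpoly.induct) (auto simp: algebra_simps)

section \<open>Derivatives of homogeneous polynomials\<close>

definition pd :: "'a::euclidean_space \<Rightarrow> ('a \<Rightarrow> real) \<Rightarrow> 'a \<Rightarrow> real" where
  "pd b f x = frechet_derivative f (at x) b"

definition lap :: "('a::euclidean_space \<Rightarrow> real) \<Rightarrow> 'a \<Rightarrow> real" where
  "lap f x = (\<Sum>b\<in>Basis. pd b (pd b f) x)"

lemma pd_eq: "(f has_derivative f') (at x) \<Longrightarrow> pd b f x = f' b"
  unfolding pd_def using frechet_derivative_at by metis

text \<open>For \<open>k = 0\<close> the degree \<open>k - 1\<close> is truncated to 0, and the
  clause that the partial derivatives vanish carries the information. The product case relies on it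
  to stay in degree \<open>k\<close>.\<close>

lemma hpoly_derivative_aux:
  "hpoly k p \<Longrightarrow> \<exists>q. (\<forall>b\<in>Basis. hpoly (k - 1) (q b)) \<and> (k = 0 \<longrightarrow> (\<forall>b x. q b x = 0)) \<and>
    (\<forall>x. (p has_derivative (\<lambda>h. \<Sum>b\<in>Basis. (h \<bullet> b) * q b x)) (at x))"
proof (induction rule: hpoly.induct)
  case (hpoly_const c)
  show ?case by (rule exI[of _ "\<lambda>b x. 0"]) (auto intro: hpoly.intros)
next
  case (hpoly_zero k)
  show ?case by (rule exI[of _ "\<lambda>b x. 0"]) (auto intro: hpoly.intros)
next
  case (hpoly_add k p q)
  then obtain p' q' where p': "\<forall>b\<in>Basis. hpoly (k - 1) (p' b)" "k = 0 \<longrightarrow> (\<forall>b x. p' b x = 0)"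
    "\<forall>x. (p has_derivative (\<lambda>h. \<Sum>b\<in>Basis. (h \<bullet> b) * p' b x)) (at x)"
    and q': "\<forall>b\<in>Basis. hpoly (k - 1) (q' b)" "k = 0 \<longrightarrow> (\<forall>b x. q' b x = 0)"
    "\<forall>x. (q has_derivative (\<lambda>h. \<Sum>b\<in>Basis. (h \<bullet> b) * q' b x)) (at x)"
    by blast
  have "((\<lambda>x. p x + q x) has_derivative (\<lambda>h. \<Sum>b\<in>Basis. (h \<bullet> b) * (p' b x + q' b x))) (at x)" for x
    using has_derivative_add[OF p'(3)[rule_format, of x] q'(3)[rule_format, of x]]
    by (simp add: distrib_left sum.distrib)
  then show ?case
    using p'(1,2) q'(1,2) by (intro exI[of _ "\<lambda>b x. p' b x + q' b x"]) (auto intro: hpoly.intros)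
next
  case (hpoly_mult k p c)
  then obtain p' where p': "\<forall>b\<in>Basis. hpoly (k - 1) (p' b)" "k = 0 \<longrightarrow> (\<forall>b x. p' b x = 0)"
    "\<forall>x. (p has_derivative (\<lambda>h. \<Sum>b\<in>Basis. (h \<bullet> b) * p' b x)) (at x)"
    by blast
  define q where "q b x = (if b = c then p x else 0) + (x \<bullet> c) * p' b x" for b x
  have "hpoly k (q b)" if b: "b \<in> Basis" for b
  proof -
    have 1: "hpoly k (\<lambda>x. if b = c then p x else 0)"
      using hpoly_mult.hyps(1) by (cases "b = c") (auto intro: hpoly.intros)
    have 2: "hpoly k (\<lambda>x. (x \<bullet> c) * p' b x)"
    proof (cases k)
      case 0
      then show ?thesis using p'(2) by (simp add: hpoly.hpoly_zero)
    next
      case (Suc j)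
      then show ?thesis using hpoly.hpoly_mult[of j "p' b" c] p'(1) b hpoly_mult.hyps(2) by simp
    qed
    show ?thesis unfolding q_def by (rule hpoly.hpoly_add[OF 1 2])
  qed
  moreover have "((\<lambda>x. (x \<bullet> c) * p x) has_derivative (\<lambda>h. \<Sum>b\<in>Basis. (h \<bullet> b) * q b x)) (at x)" for x
  proof -
    have "((\<lambda>x. (x \<bullet> c) * p x) has_derivative (\<lambda>h. (x \<bullet> c) * (\<Sum>b\<in>Basis. (h \<bullet> b) * p' b x) + (h \<bullet> c) * p x)) (at x)"
      using p'(3) by (auto intro!: derivative_eq_intros)
    moreover have "(\<Sum>b\<in>Basis. (h \<bullet> b) * q b x) = (x \<bullet> c) * (\<Sum>b\<in>Basis. (h \<bullet> b) * p' b x) + (h \<bullet> c) * p x" for h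
    proof -
      have "(\<Sum>b\<in>Basis. (h \<bullet> b) * q b x) =
          (\<Sum>b\<in>Basis. (if b = c then (h \<bullet> b) * p x else 0) + (x \<bullet> c) * ((h \<bullet> b) * p' b x))"
        unfolding q_def by (intro sum.cong) (auto simp: algebra_simps)
      then show ?thesis
        using hpoly_mult.hyps(2) by (simp add: sum.distrib sum_distrib_left)
    qed
    ultimately show ?thesis by simp
  qed
  ultimately show ?case by (intro exI[of _ q]) auto
qed

lemma sum_Basis_inner: "b \<in> Basis \<Longrightarrow> (\<Sum>c\<in>Basis. (b \<bullet> c) * f c) = f b" for b :: "'a::euclidean_space"
  by (simp add: inner_Basis if_distrib[of "\<lambda>x. x * _"] cong: if_cong)

lemma hpoly_has_derivative: "hpoly k p \<Longrightarrow> (p has_derivative (\<lambda>h. \<Sum>b\<in>Basis. (h \<bullet> b) * pd b p x)) (at x)"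
  and hpoly_pd: "hpoly k p \<Longrightarrow> b \<in> Basis \<Longrightarrow> hpoly (k - 1) (pd b p)"
  and hpoly_0_pd: "hpoly 0 p \<Longrightarrow> b \<in> Basis \<Longrightarrow> pd b p = (\<lambda>x. 0)"
proof -
  have *: "\<exists>q. (\<forall>b\<in>Basis. pd b p = q b) \<and> (\<forall>b\<in>Basis. hpoly (k - 1) (q b)) \<and> (k = 0 \<longrightarrow> (\<forall>b x. q b x = 0)) \<and>
    (\<forall>x. (p has_derivative (\<lambda>h. \<Sum>b\<in>Basis. (h \<bullet> b) * q b x)) (at x))" if hp: "hpoly k p" for k
  proof -
    obtain q where q: "\<forall>b\<in>Basis. hpoly (k - 1) (q b)" "k = 0 \<longrightarrow> (\<forall>b x. q b x = 0)"
      "\<forall>x. (p has_derivative (\<lambda>h. \<Sum>b\<in>Basis. (h \<bullet> b) * q b x)) (at x)"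
      using hpoly_derivative_aux[OF hp] by blast
    have "pd b p = q b" if "b \<in> Basis" for b
      using pd_eq[OF q(3)[rule_format]] that by (auto simp: sum_Basis_inner)
    then show ?thesis using q by blast
  qed
  show "(p has_derivative (\<lambda>h. \<Sum>b\<in>Basis. (h \<bullet> b) * pd b p x)) (at x)" if hp: "hpoly k p"
  proof -
    obtain q where q: "\<forall>b\<in>Basis. pd b p = q b"
      "\<forall>x. (p has_derivative (\<lambda>h. \<Sum>b\<in>Basis. (h \<bullet> b) * q b x)) (at x)"
      using *[OF hp] by blast
    have "(\<lambda>h. \<Sum>b\<in>Basis. (h \<bullet> b) * pd b p x) = (\<lambda>h. \<Sum>b\<in>Basis. (h \<bullet> b) * q b x)"
      using q(1) by (intro ext sum.cong) auto
    then show ?thesis using q(2) by simp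
  qed
  show "hpoly (k - 1) (pd b p)" if "hpoly k p" "b \<in> Basis"
    using *[OF that(1)] that(2) by auto
  show "pd b p = (\<lambda>x. 0)" if "hpoly 0 p" "b \<in> Basis"
    using *[OF that(1)] that(2) by (auto simp: fun_eq_iff)
qed

text \<open>Differentiate the homogeneity relation in the scaling parameter \<open>t\<close> at
  1.\<close>

lemma hpoly_euler:
  assumes "hpoly k p"
  shows "(\<Sum>b\<in>Basis. (x \<bullet> b) * pd b p x) = real k * p x"
proof -
  have "(p has_derivative (\<lambda>h. \<Sum>b\<in>Basis. (h \<bullet> b) * pd b p x)) (at (1 *\<^sub>R x))"
    using hpoly_has_derivative[OF assms, of x] by simp
  moreover have "((\<lambda>t. t *\<^sub>R x) has_derivative (\<lambda>t. t *\<^sub>R x)) (at 1)"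
    by (auto intro!: derivative_eq_intros)
  ultimately have "((\<lambda>t. p (t *\<^sub>R x)) has_derivative (\<lambda>t. \<Sum>b\<in>Basis. (t *\<^sub>R x \<bullet> b) * pd b p x)) (at 1)"
    by (rule has_derivative_compose[where g = p, rotated])
  moreover have "((\<lambda>t. p (t *\<^sub>R x)) has_derivative (\<lambda>t. t * (real k * p x))) (at 1)"
    unfolding hpoly_homogeneous[OF assms] by (auto intro!: derivative_eq_intros)
  ultimately have "(\<lambda>t. \<Sum>b\<in>Basis. (t *\<^sub>R x \<bullet> b) * pd b p x) = (\<lambda>t. t * (real k * p x))"
    by (rule has_derivative_unique)
  from fun_cong[OF this, of 1] show ?thesis by simp
qed

lemma hpoly_pd_add: "hpoly k p \<Longrightarrow> hpoly k q \<Longrightarrow> b \<in> Basis \<Longrightarrow> pd b (\<lambda>x. p x + q x) = (\<lambda>x. pd b p x + pd b q x)"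
  by (rule ext, subst pd_eq[OF has_derivative_add[OF hpoly_has_derivative hpoly_has_derivative]])
     (auto simp: sum_Basis_inner)

lemma hpoly_pd_cmult: "hpoly k p \<Longrightarrow> b \<in> Basis \<Longrightarrow> pd b (\<lambda>x. c * p x) = (\<lambda>x. c * pd b p x)"
  by (rule ext, subst pd_eq[OF has_derivative_mult_right[OF hpoly_has_derivative]])
     (auto simp: sum_Basis_inner)

lemma hpoly_lap: "hpoly k p \<Longrightarrow> hpoly (k - 2) (lap p)"
proof -
  assume "hpoly k p"
  then have "b \<in> Basis \<Longrightarrow> hpoly (k - 2) (pd b (pd b p))" for b
    using hpoly_pd[OF hpoly_pd, of k p b b] by (simp add: numeral_2_eq_2)
  then show ?thesis
    unfolding lap_def[abs_def] by (rule hpoly_sum)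
qed

lemma hpoly_lap_0: "hpoly k p \<Longrightarrow> k < 2 \<Longrightarrow> lap p = (\<lambda>x. 0)"
proof -
  assume p: "hpoly k p" and k: "k < 2"
  have "pd b (pd b p) = (\<lambda>x. 0)" if b: "b \<in> Basis" for b
    using hpoly_pd[OF p b] k b by (intro hpoly_0_pd) auto
  then show ?thesis by (simp add: lap_def[abs_def])
qed

lemma lap_add:
  assumes p: "hpoly k p" and q: "hpoly k q"
  shows "lap (\<lambda>x. p x + q x) = (\<lambda>x. lap p x + lap q x)"
proof -
  have "pd b (pd b (\<lambda>x. p x + q x)) x = pd b (pd b p) x + pd b (pd b q) x" if b: "b \<in> Basis" for b x
    unfolding hpoly_pd_add[OF p q b] hpoly_pd_add[OF hpoly_pd[OF p b] hpoly_pd[OF q b] b] ..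
  then show ?thesis
    unfolding lap_def[abs_def] sum.distrib[symmetric] by (intro ext sum.cong refl)
qed

lemma lap_cmult:
  assumes p: "hpoly k p"
  shows "lap (\<lambda>x. c * p x) = (\<lambda>x. c * lap p x)"
proof -
  have "pd b (pd b (\<lambda>x. c * p x)) x = c * pd b (pd b p) x" if b: "b \<in> Basis" for b x
    unfolding hpoly_pd_cmult[OF p b] hpoly_pd_cmult[OF hpoly_pd[OF p b] b] ..
  then show ?thesis
    unfolding lap_def[abs_def] sum_distrib_left by (intro ext sum.cong refl)
qed

lemma lap_diff: "hpoly k p \<Longrightarrow> hpoly k q \<Longrightarrow> lap (\<lambda>x. p x - q x) = (\<lambda>x. lap p x - lap q x)"
  using lap_add[OF _ hpoly_cmult[of k q "-1"], of p] lap_cmult[of k q "-1"] by simp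

text \<open>The Laplacian of \<open>x \<bullet> x\<close> contributes \<open>2 * DIM('a)\<close>;
  the cross terms are four times the Euler operator and contribute \<open>4 * j\<close>.\<close>

lemma lap_sq:
  fixes q :: "'a::euclidean_space \<Rightarrow> real"
  assumes q: "hpoly j q"
  shows "lap (\<lambda>x. (x \<bullet> x) * q x) = (\<lambda>x. (x \<bullet> x) * lap q x + (2 * real DIM('a) + 4 * real j) * q x)"
proof
  fix x :: 'a
  have 1: "pd b (\<lambda>x. (x \<bullet> x) * q x) = (\<lambda>x. 2 * (x \<bullet> b) * q x + (x \<bullet> x) * pd b q x)" if b: "b \<in> Basis" for b
  proof
    fix x
    have "((\<lambda>x. (x \<bullet> x) * q x) has_derivative
        (\<lambda>h. (x \<bullet> x) * (\<Sum>b\<in>Basis. (h \<bullet> b) * pd b q x) + (x \<bullet> h + h \<bullet> x) * q x)) (at x)"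
      by (intro has_derivative_mult has_derivative_inner has_derivative_ident hpoly_has_derivative[OF q])
    from pd_eq[OF this, of b] show "pd b (\<lambda>x. (x \<bullet> x) * q x) x = 2 * (x \<bullet> b) * q x + (x \<bullet> x) * pd b q x"
      using b by (simp add: sum_Basis_inner inner_commute)
  qed
  have 2: "pd b (pd b (\<lambda>x. (x \<bullet> x) * q x)) x =
      2 * q x + 4 * ((x \<bullet> b) * pd b q x) + (x \<bullet> x) * pd b (pd b q) x" if b: "b \<in> Basis" for b
  proof -
    have "((\<lambda>x. 2 * (x \<bullet> b) * q x + (x \<bullet> x) * pd b q x) has_derivative
        (\<lambda>h. (2 * (x \<bullet> b) * (\<Sum>c\<in>Basis. (h \<bullet> c) * pd c q x) + 2 * (h \<bullet> b) * q x) +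
          ((x \<bullet> x) * (\<Sum>c\<in>Basis. (h \<bullet> c) * pd c (pd b q) x) + (x \<bullet> h + h \<bullet> x) * pd b q x))) (at x)"
      by (intro has_derivative_add has_derivative_mult has_derivative_inner has_derivative_ident
          has_derivative_mult_right has_derivative_inner_left hpoly_has_derivative[OF q] hpoly_has_derivative[OF hpoly_pd[OF q b]])
    from pd_eq[OF this, of b] show ?thesis
      unfolding 1[OF b] using b by (simp add: sum_Basis_inner inner_commute)
  qed
  have "lap (\<lambda>x. (x \<bullet> x) * q x) x =
      (\<Sum>b\<in>(Basis :: 'a set). 2 * q x) + 4 * (\<Sum>b\<in>Basis. (x \<bullet> b) * pd b q x) + (x \<bullet> x) * lap q x"
    unfolding lap_def by (simp add: 2 sum.distrib sum_distrib_left)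
  then show "lap (\<lambda>x. (x \<bullet> x) * q x) x = (x \<bullet> x) * lap q x + (2 * real DIM('a) + 4 * real j) * q x"
    unfolding hpoly_euler[OF q] by (simp add: algebra_simps)
qed

section \<open>Splitting off the harmonic part\<close>

text \<open>The ansatz \<open>c * q = p - (x \<bullet> x) * r\<close> requires
  \<open>lap q = r\<close>. By \<open>lap_sq\<close> this is the same kind of equation for
  \<open>r\<close>, with right side \<open>lap p\<close>, degree \<open>j - 2\<close> and a larger,
  still positive constant.\<close>

lemma sq_lap_solve:
  fixes p :: "'a::euclidean_space \<Rightarrow> real"
  assumes "c > 0" "hpoly j p"
  shows "\<exists>q. hpoly j q \<and> (\<forall>x. (x \<bullet> x) * lap q x + c * q x = p x)"
  using assms
proof (induction j arbitrary: c p rule: less_induct)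
  case (less j)
  show ?case
  proof (cases "j < 2")
    case True
    have "hpoly j (\<lambda>x. 1 / c * p x)" by (rule hpoly_cmult[OF less.prems(2)])
    then show ?thesis
      using less.prems(1) hpoly_lap_0[OF \<open>hpoly j (\<lambda>x. 1 / c * p x)\<close> True]
      by (intro exI[of _ "\<lambda>x. 1 / c * p x"]) auto
  next
    case False
    define c' where "c' = 2 * real DIM('a) + 4 * real (j - 2) + c"
    have "c' > 0" unfolding c'_def using less.prems(1) by (simp add: add_nonneg_pos)
    then obtain r where r: "hpoly (j - 2) r" "\<And>x. (x \<bullet> x) * lap r x + c' * r x = lap p x"
      using less.IH[of "j - 2" c' "lap p"] False hpoly_lap[OF less.prems(2)] by auto
    define q where "q = (\<lambda>x. 1 / c * (p x - (x \<bullet> x) * r x))"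
    have sr: "hpoly j (\<lambda>x. (x \<bullet> x) * r x)"
    proof -
      have "j - 2 + 2 = j" using False by simp
      then show ?thesis using hpoly_sq[OF r(1)] by metis
    qed
    have q: "hpoly j q"
      unfolding q_def by (rule hpoly_cmult[OF hpoly_diff[OF less.prems(2) sr]])
    have "lap q x = r x" for x
    proof -
      have "lap q x = 1 / c * (lap p x - ((x \<bullet> x) * lap r x + (2 * real DIM('a) + 4 * real (j - 2)) * r x))"
        unfolding q_def lap_cmult[OF hpoly_diff[OF less.prems(2) sr]] lap_diff[OF less.prems(2) sr] lap_sq[OF r(1)] ..
      also have "\<dots> = 1 / c * (c * r x)"
        unfolding r(2)[symmetric] c'_def by (simp add: algebra_simps)
      finally show ?thesis using less.prems(1) by simp
    qed
    then have "(x \<bullet> x) * lap q x + c * q x = p x" for x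
      using less.prems(1) unfolding q_def by simp
    then show ?thesis using q by blast
  qed
qed

text \<open>The equation exhibits \<open>q\<close> as \<open>x \<bullet> x\<close> times a
  polynomial \<open>q'\<close> of degree \<open>j - 2\<close>, and \<open>q'\<close> solves the
  equation with a larger constant, so it is zero by induction.\<close>

lemma sq_lap_unique:
  fixes q :: "'a::euclidean_space \<Rightarrow> real"
  assumes "c > 0" "hpoly j q" "\<And>x. (x \<bullet> x) * lap q x + c * q x = 0"
  shows "q = (\<lambda>x. 0)"
  using assms
proof (induction j arbitrary: c q rule: less_induct)
  case (less j)
  show ?case
  proof (cases "j < 2")
    case True
    show ?thesis
      using less.prems(1,3) unfolding hpoly_lap_0[OF less.prems(2) True] by auto
  next
    case False
    define q' where "q' = (\<lambda>x. - (1 / c) * lap q x)"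
    have q': "hpoly (j - 2) q'"
      unfolding q'_def by (rule hpoly_cmult[OF hpoly_lap[OF less.prems(2)]])
    have q: "q = (\<lambda>x. (x \<bullet> x) * q' x)"
    proof
      fix x
      have "c * q x = - ((x \<bullet> x) * lap q x)" using less.prems(3)[of x] by simp
      then have "q x = - ((x \<bullet> x) * lap q x) / c" using less.prems(1) by (simp add: field_simps)
      then show "q x = (x \<bullet> x) * q' x" unfolding q'_def by simp
    qed
    define c' where "c' = 2 * real DIM('a) + 4 * real (j - 2) + c"
    have "c' > 0" unfolding c'_def using less.prems(1) by (simp add: add_nonneg_pos)
    moreover have "(x \<bullet> x) * lap q' x + c' * q' x = 0" for x
    proof -
      have "lap q x = - c * q' x" unfolding q'_def using less.prems(1) by simp
      moreover have "lap q x = (x \<bullet> x) * lap q' x + (2 * real DIM('a) + 4 * real (j - 2)) * q' x"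
        by (subst q) (simp add: lap_sq[OF q'])
      ultimately show ?thesis unfolding c'_def by (simp add: algebra_simps)
    qed
    ultimately have "q' = (\<lambda>x. 0)"
      using less.IH[of "j - 2" c' q'] q' False by auto
    then show ?thesis using q by auto
  qed
qed

definition harmonic :: "nat \<Rightarrow> ('a::euclidean_space \<Rightarrow> real) \<Rightarrow> bool" where
  "harmonic k p \<longleftrightarrow> hpoly k p \<and> lap p = (\<lambda>x. 0)"

text \<open>The remainder \<open>p - (x \<bullet> x) * q\<close> is harmonic exactly if
  \<open>q\<close> solves the equation of \<open>sq_lap_solve\<close> with the constant from
  \<open>lap_sq\<close> and right side \<open>lap p\<close>.\<close>

lemma harmonic_decomposition:
  fixes p :: "'a::euclidean_space \<Rightarrow> real"
  assumes p: "hpoly (k + 2) p"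
  obtains h q where "harmonic (k + 2) h" "hpoly k q" "p = (\<lambda>x. h x + (x \<bullet> x) * q x)"
proof -
  have "2 * real DIM('a) + 4 * real k > 0" by (simp add: add_pos_nonneg)
  then obtain q where q: "hpoly k q"
    "\<And>x. (x \<bullet> x) * lap q x + (2 * real DIM('a) + 4 * real k) * q x = lap p x"
    using sq_lap_solve[of _ k "lap p"] hpoly_lap[OF p] by auto
  define h where "h = (\<lambda>x. p x - (x \<bullet> x) * q x)"
  have "hpoly (k + 2) h" unfolding h_def by (rule hpoly_diff[OF p hpoly_sq[OF q(1)]])
  moreover have "lap h = (\<lambda>x. 0)"
    unfolding h_def lap_diff[OF p hpoly_sq[OF q(1)]] lap_sq[OF q(1)] q(2) by simp
  ultimately have "harmonic (k + 2) h" unfolding harmonic_def by simp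
  moreover have "p = (\<lambda>x. h x + (x \<bullet> x) * q x)" unfolding h_def by simp
  ultimately show ?thesis using that q(1) by blast
qed

lemma harmonic_sq_0:
  fixes q :: "'a::euclidean_space \<Rightarrow> real"
  assumes "hpoly k q" "harmonic (k + 2) (\<lambda>x. (x \<bullet> x) * q x)"
  shows "q = (\<lambda>x. 0)"
proof (rule sq_lap_unique)
  show "2 * real DIM('a) + 4 * real k > 0" by (simp add: add_pos_nonneg)
  show "(x \<bullet> x) * lap q x + (2 * real DIM('a) + 4 * real k) * q x = 0" for x
    using assms unfolding harmonic_def lap_sq[OF assms(1)] by (auto dest: fun_cong)
qed (rule assms)

text \<open>Sums of homogeneous polynomials of any degrees. Closure under products links
  \<open>hpoly\<close> to the polynomial functions of the Stone-Weierstrass theorem.\<close>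

inductive gpoly :: "('a::euclidean_space \<Rightarrow> real) \<Rightarrow> bool" where
  gpoly_hpoly: "hpoly k p \<Longrightarrow> gpoly p"
| gpoly_add: "gpoly p \<Longrightarrow> gpoly q \<Longrightarrow> gpoly (\<lambda>x. p x + q x)"

lemma gpoly_mult: "gpoly p \<Longrightarrow> gpoly q \<Longrightarrow> gpoly (\<lambda>x. p x * q x)"
proof (induction arbitrary: q rule: gpoly.induct)
  case (gpoly_hpoly k p)
  from gpoly_hpoly(2,1) show ?case
  proof (induction rule: gpoly.induct)
    case (gpoly_hpoly j q)
    then show ?case using hpoly_times gpoly.gpoly_hpoly by blast
  next
    case (gpoly_add q q')
    then show ?case using gpoly.gpoly_add[of "\<lambda>x. p x * q x" "\<lambda>x. p x * q' x"] by (simp add: distrib_left)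
  qed
next
  case (gpoly_add p p')
  then show ?case using gpoly.gpoly_add[of "\<lambda>x. p x * q x" "\<lambda>x. p' x * q x"] by (simp add: distrib_right)
qed

lemma real_polynomial_function_imp_gpoly: "real_polynomial_function p \<Longrightarrow> gpoly p"
proof (induction rule: real_polynomial_function.induct)
  case (linear f)
  then have f: "linear f" by (rule bounded_linear.linear)
  have "f x = (\<Sum>b\<in>Basis. (x \<bullet> b) * f b)" for x
  proof -
    have "f x = f (\<Sum>b\<in>Basis. (x \<bullet> b) *\<^sub>R b)" by (simp add: euclidean_representation)
    also have "\<dots> = (\<Sum>b\<in>Basis. (x \<bullet> b) * f b)"
      using f by (simp add: linear_sum linear_scale)
    finally show ?thesis .
  qed
  then have "f = (\<lambda>x. \<Sum>b\<in>Basis. (x \<bullet> b) * f b)" by blast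
  moreover have "hpoly (Suc 0) (\<lambda>x. \<Sum>b\<in>Basis. (x \<bullet> b) * f b)"
    by (intro hpoly_sum hpoly_mult hpoly_const)
  ultimately show ?case using gpoly_hpoly by metis
next
  case (const c)
  show ?case by (rule gpoly_hpoly[OF hpoly_const])
next
  case (add f g)
  show ?case by (rule gpoly_add[OF add.IH])
next
  case (mult f g)
  show ?case by (rule gpoly_mult[OF mult.IH])
qed

text \<open>On the sphere the factor \<open>x \<bullet> x\<close> is 1, so the decomposition reduces
  a polynomial of degree \<open>k\<close> to a harmonic one and one of degree \<open>k - 2\<close>.
  Hence sums of harmonic polynomials exhaust all polynomials there.\<close>

lemma sphere_polynomial_induct:
  fixes Q :: "('a::euclidean_space \<Rightarrow> real) \<Rightarrow> bool"
  assumes p: "real_polynomial_function p"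
    and add: "\<And>p q. Q p \<Longrightarrow> Q q \<Longrightarrow> Q (\<lambda>x. p x + q x)"
    and cong: "\<And>p q. (\<And>x. norm x = 1 \<Longrightarrow> p x = q x) \<Longrightarrow> Q p \<Longrightarrow> Q q"
    and harm: "\<And>k h. harmonic k h \<Longrightarrow> Q h"
  shows "Q p"
proof -
  have h: "Q p" if "hpoly k p" for k p
    using that
  proof (induction k arbitrary: p rule: less_induct)
    case (less k)
    show ?case
    proof (cases "k < 2")
      case True
      then show ?thesis using hpoly_lap_0 less.prems by (intro harm[of k]) (auto simp: harmonic_def)
    next
      case False
      then have k: "k = (k - 2) + 2" by simp
      obtain h q where hq: "harmonic k h" "hpoly (k - 2) q" "p = (\<lambda>x. h x + (x \<bullet> x) * q x)"
        using harmonic_decomposition[of "k - 2" p] less.prems k by metis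
      have "Q (\<lambda>x. h x + q x)"
        by (intro add harm[OF hq(1)] less.IH[OF _ hq(2)]) (use False in simp)
      then show ?thesis
        by (rule cong[rotated]) (simp add: hq(3) power2_norm_eq_inner[symmetric])
    qed
  qed
  from real_polynomial_function_imp_gpoly[OF p] show ?thesis
    by (induction rule: gpoly.induct) (auto intro: h add)
qed

section \<open>Monomials and the dimension count\<close>

definition monom_fun :: "('a::euclidean_space \<Rightarrow> nat) \<Rightarrow> 'a \<Rightarrow> real" where
  "monom_fun \<alpha> x = (\<Prod>b\<in>Basis. (x \<bullet> b) ^ \<alpha> b)"

definition exponents :: "nat \<Rightarrow> ('a::euclidean_space \<Rightarrow> nat) set" where
  "exponents k = {\<alpha>. (\<forall>b. b \<notin> Basis \<longrightarrow> \<alpha> b = 0) \<and> (\<Sum>b\<in>Basis. \<alpha> b) = k}"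

lemma monom_fun_step:
  assumes "b \<in> Basis" "\<alpha> b = Suc m"
  shows "monom_fun \<alpha> x = (x \<bullet> b) * monom_fun (\<alpha>(b := m)) x"
proof -
  have "monom_fun \<alpha> x = (x \<bullet> b) ^ Suc m * (\<Prod>c\<in>Basis - {b}. (x \<bullet> c) ^ \<alpha> c)"
    unfolding monom_fun_def using assms by (subst prod.remove[of _ b]) auto
  moreover have "monom_fun (\<alpha>(b := m)) x = (x \<bullet> b) ^ m * (\<Prod>c\<in>Basis - {b}. (x \<bullet> c) ^ \<alpha> c)"
    unfolding monom_fun_def using assms by (subst prod.remove[of _ b]) auto
  ultimately show ?thesis by simp
qed

lemma exponents_step:
  assumes "b \<in> Basis" "\<alpha> b = Suc m"
  shows "\<alpha> \<in> exponents (Suc k) \<longleftrightarrow> \<alpha>(b := m) \<in> exponents k"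
proof -
  have "(\<Sum>c\<in>Basis. \<alpha> c) = Suc m + (\<Sum>c\<in>Basis - {b}. \<alpha> c)"
    using assms by (subst sum.remove[of _ b]) auto
  moreover have "(\<Sum>c\<in>Basis. (\<alpha>(b := m)) c) = m + (\<Sum>c\<in>Basis - {b}. \<alpha> c)"
    using assms by (subst sum.remove[of _ b]) auto
  ultimately show ?thesis
    using assms(1) unfolding exponents_def by auto
qed

lemma hpoly_monom_fun: "\<alpha> \<in> exponents k \<Longrightarrow> hpoly k (monom_fun \<alpha>)"
proof (induction k arbitrary: \<alpha>)
  case 0
  then have "monom_fun \<alpha> = (\<lambda>x. 1)"
    by (auto simp: exponents_def monom_fun_def)
  then show ?case by (simp add: hpoly_const)
next
  case (Suc k)
  then have "(\<Sum>b\<in>Basis. \<alpha> b) \<noteq> 0" by (simp add: exponents_def)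
  then obtain b where b: "b \<in> Basis" "\<alpha> b \<noteq> 0" by (meson sum.neutral)
  then obtain m where m: "\<alpha> b = Suc m" using not0_implies_Suc by blast
  have "\<alpha>(b := m) \<in> exponents k" using exponents_step[of b \<alpha> m k] b(1) m Suc.prems by blast
  from hpoly_mult[OF Suc.IH[OF this] b(1)] show ?case
    using monom_fun_step[of b \<alpha> m] b(1) m by presburger
qed

lemma hpoly_in_span_monom: "hpoly k (p :: 'a::euclidean_space \<Rightarrow> real) \<Longrightarrow> p \<in> fs.span (monom_fun ` exponents k)"
proof (induction rule: hpoly.induct)
  case (hpoly_const c)
  have 1: "monom_fun (\<lambda>_. 0) \<in> fs.span (monom_fun ` (exponents 0 :: ('a \<Rightarrow> nat) set))"
    by (intro fs.span_base imageI) (simp add: exponents_def)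
  have "monom_fun (\<lambda>_. 0) x = 1" for x :: 'a
    by (simp add: monom_fun_def)
  then show ?case using fs.span_scale[OF 1, of c] by simp
next
  case (hpoly_zero k)
  show ?case using fs.span_zero unfolding zero_fun_def .
next
  case (hpoly_add k p q)
  show ?case using fs.span_add[OF hpoly_add.IH] unfolding plus_fun_def .
next
  case (hpoly_mult k p b)
  from hpoly_mult(3) show ?case
  proof (induction rule: fs.span_induct_alt)
    case base
    show ?case using fs.span_zero by (simp add: zero_fun_def)
  next
    case (step c q r)
    then obtain \<alpha> where \<alpha>: "\<alpha> \<in> exponents k" "q = monom_fun \<alpha>" by blast
    have eq: "((\<alpha>(b := Suc (\<alpha> b)))(b := \<alpha> b)) = \<alpha>" by auto
    have "\<alpha>(b := Suc (\<alpha> b)) \<in> exponents (Suc k)"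
      using exponents_step[of b "\<alpha>(b := Suc (\<alpha> b))" "\<alpha> b" k] hpoly_mult(2) \<alpha>(1) unfolding eq by simp
    moreover have "(\<lambda>x. (x \<bullet> b) * q x) = monom_fun (\<alpha>(b := Suc (\<alpha> b)))"
      using monom_fun_step[of b "\<alpha>(b := Suc (\<alpha> b))" "\<alpha> b"] hpoly_mult(2) unfolding eq \<alpha>(2) by auto
    ultimately have "(\<lambda>x. (x \<bullet> b) * q x) \<in> fs.span (monom_fun ` exponents (Suc k))"
      by (auto intro: fs.span_base)
    from fs.span_add[OF fs.span_scale[OF this, of c] step(2)] show ?case
      by (simp add: plus_fun_def algebra_simps)
  qed
qed

lemma hpoly_subspace: "fs.subspace {p. hpoly k p}"
  by (rule fs.subspaceI) (auto simp: zero_fun_def plus_fun_def intro: hpoly_zero hpoly_add hpoly_cmult)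

lemma span_monom_fun: "fs.span (monom_fun ` exponents k) = {p. hpoly k p}"
proof
  show "fs.span (monom_fun ` exponents k) \<subseteq> {p. hpoly k p}"
    by (rule fs.span_minimal[OF _ hpoly_subspace]) (auto intro: hpoly_monom_fun)
  show "{p. hpoly k p} \<subseteq> fs.span (monom_fun ` exponents k)"
    by (auto intro: hpoly_in_span_monom)
qed

text \<open>Induction on the variables: as a polynomial in the value at \<open>b\<close>, with the
  others fixed, each coefficient vanishes. Resetting the exponent of \<open>b\<close> to 0 makes
  these coefficients an instance for one variable less.\<close>

lemma monomial_coeffs_zero:
  fixes c :: "('b \<Rightarrow> nat) \<Rightarrow> real"
  assumes "finite B" "finite A" "\<And>\<alpha> b. \<alpha> \<in> A \<Longrightarrow> b \<notin> B \<Longrightarrow> \<alpha> b = 0"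
    and "\<And>y :: 'b \<Rightarrow> real. (\<Sum>\<alpha>\<in>A. c \<alpha> * (\<Prod>b\<in>B. y b ^ \<alpha> b)) = 0" and "\<alpha> \<in> A"
  shows "c \<alpha> = 0"
  using assms
proof (induction B arbitrary: A c \<alpha> rule: finite_induct)
  case empty
  have "\<beta> = (\<lambda>_. 0)" if "\<beta> \<in> A" for \<beta> using empty.prems(2)[OF that] by auto
  then have "A = {\<alpha>}" using empty.prems(4) by blast
  then show ?case using empty.prems(3)[of "\<lambda>_. 0"] by simp
next
  case (insert b B)
  define i where "i = \<alpha> b"
  define A' where "A' = {\<beta> \<in> A. \<beta> b = i}"
  define D where "D = (\<lambda>\<beta>. \<beta>(b := 0)) ` A'"
  have inj: "inj_on (\<lambda>\<beta>. \<beta>(b := 0)) A'"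
  proof (rule inj_onI)
    fix \<beta> \<gamma> assume "\<beta> \<in> A'" "\<gamma> \<in> A'" "\<beta>(b := 0) = \<gamma>(b := 0)"
    then show "\<beta> = \<gamma>" unfolding A'_def by (metis (mono_tags, lifting) fun_upd_triv fun_upd_upd mem_Collect_eq)
  qed
  define M where "M = Max ((\<lambda>\<beta>. \<beta> b) ` A)"
  have M: "\<beta> b \<le> M" if "\<beta> \<in> A" for \<beta>
    unfolding M_def using insert.prems(1) that by auto
  have sum0: "(\<Sum>\<beta>\<in>D. c (\<beta>(b := i)) * (\<Prod>a\<in>B. y a ^ \<beta> a)) = 0" for y :: "'b \<Rightarrow> real"
  proof -
    define C where "C j = (\<Sum>\<beta>\<in>{\<beta> \<in> A. \<beta> b = j}. c \<beta> * (\<Prod>a\<in>B. y a ^ \<beta> a))" for j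
    have "(\<Sum>j\<le>M. C j * t ^ j) = 0" for t
    proof -
      have p: "(\<Prod>a\<in>insert b B. (y(b := t)) a ^ \<beta> a) = (\<Prod>a\<in>B. y a ^ \<beta> a) * t ^ \<beta> b" for \<beta> :: "'b \<Rightarrow> nat"
      proof -
        have "(\<Prod>a\<in>B. (y(b := t)) a ^ \<beta> a) = (\<Prod>a\<in>B. y a ^ \<beta> a)"
          using insert.hyps(2) by (intro prod.cong) auto
        then show ?thesis using insert.hyps by simp
      qed
      have "(\<Sum>j\<le>M. C j * t ^ j) = (\<Sum>j\<le>M. \<Sum>\<beta>\<in>{\<beta> \<in> A. \<beta> b = j}. c \<beta> * (\<Prod>a\<in>insert b B. (y(b := t)) a ^ \<beta> a))"
        unfolding C_def p sum_distrib_right by (intro sum.cong) auto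
      also have "\<dots> = (\<Sum>\<beta>\<in>A. c \<beta> * (\<Prod>a\<in>insert b B. (y(b := t)) a ^ \<beta> a))"
        using insert.prems(1) M by (intro sum.group) auto
      finally show ?thesis using insert.prems(3) by simp
    qed
    then have "C i = 0"
      using polyfun_eq_0[where c = C and n = M] M[OF insert.prems(4)] unfolding i_def by blast
    moreover have "C i = (\<Sum>\<beta>\<in>A'. c ((\<beta>(b := 0))(b := i)) * (\<Prod>a\<in>B. y a ^ (\<beta>(b := 0)) a))"
      unfolding C_def A'_def using insert.hyps(2)
      by (intro sum.cong) (auto intro!: prod.cong arg_cong2[of _ _ _ _ times] arg_cong[of _ _ c])
    ultimately show ?thesis
      unfolding D_def by (subst sum.reindex[OF inj]) (simp add: o_def)
  qed
  have "c ((\<alpha>(b := 0))(b := i)) = 0"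
  proof (rule insert.IH[of D "\<lambda>\<beta>. c (\<beta>(b := i))" "\<alpha>(b := 0)"])
    show "finite D" unfolding D_def A'_def using insert.prems(1) by auto
    show "\<beta> a = 0" if bD: "\<beta> \<in> D" and aB: "a \<notin> B" for \<beta> a
    proof -
      obtain \<gamma> where "\<gamma> \<in> A" "\<beta> = \<gamma>(b := 0)" using bD unfolding D_def A'_def by auto
      then show ?thesis using insert.prems(2)[of \<gamma> a] aB by (cases "a = b") auto
    qed
    show "\<alpha>(b := 0) \<in> D" unfolding D_def A'_def i_def using insert.prems(4) by (intro imageI) simp
  qed (rule sum0)
  then show ?case unfolding i_def by simp
qed

lemma monom_fun_coeffs_zero:
  assumes "finite A" "A \<subseteq> exponents k" "\<And>x. (\<Sum>\<alpha>\<in>A. c \<alpha> * monom_fun \<alpha> x) = 0" "\<alpha> \<in> A"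
  shows "c \<alpha> = 0"
proof (rule monomial_coeffs_zero[of Basis A])
  fix y :: "'a \<Rightarrow> real"
  define x where "x = (\<Sum>b\<in>Basis. y b *\<^sub>R b)"
  have "x \<bullet> b = y b" if "b \<in> Basis" for b
    unfolding x_def using that by (simp add: inner_sum_left_Basis)
  then have "(\<Prod>b\<in>Basis. y b ^ \<alpha> b) = monom_fun \<alpha> x" for \<alpha>
    unfolding monom_fun_def by (intro prod.cong) auto
  then show "(\<Sum>\<alpha>\<in>A. c \<alpha> * (\<Prod>b\<in>Basis. y b ^ \<alpha> b)) = 0"
    using assms(3) by simp
qed (use assms in \<open>auto simp: exponents_def\<close>)

lemma inj_monom_fun: "inj_on monom_fun (exponents k)"
proof (rule inj_onI, rule ccontr)
  fix \<alpha> \<beta> :: "'a \<Rightarrow> nat"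
  assume ab: "\<alpha> \<in> exponents k" "\<beta> \<in> exponents k" "monom_fun \<alpha> = monom_fun \<beta>" and ne: "\<alpha> \<noteq> \<beta>"
  have "(\<lambda>\<gamma>. if \<gamma> = \<alpha> then 1 else - 1 :: real) \<alpha> = 0"
    by (rule monom_fun_coeffs_zero[of "{\<alpha>, \<beta>}" k]) (use ab ne in auto)
  then show False by simp
qed

lemma sum_fun_apply: "(\<Sum>v\<in>S. f v) x = (\<Sum>v\<in>S. f v x)" for f :: "'b \<Rightarrow> 'a \<Rightarrow> real"
  by (induction S rule: infinite_finite_induct) (auto simp: zero_fun_def plus_fun_def)

lemma independent_monom_fun: "fs.independent (monom_fun ` exponents k)"
  unfolding fs.independent_explicit_finite_subsets
proof (intro allI impI ballI)
  fix S u v assume S: "S \<subseteq> monom_fun ` exponents k" "finite S"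
    and u: "(\<Sum>v\<in>S. (\<lambda>x. u v * v x)) = 0" and v: "v \<in> S"
  obtain A where A: "A \<subseteq> exponents k" "finite A" "S = monom_fun ` A"
    using finite_subset_image[OF S(2,1)] by blast
  have inj: "inj_on monom_fun A" using inj_monom_fun A(1) by (rule inj_on_subset)
  obtain \<alpha> where \<alpha>: "\<alpha> \<in> A" "v = monom_fun \<alpha>" using v A(3) by blast
  have "(\<Sum>\<alpha>\<in>A. u (monom_fun \<alpha>) * monom_fun \<alpha> x) = 0" for x
  proof -
    have "(\<Sum>v\<in>S. u v * v x) = 0" using fun_cong[OF u, of x] by (simp add: sum_fun_apply zero_fun_def)
    then show ?thesis unfolding A(3) by (subst (asm) sum.reindex[OF inj]) (simp add: o_def)
  qed
  from monom_fun_coeffs_zero[OF A(2,1) this \<alpha>(1)] show "u v = 0" using \<alpha>(2) by simp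
qed

text \<open>Stars and bars, after an enumeration of the basis turns exponents into lists with
  prescribed length and sum.\<close>

lemma card_exponents:
  "finite (exponents k :: ('a::euclidean_space \<Rightarrow> nat) set)"
  "card (exponents k :: ('a::euclidean_space \<Rightarrow> nat) set) = (k + DIM('a) - 1) choose k"
proof -
  obtain bs :: "'a list" where bs: "set bs = Basis" "distinct bs"
    using finite_distinct_list[OF finite_Basis] by blast
  have len: "length bs = DIM('a)" using distinct_card[OF bs(2)] bs(1) by simp
  let ?L = "{l :: nat list. size l = DIM('a) \<and> sum_list l = k}"
  have "bij_betw (\<lambda>\<alpha>. map \<alpha> bs) (exponents k) ?L"
    unfolding bij_betw_def
  proof
    show "inj_on (\<lambda>\<alpha>. map \<alpha> bs) (exponents k)"
    proof (rule inj_onI)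
      fix \<alpha> \<beta> :: "'a \<Rightarrow> nat" assume ab: "\<alpha> \<in> exponents k" "\<beta> \<in> exponents k" "map \<alpha> bs = map \<beta> bs"
      show "\<alpha> = \<beta>"
      proof
        fix b show "\<alpha> b = \<beta> b"
          using ab bs(1) by (cases "b \<in> Basis") (auto simp: exponents_def)
      qed
    qed
    show "(\<lambda>\<alpha>. map \<alpha> bs) ` exponents k = ?L"
    proof (intro equalityI subsetI)
      fix l assume "l \<in> (\<lambda>\<alpha>. map \<alpha> bs) ` exponents k"
      then show "l \<in> ?L"
        using bs len by (auto simp: exponents_def sum_list_distinct_conv_sum_set)
    next
      fix l assume l: "l \<in> ?L"
      define \<alpha> where "\<alpha> b = (case map_of (zip bs l) b of Some m \<Rightarrow> m | None \<Rightarrow> 0)" for b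
      have m: "map \<alpha> bs = l"
      proof (rule nth_equalityI)
        show "length (map \<alpha> bs) = length l" using l len by simp
        fix i assume i: "i < length (map \<alpha> bs)"
        then have "map_of (zip bs l) (bs ! i) = Some (l ! i)"
          using l len bs(2) by (intro map_of_zip_nth) auto
        then show "map \<alpha> bs ! i = l ! i" using i by (simp add: \<alpha>_def)
      qed
      have "\<alpha> b = 0" if "b \<notin> Basis" for b
      proof -
        have "map_of (zip bs l) b = None" using that bs(1) l len by (simp add: map_of_zip_is_None)
        then show ?thesis by (simp add: \<alpha>_def)
      qed
      moreover have "(\<Sum>b\<in>Basis. \<alpha> b) = k"
        using l sum_list_distinct_conv_sum_set[OF bs(2), of \<alpha>] bs(1) unfolding m by simp
      ultimately have "\<alpha> \<in> exponents k" by (simp add: exponents_def)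
      then show "l \<in> (\<lambda>\<alpha>. map \<alpha> bs) ` exponents k" using m by blast
    qed
  qed
  moreover have "finite ?L"
    by (rule finite_subset[OF _ finite_lists_length_eq[of "{..k}" "DIM('a)"]])
       (auto dest: member_le_sum_list)
  ultimately show "finite (exponents k :: ('a \<Rightarrow> nat) set)"
    "card (exponents k :: ('a \<Rightarrow> nat) set) = (k + DIM('a) - 1) choose k"
    using bij_betw_finite bij_betw_same_card card_length_sum_list[of "DIM('a)" k] by metis+
qed

lemma dim_image_inj:
  assumes L: "Vector_Spaces.linear (\<lambda>(c::real) (f :: 'a \<Rightarrow> real) x. c * f x) (\<lambda>c (f :: 'b \<Rightarrow> real) x. c * f x) L"
    and B: "fs.independent B" "inj_on L (fs.span B)"
  shows "fs.independent (L ` B)" "fs.dim (L ` fs.span B) = card B" "L ` fs.span B = fs.span (L ` B)" "card (L ` B) = card B"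
proof -
  interpret L: Vector_Spaces.linear "\<lambda>(c::real) (f :: 'a \<Rightarrow> real) x. c * f x" "\<lambda>c (f :: 'b \<Rightarrow> real) x. c * f x" L
    by (rule L)
  show 1: "fs.independent (L ` B)" using B by (rule L.independent_injective_image)
  show 2: "L ` fs.span B = fs.span (L ` B)" by (rule L.span_image[symmetric])
  have "inj_on L B" using B(2) by (rule inj_on_subset) (auto intro: fs.span_base)
  then show 3: "card (L ` B) = card B" by (rule card_image)
  show "fs.dim (L ` fs.span B) = card B"
    unfolding 2 fs.dim_span_eq_card_independent[OF 1] by (rule 3)
qed

lemma harmonic_subspace: "fs.subspace {p. harmonic k p}"
proof (rule fs.subspaceI)
  have "lap (\<lambda>x :: 'a. 0) = (\<lambda>x. 0)"
    using lap_cmult[OF hpoly_zero[of 0], where c = 0] by simp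
  then show "0 \<in> {p :: 'a \<Rightarrow> real. harmonic k p}"
    by (simp add: harmonic_def zero_fun_def hpoly_zero)
next
  fix p q :: "'a \<Rightarrow> real" assume "p \<in> {p. harmonic k p}" "q \<in> {p. harmonic k p}"
  then have "harmonic k (\<lambda>x. p x + q x)"
    using lap_add[of k p q] by (auto simp: harmonic_def intro: hpoly_add)
  then show "p + q \<in> {p. harmonic k p}" by (simp add: plus_fun_def)
next
  fix c and p :: "'a \<Rightarrow> real" assume "p \<in> {p. harmonic k p}"
  then show "(\<lambda>x. c * p x) \<in> {p. harmonic k p}"
    using lap_cmult[of k p c] by (auto simp: harmonic_def intro: hpoly_cmult)
qed

lemma independent_Un:
  assumes "finite B" "fs.independent B" "fs.independent C" "fs.span B \<inter> fs.span C = {0}"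
  shows "fs.independent (B \<union> C)"
  using assms
proof (induction B rule: finite_induct)
  case (insert b B)
  have sub: "fs.span B \<subseteq> fs.span (insert b B)" by (rule fs.span_mono) auto
  have bB: "b \<notin> fs.span B"
    using insert.prems(1) insert.hyps(2) by (simp add: fs.independent_insert)
  have "fs.independent (B \<union> C)"
  proof (rule insert.IH)
    show "fs.independent B" using insert.prems(1) by (rule fs.independent_mono) auto
    have "fs.span B \<inter> fs.span C \<subseteq> {0}" using sub insert.prems(3) by blast
    moreover have "0 \<in> fs.span B \<inter> fs.span C" by (simp add: fs.span_zero)
    ultimately show "fs.span B \<inter> fs.span C = {0}" by blast
  qed (rule insert.prems)
  moreover have "b \<notin> fs.span (B \<union> C)"
  proof
    assume "b \<in> fs.span (B \<union> C)"
    then obtain u v where uv: "b = u + v" "u \<in> fs.span B" "v \<in> fs.span C"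
      unfolding fs.span_Un by blast
    have "v = b - u" using uv(1) by simp
    moreover have "b - u \<in> fs.span (insert b B)"
      using uv(2) sub by (intro fs.span_diff) (auto intro: fs.span_base)
    ultimately have "v = 0" using uv(3) insert.prems(3) by blast
    then show False using uv(1,2) bB by simp
  qed
  ultimately show ?case
    by (simp add: fs.independent_insertI)
qed simp

text \<open>Degree \<open>k\<close> is the direct sum of the harmonic part and
  \<open>x \<bullet> x\<close> times degree \<open>k - 2\<close>. Multiplication by
  \<open>x \<bullet> x\<close> is injective, so the dimension is a difference of two monomial
  counts.\<close>

lemma harmonic_basis:
  obtains B where "finite B" "fs.independent B" "fs.span B = {p :: 'a::euclidean_space \<Rightarrow> real. harmonic k p}"
    "card B = (k + DIM('a) - 1 choose k) - (if k < 2 then 0 else (k - 2 + DIM('a) - 1 choose (k - 2)))"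
proof -
  let ?H = "{p :: 'a \<Rightarrow> real. harmonic k p}"
  define m :: "nat \<Rightarrow> ('a \<Rightarrow> real) set" where "m j = monom_fun ` exponents j" for j
  have m: "finite (m j)" "fs.independent (m j)" "fs.span (m j) = {p. hpoly j p}" "card (m j) = (j + DIM('a) - 1 choose j)" for j
    unfolding m_def using card_exponents[where 'a = 'a, of j]
    by (auto simp: independent_monom_fun span_monom_fun card_image[OF inj_monom_fun])
  \<comment> \<open>A maximal independent set of harmonic polynomials; it is finite because it lies
    in the span of finitely many monomials.\<close>
  obtain B where B: "B \<subseteq> ?H" "fs.independent B" "?H \<subseteq> fs.span B"
    by (rule fs.maximal_independent_subset[of ?H])
  have fB: "finite B"
    using fs.independent_span_bound[OF m(1) B(2), of k] B(1) unfolding m(3) harmonic_def by blast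
  have sB: "fs.span B = ?H"
    using B(3) fs.span_minimal[OF B(1) harmonic_subspace] by blast
  show ?thesis
  proof (cases "k < 2")
    case True
    then have "?H = {p. hpoly k p}" using hpoly_lap_0 by (auto simp: harmonic_def)
    then show ?thesis
      using that[of "m k"] m True by simp
  next
    case False
    define j where "j = k - 2"
    have k: "k = j + 2" unfolding j_def using False by simp
    define L where "L = (\<lambda>(q :: 'a \<Rightarrow> real) x. (x \<bullet> x) * q x)"
    have Llin: "Vector_Spaces.linear (\<lambda>(c::real) (f :: 'a \<Rightarrow> real) x. c * f x) (\<lambda>c (f :: 'a \<Rightarrow> real) x. c * f x) L"
      by (rule Vector_Spaces.linear_iff[THEN iffD2])
         (auto simp: L_def plus_fun_def algebra_simps intro: vector_space_fun_scale)
    have inj: "inj_on L (fs.span (m j))"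
    proof (rule inj_onI)
      fix p q assume "p \<in> fs.span (m j)" "q \<in> fs.span (m j)" and eq: "L p = L q"
      then have pq: "hpoly j p" "hpoly j q" unfolding m(3) by auto
      have "(\<lambda>x. (x \<bullet> x) * (p x - q x)) = (\<lambda>x. 0)"
        using eq unfolding L_def by (auto simp: fun_eq_iff algebra_simps)
      moreover have "harmonic (j + 2) (\<lambda>x. 0 :: real)"
        using fs.subspace_0[OF harmonic_subspace[of "j + 2"]] by (simp add: zero_fun_def)
      ultimately have "(\<lambda>x. p x - q x) = (\<lambda>x. 0)"
        using harmonic_sq_0[OF hpoly_diff[OF pq]] by simp
      then show "p = q" by (auto simp: fun_eq_iff)
    qed
    note L = dim_image_inj[OF Llin m(2) inj]
    have int: "fs.span B \<inter> fs.span (L ` m j) = {0}"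
    proof (intro equalityI subsetI)
      fix p assume p: "p \<in> fs.span B \<inter> fs.span (L ` m j)"
      then obtain q where q: "hpoly j q" "p = L q" unfolding L(3)[symmetric] m(3) by blast
      have "harmonic (j + 2) (\<lambda>x. (x \<bullet> x) * q x)"
        using p q(2) unfolding sB k L_def by simp
      from harmonic_sq_0[OF q(1) this] show "p \<in> {0}"
        using q(2) by (simp add: L_def zero_fun_def)
    qed (auto simp: fs.span_zero)
    have ind: "fs.independent (B \<union> L ` m j)"
      by (rule independent_Un[OF fB B(2) L(1) int])
    have disj: "B \<inter> L ` m j = {}"
    proof -
      have "p = 0" if "p \<in> B" "p \<in> L ` m j" for p
      proof -
        have "p \<in> fs.span B \<inter> fs.span (L ` m j)" by (intro IntI fs.span_base that)
        then show ?thesis unfolding int by simp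
      qed
      moreover have "0 \<notin> B"
      proof
        assume "0 \<in> B"
        then have "fs.dependent B" by (rule fs.dependent_zero)
        then show False using B(2) by contradiction
      qed
      ultimately show ?thesis by (metis disjoint_iff)
    qed
    have sp: "fs.span (B \<union> L ` m j) = {p. hpoly k p}"
    proof (intro equalityI subsetI)
      fix p assume p: "p \<in> fs.span (B \<union> L ` m j)"
      have "hpoly k p" if pL: "p \<in> L ` m j" for p
      proof -
        obtain q where q: "q \<in> m j" "p = L q" using pL by auto
        have "q \<in> fs.span (m j)" using q(1) by (rule fs.span_base)
        then have "hpoly j q" unfolding m(3) by simp
        from hpoly_sq[OF this] show ?thesis unfolding q(2) L_def k .
      qed
      then have "B \<union> L ` m j \<subseteq> {p. hpoly k p}"
        using B(1) by (auto simp: harmonic_def)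
      then have "fs.span (B \<union> L ` m j) \<subseteq> {p. hpoly k p}"
        by (rule fs.span_minimal[OF _ hpoly_subspace])
      then show "p \<in> {p. hpoly k p}" using p by (rule subsetD)
    next
      fix p assume "p \<in> {p :: 'a \<Rightarrow> real. hpoly k p}"
      then have "hpoly (j + 2) p" unfolding k by simp
      then obtain h q where hq: "harmonic (j + 2) h" "hpoly j q" "p = (\<lambda>x. h x + (x \<bullet> x) * q x)"
        by (rule harmonic_decomposition)
      have "h \<in> fs.span B" unfolding sB using hq(1) k by simp
      moreover have "L q \<in> fs.span (L ` m j)"
        unfolding L(3)[symmetric] m(3) using hq(2) by (intro imageI) simp
      moreover have "p = h + L q" unfolding hq(3) L_def plus_fun_def ..
      ultimately show "p \<in> fs.span (B \<union> L ` m j)"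
        unfolding fs.span_Un by (intro CollectI exI conjI)
    qed
    have "card (B \<union> L ` m j) = card B + card (m j)"
      using card_Un_disjoint[OF fB _ disj] m(1) L(4) by simp
    moreover have "card (B \<union> L ` m j) = card (m k)"
      using trans[OF fs.dim_span_eq_card_independent[OF ind, unfolded sp, symmetric]
          fs.dim_span_eq_card_independent[OF m(2)[of k], unfolded m(3)]] .
    ultimately have "card B = (k + DIM('a) - 1 choose k) - (k - 2 + DIM('a) - 1 choose (k - 2))"
      unfolding m(4) j_def by simp
    then show ?thesis
      using that[OF fB B(2) sB] False by simp
  qed
qed

section \<open>Eigenfunctions on the sphere\<close>

definition to_sphere :: "('a::euclidean_space \<Rightarrow> real) \<Rightarrow> 'a \<Rightarrow> real" where
  "to_sphere p = (\<lambda>x. if norm x = 1 then p x else 0)"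

lemma radial_extension_to_sphere:
  assumes "hpoly k p" "x \<noteq> 0"
  shows "radial_extension (to_sphere p) x = p x * inverse (norm x) ^ k"
  using assms hpoly_homogeneous[OF assms(1), of "inverse (norm x)" x]
  by (simp add: radial_extension_def to_sphere_def mult.commute)

lemma inverse_norm_power_has_derivative:
  fixes x :: "'a::euclidean_space"
  assumes x: "x \<noteq> 0"
  shows "((\<lambda>x. inverse (norm x) ^ m) has_derivative (\<lambda>h. - real m * (x \<bullet> h) * inverse (norm x) ^ (m + 2))) (at x)"
proof -
  have "((\<lambda>x. inverse (norm x)) has_derivative (\<lambda>h. - (inverse (norm x) * (x \<bullet> h / norm x) * inverse (norm x)))) (at x)"
  proof -
    have n: "(norm has_derivative (\<lambda>h. x \<bullet> h / norm x)) (at x)"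
      using has_derivative_norm[OF x] by (simp add: sgn_div_norm inner_commute divide_inverse mult.commute)
    have "norm x \<noteq> 0" using x by simp
    from Deriv.has_derivative_inverse[OF this n] show ?thesis .
  qed
  then have "((\<lambda>x. inverse (norm x)) has_derivative (\<lambda>h. - (x \<bullet> h) * inverse (norm x) ^ 3)) (at x)"
    by (simp add: power3_eq_cube divide_inverse mult_ac)
  from has_derivative_power[OF this, of m]
  have "((\<lambda>x. inverse (norm x) ^ m) has_derivative
      (\<lambda>h. real m * (- (x \<bullet> h) * inverse (norm x) ^ 3) * inverse (norm x) ^ (m - 1))) (at x)" .
  moreover have "real m * (- (x \<bullet> h) * inverse (norm x) ^ 3) * inverse (norm x) ^ (m - 1) =
      - real m * (x \<bullet> h) * inverse (norm x) ^ (m + 2)" for h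
    by (cases m) (simp_all add: power_add power3_eq_cube power2_eq_square algebra_simps)
  ultimately show ?thesis by (simp only:)
qed

lemma open_nonzero: "open (- {0 :: 'a::euclidean_space})"
  by auto

lemma ratio_has_derivative:
  fixes g :: "'a::euclidean_space \<Rightarrow> real"
  assumes q: "hpoly k q" and g: "\<And>x. x \<noteq> 0 \<Longrightarrow> g x = q x * inverse (norm x) ^ m" and x: "x \<noteq> 0"
  shows "(g has_derivative (\<lambda>h. q x * (- real m * (x \<bullet> h) * inverse (norm x) ^ (m + 2)) +
    (\<Sum>b\<in>Basis. (h \<bullet> b) * pd b q x) * inverse (norm x) ^ m)) (at x)"
proof (rule has_derivative_transform_within_open[OF _ open_nonzero])
  show "((\<lambda>x. q x * inverse (norm x) ^ m) has_derivative (\<lambda>h. q x * (- real m * (x \<bullet> h) * inverse (norm x) ^ (m + 2)) +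
    (\<Sum>b\<in>Basis. (h \<bullet> b) * pd b q x) * inverse (norm x) ^ m)) (at x)"
    by (intro has_derivative_mult hpoly_has_derivative[OF q] inverse_norm_power_has_derivative x)
qed (use x g in auto)

text \<open>Over the common denominator \<open>norm x ^ (m + 2)\<close> the derivative has a
  homogeneous numerator again. Quotients of this form are thus closed under partial derivatives,
  which gives smoothness to all orders.\<close>

lemma ratio_pd:
  fixes g :: "'a::euclidean_space \<Rightarrow> real"
  assumes q: "hpoly k q" and g: "\<And>x. x \<noteq> 0 \<Longrightarrow> g x = q x * inverse (norm x) ^ m"
    and x: "x \<noteq> 0" and b: "b \<in> Basis"
  shows "pd b g x = ((x \<bullet> x) * pd b q x - real m * ((x \<bullet> b) * q x)) * inverse (norm x) ^ (m + 2)"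
proof -
  have 1: "(x \<bullet> x) * inverse (norm x) ^ 2 = 1"
    using x by (simp add: power2_norm_eq_inner[symmetric] power_inverse)
  have "(x \<bullet> x) * inverse (norm x) ^ (m + 2) = ((x \<bullet> x) * inverse (norm x) ^ 2) * inverse (norm x) ^ m"
    by (simp only: power_add mult_ac)
  then have e: "inverse (norm x) ^ m = (x \<bullet> x) * inverse (norm x) ^ (m + 2)"
    unfolding 1 by simp
  define P where "P = inverse (norm x) ^ (m + 2)"
  have "pd b g x = q x * (- real m * (x \<bullet> b) * P) + (\<Sum>c\<in>Basis. (b \<bullet> c) * pd c q x) * inverse (norm x) ^ m"
    unfolding P_def by (rule pd_eq[OF ratio_has_derivative[OF q g x]])
  also have "\<dots> = ((x \<bullet> x) * pd b q x - real m * ((x \<bullet> b) * q x)) * P"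
    unfolding sum_Basis_inner[OF b] e P_def[symmetric] by (simp add: algebra_simps)
  finally show ?thesis unfolding P_def .
qed

lemma ratio_pd_hpoly:
  assumes q: "hpoly k q" and b: "b \<in> Basis"
  shows "hpoly (Suc k) (\<lambda>x. (x \<bullet> x) * pd b q x - real m * ((x \<bullet> b) * q x))"
proof -
  have 1: "hpoly (Suc k) (\<lambda>x. (x \<bullet> x) * pd b q x)"
  proof (cases k)
    case 0
    then show ?thesis using hpoly_0_pd[of q b] q b by (simp add: hpoly_zero)
  next
    case (Suc j)
    then show ?thesis using hpoly_sq[OF hpoly_pd[OF q b]] by simp
  qed
  have 2: "hpoly (Suc k) (\<lambda>x. real m * ((x \<bullet> b) * q x))"
    by (rule hpoly_cmult[OF hpoly_mult[OF q b]])
  show ?thesis by (rule hpoly_diff[OF 1 2])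
qed

lemma iter_partial_Cons: "iter_partial (b # bs) f = pd b (iter_partial bs f)"
  by (simp add: pd_def[abs_def])

lemma iter_partial_ratio:
  fixes f :: "'a::euclidean_space \<Rightarrow> real"
  assumes "hpoly k p" "\<And>x. x \<noteq> 0 \<Longrightarrow> f x = p x * inverse (norm x) ^ m" "bs \<in> lists Basis"
  shows "\<exists>k' q m'. hpoly k' q \<and> (\<forall>x. x \<noteq> 0 \<longrightarrow> iter_partial bs f x = q x * inverse (norm x) ^ m')"
  using assms(3)
proof (induction bs)
  case Nil
  then show ?case using assms(1,2) by auto
next
  case (Cons b bs)
  then obtain k' q m' where q: "hpoly k' q" "\<And>x. x \<noteq> 0 \<Longrightarrow> iter_partial bs f x = q x * inverse (norm x) ^ m'"
    by auto
  have b: "b \<in> Basis" using Cons by simp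
  show ?case
    unfolding iter_partial_Cons using ratio_pd_hpoly[OF q(1) b, of m'] ratio_pd[OF q _ b] by blast
qed

lemma to_sphere_smooth:
  assumes p: "hpoly k p"
  shows "to_sphere p \<in> smooth_sphere_functions"
proof -
  have "iter_partial bs (radial_extension (to_sphere p)) differentiable at x" if bs: "bs \<in> lists Basis" and x: "x \<noteq> 0" for bs x
  proof -
    obtain k' q m' where q: "hpoly k' q"
      "\<And>x. x \<noteq> 0 \<Longrightarrow> iter_partial bs (radial_extension (to_sphere p)) x = q x * inverse (norm x) ^ m'"
      using iter_partial_ratio[OF p radial_extension_to_sphere[OF p] bs] by blast
    show ?thesis
      using ratio_has_derivative[OF q x] by (rule differentiableI)
  qed
  then show ?thesis
    unfolding smooth_sphere_functions_def smooth_real_on_def by (auto simp: to_sphere_def)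
qed

lemma sphere_laplacian_eq:
  "sphere_laplacian f x = (if norm x = 1 then - lap (radial_extension f) x else 0)"
  by (simp add: sphere_laplacian_def lap_def iter_partial_Cons del: iter_partial.simps(2))

definition sphere_eigenvalue :: "'a::euclidean_space itself \<Rightarrow> nat \<Rightarrow> real" where
  "sphere_eigenvalue _ k = real k * (real k + real DIM('a) - 2)"

lemma sphere_laplacian_harmonic:
  fixes p :: "'a::euclidean_space \<Rightarrow> real"
  assumes "harmonic k p"
  shows "sphere_laplacian (to_sphere p) = (\<lambda>x. sphere_eigenvalue TYPE('a) k * to_sphere p x)"
proof
  fix x :: 'a
  have p: "hpoly k p" and lp: "lap p = (\<lambda>x. 0)" using assms by (auto simp: harmonic_def)
  let ?F = "radial_extension (to_sphere p)"
  show "sphere_laplacian (to_sphere p) x = sphere_eigenvalue TYPE('a) k * to_sphere p x"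
  proof (cases "norm x = 1")
    case True
    then have x: "x \<noteq> 0" and xx: "x \<bullet> x = 1" by (auto simp: power2_norm_eq_inner[symmetric])
    define q where "q b = (\<lambda>x. (x \<bullet> x) * pd b p x - real k * ((x \<bullet> b) * p x))" for b
    have q: "hpoly (Suc k) (q b)" if "b \<in> Basis" for b
      unfolding q_def by (rule ratio_pd_hpoly[OF p that])
    have F1: "pd b ?F y = q b y * inverse (norm y) ^ (k + 2)" if "b \<in> Basis" "y \<noteq> 0" for b y
      unfolding q_def by (rule ratio_pd[OF p radial_extension_to_sphere[OF p] that(2,1)])
    have F2: "pd b (pd b ?F) x = pd b (q b) x - real (k + 2) * ((x \<bullet> b) * q b x)" if "b \<in> Basis" for b
      using ratio_pd[OF q[OF that] F1[OF that] x that] xx True by simp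
    have dq: "pd b (q b) x = 2 * ((x \<bullet> b) * pd b p x) + pd b (pd b p) x - real k * ((x \<bullet> b) * pd b p x) - real k * p x"
      if b: "b \<in> Basis" for b
    proof -
      have "(q b has_derivative (\<lambda>h. ((x \<bullet> x) * (\<Sum>c\<in>Basis. (h \<bullet> c) * pd c (pd b p) x) + (x \<bullet> h + h \<bullet> x) * pd b p x) -
          real k * ((x \<bullet> b) * (\<Sum>c\<in>Basis. (h \<bullet> c) * pd c p x) + (h \<bullet> b) * p x))) (at x)"
        unfolding q_def
        by (intro has_derivative_diff has_derivative_mult has_derivative_mult_right has_derivative_inner has_derivative_ident
            has_derivative_inner_left hpoly_has_derivative[OF p] hpoly_has_derivative[OF hpoly_pd[OF p b]])
      from pd_eq[OF this, of b] show ?thesis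
        using b xx by (simp add: sum_Basis_inner inner_commute algebra_simps)
    qed
    have e: "(\<Sum>b\<in>Basis. (x \<bullet> b) * pd b p x) = real k * p x" by (rule hpoly_euler[OF p])
    \<comment> \<open>Up to a power of the norm, \<open>q b\<close> is the \<open>b\<close>-th
      partial derivative of the extension, so this sum is its radial derivative, zero for a function
      constant on rays.\<close>
    have e2: "(\<Sum>b\<in>Basis. (x \<bullet> b) * q b x) = 0"
    proof -
      have "(\<Sum>b\<in>Basis. (x \<bullet> b) * q b x) =
          (\<Sum>b\<in>Basis. (x \<bullet> b) * pd b p x) - real k * p x * (\<Sum>b\<in>Basis. (x \<bullet> b) * (x \<bullet> b))"
        unfolding q_def xx by (simp add: sum_subtractf sum_distrib_left algebra_simps)
      then show ?thesis unfolding e inner_self_sum[symmetric] xx by simp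
    qed
    have "lap ?F x = (\<Sum>b\<in>Basis. pd b (q b) x - real (k + 2) * ((x \<bullet> b) * q b x))"
      unfolding lap_def by (intro sum.cong refl F2)
    also have "\<dots> = (\<Sum>b\<in>Basis. pd b (q b) x) - real (k + 2) * (\<Sum>b\<in>Basis. (x \<bullet> b) * q b x)"
      by (simp only: sum_subtractf sum_distrib_left)
    also have "(\<Sum>b\<in>Basis. pd b (q b) x) = (\<Sum>b\<in>Basis. 2 * ((x \<bullet> b) * pd b p x) + pd b (pd b p) x - real k * ((x \<bullet> b) * pd b p x) - real k * p x)"
      by (intro sum.cong refl dq)
    also have "\<dots> = 2 * (\<Sum>b\<in>Basis. (x \<bullet> b) * pd b p x) + lap p x - real k * (\<Sum>b\<in>Basis. (x \<bullet> b) * pd b p x) - real DIM('a) * (real k * p x)"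
      by (simp add: sum_subtractf sum.distrib sum_distrib_left lap_def)
    finally have "lap ?F x = 2 * (real k * p x) - real k * (real k * p x) - real DIM('a) * (real k * p x)"
      unfolding e e2 lp by simp
    then show ?thesis
      using True by (simp add: sphere_laplacian_eq to_sphere_def sphere_eigenvalue_def algebra_simps)
  qed (simp add: sphere_laplacian_eq to_sphere_def)
qed

section \<open>Radial extensions of smooth functions\<close>

lemma radial_extension_scale: "t > 0 \<Longrightarrow> radial_extension f (t *\<^sub>R x) = radial_extension f x"
proof -
  assume t: "t > 0"
  have "inverse t * inverse (norm x) * t = (inverse t * t) * inverse (norm x)" by (simp only: mult_ac)
  also have "\<dots> = inverse (norm x)" using t by simp
  finally have e: "inverse t * inverse (norm x) * t = inverse (norm x)" .
  show ?thesis
    using t by (simp add: radial_extension_def) (simp only: e)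
qed

lemma pd_differentiable: "f differentiable at x \<Longrightarrow> (f has_derivative (\<lambda>h. \<Sum>b\<in>Basis. (h \<bullet> b) * pd b f x)) (at x)"
proof -
  assume "f differentiable at x"
  then have f: "(f has_derivative frechet_derivative f (at x)) (at x)"
    by (simp add: frechet_derivative_works)
  then have l: "linear (frechet_derivative f (at x))" by (rule has_derivative_linear)
  have "frechet_derivative f (at x) h = (\<Sum>b\<in>Basis. (h \<bullet> b) * pd b f x)" for h
  proof -
    have "frechet_derivative f (at x) h = frechet_derivative f (at x) (\<Sum>b\<in>Basis. (h \<bullet> b) *\<^sub>R b)"
      by (simp add: euclidean_representation)
    then show ?thesis by (simp add: linear_sum[OF l] linear_scale[OF l] pd_def)
  qed
  then have "frechet_derivative f (at x) = (\<lambda>h. \<Sum>b\<in>Basis. (h \<bullet> b) * pd b f x)" by blast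
  then show ?thesis using f by metis
qed

text \<open>The chain rule for scaling by \<open>t\<close>: a partial derivative lowers the degree
  of homogeneity by one.\<close>

lemma pd_scale:
  fixes g :: "'a::euclidean_space \<Rightarrow> real"
  assumes t: "t > 0" and g: "\<And>y. y \<noteq> 0 \<Longrightarrow> g (t *\<^sub>R y) = a * g y"
    and d: "\<And>y. y \<noteq> 0 \<Longrightarrow> g differentiable at y" and x: "x \<noteq> 0" and b: "b \<in> Basis"
  shows "pd b g (t *\<^sub>R x) = a / t * pd b g x"
proof -
  have "t *\<^sub>R x \<noteq> 0" using t x by simp
  have "(g has_derivative (\<lambda>h. \<Sum>b\<in>Basis. (h \<bullet> b) * pd b g (t *\<^sub>R x))) (at (t *\<^sub>R x))"
    by (rule pd_differentiable[OF d[OF \<open>t *\<^sub>R x \<noteq> 0\<close>]])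
  moreover have "((\<lambda>y. t *\<^sub>R y) has_derivative (\<lambda>h. t *\<^sub>R h)) (at x)"
    by (auto intro!: derivative_eq_intros)
  ultimately have "((\<lambda>y. g (t *\<^sub>R y)) has_derivative (\<lambda>h. \<Sum>b\<in>Basis. (t *\<^sub>R h \<bullet> b) * pd b g (t *\<^sub>R x))) (at x)"
    by (rule has_derivative_compose[where g = g, rotated])
  moreover have "((\<lambda>y. g (t *\<^sub>R y)) has_derivative (\<lambda>h. a * (\<Sum>b\<in>Basis. (h \<bullet> b) * pd b g x))) (at x)"
    by (rule has_derivative_transform_within_open[OF has_derivative_mult_right[OF pd_differentiable[OF d[OF x]]] open_nonzero])
       (use x g in auto)
  ultimately have "(\<lambda>h. \<Sum>b\<in>Basis. (t *\<^sub>R h \<bullet> b) * pd b g (t *\<^sub>R x)) = (\<lambda>h. a * (\<Sum>b\<in>Basis. (h \<bullet> b) * pd b g x))"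
    by (rule has_derivative_unique)
  from fun_cong[OF this, of b] have "t * pd b g (t *\<^sub>R x) = a * pd b g x"
    using b by (simp add: mult.assoc sum_distrib_left[symmetric] sum_Basis_inner)
  then show ?thesis using t by (simp add: field_simps)
qed

lemma smooth_sphereD:
  assumes f: "f \<in> smooth_sphere_functions" and x: "x \<noteq> 0"
  shows "radial_extension f differentiable at x"
    and "b \<in> Basis \<Longrightarrow> pd b (radial_extension f) differentiable at x"
    and "b \<in> Basis \<Longrightarrow> pd b (pd b (radial_extension f)) differentiable at x"
proof -
  have *: "iter_partial bs (radial_extension f) differentiable at x" if "bs \<in> lists Basis" for bs
    using f x that by (auto simp: smooth_sphere_functions_def smooth_real_on_def)
  show "radial_extension f differentiable at x" using *[of "[]"] by simp
  show "pd b (radial_extension f) differentiable at x" if "b \<in> Basis"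
    using *[of "[b]"] that by (simp only: iter_partial_Cons iter_partial.simps(1)) simp
  show "pd b (pd b (radial_extension f)) differentiable at x" if "b \<in> Basis"
    using *[of "[b, b]"] that by (simp only: iter_partial_Cons iter_partial.simps(1)) simp
qed

lemma radial_extension_euler:
  assumes f: "f \<in> smooth_sphere_functions" and x: "x \<noteq> 0"
  shows "(\<Sum>b\<in>Basis. (x \<bullet> b) * pd b (radial_extension f) x) = 0"
proof -
  let ?F = "radial_extension f"
  have "(?F has_derivative (\<lambda>h. \<Sum>b\<in>Basis. (h \<bullet> b) * pd b ?F x)) (at (1 *\<^sub>R x))"
    using pd_differentiable[OF smooth_sphereD(1)[OF f x]] by simp
  moreover have "((\<lambda>t. t *\<^sub>R x) has_derivative (\<lambda>t. t *\<^sub>R x)) (at 1)"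
    by (auto intro!: derivative_eq_intros)
  ultimately have "((\<lambda>t. ?F (t *\<^sub>R x)) has_derivative (\<lambda>t. \<Sum>b\<in>Basis. (t *\<^sub>R x \<bullet> b) * pd b ?F x)) (at 1)"
    by (rule has_derivative_compose[where g = ?F, rotated])
  moreover have "((\<lambda>t. ?F (t *\<^sub>R x)) has_derivative (\<lambda>t. 0)) (at 1)"
  proof (rule has_derivative_transform_within_open[of "\<lambda>_. ?F x"])
    show "open {0 :: real<..}" by simp
  qed (auto simp: radial_extension_scale)
  ultimately have "(\<lambda>t. \<Sum>b\<in>Basis. (t *\<^sub>R x \<bullet> b) * pd b ?F x) = (\<lambda>t. 0)"
    by (rule has_derivative_unique)
  from fun_cong[OF this, of 1] show ?thesis by simp
qed

text \<open>The extension is homogeneous of degree 0 and its Laplacian of degree \<open>-2\<close>,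
  so the eigenvalue equation on the sphere spreads to all of space with the factor
  \<open>x \<bullet> x\<close>.\<close>

lemma lap_radial_extension:
  assumes f: "f \<in> smooth_sphere_functions" and ev: "sphere_laplacian f = (\<lambda>x. \<mu> * f x)" and x: "x \<noteq> 0"
  shows "(x \<bullet> x) * lap (radial_extension f) x = - \<mu> * radial_extension f x"
proof -
  let ?F = "radial_extension f"
  define t where "t = norm x"
  define y where "y = x /\<^sub>R norm x"
  have t: "t > 0" and xy: "x = t *\<^sub>R y" and y: "y \<noteq> 0" "norm y = 1"
    using x unfolding t_def y_def by auto
  have 1: "pd b ?F (t *\<^sub>R z) = 1 / t * pd b ?F z" if "b \<in> Basis" "z \<noteq> 0" for b z
    using pd_scale[OF t _ smooth_sphereD(1)[OF f] that(2,1), of 1] t by (simp add: radial_extension_scale)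
  have 2: "pd b (pd b ?F) (t *\<^sub>R y) = 1 / t / t * pd b (pd b ?F) y" if b: "b \<in> Basis" for b
    by (rule pd_scale[OF t 1[OF b] smooth_sphereD(2)[OF f _ b] y(1) b])
  have "lap ?F x = 1 / t / t * lap ?F y"
    unfolding lap_def xy sum_distrib_left by (intro sum.cong refl 2)
  moreover have "x \<bullet> x = t * t"
    unfolding t_def by (simp add: power2_norm_eq_inner[symmetric] power2_eq_square)
  moreover have "lap ?F y = - \<mu> * f y"
    using fun_cong[OF ev, of y] y by (simp add: sphere_laplacian_eq)
  moreover have "f y = ?F x" unfolding y_def radial_extension_def ..
  ultimately show ?thesis using t by simp
qed

section \<open>Completeness of the spherical harmonics\<close>

text \<open>One summand of the divergence theorem. The integral of \<open>A\<close> translated along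
  \<open>b\<close> is constant, and its derivative at 0 is the integral of \<open>D\<close>. The box
  has half-width 3 so that the support, of radius 2, stays inside under shifts up to 1.\<close>

lemma integral_directional_derivative:
  fixes A D :: "'a::euclidean_space \<Rightarrow> real"
  assumes A: "\<And>x. ((\<lambda>t. A (x + t *\<^sub>R b)) has_real_derivative D x) (at 0)"
    and contA: "continuous_on UNIV A" and contD: "continuous_on UNIV D"
    and supp: "\<And>x. norm x \<ge> 2 \<Longrightarrow> A x = 0" and b: "norm b = 1"
  shows "integral (cbox (- (3 *\<^sub>R One)) (3 *\<^sub>R One)) D = 0"
proof -
  let ?K = "cbox (- (3 *\<^sub>R One)) (3 *\<^sub>R One) :: 'a set"
  have One: "(One :: 'a) \<bullet> i = 1" if "i \<in> Basis" for i using that by simp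
  have box: "x \<in> cbox (- (3 *\<^sub>R One) + s *\<^sub>R b) (3 *\<^sub>R One + s *\<^sub>R b)" if "norm x \<le> 2" "\<bar>s\<bar> \<le> 1" for x :: 'a and s
    unfolding mem_box
  proof
    fix i :: 'a assume i: "i \<in> Basis"
    have 1: "\<bar>x \<bullet> i\<bar> \<le> 2" using Basis_le_norm[OF i, of x] that(1) by linarith
    have 2: "\<bar>s * (b \<bullet> i)\<bar> \<le> 1"
    proof -
      have "\<bar>b \<bullet> i\<bar> \<le> 1" using Basis_le_norm[OF i, of b] b by simp
      then show ?thesis using that(2) by (simp add: abs_mult mult_le_one)
    qed
    show "(- (3 *\<^sub>R One) + s *\<^sub>R b) \<bullet> i \<le> x \<bullet> i \<and> x \<bullet> i \<le> (3 *\<^sub>R One + s *\<^sub>R b) \<bullet> i"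
      using 1 2 One[OF i] by (simp add: inner_add_left inner_diff_left) linarith
  qed
  define J where "J s = integral ?K (\<lambda>x. A (x + s *\<^sub>R b))" for s
  have J: "J s = J 0" if s: "\<bar>s\<bar> \<le> 1" for s
  proof -
    have U: "integral (cbox (- (3 *\<^sub>R One) + s *\<^sub>R b) (3 *\<^sub>R One + s *\<^sub>R b)) A = integral UNIV A" if s: "\<bar>s\<bar> \<le> 1" for s
    proof -
      have "(A has_integral integral (cbox (- (3 *\<^sub>R One) + s *\<^sub>R b) (3 *\<^sub>R One + s *\<^sub>R b)) A)
          (cbox (- (3 *\<^sub>R One) + s *\<^sub>R b) (3 *\<^sub>R One + s *\<^sub>R b))"
        by (intro integrable_integral integrable_continuous continuous_on_subset[OF contA]) auto
      then have "(A has_integral integral (cbox (- (3 *\<^sub>R One) + s *\<^sub>R b) (3 *\<^sub>R One + s *\<^sub>R b)) A) UNIV"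
      proof (rule has_integral_on_superset)
        fix x assume "x \<notin> cbox (- (3 *\<^sub>R One) + s *\<^sub>R b) (3 *\<^sub>R One + s *\<^sub>R b)"
        then have "\<not> norm x \<le> 2" using box[OF _ s] by blast
        then show "A x = 0" by (intro supp) simp
      qed simp
      then show ?thesis by (metis integral_unique)
    qed
    have "J s = integral (cbox (- (3 *\<^sub>R One) + s *\<^sub>R b) (3 *\<^sub>R One + s *\<^sub>R b)) A" for s
      unfolding J_def using integral_shift_cbox_plus[of "- (3 *\<^sub>R One)" "3 *\<^sub>R One" A "s *\<^sub>R b"]
      by (simp add: o_def add.commute)
    then show ?thesis using U[OF s] U[of 0] by simp
  qed
  have "((\<lambda>s. integral ?K (\<lambda>x. A (x + s *\<^sub>R b))) has_field_derivative integral ?K (\<lambda>x. D (x + 0 *\<^sub>R b))) (at 0 within {-1..1})"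
  proof (rule leibniz_rule_field_derivative)
    fix s x
    have e: "(\<lambda>t. A (x + s *\<^sub>R b + t *\<^sub>R b)) = (\<lambda>t. A (x + (t + s) *\<^sub>R b))"
      by (rule ext, rule arg_cong[of _ _ A]) (simp only: scaleR_add_left add_ac)
    have "((\<lambda>t. A (x + (t + s) *\<^sub>R b)) has_real_derivative D (x + s *\<^sub>R b)) (at 0)"
      by (rule A[of "x + s *\<^sub>R b", unfolded e])
    then have "((\<lambda>s. A (x + s *\<^sub>R b)) has_field_derivative D (x + s *\<^sub>R b)) (at (0 + s))"
      by (rule DERIV_shift[where f = "\<lambda>s. A (x + s *\<^sub>R b)", THEN iffD2])
    then show "((\<lambda>s. A (x + s *\<^sub>R b)) has_field_derivative D (x + s *\<^sub>R b)) (at s within {-1..1})"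
      unfolding add_0 by (rule has_field_derivative_at_within)
  next
    show "(\<lambda>x. A (x + s *\<^sub>R b)) integrable_on ?K" for s
      by (intro integrable_continuous continuous_on_compose2[OF contA] continuous_intros) auto
    show "continuous_on ({-1..1} \<times> ?K) (\<lambda>(s, x). D (x + s *\<^sub>R b))"
      unfolding case_prod_beta by (intro continuous_on_compose2[OF contD] continuous_intros) auto
  qed auto
  then have "(J has_field_derivative integral ?K D) (at 0 within {-1..1})"
    unfolding J_def by simp
  then have "(J has_field_derivative integral ?K D) (at 0)"
    using at_within_interior[of 0 "{-1..1 :: real}"] by simp
  moreover have "(J has_field_derivative 0) (at 0)"
  proof (rule has_field_derivative_transform_within_open[of "\<lambda>_. J 0"])
    show "open {-1<..<1 :: real}" by simp
    show "J 0 = J s" if "s \<in> {-1<..<1}" for s using J[of s] that by auto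
  qed auto
  ultimately show ?thesis by (rule DERIV_unique)
qed

text \<open>The support is the annulus \<open>1 \<le> norm x \<le> 2\<close>, and the gradient is radial, hence orthogonal to
  that of a function constant on rays.\<close>

definition bump_arg :: "'a::euclidean_space \<Rightarrow> real" where
  "bump_arg x = max 0 ((x \<bullet> x - 1) * (4 - x \<bullet> x))"

text \<open>The square makes the positive part continuously differentiable across the boundary of
  the annulus, as one integration by parts requires.\<close>

definition bump :: "'a::euclidean_space \<Rightarrow> real" where
  "bump x = bump_arg x ^ 2"

text \<open>A scalar: the gradient of \<open>bump\<close> at \<open>x\<close> is
  \<open>bump_grad x\<close> times the vector \<open>x\<close>.\<close>

definition bump_grad :: "'a::euclidean_space \<Rightarrow> real" where
  "bump_grad x = 4 * bump_arg x * (5 - 2 * (x \<bullet> x))"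

lemma square_max_has_real_derivative: "((\<lambda>s. (max 0 s) ^ 2) has_real_derivative 2 * max 0 s) (at s)" for s :: real
proof (cases s "0 :: real" rule: linorder_cases)
  case less
  have "((\<lambda>s. 0) has_real_derivative 0) (at s)" by simp
  then have "((\<lambda>s. (max 0 s) ^ 2) has_real_derivative 0) (at s)"
    by (rule has_field_derivative_transform_within_open[of _ _ _ "{..<0}"]) (use less in simp_all)
  then show ?thesis using less by (simp only: max_absorb1 less_imp_le mult_zero_right)
next
  case greater
  have "((\<lambda>s. s ^ 2) has_real_derivative 2 * s) (at s)"
    by (auto intro!: derivative_eq_intros)
  then have "((\<lambda>s. (max 0 s) ^ 2) has_real_derivative 2 * s) (at s)"
    by (rule has_field_derivative_transform_within_open[of _ _ _ "{0<..}"]) (use greater in simp_all)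
  then show ?thesis using greater by (simp only: max_absorb2 less_imp_le)
next
  case equal
  have "((\<lambda>h. ((max 0 (0 + h)) ^ 2 - (max 0 (0::real)) ^ 2) / h) \<longlongrightarrow> 0) (at 0)"
  proof (rule tendsto_rabs_zero_cancel, rule tendsto_sandwich)
    show "\<forall>\<^sub>F h in at (0::real). 0 \<le> \<bar>((max 0 (0 + h)) ^ 2 - (max 0 (0::real)) ^ 2) / h\<bar>" by simp
    show "\<forall>\<^sub>F h in at (0::real). \<bar>((max 0 (0 + h)) ^ 2 - (max 0 (0::real)) ^ 2) / h\<bar> \<le> \<bar>h\<bar>"
      by (intro always_eventually allI) (auto simp: max_def power2_eq_square abs_mult)
    show "((\<lambda>h::real. \<bar>h\<bar>) \<longlongrightarrow> 0) (at 0)" by (intro tendsto_rabs_zero tendsto_ident_at)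
  qed simp
  then show ?thesis unfolding equal DERIV_def by simp
qed

lemma bump_has_derivative: "(bump has_derivative (\<lambda>h. bump_grad x * (x \<bullet> h))) (at x)"
proof -
  let ?S = "\<lambda>x :: 'a. (x \<bullet> x - 1) * (4 - x \<bullet> x)"
  have "(?S has_derivative (\<lambda>h. (x \<bullet> x - 1) * (0 - (x \<bullet> h + h \<bullet> x)) + (x \<bullet> h + h \<bullet> x - 0) * (4 - x \<bullet> x))) (at x)"
    by (intro has_derivative_mult has_derivative_diff has_derivative_inner has_derivative_ident has_derivative_const)
  then have S: "(?S has_derivative (\<lambda>h. 2 * (5 - 2 * (x \<bullet> x)) * (x \<bullet> h))) (at x)"
    by (rule has_derivative_eq_rhs) (auto simp: inner_commute algebra_simps)
  have "((\<lambda>s. (max 0 s) ^ 2) has_derivative (\<lambda>h. h * (2 * bump_arg x))) (at (?S x))"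
    using square_max_has_real_derivative[of "?S x"]
    by (simp add: has_field_derivative_def bump_arg_def mult.commute[of "2 * max _ _"] mult_commute_abs)
  from has_derivative_compose[OF S this]
  have "((\<lambda>x. (max 0 (?S x)) ^ 2) has_derivative (\<lambda>h. 2 * (5 - 2 * (x \<bullet> x)) * (x \<bullet> h) * (2 * bump_arg x))) (at x)" .
  then show ?thesis
    unfolding bump_def[abs_def, unfolded bump_arg_def] bump_grad_def
    by (rule has_derivative_eq_rhs) (auto simp: algebra_simps)
qed

lemma bump_arg_zero: "norm x < 1 \<or> norm x \<ge> 2 \<Longrightarrow> bump_arg x = 0"
proof -
  assume "norm x < 1 \<or> norm x \<ge> 2"
  then have "(norm x ^ 2 - 1) * (4 - norm x ^ 2) \<le> 0"
  proof
    assume "norm x < 1"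
    then have "norm x ^ 2 \<le> 1" by (simp add: power_le_one)
    then show ?thesis by (intro mult_nonpos_nonneg) auto
  next
    assume "norm x \<ge> 2"
    then have "norm x ^ 2 \<ge> 2 ^ 2" by (intro power_mono) auto
    then show ?thesis by (intro mult_nonneg_nonpos) auto
  qed
  then show ?thesis by (simp add: bump_arg_def power2_norm_eq_inner)
qed

lemma bump_continuous: "continuous_on A bump" "continuous_on A bump_grad"
  unfolding bump_def[abs_def] bump_grad_def[abs_def] bump_arg_def[abs_def]
  by (intro continuous_intros)+

text \<open>The singularity of \<open>g\<close> at the origin is invisible because \<open>c\<close>
  vanishes on the unit ball.\<close>

lemma cutoff_continuous:
  fixes c g :: "'a::euclidean_space \<Rightarrow> real"
  assumes c: "continuous_on UNIV c" "\<And>x. norm x < 1 \<Longrightarrow> c x = 0" and g: "continuous_on (- {0}) g"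
  shows "continuous_on UNIV (\<lambda>x. c x * g x)"
proof -
  have "continuous_on (ball 0 1) (\<lambda>x :: 'a. 0 :: real)" by (rule continuous_on_const)
  then have 1: "continuous_on (ball 0 1) (\<lambda>x. c x * g x)"
    by (rule continuous_on_eq) (simp add: c(2))
  have 2: "continuous_on (- {0}) (\<lambda>x. c x * g x)"
    by (intro continuous_on_mult g continuous_on_subset[OF c(1)]) auto
  have "continuous_on (ball 0 1 \<union> - {0}) (\<lambda>x. c x * g x)"
    by (intro continuous_on_open_Un 1 2) auto
  moreover have "ball 0 1 \<union> - {0} = (UNIV :: 'a set)" by auto
  ultimately show ?thesis by simp
qed

section \<open>An inner product for functions on the sphere\<close>

definition sphere_fun :: "('a::euclidean_space \<Rightarrow> real) \<Rightarrow> bool" where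
  "sphere_fun f \<longleftrightarrow> (\<forall>x. norm x \<noteq> 1 \<longrightarrow> f x = 0) \<and> continuous_on (sphere 0 1) f"

lemma sphere_fun_radial_continuous:
  assumes "sphere_fun f"
  shows "continuous_on (- {0}) (radial_extension f)"
proof -
  have "continuous_on (- {0}) (\<lambda>x. f (x /\<^sub>R norm x))"
  proof (rule continuous_on_compose2[of "sphere 0 1" f])
    show "continuous_on (- {0}) (\<lambda>x :: 'a. x /\<^sub>R norm x)"
      by (intro continuous_intros) auto
    show "(\<lambda>x :: 'a. x /\<^sub>R norm x) ` (- {0}) \<subseteq> sphere 0 1"
    proof (intro subsetI, elim imageE)
      fix x y :: 'a assume y: "y = x /\<^sub>R norm x" and "x \<in> - {0}"
      then have "norm x \<noteq> 0" by simp
      then have "inverse (norm x) * norm x = 1" by (rule left_inverse)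
      then show "y \<in> sphere 0 1" unfolding y by simp
    qed
  qed (use assms in \<open>simp add: sphere_fun_def\<close>)
  then show ?thesis unfolding radial_extension_def[abs_def] .
qed

lemma differentiable_imp_continuous_nonzero:
  fixes h :: "'a::euclidean_space \<Rightarrow> real"
  assumes "\<And>x. x \<noteq> 0 \<Longrightarrow> h differentiable at x"
  shows "continuous_on (- {0}) h"
  by (rule continuous_at_imp_continuous_on) (use assms differentiable_imp_continuous_within in blast)

lemma smooth_imp_sphere_fun:
  assumes f: "f \<in> smooth_sphere_functions"
  shows "sphere_fun f"
proof -
  have "continuous_on (- {0}) (radial_extension f)"
    by (rule differentiable_imp_continuous_nonzero[OF smooth_sphereD(1)[OF f]])
  then have "continuous_on (sphere 0 1) (radial_extension f)"
    by (rule continuous_on_subset) auto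
  then have "continuous_on (sphere 0 1) f"
    by (rule continuous_on_eq) (simp add: radial_extension_def)
  then show ?thesis
    using f by (auto simp: sphere_fun_def smooth_sphere_functions_def)
qed

lemma sphere_fun_to_sphere: "continuous_on (sphere 0 1) p \<Longrightarrow> sphere_fun (to_sphere p)"
  unfolding sphere_fun_def by (auto simp: to_sphere_def intro: continuous_on_eq)

lemma sphere_fun_add: "sphere_fun f \<Longrightarrow> sphere_fun g \<Longrightarrow> sphere_fun (\<lambda>x. f x + g x)"
  and sphere_fun_cmult: "sphere_fun f \<Longrightarrow> sphere_fun (\<lambda>x. c * f x)"
  by (auto simp: sphere_fun_def intro!: continuous_intros)

text \<open>The extensions are constant on rays and \<open>bump\<close> is radial, so in polar
  coordinates this is a positive multiple of the L2 product on the sphere. The weight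
  \<open>1 / (x \<bullet> x)\<close> is the one that the eigenvalue equation acquires off the
  sphere.\<close>

definition ip :: "('a::euclidean_space \<Rightarrow> real) \<Rightarrow> ('a \<Rightarrow> real) \<Rightarrow> real" where
  "ip f g = integral (cbox (- (3 *\<^sub>R One)) (3 *\<^sub>R One))
     (\<lambda>x. bump x * (radial_extension f x * radial_extension g x / (x \<bullet> x)))"

lemma bump_zero: "norm x < 1 \<Longrightarrow> bump x = 0" "norm x \<ge> 2 \<Longrightarrow> bump x = 0"
  "norm x < 1 \<Longrightarrow> bump_grad x = 0"
  by (simp_all add: bump_def bump_grad_def bump_arg_zero)

lemma ip_continuous:
  assumes "sphere_fun f" "sphere_fun g"
  shows "continuous_on UNIV (\<lambda>x. bump x * (radial_extension f x * radial_extension g x / (x \<bullet> x)))"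
  by (intro cutoff_continuous bump_continuous continuous_intros sphere_fun_radial_continuous assms)
     (auto simp: bump_zero)

lemma ip_integrable:
  assumes "sphere_fun f" "sphere_fun g"
  shows "(\<lambda>x. bump x * (radial_extension f x * radial_extension g x / (x \<bullet> x))) integrable_on cbox a b"
  by (rule integrable_continuous[OF continuous_on_subset[OF ip_continuous[OF assms]]]) simp

lemma ip_commute: "ip f g = ip g f"
  by (simp add: ip_def mult.commute)

lemma ip_add_right:
  assumes "sphere_fun f" "sphere_fun g" "sphere_fun h"
  shows "ip f (\<lambda>x. g x + h x) = ip f g + ip f h"
  unfolding ip_def
  by (subst integral_add[symmetric, OF ip_integrable[OF assms(1,2)] ip_integrable[OF assms(1,3)]])
     (simp add: radial_extension_def ring_distribs add_divide_distrib)

lemma ip_cmult_right: "ip f (\<lambda>x. c * g x) = c * ip f g"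
proof -
  have "bump x * (radial_extension f x * radial_extension (\<lambda>x. c * g x) x / (x \<bullet> x)) =
      c * (bump x * (radial_extension f x * radial_extension g x / (x \<bullet> x)))" for x
    by (simp add: radial_extension_def)
  then show ?thesis unfolding ip_def by (simp only: integral_mult_right)
qed

lemma ip_diff_left:
  assumes "sphere_fun f" "sphere_fun g" "sphere_fun h"
  shows "ip (\<lambda>x. f x - g x) h = ip f h - ip g h"
proof -
  have "ip h (\<lambda>x. f x + (- 1) * g x) = ip h f + (- 1) * ip h g"
    by (subst ip_add_right[OF assms(3,1) sphere_fun_cmult[OF assms(2)]]) (simp only: ip_cmult_right)
  then show ?thesis by (simp add: ip_commute[of _ h])
qed

lemma ip_self_eq_0:
  fixes f :: "'a::euclidean_space \<Rightarrow> real"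
  assumes f: "sphere_fun f" and 0: "ip f f = 0"
  shows "f = (\<lambda>x. 0)"
proof
  fix x :: 'a
  show "f x = 0"
  proof (cases "norm x = 1")
    case True
    \<comment> \<open>Radius \<open>3 / 2\<close> lies inside the annulus, where \<open>bump\<close>
      is positive; the continuous nonnegative integrand vanishes there because its integral
      does.\<close>
    define y where "y = (3 / 2) *\<^sub>R x"
    have ny: "norm y = 3 / 2" unfolding y_def using True by simp
    let ?g = "\<lambda>x. bump x * (radial_extension f x * radial_extension f x / (x \<bullet> x))"
    have yK: "y \<in> cbox (- (3 *\<^sub>R One)) (3 *\<^sub>R One)"
      unfolding mem_box
    proof
      fix i :: 'a assume i: "i \<in> Basis"
      have "\<bar>y \<bullet> i\<bar> \<le> 3" using Basis_le_norm[OF i, of y] ny by linarith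
      then show "- (3 *\<^sub>R One) \<bullet> i \<le> y \<bullet> i \<and> y \<bullet> i \<le> 3 *\<^sub>R One \<bullet> i"
        using i by (auto simp: abs_le_iff)
    qed
    have "?g y = 0"
    proof (rule has_integral_0_cbox_imp_0[of "- (3 *\<^sub>R One)" "3 *\<^sub>R One" ?g])
      show "continuous_on (cbox (- (3 *\<^sub>R One)) (3 *\<^sub>R One)) ?g"
        by (rule continuous_on_subset[OF ip_continuous[OF f f]]) simp
      show "0 \<le> ?g x" for x by (auto simp: bump_def)
      show "(?g has_integral 0) (cbox (- (3 *\<^sub>R One)) (3 *\<^sub>R One))"
        using integrable_integral[OF ip_integrable[OF f f, where a = "- (3 *\<^sub>R One)" and b = "3 *\<^sub>R One"]]
        unfolding 0[unfolded ip_def] .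
      show "box (- (3 *\<^sub>R One)) (3 *\<^sub>R One) \<noteq> ({} :: 'a set)" by (simp add: box_ne_empty)
    qed (rule yK)
    moreover have yy: "y \<bullet> y = 9 / 4"
      unfolding dot_square_norm ny by (simp add: power2_eq_square)
    moreover have "bump y \<noteq> 0"
      unfolding bump_def bump_arg_def yy by simp
    ultimately have "radial_extension f y = 0" by auto
    then show ?thesis unfolding y_def using True by (simp add: radial_extension_scale) (simp add: radial_extension_def)
  qed (use f in \<open>simp add: sphere_fun_def\<close>)
qed

lemma has_derivative_along:
  assumes "(A has_derivative A') (at x)"
  shows "((\<lambda>t. A (x + t *\<^sub>R b)) has_real_derivative A' b) (at 0)"
proof -
  have "(A has_derivative A') (at (x + 0 *\<^sub>R b))" using assms by simp
  moreover have "((\<lambda>t. x + t *\<^sub>R b) has_derivative (\<lambda>t. t *\<^sub>R b)) (at 0)"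
    by (auto intro!: derivative_eq_intros)
  ultimately have "((\<lambda>t. A (x + t *\<^sub>R b)) has_derivative (\<lambda>t. A' (t *\<^sub>R b))) (at 0)"
    by (rule has_derivative_compose[where g = A, rotated])
  moreover have "A' (t *\<^sub>R b) = A' b * t" for t
    using linear_scale[OF has_derivative_linear[OF assms], of t b] by simp
  ultimately show ?thesis by (simp add: has_field_derivative_def)
qed

text \<open>Green's identity for the vector field \<open>bump x * V b x\<close>. Its divergence
  integrates to 0. The gradient of \<open>bump\<close> is radial and drops out, as \<open>V\<close>
  has no radial component; the rest is \<open>\<mu> - \<nu>\<close> times the integrand of
  \<open>ip f g\<close>.\<close>

lemma eigenfunctions_orthogonal:
  fixes f g :: "'a::euclidean_space \<Rightarrow> real"
  assumes f: "f \<in> smooth_sphere_functions" "sphere_laplacian f = (\<lambda>x. \<mu> * f x)"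
    and g: "g \<in> smooth_sphere_functions" "sphere_laplacian g = (\<lambda>x. \<nu> * g x)" and ne: "\<mu> \<noteq> \<nu>"
  shows "ip f g = 0"
proof -
  let ?K = "cbox (- (3 *\<^sub>R One)) (3 *\<^sub>R One) :: 'a set"
  define F where "F = radial_extension f"
  define G where "G = radial_extension g"
  note sf = smooth_sphereD[OF f(1), folded F_def] and sg = smooth_sphereD[OF g(1), folded G_def]
  define V where "V b x = F x * pd b G x - G x * pd b F x" for b x
  define A where "A b x = bump x * V b x" for b x
  define W where "W b x = F x * pd b (pd b G) x - G x * pd b (pd b F) x" for b x
  define D where "D b x = bump_grad x * ((x \<bullet> b) * V b x) + bump x * W b x" for b x
  note cont = differentiable_imp_continuous_nonzero
  note cf = cont[OF sf(1)] cont[OF sf(2)] cont[OF sf(3)] and cg = cont[OF sg(1)] cont[OF sg(2)] cont[OF sg(3)]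
  have contV: "continuous_on (- {0}) (V b)" and contW: "continuous_on (- {0}) (W b)" if "b \<in> Basis" for b
    unfolding V_def[abs_def] W_def[abs_def] using that by (auto intro!: continuous_intros cf cg)
  have contA: "continuous_on UNIV (A b)" if "b \<in> Basis" for b
    unfolding A_def[abs_def] by (intro cutoff_continuous bump_continuous contV that) (auto simp: bump_zero)
  have contD: "continuous_on UNIV (D b)" if "b \<in> Basis" for b
    unfolding D_def[abs_def]
    by (intro continuous_on_add cutoff_continuous bump_continuous contV contW that continuous_intros) (auto simp: bump_zero)
  have AD: "((\<lambda>t. A b (x + t *\<^sub>R b)) has_real_derivative D b x) (at 0)" if b: "b \<in> Basis" for b x
  proof (cases "x = 0")
    case True
    have "(A b has_derivative (\<lambda>h. 0)) (at x)"
    proof (rule has_derivative_transform_within_open[of "\<lambda>_. 0" _ _ _ "ball 0 1"])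
      show "0 = A b y" if "y \<in> ball 0 1" for y using that by (simp add: A_def bump_zero)
    qed (use True in auto)
    moreover have "D b x = 0" using True by (simp add: D_def bump_zero)
    ultimately show ?thesis using has_derivative_along by fastforce
  next
    case False
    note dd = pd_differentiable[OF sf(1)[OF False]] pd_differentiable[OF sf(2)[OF False b]]
      pd_differentiable[OF sg(1)[OF False]] pd_differentiable[OF sg(2)[OF False b]]
    have "(A b has_derivative (\<lambda>h. bump x * ((F x * (\<Sum>c\<in>Basis. (h \<bullet> c) * pd c (pd b G) x) +
        (\<Sum>c\<in>Basis. (h \<bullet> c) * pd c F x) * pd b G x) - (G x * (\<Sum>c\<in>Basis. (h \<bullet> c) * pd c (pd b F) x) +
        (\<Sum>c\<in>Basis. (h \<bullet> c) * pd c G x) * pd b F x)) + bump_grad x * (x \<bullet> h) * V b x)) (at x)"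
      unfolding A_def[abs_def] V_def[abs_def]
      by (intro has_derivative_mult has_derivative_diff dd bump_has_derivative)
    from has_derivative_along[OF this, of b] show ?thesis
      by (simp only: sum_Basis_inner[OF b]) (simp add: D_def W_def algebra_simps)
  qed
  have "integral ?K (D b) = 0" if b: "b \<in> Basis" for b
    by (rule integral_directional_derivative[OF AD[OF b] contA[OF b] contD[OF b]])
       (use b in \<open>auto simp: A_def bump_zero\<close>)
  then have "(\<Sum>b\<in>Basis. integral ?K (D b)) = 0" by simp
  moreover have "integral ?K (\<lambda>x. \<Sum>b\<in>Basis. D b x) = (\<Sum>b\<in>Basis. integral ?K (D b))"
    by (intro integral_sum integrable_continuous continuous_on_subset[OF contD]) auto
  moreover have "(\<Sum>b\<in>Basis. D b x) = (\<mu> - \<nu>) * (bump x * (F x * G x / (x \<bullet> x)))" for x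
  proof (cases "x = 0")
    case True
    then show ?thesis by (simp add: D_def bump_zero)
  next
    case False
    have e: "(\<Sum>b\<in>Basis. (x \<bullet> b) * V b x) = 0"
    proof -
      have "(\<Sum>b\<in>Basis. (x \<bullet> b) * V b x) =
          F x * (\<Sum>b\<in>Basis. (x \<bullet> b) * pd b G x) - G x * (\<Sum>b\<in>Basis. (x \<bullet> b) * pd b F x)"
        unfolding V_def by (simp add: sum_subtractf sum_distrib_left algebra_simps)
      then show ?thesis
        using radial_extension_euler[OF f(1) False] radial_extension_euler[OF g(1) False]
        unfolding F_def G_def by simp
    qed
    have w: "(\<Sum>b\<in>Basis. W b x) = F x * lap G x - G x * lap F x"
      unfolding W_def lap_def by (simp add: sum_subtractf sum_distrib_left)
    have xx: "x \<bullet> x \<noteq> 0" using False by simp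
    have lF: "lap F x = - \<mu> * F x / (x \<bullet> x)" "lap G x = - \<nu> * G x / (x \<bullet> x)"
      using lap_radial_extension[OF f False] lap_radial_extension[OF g False] xx
      unfolding F_def G_def by (simp_all add: field_simps)
    have "(\<Sum>b\<in>Basis. D b x) = bump_grad x * (\<Sum>b\<in>Basis. (x \<bullet> b) * V b x) + bump x * (\<Sum>b\<in>Basis. W b x)"
      unfolding D_def by (simp add: sum.distrib sum_distrib_left)
    also have "\<dots> = (\<mu> - \<nu>) * (bump x * (F x * G x / (x \<bullet> x)))"
      unfolding e w lF by (simp add: algebra_simps diff_divide_distrib)
    finally show ?thesis .
  qed
  ultimately have "integral ?K (\<lambda>x. (\<mu> - \<nu>) * (bump x * (F x * G x / (x \<bullet> x)))) = 0" by simp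
  then have "(\<mu> - \<nu>) * ip f g = 0"
    unfolding ip_def F_def G_def by (simp only: integral_mult_right)
  then show ?thesis using ne by simp
qed

lemma sphere_fun_harmonic: "hpoly k h \<Longrightarrow> sphere_fun (to_sphere h)"
  by (rule smooth_imp_sphere_fun[OF to_sphere_smooth])

text \<open>Orthogonality extends to all polynomials by \<open>sphere_polynomial_induct\<close>. For
  a uniform approximation \<open>p\<close> of \<open>f\<close> with error \<open>e\<close>,
  \<open>ip f f\<close> equals the product of \<open>f\<close> with \<open>f - p\<close> and is at
  most \<open>e * M\<close>, with \<open>M\<close> independent of \<open>e\<close>.\<close>

lemma orthogonal_to_harmonics_imp_0:
  fixes f :: "'a::euclidean_space \<Rightarrow> real"
  assumes f: "sphere_fun f" and orth: "\<And>k h. harmonic k h \<Longrightarrow> ip f (to_sphere h) = 0"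
  shows "f = (\<lambda>x. 0)"
proof (rule ip_self_eq_0[OF f])
  let ?K = "cbox (- (3 *\<^sub>R One)) (3 *\<^sub>R One) :: 'a set"
  have poly: "continuous_on (sphere 0 1) p \<and> ip f (to_sphere p) = 0" if "real_polynomial_function p" for p
    using that
  proof (rule sphere_polynomial_induct)
    fix p q assume p: "continuous_on (sphere 0 1) p \<and> ip f (to_sphere p) = 0"
      and q: "continuous_on (sphere 0 1) q \<and> ip f (to_sphere q) = 0"
    have "to_sphere (\<lambda>x. p x + q x) = (\<lambda>x. to_sphere p x + to_sphere q x)"
      by (auto simp: to_sphere_def)
    then show "continuous_on (sphere 0 1) (\<lambda>x. p x + q x) \<and> ip f (to_sphere (\<lambda>x. p x + q x)) = 0"
      using p q ip_add_right[OF f sphere_fun_to_sphere sphere_fun_to_sphere, of p q]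
      by (auto intro: continuous_on_add)
  next
    fix p q :: "'a \<Rightarrow> real" assume eq: "\<And>x. norm x = 1 \<Longrightarrow> p x = q x"
      and p: "continuous_on (sphere 0 1) p \<and> ip f (to_sphere p) = 0"
    have "to_sphere q = to_sphere p" using eq by (auto simp: to_sphere_def)
    moreover have "continuous_on (sphere 0 1) q"
      using p eq by (auto intro: continuous_on_eq)
    ultimately show "continuous_on (sphere 0 1) q \<and> ip f (to_sphere q) = 0" using p by simp
  next
    fix k h assume h: "harmonic k (h :: 'a \<Rightarrow> real)"
    then have "hpoly k h" by (simp add: harmonic_def)
    from has_derivative_continuous_on[of "sphere 0 1" h, OF has_derivative_at_withinI[OF hpoly_has_derivative[OF this]]]
    show "continuous_on (sphere 0 1) h \<and> ip f (to_sphere h) = 0" using orth[OF h] by simp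
  qed
  define M where "M = integral ?K (\<lambda>x. bump x * (\<bar>radial_extension f x\<bar> / (x \<bullet> x)))"
  have contM: "continuous_on UNIV (\<lambda>x. bump x * (\<bar>radial_extension f x\<bar> / (x \<bullet> x)))"
    by (intro cutoff_continuous bump_continuous continuous_intros sphere_fun_radial_continuous f)
       (auto simp: bump_zero)
  have le: "\<bar>ip f f\<bar> \<le> e * M" if e: "e > 0" for e
  proof -
    have "continuous_on (sphere 0 1) f" using f by (simp add: sphere_fun_def)
    then obtain p where p: "polynomial_function p" "\<And>x. x \<in> sphere 0 1 \<Longrightarrow> norm (f x - p x) < e"
      using Stone_Weierstrass_polynomial_function[of "sphere 0 1" f e] e by auto
    have rp: "real_polynomial_function p" using p(1) by (simp add: real_polynomial_function_eq)
    note pp = poly[OF rp]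
    have sp: "sphere_fun (to_sphere p)" using pp by (intro sphere_fun_to_sphere) simp
    have sd: "sphere_fun (\<lambda>x. f x + (- 1) * to_sphere p x)"
      by (intro sphere_fun_add f sphere_fun_cmult sp)
    have "ip f (\<lambda>x. f x + (- 1) * to_sphere p x) = ip f f + (- 1) * ip f (to_sphere p)"
      by (subst ip_add_right[OF f f sphere_fun_cmult[OF sp]]) (simp only: ip_cmult_right)
    then have "ip f f = ip f (\<lambda>x. f x + (- 1) * to_sphere p x)" using pp by simp
    then have "\<bar>ip f f\<bar> = norm (ip f (\<lambda>x. f x + (- 1) * to_sphere p x))" by simp
    also have "\<dots> \<le> integral ?K (\<lambda>x. e * (bump x * (\<bar>radial_extension f x\<bar> / (x \<bullet> x))))"
      unfolding ip_def
    proof (rule integral_norm_bound_integral[OF ip_integrable[OF f sd]])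
      show "(\<lambda>x. e * (bump x * (\<bar>radial_extension f x\<bar> / (x \<bullet> x)))) integrable_on ?K"
        by (intro integrable_continuous continuous_on_mult continuous_on_const continuous_on_subset[OF contM]) simp
      fix x :: 'a
      show "norm (bump x * (radial_extension f x * radial_extension (\<lambda>x. f x + (- 1) * to_sphere p x) x / (x \<bullet> x)))
          \<le> e * (bump x * (\<bar>radial_extension f x\<bar> / (x \<bullet> x)))"
      proof (cases "x = 0")
        case True
        then show ?thesis by (simp add: bump_zero)
      next
        case False
        have n: "norm (x /\<^sub>R norm x) = 1" using False by simp
        have "\<bar>radial_extension (\<lambda>x. f x + (- 1) * to_sphere p x) x\<bar> \<le> e"
          using p(2)[of "x /\<^sub>R norm x"] n by (simp add: radial_extension_def to_sphere_def)
        moreover have "bump x \<ge> 0" by (simp add: bump_def)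
        ultimately have "(bump x * (\<bar>radial_extension f x\<bar> / (x \<bullet> x))) * \<bar>radial_extension (\<lambda>x. f x + (- 1) * to_sphere p x) x\<bar>
            \<le> (bump x * (\<bar>radial_extension f x\<bar> / (x \<bullet> x))) * e"
          by (intro mult_left_mono) auto
        then show ?thesis
          using \<open>bump x \<ge> 0\<close> by (simp add: abs_mult mult_ac)
      qed
    qed
    also have "\<dots> = e * M" unfolding M_def by (rule integral_mult_right)
    finally show ?thesis .
  qed
  show "ip f f = 0"
  proof (rule ccontr)
    assume "ip f f \<noteq> 0"
    then have pos: "\<bar>ip f f\<bar> > 0" by simp
    have "\<bar>ip f f\<bar> \<le> 1 * M" by (rule le) simp
    then have M: "M > 0" using pos by linarith
    have "\<bar>ip f f\<bar> \<le> \<bar>ip f f\<bar> / (2 * M) * M" by (rule le) (use pos M in simp)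
    then show False using pos M by simp
  qed
qed

lemma ip_span_eq_0:
  assumes g: "sphere_fun g" and B: "\<And>b. b \<in> B \<Longrightarrow> sphere_fun b" "\<And>b. b \<in> B \<Longrightarrow> ip g b = 0"
    and v: "v \<in> fs.span B"
  shows "sphere_fun v \<and> ip g v = 0"
  using v
proof (induction rule: fs.span_induct_alt)
  case base
  have "sphere_fun (\<lambda>x. 0)" by (simp add: sphere_fun_def)
  then show ?case using ip_cmult_right[of g 0 "\<lambda>x. 0"] by (simp add: zero_fun_def)
next
  case (step c p q)
  then have p: "sphere_fun p" "ip g p = 0" using B by auto
  have "sphere_fun (\<lambda>x. c * p x + q x)" using step p by (intro sphere_fun_add sphere_fun_cmult) auto
  moreover have "ip g (\<lambda>x. c * p x + q x) = 0"
    using step p ip_add_right[OF g sphere_fun_cmult[OF p(1), of c], of q]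
    by (simp add: ip_cmult_right)
  ultimately show ?case by (simp add: plus_fun_def)
qed

section \<open>Determination of all smooth eigenfunctions\<close>

text \<open>A Gram-Schmidt step: the induction hypothesis is applied both to \<open>f\<close> and to
  the new vector \<open>b\<close>, whose residue \<open>b'\<close> supplies the direction still
  missing.\<close>

lemma orthogonal_projection:
  fixes f :: "'a::euclidean_space \<Rightarrow> real"
  assumes "finite B" "\<And>b. b \<in> B \<Longrightarrow> sphere_fun b" "sphere_fun f"
  shows "\<exists>w\<in>fs.span B. sphere_fun w \<and> (\<forall>b\<in>B. ip (\<lambda>x. f x - w x) b = 0)"
  using assms
proof (induction B arbitrary: f rule: finite_induct)
  case empty
  have "sphere_fun (\<lambda>x :: 'a. 0 :: real)" by (simp add: sphere_fun_def)
  then show ?case by (intro bexI[of _ "\<lambda>x. 0"]) (auto simp: zero_fun_def)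
next
  case (insert b B)
  have sb: "sphere_fun b" using insert.prems by simp
  obtain w where w: "w \<in> fs.span B" "sphere_fun w" "\<forall>c\<in>B. ip (\<lambda>x. f x - w x) c = 0"
    using insert.IH[of f] insert.prems by auto
  obtain u where u: "u \<in> fs.span B" "sphere_fun u" "\<forall>c\<in>B. ip (\<lambda>x. b x - u x) c = 0"
    using insert.IH[of b] insert.prems by auto
  have sdiff: "sphere_fun (\<lambda>x. p x - q x)" if "sphere_fun p" "sphere_fun q" for p q :: "'a \<Rightarrow> real"
    using sphere_fun_add[OF that(1) sphere_fun_cmult[OF that(2), of "-1"]] by simp
  define b' where "b' = (\<lambda>x. b x - u x)"
  have sb': "sphere_fun b'" unfolding b'_def by (rule sdiff[OF sb u(2)])
  have span_B: "ip (\<lambda>x. f x - w x) v = 0" if "v \<in> fs.span B" for v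
    using ip_span_eq_0[OF sdiff[OF insert.prems(2) w(2)] _ _ that] insert.prems(1) w(3) by simp
  \<comment> \<open>If \<open>ip b' b' = 0\<close>, then \<open>b'\<close> is zero by definiteness
    and the coefficient 0 is a valid choice.\<close>
  define a where "a = (if ip b' b' = 0 then 0 else ip (\<lambda>x. f x - w x) b' / ip b' b')"
  define v where "v = (\<lambda>x. w x + a * b' x)"
  have sv: "sphere_fun v" unfolding v_def by (intro sphere_fun_add sphere_fun_cmult w sb')
  have eq: "ip (\<lambda>x. f x - v x) c = ip (\<lambda>x. f x - w x) c - a * ip b' c" if "sphere_fun c" for c
  proof -
    have "(\<lambda>x. f x - v x) = (\<lambda>x. (f x - w x) - a * b' x)" unfolding v_def by auto
    then have "ip (\<lambda>x. f x - v x) c = ip (\<lambda>x. f x - w x) c - ip (\<lambda>x. a * b' x) c"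
      using ip_diff_left[OF sdiff[OF insert.prems(2) w(2)] sphere_fun_cmult[OF sb'] that, of a] by simp
    then show ?thesis using ip_cmult_right[of c a b'] by (simp add: ip_commute[of _ c])
  qed
  have vb': "ip (\<lambda>x. f x - v x) b' = 0"
  proof (cases "ip b' b' = 0")
    case True
    then have "b' = (\<lambda>x. 0)" by (rule ip_self_eq_0[OF sb'])
    then show ?thesis using ip_cmult_right[of "\<lambda>x. f x - v x" 0 "\<lambda>x. 0"] by simp
  next
    case False
    then show ?thesis unfolding eq[OF sb'] a_def by simp
  qed
  have vB: "ip (\<lambda>x. f x - v x) c = 0" if "c \<in> B" for c
    using eq[of c] insert.prems(1) that w(3) u(3) unfolding b'_def by simp
  have vspan: "ip (\<lambda>x. f x - v x) u = 0"
  proof -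
    have "ip b' u = 0"
      using ip_span_eq_0[OF sb' _ _ u(1)] insert.prems(1) u(3) unfolding b'_def by simp
    then show ?thesis using eq[OF u(2)] span_B[OF u(1)] by simp
  qed
  have vb: "ip (\<lambda>x. f x - v x) b = 0"
  proof -
    have "b = (\<lambda>x. b' x + u x)" unfolding b'_def by simp
    then have "ip (\<lambda>x. f x - v x) b = ip (\<lambda>x. f x - v x) b' + ip (\<lambda>x. f x - v x) u"
      using ip_add_right[OF sdiff[OF insert.prems(2) sv] sb' u(2)] by metis
    then show ?thesis using vb' vspan by simp
  qed
  have "v \<in> fs.span (insert b B)"
  proof -
    have sub: "fs.span B \<subseteq> fs.span (insert b B)" by (rule fs.span_mono) auto
    have "b - u \<in> fs.span (insert b B)"
      using u(1) sub by (intro fs.span_diff) (auto intro: fs.span_base)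
    then have "b' \<in> fs.span (insert b B)" by (simp add: b'_def fun_diff_def)
    from fs.span_add[OF subsetD[OF sub w(1)] fs.span_scale[OF this, of a]]
    show ?thesis unfolding v_def plus_fun_def .
  qed
  then show ?case using sv vb vB by (intro bexI[of _ v]) auto
qed

lemma sphere_eigenvalue_inj:
  assumes "DIM('a::euclidean_space) \<ge> 2" "sphere_eigenvalue TYPE('a) j = sphere_eigenvalue TYPE('a) k"
  shows "j = k"
proof (rule ccontr)
  have lt: "sphere_eigenvalue TYPE('a) j < sphere_eigenvalue TYPE('a) k" if "j < k" for j k
  proof -
    have "real j * (real j + real DIM('a) - 2) \<le> real j * (real k + real DIM('a) - 2)"
      using that by (intro mult_left_mono) auto
    also have "\<dots> < real k * (real k + real DIM('a) - 2)"
      using that assms(1) by (intro mult_strict_right_mono) auto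
    finally show ?thesis unfolding sphere_eigenvalue_def .
  qed
  assume "j \<noteq> k"
  then show False using lt[of j k] lt[of k j] assms(2) by (cases "j < k") auto
qed

text \<open>An eigenfunction is orthogonal to the harmonics of every other eigenvalue, so
  \<open>\<mu>\<close> must be one of theirs, as otherwise \<open>f\<close> would be zero.
  Subtracting the projection to that finite-dimensional space leaves a function orthogonal to all
  harmonics.\<close>

lemma sphere_eigenspace_subset:
  fixes f :: "'a::euclidean_space \<Rightarrow> real"
  assumes dim: "DIM('a) \<ge> 2" and f: "f \<in> eigenspace smooth_sphere_functions sphere_laplacian \<mu>"
    and f0: "f \<noteq> (\<lambda>x. 0)"
  obtains k p where "\<mu> = sphere_eigenvalue TYPE('a) k" "harmonic k p" "f = to_sphere p"
proof -
  have fs: "f \<in> smooth_sphere_functions" "sphere_laplacian f = (\<lambda>x. \<mu> * f x)"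
    using f by (auto simp: eigenspace_def)
  note sf = smooth_imp_sphere_fun[OF fs(1)]
  have orth: "ip f (to_sphere h) = 0" if "harmonic j h" "\<mu> \<noteq> sphere_eigenvalue TYPE('a) j" for j h
    using eigenfunctions_orthogonal[OF fs to_sphere_smooth sphere_laplacian_harmonic[OF that(1)] that(2)] that(1)
    by (auto simp: harmonic_def)
  obtain k where k: "\<mu> = sphere_eigenvalue TYPE('a) k"
    using orthogonal_to_harmonics_imp_0[OF sf] orth f0 by blast
  obtain B where B: "finite B" "fs.span B = {p :: 'a \<Rightarrow> real. harmonic k p}"
    by (rule harmonic_basis[where 'a = 'a, of k])
  have lin: "Vector_Spaces.linear (\<lambda>(c::real) (f :: 'a \<Rightarrow> real) x. c * f x) (\<lambda>c (f :: 'a \<Rightarrow> real) x. c * f x) to_sphere"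
    by (rule Vector_Spaces.linear_iff[THEN iffD2])
       (auto simp: to_sphere_def plus_fun_def intro: vector_space_fun_scale)
  interpret L: Vector_Spaces.linear "\<lambda>(c::real) (f :: 'a \<Rightarrow> real) x. c * f x" "\<lambda>c (f :: 'a \<Rightarrow> real) x. c * f x" to_sphere
    by (rule lin)
  have spanL: "fs.span (to_sphere ` B) = to_sphere ` {p. harmonic k p}"
    unfolding L.span_image B(2) ..
  have sB: "sphere_fun b" if bB: "b \<in> to_sphere ` B" for b
  proof -
    obtain p where p: "p \<in> B" "b = to_sphere p" using bB by auto
    have "p \<in> fs.span B" using p(1) by (rule fs.span_base)
    then have "hpoly k p" unfolding B(2) harmonic_def by simp
    then show ?thesis unfolding p(2) by (rule sphere_fun_harmonic)
  qed
  obtain w where w: "w \<in> fs.span (to_sphere ` B)" "sphere_fun w" "\<forall>b\<in>to_sphere ` B. ip (\<lambda>x. f x - w x) b = 0"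
    using orthogonal_projection[OF finite_imageI[OF B(1)] sB sf] by blast
  obtain p where p: "harmonic k p" "w = to_sphere p" using w(1) unfolding spanL by blast
  have sd: "sphere_fun (\<lambda>x. f x - w x)"
    using sphere_fun_add[OF sf sphere_fun_cmult[OF w(2), of "-1"]] by simp
  have "(\<lambda>x. f x - w x) = (\<lambda>x. 0)"
  proof (rule orthogonal_to_harmonics_imp_0[OF sd])
    fix j h assume h: "harmonic j (h :: 'a \<Rightarrow> real)"
    show "ip (\<lambda>x. f x - w x) (to_sphere h) = 0"
    proof (cases "j = k")
      case True
      have "to_sphere h \<in> fs.span (to_sphere ` B)" unfolding spanL using h True by blast
      then show ?thesis using ip_span_eq_0[OF sd sB] w(3) by blast
    next
      case False
      then have ne: "\<mu> \<noteq> sphere_eigenvalue TYPE('a) j"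
        using sphere_eigenvalue_inj[where 'a = 'a, OF dim, of k j] k by auto
      have "ip (to_sphere p) (to_sphere h) = 0"
        using p(1) h ne k
        by (intro eigenfunctions_orthogonal[OF _ sphere_laplacian_harmonic[OF p(1)] _ sphere_laplacian_harmonic[OF h]] to_sphere_smooth)
           (auto simp: harmonic_def)
      moreover have "ip f (to_sphere h) = 0" by (rule orth[OF h ne])
      moreover have "sphere_fun (to_sphere h)" using h by (auto simp: harmonic_def intro: sphere_fun_harmonic)
      ultimately show ?thesis using ip_diff_left[OF sf w(2)] unfolding p(2) by simp
    qed
  qed
  then have "f = to_sphere p" unfolding p(2) by (auto simp: fun_eq_iff)
  then show ?thesis using that k p(1) by blast
qed

lemma to_sphere_inj:
  fixes p q :: "'a::euclidean_space \<Rightarrow> real"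
  assumes p: "hpoly k p" and q: "hpoly k q" and eq: "to_sphere p = to_sphere q"
  shows "p = q"
proof
  have sph: "p x = q x" if "norm x = 1" for x
    using fun_cong[OF eq, of x] that by (simp add: to_sphere_def)
  fix x :: 'a
  obtain e :: 'a where e: "norm e = 1"
    using nonempty_Basis norm_Basis by blast
  define y where "y = (if x = 0 then e else x /\<^sub>R norm x)"
  have y: "norm y = 1" "x = norm x *\<^sub>R y" using e unfolding y_def by auto
  have "p (norm x *\<^sub>R y) = q (norm x *\<^sub>R y)"
    unfolding hpoly_homogeneous[OF p] hpoly_homogeneous[OF q] sph[OF y(1)] ..
  then show "p x = q x" using y(2) by metis
qed

section \<open>Multiplicities and reduction to sums over the degree\<close>

text \<open>A sum of two binomial coefficients avoids truncated subtraction. The degree 0 is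
  separate because for \<open>n = 1\<close> the formula would give 2.\<close>

definition sphere_mult :: "nat \<Rightarrow> nat \<Rightarrow> nat" where
  "sphere_mult n k = (if k = 0 then 1 else (n + k - 1 choose (n - 1)) + (n + k - 2 choose (n - 1)))"

lemma sphere_mult_eq:
  assumes n: "n \<ge> 1"
  shows "(k + n choose k) - (if k < 2 then 0 else (k - 2 + n choose (k - 2))) = sphere_mult n k"
proof -
  obtain m where m: "n = Suc m" using n by (cases n) auto
  show ?thesis
  proof (cases k)
    case 0
    then show ?thesis by (simp add: sphere_mult_def)
  next
    case (Suc j)
    have 1: "(k + n choose k) = (k + n choose n)"
      using binomial_symmetric[of k "k + n"] by simp
    have 2: "(if k < 2 then 0 else (k - 2 + n choose (k - 2))) = (n + k - 2 choose n)"
    proof (cases "k < 2")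
      case True
      then have "n + k - 2 < n" using Suc m by simp
      then show ?thesis using True by simp
    next
      case False
      then have e: "k - 2 + n = n + k - 2" "n + k - 2 - n = k - 2" by auto
      have "(n + k - 2 choose n) = (n + k - 2 choose (n + k - 2 - n))"
        by (rule binomial_symmetric) (use False in simp)
      then show ?thesis using False unfolding e by simp
    qed
    have 3: "(k + n choose n) = (n + k - 1 choose (n - 1)) + ((n + k - 2 choose (n - 1)) + (n + k - 2 choose n))"
      unfolding Suc m by (simp add: add.commute)
    show ?thesis unfolding 1 2 3 using Suc by (simp add: sphere_mult_def)
  qed
qed

lemma sphere_mult_pos: "n \<ge> 1 \<Longrightarrow> sphere_mult n k > 0"
  by (auto simp: sphere_mult_def)

lemma sphere_eigenspace:
  fixes n :: nat
  assumes n: "n \<ge> 1" and dim: "DIM('a::euclidean_space) = n + 1"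
  shows "eigenvalues (smooth_sphere_functions :: ('a \<Rightarrow> real) set) sphere_laplacian = range (sphere_eigenvalue TYPE('a))"
    and "eigen_mult (smooth_sphere_functions :: ('a \<Rightarrow> real) set) sphere_laplacian (sphere_eigenvalue TYPE('a) k) = sphere_mult n k"
proof -
  let ?E = "\<lambda>k. eigenspace (smooth_sphere_functions :: ('a \<Rightarrow> real) set) sphere_laplacian (sphere_eigenvalue TYPE('a) k)"
  have d2: "DIM('a) \<ge> 2" using n dim by simp
  have sub: "to_sphere ` {p :: 'a \<Rightarrow> real. harmonic k p} \<subseteq> ?E k" for k
    using to_sphere_smooth sphere_laplacian_harmonic by (auto simp: eigenspace_def harmonic_def)
  have z: "harmonic k (\<lambda>x :: 'a. 0)" for k
    using fs.subspace_0[OF harmonic_subspace[of k]] by (simp add: zero_fun_def)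
  have E: "?E k = to_sphere ` {p. harmonic k p}" for k
  proof (rule equalityI[OF _ sub], rule subsetI)
    fix f assume f: "f \<in> ?E k"
    show "f \<in> to_sphere ` {p. harmonic k p}"
    proof (cases "f = (\<lambda>x. 0)")
      case True
      then have "f = to_sphere (\<lambda>x. 0)" by (simp add: to_sphere_def)
      then show ?thesis using z by blast
    next
      case False
      obtain j p where j: "sphere_eigenvalue TYPE('a) k = sphere_eigenvalue TYPE('a) j" "harmonic j p" "f = to_sphere p"
        by (rule sphere_eigenspace_subset[OF d2 f False])
      then show ?thesis using sphere_eigenvalue_inj[where 'a = 'a, OF d2 j(1)] by blast
    qed
  qed
  have lin: "Vector_Spaces.linear (\<lambda>(c::real) (f :: 'a \<Rightarrow> real) x. c * f x) (\<lambda>c (f :: 'a \<Rightarrow> real) x. c * f x) to_sphere"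
    by (rule Vector_Spaces.linear_iff[THEN iffD2])
       (auto simp: to_sphere_def plus_fun_def intro: vector_space_fun_scale)
  have dimE: "fs.dim (?E k) = sphere_mult n k" for k
  proof -
    obtain B where B: "finite B" "fs.independent B" "fs.span B = {p :: 'a \<Rightarrow> real. harmonic k p}"
      "card B = (k + DIM('a) - 1 choose k) - (if k < 2 then 0 else (k - 2 + DIM('a) - 1 choose (k - 2)))"
      by (rule harmonic_basis[where 'a = 'a, of k])
    have inj: "inj_on to_sphere (fs.span B)"
      unfolding B(3) by (rule inj_onI) (auto simp: harmonic_def intro: to_sphere_inj)
    have "fs.dim (?E k) = card B"
      unfolding E B(3)[symmetric] by (rule dim_image_inj(2)[OF lin B(2) inj])
    moreover have "k + (n + 1) - 1 = k + n" "k - 2 + (n + 1) - 1 = k - 2 + n" by simp_all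
    ultimately show ?thesis unfolding B(4) dim by (simp only: sphere_mult_eq[OF n])
  qed
  show "eigen_mult (smooth_sphere_functions :: ('a \<Rightarrow> real) set) sphere_laplacian (sphere_eigenvalue TYPE('a) k) = sphere_mult n k"
    unfolding eigen_mult_def by (rule dimE)
  show "eigenvalues (smooth_sphere_functions :: ('a \<Rightarrow> real) set) sphere_laplacian = range (sphere_eigenvalue TYPE('a))"
  proof (intro equalityI subsetI)
    fix \<mu> assume "\<mu> \<in> eigenvalues (smooth_sphere_functions :: ('a \<Rightarrow> real) set) sphere_laplacian"
    then obtain f :: "'a \<Rightarrow> real" where f: "f \<in> eigenspace smooth_sphere_functions sphere_laplacian \<mu>" "f \<noteq> (\<lambda>x. 0)"
      unfolding eigenvalues_def by blast
    show "\<mu> \<in> range (sphere_eigenvalue TYPE('a))"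
      by (rule sphere_eigenspace_subset[OF d2 f]) blast
  next
    fix \<mu> assume "\<mu> \<in> range (sphere_eigenvalue TYPE('a))"
    then obtain k where k: "\<mu> = sphere_eigenvalue TYPE('a) k" by blast
    have "\<exists>f\<in>?E k. f \<noteq> (\<lambda>x. 0)"
    proof (rule ccontr)
      assume "\<not> (\<exists>f\<in>?E k. f \<noteq> (\<lambda>x. 0))"
      then have "?E k \<subseteq> fs.span {}" by (auto simp: zero_fun_def)
      then have "fs.dim (?E k) \<le> card ({} :: ('a \<Rightarrow> real) set)" by (rule fs.dim_le_card) simp
      then show False using dimE[of k] sphere_mult_pos[OF n, of k] by simp
    qed
    then show "\<mu> \<in> eigenvalues (smooth_sphere_functions :: ('a \<Rightarrow> real) set) sphere_laplacian"
      unfolding eigenvalues_def k by blast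
  qed
qed

lemma conformal_eigenspace:
  "eigenspace (smooth_sphere_functions :: ('a::euclidean_space \<Rightarrow> real) set) (conformal_laplacian n) \<mu> =
    eigenspace smooth_sphere_functions sphere_laplacian (\<mu> - real n * (real n - 2) / 4)"
  unfolding eigenspace_def conformal_laplacian_def by (auto simp: fun_eq_iff algebra_simps)

lemma conformal_eigenvalues:
  fixes n :: nat
  assumes n: "n \<ge> 1" and dim: "DIM('a::euclidean_space) = n + 1"
  shows "eigenvalues (smooth_sphere_functions :: ('a \<Rightarrow> real) set) (conformal_laplacian n) =
      range (\<lambda>k. sphere_eigenvalue TYPE('a) k + real n * (real n - 2) / 4)"
    and "eigen_mult (smooth_sphere_functions :: ('a \<Rightarrow> real) set) (conformal_laplacian n)
      (sphere_eigenvalue TYPE('a) k + real n * (real n - 2) / 4) = sphere_mult n k"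
proof -
  let ?V = "smooth_sphere_functions :: ('a \<Rightarrow> real) set"
  let ?c = "real n * (real n - 2) / 4"
  have "\<mu> \<in> eigenvalues ?V (conformal_laplacian n) \<longleftrightarrow> \<mu> - ?c \<in> eigenvalues ?V sphere_laplacian" for \<mu>
    unfolding eigenvalues_def conformal_eigenspace by simp
  then show "eigenvalues ?V (conformal_laplacian n) = range (\<lambda>k. sphere_eigenvalue TYPE('a) k + ?c)"
    unfolding sphere_eigenspace(1)[OF n dim] by (auto simp: image_iff algebra_simps)
  show "eigen_mult ?V (conformal_laplacian n) (sphere_eigenvalue TYPE('a) k + ?c) = sphere_mult n k"
    using sphere_eigenspace(2)[OF n dim, of k] unfolding eigen_mult_def conformal_eigenspace by simp
qed

text \<open>Injectivity of \<open>ev\<close> allows the sum over the set of eigenvalues to be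
  reindexed by the degree \<open>k\<close>.\<close>

lemma zeta_det_eq:
  assumes ev: "eigenvalues V A = range ev" and inj: "inj ev" and mult: "\<And>k. eigen_mult V A (ev k) = m k"
    and D: "zeta_reg (\<lambda>k w. of_nat (m k) * of_real (ev k) powr (- w)) {k. ev k > 0} D"
  shows "zeta_det V A = exp (- D)"
proof -
  have bij: "bij_betw ev {k. ev k > 0} (eigenvalues V A \<inter> {0<..})"
    unfolding ev bij_betw_def using inj by (auto intro: inj_on_subset)
  have "zeta_reg (\<lambda>\<mu> w. of_nat (eigen_mult V A \<mu>) * of_real \<mu> powr (- w)) (eigenvalues V A \<inter> {0<..}) D"
    by (rule zeta_reg_reindex[OF bij, THEN iffD1]) (simp add: mult D)
  then show ?thesis
    unfolding zeta_det_def spectral_zeta_def by (simp only: zeta_reg_continued_sum)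
qed

lemma zeta_det_laplacian:
  fixes n :: nat
  assumes n: "n \<ge> 1" and dim: "DIM('a::euclidean_space) = n + 1"
    and D: "zeta_reg (\<lambda>k w. of_nat (sphere_mult n k) * of_real (real k * (real k + real n - 1)) powr (- w)) {1..} D"
  shows "zeta_det (smooth_sphere_functions :: ('a \<Rightarrow> real) set) sphere_laplacian = exp (- D)"
proof (rule zeta_det_eq[OF sphere_eigenspace(1)[OF n dim]])
  have e: "sphere_eigenvalue TYPE('a) k = real k * (real k + real n - 1)" for k
    by (simp add: sphere_eigenvalue_def dim algebra_simps)
  show "inj (sphere_eigenvalue TYPE('a))"
    by (rule injI, rule sphere_eigenvalue_inj) (use n dim in auto)
  have "{k. sphere_eigenvalue TYPE('a) k > 0} = {1..}"
    unfolding e using n by (auto simp: zero_less_mult_iff Suc_le_eq)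
  then show "zeta_reg (\<lambda>k w. of_nat (sphere_mult n k) * of_real (sphere_eigenvalue TYPE('a) k) powr (- w))
      {k. sphere_eigenvalue TYPE('a) k > 0} D"
    unfolding e using D by simp
qed (rule sphere_eigenspace(2)[OF n dim])

lemma zeta_det_conformal:
  fixes n :: nat
  assumes n: "n \<ge> 1" and dim: "DIM('a::euclidean_space) = n + 1"
    and D: "zeta_reg (\<lambda>k w. of_nat (sphere_mult n k) * of_real ((real k + real n / 2 - 1) * (real k + real n / 2)) powr (- w))
      {if n \<ge> 3 then 0 else 1..} D"
  shows "zeta_det (smooth_sphere_functions :: ('a \<Rightarrow> real) set) (conformal_laplacian n) = exp (- D)"
proof (rule zeta_det_eq[OF conformal_eigenvalues(1)[OF n dim]])
  let ?ev = "\<lambda>k. sphere_eigenvalue TYPE('a) k + real n * (real n - 2) / 4"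
  have e: "?ev k = (real k + real n / 2 - 1) * (real k + real n / 2)" for k
    by (simp add: sphere_eigenvalue_def dim field_simps)
  have "inj (sphere_eigenvalue TYPE('a))"
    by (rule injI, rule sphere_eigenvalue_inj) (use n dim in auto)
  then show "inj ?ev" by (auto simp: inj_on_def)
  have pos: "?ev k > 0 \<longleftrightarrow> real k + real n / 2 - 1 > 0" for k
  proof -
    have "real k + real n / 2 > 0" using n by (simp add: add_nonneg_pos)
    then show ?thesis unfolding e by (simp add: zero_less_mult_iff)
  qed
  \<comment> \<open>Degree 0 has eigenvalue \<open>n * (n - 2) / 4\<close>, which is negative for
    \<open>n = 1\<close>, zero for \<open>n = 2\<close> and positive from 3 on.\<close>
  have "?ev k > 0 \<longleftrightarrow> k \<in> {if n \<ge> 3 then 0 else 1..}" for k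
    unfolding pos using n by (cases k) (auto simp: field_simps)
  then have "{k. ?ev k > 0} = {if n \<ge> 3 then 0 else 1..}" by blast
  then show "zeta_reg (\<lambda>k w. of_nat (sphere_mult n k) * of_real (?ev k) powr (- w)) {k. ?ev k > 0} D"
    unfolding e using D by simp
qed (rule conformal_eigenvalues(2)[OF n dim])

section \<open>The multiplicity polynomial and the generating functions\<close>

lemma atMost_minus_1: "n \<ge> 1 \<Longrightarrow> {0..n - 1} = {..<n :: nat}"
  by auto

lemma poly_eq_sum_lessThan:
  fixes z :: "'a::comm_semiring_1"
  assumes "degree p < n"
  shows "poly p z = (\<Sum>k<n. coeff p k * z ^ k)"
  unfolding poly_altdef using assms
  by (intro sum.mono_neutral_left) (auto simp: coeff_eq_0)

lemma coeffs_unique: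
  fixes c c' :: "nat \<Rightarrow> 'a::idom"
  assumes A: "infinite A" and eq: "\<And>z. z \<in> A \<Longrightarrow> (\<Sum>k<n. c k * z ^ k) = (\<Sum>k<n. c' k * z ^ k)" and k: "k < n"
  shows "c k = c' k"
proof -
  define p where "p = (\<Sum>k<n. monom (c k - c' k) k)"
  have "poly p z = 0" if "z \<in> A" for z
    using eq[OF that] unfolding p_def by (simp add: poly_sum poly_monom left_diff_distrib sum_subtractf)
  then have "A \<subseteq> {z. poly p z = 0}" by auto
  then have "infinite {z. poly p z = 0}" using A finite_subset by blast
  then have "p = 0" using poly_roots_finite by blast
  then have "coeff p k = 0" by simp
  then show ?thesis
    using k unfolding p_def by (simp add: coeff_sum sum.delta)
qed

definition gchoose_poly :: "'a::field_char_0 \<Rightarrow> nat \<Rightarrow> 'a poly" where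
  "gchoose_poly c n = smult (inverse (fact n)) (\<Prod>i<n. [:c - of_nat i, 1:])"

lemma poly_gchoose_poly: "poly (gchoose_poly c n) z = ((z + c) gchoose n)"
  by (simp add: gchoose_poly_def poly_prod gbinomial_prod_rev atLeast0LessThan divide_inverse algebra_simps)

lemma gchoose_poly_degree: "degree (gchoose_poly c n) = n" "coeff (gchoose_poly c n) n = inverse (fact n)"
proof -
  have d: "degree (\<Prod>i<n. [:c - of_nat i, 1:]) = n"
    by (subst degree_prod_eq_sum_degree) auto
  moreover have "lead_coeff (\<Prod>i<n. [:c - of_nat i, 1:]) = 1"
    by (simp add: lead_coeff_prod)
  ultimately show "degree (gchoose_poly c n) = n" "coeff (gchoose_poly c n) n = inverse (fact n)"
    by (simp_all add: gchoose_poly_def)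
qed

text \<open>Both binomial coefficients have leading coefficient \<open>1 / fact n\<close>, which
  cancels in the difference.\<close>

lemma gchoose_diff_poly:
  fixes c c' :: "'a::field_char_0"
  assumes "n \<ge> 1"
  obtains p where "degree p < n" "\<And>z. poly p z = ((z + c) gchoose n) - ((z + c') gchoose n)"
proof -
  let ?p = "gchoose_poly c n - gchoose_poly c' n"
  have "degree ?p \<le> n" by (rule degree_diff_le) (simp_all add: gchoose_poly_degree)
  moreover have "coeff ?p n = 0" by (simp add: gchoose_poly_degree)
  ultimately have "?p = 0 \<or> degree ?p < n" by (rule eq_zero_or_degree_less)
  then have "degree ?p < n" using assms by auto
  then show ?thesis using that by (simp add: poly_gchoose_poly)
qed

lemma P_fun_poly:
  assumes "n \<ge> 1"
  obtains p where "degree p < n" "\<And>z. poly p z = P_fun n z"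
  using gchoose_diff_poly[OF assms, of "n_check n + 1" "n_check n - 1"]
  unfolding P_fun_def by (simp add: add.assoc diff_add_eq[symmetric] add_diff_eq) metis

lemma T_coeff_eq:
  assumes n: "n \<ge> 1" and q: "degree q < n" "\<And>x. poly q x = P_fun n (x + s)"
  shows "T_coeff n s = coeff q"
  unfolding T_coeff_def
proof (rule the_equality)
  have "P_fun n z = (\<Sum>d=0..n - 1. coeff q d * (z - s) ^ d)" for z
    using q(2)[of "z - s"] poly_eq_sum_lessThan[OF q(1), of "z - s"] atMost_minus_1[OF n] by simp
  then show "(\<forall>d\<ge>n. coeff q d = 0) \<and> (\<forall>z. P_fun n z = (\<Sum>d=0..n - 1. coeff q d * (z - s) ^ d))"
    using q(1) by (auto intro: coeff_eq_0)
next
  fix T assume T: "(\<forall>d\<ge>n. T d = 0) \<and> (\<forall>z. P_fun n z = (\<Sum>d=0..n - 1. T d * (z - s) ^ d))"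
  have "T d = coeff q d" if "d < n" for d
  proof (rule coeffs_unique[where A = UNIV and n = n and c = T and c' = "coeff q", OF _ _ that])
    show "infinite (UNIV :: real set)" by (rule infinite_UNIV_char_0)
    fix x :: real
    have "P_fun n (x + s) = (\<Sum>d=0..n - 1. T d * ((x + s) - s) ^ d)" using T by blast
    then show "(\<Sum>k<n. T k * x ^ k) = (\<Sum>k<n. coeff q k * x ^ k)"
      using q(2)[of x] poly_eq_sum_lessThan[OF q(1), of x] atMost_minus_1[OF n] by simp
  qed
  moreover have "T d = coeff q d" if "d \<ge> n" for d
    using T that q(1) by (simp add: coeff_eq_0)
  ultimately show "T = coeff q" by (metis ext linorder_not_le)
qed

lemma P_fun_T_coeff:
  assumes n: "n \<ge> 1"
  shows "P_fun n (x + s) = (\<Sum>d<n. T_coeff n s d * x ^ d)"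
proof -
  obtain p where p: "degree p < n" "\<And>z. poly p z = P_fun n z"
    using P_fun_poly[OF n] by blast
  define q where "q = p \<circ>\<^sub>p [:s, 1:]"
  have q: "degree q < n" "\<And>x. poly q x = P_fun n (x + s)"
    unfolding q_def using p by (simp_all add: degree_pcompose poly_pcompose add.commute)
  show ?thesis
    unfolding T_coeff_eq[OF n q] q(2)[symmetric] by (rule poly_eq_sum_lessThan[OF q(1)])
qed

text \<open>The anomaly of \<open>zeta_reg_product\<close> with \<open>b = 2 * s\<close>, up to
  sign. The added term \<open>d = 0\<close> vanishes because \<open>harm 0 = 0\<close>.\<close>

lemma f1_eq:
  assumes n: "n \<ge> 1"
  shows "f1 n s = - (\<Sum>d<n. T_coeff n s d * ((2 * s) ^ (d + 1) * ((- 1) ^ d * harm d / real (d + 1)) / 2))"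
proof -
  have "f1 n s = (\<Sum>d=1..n - 1. - (T_coeff n s d * ((2 * s) ^ (d + 1) * ((- 1) ^ d * harm d / real (d + 1)) / 2)))"
    unfolding f1_def by (intro sum.cong refl) (simp add: harm_def inverse_eq_divide field_simps)
  also have "\<dots> = (\<Sum>d<n. - (T_coeff n s d * ((2 * s) ^ (d + 1) * ((- 1) ^ d * harm d / real (d + 1)) / 2)))"
    using n by (intro sum.mono_neutral_left) (auto simp: harm_def not_le)
  finally show ?thesis by (simp add: sum_negf)
qed

lemma P_fun_minus:
  assumes n: "n \<ge> 1"
  shows "P_fun n (- z) = (- 1) ^ (n + 1) * P_fun n z"
proof -
  have c: "real n - (- z + n_check n + 1) - 1 = z + n_check n - 1" "real n - (- z + n_check n - 1) - 1 = z + n_check n + 1"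
    by (simp_all add: n_check_def field_simps)
  show ?thesis
    unfolding P_fun_def gbinomial_negated_upper[of "- z + n_check n + 1"] gbinomial_negated_upper[of "- z + n_check n - 1"] c
    by (simp add: algebra_simps)
qed

text \<open>Sums of this shape arise from expanding powers of \<open>x + 1 / 2\<close>. The recursion in \<open>m\<close> is Pascal's
  rule, and it has period two because of the sign of \<open>(1 - 2) ^ m\<close>.\<close>

lemma harmonic_binomial_sum_odd:
  assumes "odd m"
  shows "(\<Sum>j=1..m. (- 2) ^ j * real (m choose j) * harm (j - 1)) = 0"
proof -
  define b where "b m = (\<Sum>j=1..m. (- 2) ^ j * real (m choose j) * harm (j - 1))" for m
  define g where "g m = (\<Sum>j=1..m. (- 2) ^ j * real (m choose j) / real j)" for m
  have b': "b m = (\<Sum>j=1..m'. (- 2) ^ j * real (m choose j) * harm (j - 1))" if "m' \<ge> m" for m m'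
    unfolding b_def using that by (intro sum.mono_neutral_left) auto
  have g': "g m = (\<Sum>j=1..m'. (- 2) ^ j * real (m choose j) / real j)" if "m' \<ge> m" for m m'
    unfolding g_def using that by (intro sum.mono_neutral_left) auto
  have bin: "real (Suc m choose j) = real (m choose j) + real (m choose (j - 1))" if "j \<ge> 1" for m j
    using that by (cases j) auto
  \<comment> \<open>Pascal's rule adds an index-shifted sum equal to \<open>- 2 * b m\<close>, up to
    the correction \<open>g\<close> that comes from
    \<open>harm j - harm (j - 1) = 1 / j\<close>.\<close>
  have bstep: "b (Suc m) = - b m - 2 * g m" for m
  proof -
    have "b (Suc m) = b m + (\<Sum>j=1..Suc m. (- 2) ^ j * real (m choose (j - 1)) * harm (j - 1))"
      unfolding b'[of m "Suc m", OF le_SucI[OF order_refl]] unfolding b_def sum.distrib[symmetric]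
      by (intro sum.cong refl) (simp add: bin ring_distribs)
    also have "(\<Sum>j=1..Suc m. (- 2) ^ j * real (m choose (j - 1)) * harm (j - 1)) =
        (\<Sum>j=0..m. (- 2) ^ Suc j * real (m choose j) * harm j)"
      using sum.shift_bounds_cl_Suc_ivl[of "\<lambda>j. (- 2) ^ j * real (m choose (j - 1)) * harm (j - 1)" 0 m] by simp
    also have "\<dots> = (\<Sum>j=1..m. (- 2) ^ Suc j * real (m choose j) * harm j)"
      by (intro sum.mono_neutral_right) (auto simp: harm_def not_le)
    also have "\<dots> = (\<Sum>j=1..m. - 2 * ((- 2) ^ j * real (m choose j) * harm (j - 1)) +
        - 2 * ((- 2) ^ j * real (m choose j) / real j))"
    proof (intro sum.cong refl)
      fix j assume "j \<in> {1..m}"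
      then obtain i where i: "j = Suc i" by (cases j) auto
      have "harm j = harm (j - 1) + 1 / real j" unfolding i harm_Suc by (simp add: inverse_eq_divide)
      then show "(- 2) ^ Suc j * real (m choose j) * harm j = - 2 * ((- 2) ^ j * real (m choose j) * harm (j - 1)) +
        - 2 * ((- 2) ^ j * real (m choose j) / real j)" by (simp only:) (simp add: algebra_simps)
    qed
    also have "\<dots> = - 2 * b m - 2 * g m"
      unfolding sum.distrib sum_distrib_left[symmetric] b_def g_def by simp
    finally show ?thesis by simp
  qed
  \<comment> \<open>Absorption turns the additional sum into the expansion of
    \<open>(1 - 2) ^ Suc m\<close> without its constant term.\<close>
  have gstep: "g (Suc m) = g m + ((- 1) ^ Suc m - 1) / real (Suc m)" for m
  proof -
    have "g (Suc m) = g m + (\<Sum>j=1..Suc m. (- 2) ^ j * real (m choose (j - 1)) / real j)"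
      unfolding g'[of m "Suc m", OF le_SucI[OF order_refl]] unfolding g_def sum.distrib[symmetric]
      by (intro sum.cong refl) (simp add: bin ring_distribs add_divide_distrib)
    also have "(\<Sum>j=1..Suc m. (- 2) ^ j * real (m choose (j - 1)) / real j) =
        (\<Sum>j=1..Suc m. (- 2) ^ j * real (Suc m choose j)) / real (Suc m)"
      unfolding sum_divide_distrib
    proof (intro sum.cong refl)
      fix j assume "j \<in> {1..Suc m}"
      then obtain i where i: "j = Suc i" by (cases j) auto
      have "real (Suc i) * real (Suc m choose Suc i) = real (Suc m) * real (m choose i)"
        using Suc_times_binomial[of i m] by (metis of_nat_mult)
      then have e: "real (m choose i) / real (Suc i) = real (Suc m choose Suc i) / real (Suc m)"
        by (simp add: field_simps del: of_nat_Suc binomial_Suc_Suc)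
      have "(- 2) ^ j * real (m choose (j - 1)) / real j = (- 2) ^ j * (real (m choose i) / real (Suc i))"
        unfolding i by simp
      also have "\<dots> = (- 2) ^ j * real (Suc m choose j) / real (Suc m)"
        unfolding e unfolding i by simp
      finally show "(- 2) ^ j * real (m choose (j - 1)) / real j = (- 2) ^ j * real (Suc m choose j) / real (Suc m)" .
    qed
    also have "(\<Sum>j=1..Suc m. (- 2) ^ j * real (Suc m choose j)) = (- 1) ^ Suc m - 1"
    proof -
      have "(- 2 + 1 :: real) ^ Suc m = (\<Sum>j\<le>Suc m. real (Suc m choose j) * (- 2) ^ j * 1 ^ (Suc m - j))"
        by (rule binomial_ring)
      also have "\<dots> = (\<Sum>j=0..Suc m. (- 2) ^ j * real (Suc m choose j))"
        unfolding atMost_atLeast0 by (intro sum.cong refl) (simp del: binomial_Suc_Suc)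
      also have "\<dots> = 1 + (\<Sum>j=1..Suc m. (- 2) ^ j * real (Suc m choose j))"
        by (subst sum.atLeast_Suc_atMost) simp_all
      finally show ?thesis by simp
    qed
    finally show ?thesis .
  qed
  have "b (2 * k + 1) = 0" for k
  proof (induction k)
    case 0
    show ?case by (simp add: b_def harm_def)
  next
    case (Suc k)
    have "2 * Suc k + 1 = Suc (Suc (2 * k + 1))" by simp
    \<comment> \<open>At this even exponent the increment of \<open>g\<close> is 0, so the two uses
      of \<open>bstep\<close> cancel.\<close>
    moreover have "g (Suc (2 * k + 1)) = g (2 * k + 1)" unfolding gstep by simp
    ultimately show ?case using Suc bstep[of "Suc (2 * k + 1)"] bstep[of "2 * k + 1"] by simp
  qed
  note bz = this
  obtain k where m: "m = 2 * k + 1" using assms by (rule oddE)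
  show ?thesis using bz[of k] unfolding b_def m .
qed

text \<open>For odd \<open>n\<close> the multiplicity polynomial is even in \<open>z\<close>. Each
  even power \<open>k\<close>, expanded about \<open>1 / 2\<close>, contributes a harmonic binomial
  sum of odd length \<open>k + 1\<close>, and that sum is zero.\<close>

lemma f1_half_odd:
  assumes n: "odd n"
  shows "f1 n (1 / 2) = 0"
proof -
  have n1: "n \<ge> 1" using n by (cases n) auto
  obtain p where p: "degree p < n" "\<And>z. poly p z = P_fun n z"
    using P_fun_poly[OF n1] by blast
  have odd0: "coeff p k = 0" if k: "odd k" for k
  proof (cases "k < n")
    case True
    have "coeff p k = coeff p k * (- 1) ^ k"
    proof (rule coeffs_unique[where A = UNIV and n = n and c = "coeff p" and c' = "\<lambda>k. coeff p k * (- 1) ^ k", OF _ _ True])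
      fix z :: real
      have "(\<Sum>k<n. coeff p k * (- 1) ^ k * z ^ k) = (\<Sum>k<n. coeff p k * (- z) ^ k)"
        by (intro sum.cong refl) (simp add: power_minus[of z])
      then show "(\<Sum>k<n. coeff p k * z ^ k) = (\<Sum>k<n. coeff p k * (- 1) ^ k * z ^ k)"
        using p(2)[of z] p(2)[of "- z"] P_fun_minus[OF n1, of z] n
        by (simp add: poly_eq_sum_lessThan[OF p(1)])
    qed (rule infinite_UNIV_char_0)
    then show ?thesis using k by simp
  qed (use p(1) in \<open>simp add: coeff_eq_0\<close>)
  define T where "T d = (\<Sum>k<n. coeff p k * (real (k choose d) * (1 / 2) ^ (k - d)))" for d
  have T: "T_coeff n (1 / 2) d = T d" if d: "d < n" for d
  proof (rule coeffs_unique[where A = UNIV and n = n and c = "T_coeff n (1 / 2)" and c' = T, OF _ _ d])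
    fix x :: real
    have "(\<Sum>d<n. T_coeff n (1 / 2) d * x ^ d) = (\<Sum>k<n. coeff p k * (x + 1 / 2) ^ k)"
      unfolding P_fun_T_coeff[OF n1, symmetric] p(2)[symmetric] by (rule poly_eq_sum_lessThan[OF p(1)])
    also have "\<dots> = (\<Sum>k<n. \<Sum>d<n. coeff p k * (real (k choose d) * (1 / 2) ^ (k - d)) * x ^ d)"
    proof (intro sum.cong refl)
      fix k assume k: "k \<in> {..<n}"
      have "(x + 1 / 2) ^ k = (\<Sum>d\<le>k. real (k choose d) * x ^ d * (1 / 2) ^ (k - d))" by (rule binomial_ring)
      also have "\<dots> = (\<Sum>d<n. real (k choose d) * x ^ d * (1 / 2) ^ (k - d))"
        using k by (intro sum.mono_neutral_left) auto
      finally show "coeff p k * (x + 1 / 2) ^ k = (\<Sum>d<n. coeff p k * (real (k choose d) * (1 / 2) ^ (k - d)) * x ^ d)"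
        by (simp add: sum_distrib_left mult_ac)
    qed
    also have "\<dots> = (\<Sum>d<n. T d * x ^ d)"
      unfolding T_def sum_distrib_right by (rule sum.swap)
    finally show "(\<Sum>d<n. T_coeff n (1 / 2) d * x ^ d) = (\<Sum>d<n. T d * x ^ d)" .
  qed (rule infinite_UNIV_char_0)
  define w where "w d = (- 1) ^ d * harm d / real (d + 1)" for d
  have key: "(\<Sum>d<n. real (k choose d) * (1 / 2) ^ (k - d) * w d) = 0" if k: "even k" "k < n" for k
  proof -
    have "(\<Sum>d<n. real (k choose d) * (1 / 2) ^ (k - d) * w d) = (\<Sum>d\<le>k. real (k choose d) * (1 / 2) ^ (k - d) * w d)"
      using k by (intro sum.mono_neutral_right) auto
    also have "\<dots> = (\<Sum>d\<le>k. - ((1 / 2) ^ Suc k / real (Suc k)) * ((- 2) ^ Suc d * real (Suc k choose Suc d) * harm d))"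
    proof (intro sum.cong refl)
      fix d assume "d \<in> {..k}"
      then have d: "d \<le> k" by simp
      have "real (Suc d) * real (Suc k choose Suc d) = real (Suc k) * real (k choose d)"
        using Suc_times_binomial[of d k] by (metis of_nat_mult)
      then have e: "real (k choose d) / real (Suc d) = real (Suc k choose Suc d) / real (Suc k)"
        by (simp add: field_simps del: of_nat_Suc binomial_Suc_Suc)
      have "(1 / 2 :: real) ^ (k - d) * (1 / 2) ^ Suc d = (1 / 2) ^ Suc k"
        using d by (simp add: power_add[symmetric])
      then have h: "(1 / 2 :: real) ^ (k - d) = (1 / 2) ^ Suc k * 2 ^ Suc d"
        by (simp add: power_one_over field_simps)
      have s: "(- 2 :: real) ^ Suc d = - ((- 1) ^ d * 2 ^ Suc d)"
        by (simp add: power_minus[of 2])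
      have "real (k choose d) * (1 / 2) ^ (k - d) * w d = (1 / 2) ^ (k - d) * (- 1) ^ d * harm d * (real (k choose d) / real (Suc d))"
        unfolding w_def by simp
      also have "\<dots> = - ((1 / 2) ^ Suc k / real (Suc k)) * ((- 2) ^ Suc d * real (Suc k choose Suc d) * harm d)"
        unfolding e h s by (simp del: power_Suc of_nat_Suc binomial_Suc_Suc)
      finally show "real (k choose d) * (1 / 2) ^ (k - d) * w d =
        - ((1 / 2) ^ Suc k / real (Suc k)) * ((- 2) ^ Suc d * real (Suc k choose Suc d) * harm d)" .
    qed
    also have "\<dots> = - ((1 / 2) ^ Suc k / real (Suc k)) * (\<Sum>d\<le>k. (- 2) ^ Suc d * real (Suc k choose Suc d) * harm d)"
      by (rule sum_distrib_left[symmetric])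
    also have "(\<Sum>d\<le>k. (- 2) ^ Suc d * real (Suc k choose Suc d) * harm d) =
        (\<Sum>j=1..Suc k. (- 2) ^ j * real (Suc k choose j) * harm (j - 1))"
      using sum.shift_bounds_cl_Suc_ivl[of "\<lambda>j. (- 2) ^ j * real (Suc k choose j) * harm (j - 1)" 0 k]
      by (simp add: atMost_atLeast0 del: power_Suc binomial_Suc_Suc)
    also have "\<dots> = 0" by (rule harmonic_binomial_sum_odd) (use k in simp)
    finally show ?thesis by simp
  qed
  have "(\<Sum>d<n. T d * w d) = (\<Sum>d<n. \<Sum>k<n. coeff p k * (real (k choose d) * (1 / 2) ^ (k - d)) * w d)"
    unfolding T_def sum_distrib_right ..
  also have "\<dots> = (\<Sum>k<n. \<Sum>d<n. coeff p k * (real (k choose d) * (1 / 2) ^ (k - d)) * w d)"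
    by (rule sum.swap)
  also have "\<dots> = (\<Sum>k<n. coeff p k * (\<Sum>d<n. real (k choose d) * (1 / 2) ^ (k - d) * w d))"
    by (simp only: sum_distrib_left mult.assoc)
  also have "\<dots> = 0"
    using key odd0 by (intro sum.neutral ballI) auto
  finally have 0: "(\<Sum>d<n. T d * w d) = 0" .
  have "f1 n (1 / 2) = - (\<Sum>d<n. T_coeff n (1 / 2) d * ((2 * (1 / 2)) ^ (d + 1) * ((- 1) ^ d * harm d / real (d + 1)) / 2))"
    by (rule f1_eq[OF n1])
  also have "(\<Sum>d<n. T_coeff n (1 / 2) d * ((2 * (1 / 2)) ^ (d + 1) * ((- 1) ^ d * harm d / real (d + 1)) / 2)) =
      (\<Sum>d<n. T d * w d) / 2"
    unfolding sum_divide_distrib by (intro sum.cong refl) (simp add: T w_def)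
  finally show ?thesis unfolding 0 by simp
qed

section \<open>Gaps of binomial coefficients and their symmetry\<close>

text \<open>The multiplicity polynomial with its centre moved away, so that it takes its values at
  integers. It is polymorphic because the generating functions live over \<open>rat\<close> and the
  multiplicities over \<open>real\<close>.\<close>

definition gchoose_gap :: "nat \<Rightarrow> 'a::field_char_0 \<Rightarrow> 'a" where
  "gchoose_gap n a = (a gchoose n) - ((a - 2) gchoose n)"

lemma P_fun_gap: "P_fun n z = gchoose_gap n (z + n_check n + 1)"
  by (simp add: P_fun_def gchoose_gap_def algebra_simps)

lemma gchoose_gap_Suc: "gchoose_gap (Suc m) a = ((a - 1) gchoose m) + ((a - 2) gchoose m)"
proof -
  have "a - 2 = a - 1 - 1" by simp
  then show ?thesis
    unfolding gchoose_gap_def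
    using gbinomial_Suc_Suc[of "a - 1" m] gbinomial_Suc_Suc[of "a - 2" m] by simp
qed

text \<open>Upper negation exchanges the two binomial coefficients of the gap; the centre of
  symmetry is \<open>(n + 1) / 2\<close>.\<close>

lemma gchoose_gap_reflect:
  fixes a :: "'a::field_char_0"
  shows "gchoose_gap n (of_nat n + 1 - a) = (- 1) ^ (n + 1) * gchoose_gap n a"
proof -
  have e: "of_nat n - a - 1 = of_nat n + 1 - a - 2" "of_nat n - (a - 2) - 1 = of_nat n + 1 - a"
    by simp_all
  show ?thesis
    unfolding gchoose_gap_def gbinomial_negated_upper[of a n] gbinomial_negated_upper[of "a - 2" n] e
    by (simp add: right_diff_distrib mult.assoc[symmetric] power_mult_distrib[symmetric])
qed

lemma of_rat_gbinomial: "(of_rat (a gchoose k) :: 'a::field_char_0) = (of_rat a gchoose k)"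
proof -
  have "(of_rat (fact k) :: 'a) = fact k" by (metis of_nat_fact of_rat_of_nat_eq)
  then show ?thesis
    by (simp add: gbinomial_prod_rev of_rat_divide of_rat_prod of_rat_diff)
qed

lemma of_rat_gchoose_gap: "(of_rat (gchoose_gap n a) :: 'a::field_char_0) = gchoose_gap n (of_rat a)"
  by (simp add: gchoose_gap_def of_rat_diff of_rat_gbinomial)

lemma gchoose_gap_of_nat:
  assumes "2 \<le> p" "p \<le> n"
  shows "gchoose_gap n (of_nat p :: 'a::field_char_0) = (if p = n then 1 else 0)"
proof -
  have "of_nat p - 2 = (of_nat (p - 2) :: 'a)" using assms by (simp add: of_nat_diff)
  then show ?thesis
    using assms unfolding gchoose_gap_def \<open>of_nat p - 2 = of_nat (p - 2)\<close> binomial_gbinomial[symmetric] by (cases "p = n") (auto simp: binomial_eq_0)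
qed

lemma infinite_nonzero: "infinite {z :: 'a::field_char_0. z \<noteq> 0}"
proof -
  have "{z :: 'a. z \<noteq> 0} = UNIV - {0}" by auto
  then show ?thesis by (simp add: infinite_UNIV_char_0)
qed

lemma genfun_coeffs_eqI:
  assumes n: "n \<ge> 1" and p: "degree p < n" "\<And>z. z \<noteq> 0 \<Longrightarrow> poly p z = G z"
  shows "genfun_coeffs n G = coeff p"
  unfolding genfun_coeffs_def
proof (rule the_equality)
  show "(\<forall>k\<ge>n. coeff p k = 0) \<and> (\<forall>z. z \<noteq> 0 \<longrightarrow> (\<Sum>k = 0..n - 1. coeff p k * z ^ k) = G z)"
    using p(1) p(2)[symmetric] atMost_minus_1[OF n] by (auto simp: coeff_eq_0 poly_eq_sum_lessThan[OF p(1)])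
next
  fix c assume c: "(\<forall>k\<ge>n. c k = 0) \<and> (\<forall>z. z \<noteq> 0 \<longrightarrow> (\<Sum>k = 0..n - 1. c k * z ^ k) = G z)"
  show "c = coeff p"
  proof
    fix k
    show "c k = coeff p k"
    proof (cases "k < n")
      case True
      show ?thesis
      proof (rule coeffs_unique[where A = "{z. z \<noteq> 0}" and n = n and c = c and c' = "coeff p", OF infinite_nonzero _ True])
        fix z :: rat assume z: "z \<in> {z. z \<noteq> 0}"
        then have "(\<Sum>k = 0..n - 1. c k * z ^ k) = G z" using c by blast
        then show "(\<Sum>k<n. c k * z ^ k) = (\<Sum>k<n. coeff p k * z ^ k)"
          using z p(2)[of z] atMost_minus_1[OF n] by (simp add: poly_eq_sum_lessThan[OF p(1)])
      qed
    next
      case False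
      then show ?thesis using c p(1) by (simp add: coeff_eq_0)
    qed
  qed
qed

text \<open>If \<open>a + b = n + 1\<close>, the reflection \<open>z\<close> to \<open>- z\<close>
  exchanges the two gaps up to the sign \<open>(- 1) ^ (n + 1)\<close>. Their sum is therefore even
  or odd, and the coefficients with the parity of \<open>n\<close> vanish.\<close>

lemma genfun_coeffs_gap:
  assumes n: "n \<ge> 1" and G: "\<And>z. z \<noteq> 0 \<Longrightarrow> G z = - (gchoose_gap n (z + a) + gchoose_gap n (z + b))"
  shows "(\<Sum>k<n. genfun_coeffs n G k * z ^ k) = - (gchoose_gap n (z + a) + gchoose_gap n (z + b))"
    and "a + b = of_nat n + 1 \<Longrightarrow> even k = even n \<Longrightarrow> genfun_coeffs n G k = 0"
proof -
  obtain p where p: "degree p < n" "\<And>z. poly p z = ((z + a) gchoose n) - ((z + (a - 2)) gchoose n)"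
    using gchoose_diff_poly[OF n] by blast
  obtain q where q: "degree q < n" "\<And>z. poly q z = ((z + b) gchoose n) - ((z + (b - 2)) gchoose n)"
    using gchoose_diff_poly[OF n] by blast
  define r where "r = - (p + q)"
  have r: "degree r < n" unfolding r_def degree_minus by (rule degree_add_less[OF p(1) q(1)])
  have r2: "poly r z = - (gchoose_gap n (z + a) + gchoose_gap n (z + b))" for z
    unfolding r_def by (simp add: p(2) q(2) gchoose_gap_def add_diff_eq)
  have c: "genfun_coeffs n G = coeff r"
    by (rule genfun_coeffs_eqI[OF n r]) (simp add: r2 G)
  show eq: "(\<Sum>k<n. genfun_coeffs n G k * z ^ k) = - (gchoose_gap n (z + a) + gchoose_gap n (z + b))" for z
    unfolding c r2[symmetric] by (rule poly_eq_sum_lessThan[OF r, symmetric])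
  assume ab: "a + b = of_nat n + 1" and k: "even k = even n"
  show "genfun_coeffs n G k = 0"
  proof (cases "k < n")
    case True
    have reflect: "gchoose_gap n (- z + a) = (- 1) ^ (n + 1) * gchoose_gap n (z + b)"
      "gchoose_gap n (- z + b) = (- 1) ^ (n + 1) * gchoose_gap n (z + a)" for z
      unfolding gchoose_gap_reflect[symmetric] ab[symmetric] by (simp_all add: algebra_simps)
    have "genfun_coeffs n G k = (- 1) ^ (n + 1) * ((- 1) ^ k * genfun_coeffs n G k)"
    proof (rule coeffs_unique[where A = UNIV and n = n and c = "genfun_coeffs n G" and
          c' = "\<lambda>k. (- 1) ^ (n + 1) * ((- 1) ^ k * genfun_coeffs n G k)", OF infinite_UNIV_char_0 _ True])
      fix z :: rat
      have "(\<Sum>k<n. (- 1) ^ (n + 1) * ((- 1) ^ k * genfun_coeffs n G k) * z ^ k) =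
          (- 1) ^ (n + 1) * (\<Sum>k<n. genfun_coeffs n G k * (- z) ^ k)"
        unfolding sum_distrib_left by (intro sum.cong refl) (simp add: power_minus[of z] mult_ac)
      also have "\<dots> = (- 1) ^ (n + 1) * ((- 1) ^ (n + 1) * (\<Sum>k<n. genfun_coeffs n G k * z ^ k))"
        unfolding eq unfolding reflect by (simp add: algebra_simps)
      also have "\<dots> = (\<Sum>k<n. genfun_coeffs n G k * z ^ k)"
        by (simp add: mult.assoc[symmetric] power_mult_distrib[symmetric])
      finally show "(\<Sum>k<n. genfun_coeffs n G k * z ^ k) = (\<Sum>k<n. (- 1) ^ (n + 1) * ((- 1) ^ k * genfun_coeffs n G k) * z ^ k)"
        by (rule sym)
    qed
    then show ?thesis using k by (cases "even n") auto
  next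
    case False
    then show ?thesis unfolding c using r by (simp add: coeff_eq_0)
  qed
qed

lemma gchoose_gap_eq_divide:
  fixes z :: "'a::field_char_0"
  assumes "n \<ge> 1" "z \<noteq> 0"
  shows "gchoose_gap n (z + of_nat n) = ((z + of_nat n - 2) gchoose (n - 1)) * ((of_nat n + 2 * z - 1) / z)"
proof -
  obtain m where m: "n = Suc m" using assms(1) by (cases n) auto
  have e: "z + of_nat n - 1 = z + of_nat m" "z + of_nat n - 2 = z + of_nat m - 1" unfolding m by simp_all
  have "z * ((z + of_nat m) gchoose m) = (z + of_nat m) * ((z + of_nat m - 1) gchoose m)"
    using gbinomial_absorb_comp[of "z + of_nat m" m] by simp
  then have "((z + of_nat m) gchoose m) = (z + of_nat m) * ((z + of_nat m - 1) gchoose m) / z"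
    using assms(2) by (simp add: field_simps)
  then show ?thesis
    unfolding m gchoose_gap_Suc unfolding m[symmetric] e using assms(2) by (simp add: m field_simps)
qed

text \<open>Up to sign, the second summand of \<open>d_genfun\<close> is the first one at
  \<open>- z\<close>, and reflection turns the gap at \<open>- z + n\<close> into the gap at
  \<open>z + 1\<close>.\<close>

lemma d_genfun_gap:
  assumes n: "n \<ge> 1" and z: "z \<noteq> 0"
  shows "d_genfun n z = - (gchoose_gap n (z + of_nat n) + gchoose_gap n (z + 1))"
proof -
  have 2: "gchoose_gap n (z + 1) = (- 1) ^ (n + 1) * gchoose_gap n (- z + of_nat n)"
    unfolding gchoose_gap_reflect[symmetric] by (simp add: algebra_simps)
  show ?thesis
    unfolding 2 d_genfun_def gchoose_gap_eq_divide[OF n z] gchoose_gap_eq_divide[OF n, of "- z", unfolded neg_equal_0_iff_equal, OF z]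
    by simp
qed

text \<open>The two gaps have the binomial coefficients of three consecutive arguments with weights
  1, 2, 1. This is the second difference, with weights 1, -2, 1, plus 4 times the middle term. The
  second difference is \<open>E\<close>, and the 4 is the one in the generating functions of
  \<open>y_coeff\<close>.\<close>

lemma gchoose_gap_add_eq:
  fixes z :: "'a::field_char_0"
  assumes n: "n \<ge> 3"
  defines "E \<equiv> ((z + of_nat n / 2 - 2) gchoose (n - 3))"
  shows "gchoose_gap n (z + of_nat n / 2 + 1) + gchoose_gap n (z + of_nat n / 2) =
      E + 4 * ((z + of_nat n / 2 - 1) gchoose (n - 1))"
    and "((z + of_nat n / 2 - 1) gchoose (n - 1)) = E * (z\<^sup>2 - (of_nat n / 2 - 1)\<^sup>2) / (of_nat (n - 1) * of_nat (n - 2))"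
proof -
  obtain q where q: "n = q + 3" using n by (metis add.commute le_Suc_ex)
  define a where "a = z + of_nat n / 2"
  define K where "K = (of_nat (Suc q) * of_nat (Suc (Suc q)) :: 'a)"
  have K0: "K \<noteq> 0" unfolding K_def mult_eq_0_iff of_nat_eq_0_iff by simp
  have E: "E = ((a - 2) gchoose q)" unfolding E_def a_def q by simp
  have S1: "((x + 1) gchoose Suc k) = (x + 1) / of_nat (Suc k) * (x gchoose k)" for x :: 'a and k
    using gbinomial_absorption[of k "x + 1"] by (simp add: field_simps del: of_nat_Suc)
  have S2: "(x gchoose Suc k) = (x - of_nat k) / of_nat (Suc k) * (x gchoose k)" for x :: 'a and k
    using gbinomial_absorption[of k x] gbinomial_absorb_comp[of x k] by (simp add: field_simps del: of_nat_Suc)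
  have a2: "a - 1 = a - 2 + 1" "a = a - 1 + 1" by simp_all
  have C1: "(a gchoose Suc (Suc q)) = a * (a - 1) / K * E"
    unfolding E K_def using S1[of "a - 1" "Suc q"] S1[of "a - 2" q] by simp
  have C2: "((a - 1) gchoose Suc (Suc q)) = (a - 1) * (a - 2 - of_nat q) / K * E"
    unfolding E K_def using S1[of "a - 2" "Suc q"] S2[of "a - 2" q] by (simp add: mult_ac)
  have C3: "((a - 2) gchoose Suc (Suc q)) = (a - 2 - of_nat q) * (a - 2 - of_nat (Suc q)) / K * E"
    unfolding E K_def using S2[of "a - 2" "Suc q"] S2[of "a - 2" q] by (simp add: mult_ac)
  have "gchoose_gap n (a + 1) + gchoose_gap n a =
      (a gchoose Suc (Suc q)) + 2 * ((a - 1) gchoose Suc (Suc q)) + ((a - 2) gchoose Suc (Suc q))"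
  proof -
    have s: "n = Suc (Suc (Suc q))" using q by simp
    show ?thesis unfolding s gchoose_gap_Suc by simp
  qed
  also have "\<dots> = E + 4 * ((a - 1) gchoose Suc (Suc q))"
  proof -
    define A X Y where "A = a * (a - 1)" and "X = (a - 1) * (a - 2 - of_nat q)"
      and "Y = (a - 2 - of_nat q) * (a - 2 - of_nat (Suc q))"
    have "A - 2 * X + Y = K"
      unfolding A_def X_def Y_def K_def by (simp add: algebra_simps)
    then have "A / K - 2 * (X / K) + Y / K = 1"
      using K0 by (simp add: add_divide_distrib[symmetric] diff_divide_distrib[symmetric])
    moreover have "A / K * E + 2 * (X / K * E) + Y / K * E = (A / K - 2 * (X / K) + Y / K) * E + 4 * (X / K * E)"
      by (simp add: algebra_simps)
    ultimately show ?thesis unfolding C1 C2 C3 A_def[symmetric] X_def[symmetric] Y_def[symmetric] by simp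
  qed
  finally show "gchoose_gap n (z + of_nat n / 2 + 1) + gchoose_gap n (z + of_nat n / 2) =
      E + 4 * ((z + of_nat n / 2 - 1) gchoose (n - 1))"
    unfolding a_def by (simp add: q)
  have "(a - 1) * (a - 2 - of_nat q) = z\<^sup>2 - (of_nat n / 2 - 1)\<^sup>2"
    unfolding a_def q by (simp add: field_simps power2_eq_square)
  moreover have "K = of_nat (n - 1) * of_nat (n - 2)" unfolding K_def q by simp
  moreover have "n - 1 = Suc (Suc q)" using q by simp
  ultimately show "((z + of_nat n / 2 - 1) gchoose (n - 1)) = E * (z\<^sup>2 - (of_nat n / 2 - 1)\<^sup>2) / (of_nat (n - 1) * of_nat (n - 2))"
    using C2 unfolding a_def by (simp only:) (simp add: mult.commute)
qed

section \<open>Central products in the conformal generating functions\<close>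

text \<open>Upper negation makes the second factor continue the falling product of the first, and
  trinomial revision merges both into one binomial coefficient of order
  \<open>2 * j\<close>.\<close>

lemma gbinomial_central_odd:
  fixes z :: "'a::field_char_0"
  shows "inverse (of_nat ((2 * j) choose j)) * ((z + of_nat j - 1 / 2) gchoose j) * ((- z + of_nat j - 1 / 2) gchoose j) =
    (- 1) ^ j * ((z + of_nat j - 1 / 2) gchoose (2 * j))"
proof -
  have m: "((- z + of_nat j - 1 / 2) gchoose j) = (- 1) ^ j * ((z + of_nat j - 1 / 2 - of_nat j) gchoose j)"
    unfolding gbinomial_negated_upper[of "- z + of_nat j - 1 / 2"] by (simp add: field_simps)
  have le: "j \<le> 2 * j" and jj: "2 * j - j = j" by simp_all
  have "((z + of_nat j - 1 / 2) gchoose (2 * j)) * of_nat ((2 * j) choose j) =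
      ((z + of_nat j - 1 / 2) gchoose j) * ((z + of_nat j - 1 / 2 - of_nat j) gchoose j)"
    using gbinomial_trinomial_revision[OF le, of "z + of_nat j - 1 / 2"] unfolding binomial_gbinomial jj .
  moreover have "of_nat ((2 * j) choose j) \<noteq> (0 :: 'a)" by simp
  ultimately show ?thesis unfolding m by (simp add: field_simps)
qed

text \<open>As in the odd case, but after negation the second factor overlaps in \<open>z\<close>;
  absorption splits off \<open>z / j\<close>, which the prefactor compensates together with the 2
  from halving the central binomial coefficient.\<close>

lemma gbinomial_central_even:
  fixes z :: "'a::field_char_0"
  assumes j: "j \<ge> 1" and z: "z \<noteq> 0"
  shows "2 * of_nat j / z * inverse (of_nat ((2 * j) choose j)) * ((z + of_nat j - 1) gchoose j) * ((- z + of_nat j - 1) gchoose j) =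
    (- 1) ^ j * ((z + of_nat j - 1) gchoose (2 * j - 1))"
proof -
  obtain i where i: "j = Suc i" using j by (cases j) auto
  have "((- z + of_nat j - 1) gchoose j) = (- 1) ^ j * (z gchoose j)"
    unfolding gbinomial_negated_upper[of "- z + of_nat j - 1"] by (simp add: field_simps)
  moreover have "of_nat j * (z gchoose j) = z * ((z - 1) gchoose (j - 1))"
    using gbinomial_absorption[of i z] by (simp add: i)
  then have "(z gchoose j) = z * ((z - 1) gchoose (j - 1)) / of_nat j" using j by (simp add: field_simps)
  ultimately have m: "((- z + of_nat j - 1) gchoose j) = (- 1) ^ j * (z * ((z - 1) gchoose (j - 1)) / of_nat j)"
    by simp
  have "((z + of_nat j - 1) gchoose (2 * j - 1)) * of_nat ((2 * j - 1) choose j) =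
      ((z + of_nat j - 1) gchoose j) * ((z + of_nat j - 1 - of_nat j) gchoose (2 * j - 1 - j))"
    using gbinomial_trinomial_revision[of j "2 * j - 1" "z + of_nat j - 1"] j
    unfolding binomial_gbinomial by linarith
  moreover have "z + of_nat j - 1 - of_nat j = z - 1" "2 * j - 1 - j = j - 1" by simp_all
  ultimately have t: "((z + of_nat j - 1) gchoose j) * ((z - 1) gchoose (j - 1)) =
      ((z + of_nat j - 1) gchoose (2 * j - 1)) * of_nat ((2 * j - 1) choose j)" by simp
  have "(2 * j choose j) = 2 * ((2 * j - 1) choose j)"
  proof -
    have "(2 * j choose j) = (Suc (2 * i) choose i) + (Suc (2 * i) choose Suc i)" unfolding i by simp
    moreover have "(Suc (2 * i) choose i) = (Suc (2 * i) choose Suc i)"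
      using binomial_symmetric[of i "Suc (2 * i)"] by simp
    ultimately show ?thesis unfolding i by simp
  qed
  then have c: "(of_nat (2 * j choose j) :: 'a) = 2 * of_nat ((2 * j - 1) choose j)" by simp
  have c0: "of_nat ((2 * j - 1) choose j) \<noteq> (0 :: 'a)" using j by simp
  have j0: "of_nat j \<noteq> (0 :: 'a)" using j by simp
  define u where "u = ((z - 1) gchoose (j - 1))"
  have "2 * of_nat j / z * inverse (of_nat ((2 * j) choose j)) * ((z + of_nat j - 1) gchoose j) * ((- z + of_nat j - 1) gchoose j) =
    (- 1) ^ j * (((z + of_nat j - 1) gchoose j) * u) * inverse (of_nat ((2 * j - 1) choose j))"
    unfolding m c u_def[symmetric] using z c0 j0 by (simp add: field_simps)
  then show ?thesis unfolding u_def t using c0 by simp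
qed

lemma y_genfun_odd_eq:
  assumes "m \<ge> 1"
  shows "y_genfun_odd m z = - (gchoose_gap (2 * m + 1) (z + of_nat (2 * m + 1) / 2 + 1) + gchoose_gap (2 * m + 1) (z + of_nat (2 * m + 1) / 2))"
proof -
  obtain j where m: "m = Suc j" using assms by (cases m) auto
  have n: "2 * m + 1 \<ge> 3" "2 * m + 1 - 3 = 2 * j" "2 * m + 1 - 1 = 2 * m" using m by simp_all
  have e: "z + of_nat (2 * m + 1) / 2 - 2 = z + of_nat j - 1 / 2" "z + of_nat (2 * m + 1) / 2 - 1 = z + of_nat m - 1 / 2"
    "w + of_nat m - 3 / 2 = w + of_nat j - 1 / 2" "2 * m - 2 = 2 * j" "m - 1 = j" for w :: rat
    using m by (simp_all add: field_simps)
  show ?thesis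
    unfolding gchoose_gap_add_eq(1)[OF n(1)] n e y_genfun_odd_def
    using gbinomial_central_odd[of j z] gbinomial_central_odd[of m z]
    by (simp add: mult.assoc) (simp add: m mult.assoc[symmetric] power_mult_distrib[symmetric])
qed

lemma y_genfun_even_eq:
  assumes "m \<ge> 2" "z \<noteq> 0"
  shows "y_genfun_even m z = - (gchoose_gap (2 * m) (z + of_nat (2 * m) / 2 + 1) + gchoose_gap (2 * m) (z + of_nat (2 * m) / 2))"
proof -
  obtain j where m: "m = Suc j" and j: "j \<ge> 1" "m \<ge> 1" using assms by (cases m) auto
  have n: "2 * m \<ge> 3" "2 * m - 3 = 2 * j - 1" using m j by simp_all
  have e: "z + of_nat (2 * m) / 2 - 2 = z + of_nat j - 1" "z + of_nat (2 * m) / 2 - 1 = z + of_nat m - 1"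
    "w + of_nat m - 2 = w + of_nat j - 1" "2 * m - 2 = 2 * j" "m - 1 = j" "2 * of_nat m - 2 = 2 * (of_nat j :: rat)" for w :: rat
    using m by (simp_all add: field_simps)
  define A B where "A = inverse (of_nat ((2 * j) choose j)) * ((z + of_nat j - 1) gchoose j) * ((- z + of_nat j - 1) gchoose j)"
    and "B = inverse (of_nat ((2 * m) choose m)) * ((z + of_nat m - 1) gchoose m) * ((- z + of_nat m - 1) gchoose m)"
  have "y_genfun_even m z = (- 1) ^ m * (2 * of_nat j / z * A) + 4 * ((- 1) ^ (m + 1) * (2 * of_nat m / z * B))"
    unfolding y_genfun_even_def e A_def B_def by (simp only: mult.assoc times_divide_eq_left times_divide_eq_right)
  also have "2 * of_nat j / z * A = (- 1) ^ j * ((z + of_nat j - 1) gchoose (2 * j - 1))"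
    unfolding A_def mult.assoc[symmetric] by (rule gbinomial_central_even[OF j(1) assms(2)])
  also have "2 * of_nat m / z * B = (- 1) ^ m * ((z + of_nat m - 1) gchoose (2 * m - 1))"
    unfolding B_def mult.assoc[symmetric] by (rule gbinomial_central_even[OF j(2) assms(2)])
  finally show ?thesis
    unfolding gchoose_gap_add_eq(1)[OF n(1)] n(2) e
    by (simp add: m mult.assoc[symmetric] power_mult_distrib[symmetric])
qed

lemma y_genfun_gap:
  assumes "n \<ge> 3" "z \<noteq> 0"
  shows "y_genfun n z = - (gchoose_gap n (z + (of_nat n / 2 + 1)) + gchoose_gap n (z + of_nat n / 2))"
proof (cases "odd n")
  case True
  then obtain m where m: "n = 2 * m + 1" by (rule oddE)
  then have "m \<ge> 1" "n div 2 = m" using assms by auto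
  moreover from this True have "y_genfun n = y_genfun_odd m" by (simp add: y_genfun_def)
  ultimately show ?thesis using y_genfun_odd_eq[of m z] unfolding m add.assoc by simp
next
  case False
  then obtain m where m: "n = 2 * m" by (metis evenE)
  then have "m \<ge> 2" "n div 2 = m" using assms by auto
  moreover from this False have "y_genfun n = y_genfun_even m" by (simp add: y_genfun_def)
  ultimately show ?thesis using y_genfun_even_eq[of m z] assms(2) unfolding m add.assoc by simp
qed

lemma double_fact_rec:
  assumes "k \<ge> 1"
  shows "double_fact k = k * double_fact (k - 2)"
proof -
  have "{i. 1 \<le> i \<and> i \<le> k \<and> even (k - i)} = insert k {i. 1 \<le> i \<and> i \<le> k - 2 \<and> even (k - 2 - i)}"
  proof (intro equalityI subsetI)
    fix i assume i: "i \<in> {i. 1 \<le> i \<and> i \<le> k \<and> even (k - i)}"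
    then have "i \<noteq> k - 1" by auto
    then show "i \<in> insert k {i. 1 \<le> i \<and> i \<le> k - 2 \<and> even (k - 2 - i)}" using i by auto
  qed (use assms in auto)
  moreover have "finite {i. 1 \<le> i \<and> i \<le> k - 2 \<and> even (k - 2 - i)}"
    by (rule finite_subset[of _ "{1..k}"]) auto
  ultimately show ?thesis unfolding double_fact_def by simp
qed

lemma double_fact_0 [simp]: "double_fact 0 = 1" "double_fact (- 1) = 1"
  unfolding double_fact_def by (rule prod.neutral, force)+

lemma double_fact_pos: "double_fact k > 0"
  unfolding double_fact_def by (rule prod_pos) auto

text \<open>The second part of \<open>gchoose_gap_add_eq\<close> at \<open>z = 0\<close> with
  \<open>n = 2 * j + 3\<close> is a recursion from \<open>j\<close> to \<open>Suc j\<close>, and it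
  matches the recursions of the two double factorials.\<close>

lemma gbinomial_half_eq_double_fact:
  "((of_nat j - 1 / 2) gchoose (2 * j)) =
    (- 1) ^ j * of_int (double_fact (2 * int j - 1)) / (4 ^ j * of_int (double_fact (2 * int j)) :: 'a::field_char_0)"
proof (induction j)
  case (Suc j)
  have n: "2 * j + 3 \<ge> 3" by simp
  have e: "0 + of_nat (2 * j + 3) / 2 - 2 = (of_nat j - 1 / 2 :: 'a)" "0 + of_nat (2 * j + 3) / 2 - 1 = (of_nat (Suc j) - 1 / 2 :: 'a)"
    "2 * j + 3 - 3 = 2 * j" "2 * j + 3 - 1 = 2 * Suc j" "2 * j + 3 - 2 = 2 * j + 1" "of_nat (2 * j + 3) / 2 - 1 = (of_nat (2 * j + 1) / 2 :: 'a)"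
    by (simp_all add: field_simps)
  have d: "double_fact (2 * int (Suc j) - 1) = (2 * int j + 1) * double_fact (2 * int j - 1)"
    "double_fact (2 * int (Suc j)) = 2 * (int j + 1) * double_fact (2 * int j)"
    using double_fact_rec[of "2 * int (Suc j) - 1"] double_fact_rec[of "2 * int (Suc j)"] by (simp_all add: algebra_simps)
  have nz: "of_nat (2 * j + 1) \<noteq> (0 :: 'a)" "of_nat (2 * Suc j) \<noteq> (0 :: 'a)" "of_int (double_fact (2 * int j)) \<noteq> (0 :: 'a)"
    unfolding of_nat_eq_0_iff of_int_eq_0_iff using double_fact_pos[of "2 * int j"] by auto
  define x where "x = (of_nat (2 * j + 1) :: 'a)"
  define y where "y = (of_nat (2 * Suc j) :: 'a)"
  have i: "of_int (2 * int j + 1) = x" "of_int (2 * (int j + 1)) = y" unfolding x_def y_def by simp_all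
  show ?case
    using gchoose_gap_add_eq(2)[OF n, of "0 :: 'a"] nz
    unfolding e d Suc.IH x_def[symmetric] y_def[symmetric] of_int_mult[of "2 * int j + 1"] of_int_mult[of "2 * (int j + 1)"] i
    by (simp add: field_simps power2_eq_square)
qed simp

lemma y_coeff_sum:
  assumes n: "n \<ge> 3"
  shows "(\<Sum>k<n. y_coeff n k * z ^ k) = - (gchoose_gap n (z + (of_nat n / 2 + 1)) + gchoose_gap n (z + of_nat n / 2))"
    and "even k = even n \<Longrightarrow> y_coeff n k = 0"
proof -
  have n1: "n \<ge> 1" using n by simp
  show "(\<Sum>k<n. y_coeff n k * z ^ k) = - (gchoose_gap n (z + (of_nat n / 2 + 1)) + gchoose_gap n (z + of_nat n / 2))"
    unfolding y_coeff_def by (rule genfun_coeffs_gap(1)[OF n1 y_genfun_gap[OF n]])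
  show "y_coeff n k = 0" if "even k = even n"
    unfolding y_coeff_def by (rule genfun_coeffs_gap(2)[OF n1 y_genfun_gap[OF n] _ that]) auto
qed

lemma d_coeff_sum:
  assumes n: "n \<ge> 1"
  shows "(\<Sum>k<n. d_coeff n k * z ^ k) = - (gchoose_gap n (z + of_nat n) + gchoose_gap n (z + 1))"
    and "even k = even n \<Longrightarrow> d_coeff n k = 0"
proof -
  show "(\<Sum>k<n. d_coeff n k * z ^ k) = - (gchoose_gap n (z + of_nat n) + gchoose_gap n (z + 1))"
    unfolding d_coeff_def by (rule genfun_coeffs_gap(1)[OF n d_genfun_gap[OF n]])
  show "d_coeff n k = 0" if "even k = even n"
    unfolding d_coeff_def by (rule genfun_coeffs_gap(2)[OF n d_genfun_gap[OF n] _ that]) auto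
qed

text \<open>The coefficient identity for the gap sum holds at \<open>z = 0\<close> too. With
  \<open>x = 2 * j + 1\<close> and \<open>y = x + 1\<close> the sum there is
  \<open>E * (1 - x / y) = E / y\<close>, and \<open>E\<close> is the half-integer binomial
  coefficient of the preceding lemma on double factorials.\<close>

lemma y_coeff_odd_0:
  assumes m: "m \<ge> 1"
  shows "y_coeff (2 * m + 1) 0 =
    (- 1) ^ m * of_int (double_fact (2 * int m - 3)) / (4 ^ (m - 1) * of_int (double_fact (2 * int m)))"
proof -
  obtain j where j: "m = Suc j" using m by (cases m) auto
  have n: "2 * m + 1 \<ge> 3" using m by simp
  have e: "0 + of_nat (2 * m + 1) / 2 - 2 = (of_nat j - 1 / 2 :: rat)" "0 + (of_nat (2 * m + 1) / 2 + 1) = 0 + of_nat (2 * m + 1) / 2 + (1 :: rat)"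
    "2 * m + 1 - 3 = 2 * j" "2 * m + 1 - 1 = 2 * Suc j" "2 * m + 1 - 2 = 2 * j + 1" "of_nat (2 * m + 1) / 2 - 1 = (of_nat (2 * j + 1) / 2 :: rat)"
    "m - 1 = j" "2 * int m - 3 = 2 * int j - 1"
    using j by (simp_all add: field_simps)
  define x where "x = (of_nat (2 * j + 1) :: rat)"
  define y where "y = (of_nat (2 * Suc j) :: rat)"
  have xy: "x \<noteq> 0" "y \<noteq> 0" "y = x + 1" unfolding x_def y_def by simp_all
  have d: "double_fact (2 * int m) = int (2 * Suc j) * double_fact (2 * int j)"
    using double_fact_rec[of "2 * int (Suc j)"] j by simp
  have d': "of_int (double_fact (2 * int m)) = y * of_int (double_fact (2 * int j))"
    unfolding d y_def by simp
  have nz: "of_int (double_fact (2 * int j)) \<noteq> (0 :: rat)" using double_fact_pos[of "2 * int j"] by simp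
  have key: "- (w + 4 * (w * (0\<^sup>2 - (x / 2)\<^sup>2) / (y * x))) = - (w / y)" for w
  proof -
    have "w * y - w * x = w" unfolding xy(3) by (simp add: algebra_simps)
    then have "w - w * x / y = w / y" using xy(2) by (simp add: field_simps)
    moreover have "4 * (w * (0\<^sup>2 - (x / 2)\<^sup>2) / (y * x)) = - (w * x / y)"
      using xy(1,2) by (simp add: power2_eq_square)
    ultimately show ?thesis by simp
  qed
  have "(\<Sum>k<2 * m + 1. y_coeff (2 * m + 1) k * 0 ^ k) = y_coeff (2 * m + 1) 0"
    unfolding Suc_eq_plus1[symmetric] sum.lessThan_Suc_shift by simp
  then have "y_coeff (2 * m + 1) 0 = (\<Sum>k<2 * m + 1. y_coeff (2 * m + 1) k * 0 ^ k)" ..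
  also have "\<dots> = - (gchoose_gap (2 * m + 1) (0 + of_nat (2 * m + 1) / 2 + 1) + gchoose_gap (2 * m + 1) (0 + of_nat (2 * m + 1) / 2))"
    unfolding y_coeff_sum(1)[OF n] e(2) ..
  also have "\<dots> = - (((of_nat j - 1 / 2) gchoose (2 * j)) / y)"
    unfolding gchoose_gap_add_eq[OF n] unfolding e x_def[symmetric] y_def[symmetric]
    by (simp only: key)
  finally show ?thesis
    unfolding gbinomial_half_eq_double_fact e d' using nz xy by (simp add: j field_simps)
qed

section \<open>The determinants\<close>

lemma real_sphere_mult:
  assumes n: "n \<ge> 1"
  shows "real (sphere_mult n (Suc j)) = gchoose_gap n (real (j + n + 1))"
proof -
  obtain m where m: "n = Suc m" using n by (cases n) auto
  have s: "sphere_mult (Suc m) (Suc j) = (j + m + 1 choose m) + (j + m choose m)"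
    by (simp add: sphere_mult_def add.commute)
  have e: "real (j + Suc m + 1) - 1 = real (j + m + 1)" "real (j + Suc m + 1) - 2 = real (j + m)" by simp_all
  show ?thesis
    unfolding m s gchoose_gap_Suc e of_nat_add[of "j + m + 1 choose m"] binomial_gbinomial ..
qed

text \<open>The hockey-stick identity. The summand for \<open>l\<close> counts the lattice points of
  the Barnes zeta function of order \<open>l\<close>; order \<open>n\<close> occurs twice in total,
  hence the exponent \<open>-2\<close> of \<open>barnes_Gamma n\<close> beside \<open>-1\<close> for
  the lower orders.\<close>

lemma sphere_mult_eq_sum:
  assumes n: "n \<ge> 1"
  shows "sphere_mult n (Suc j) = ((j + n - 1) choose (n - 1)) + (\<Sum>l=1..n. (j + l - 1) choose (l - 1))"
proof -
  obtain m where m: "n = Suc m" using n by (cases n) auto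
  have sum: "(\<Sum>l=1..Suc m. (j + l - 1) choose (l - 1)) = (j + Suc m) choose m" for m
  proof (induction m)
    case (Suc m)
    have "(\<Sum>l=1..Suc (Suc m). (j + l - 1) choose (l - 1)) =
        (\<Sum>l=1..Suc m. (j + l - 1) choose (l - 1)) + ((j + Suc m) choose Suc m)"
      by (subst sum.cl_ivl_Suc) simp
    then show ?case unfolding Suc.IH by simp
  qed simp
  show ?thesis unfolding m sum by (simp add: sphere_mult_def add.commute)
qed

text \<open>Grouping the lattice points of the Barnes zeta function by coordinate sum turns it into a
  one-dimensional series with polynomial coefficients.\<close>

lemma zeta_reg_barnes:
  assumes l: "l \<ge> 1" and a: "a > (0::real)"
  shows "zeta_reg (\<lambda>j w. of_nat ((j + l - 1) choose (l - 1)) * of_real (real j + a) powr (- w)) UNIV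
    (deriv (barnes_zeta l (of_real a)) 0)"
proof -
  define T where "T = coeff (gchoose_poly (real l - 1 - a) (l - 1))"
  have T: "real ((j + l - 1) choose (l - 1)) = (\<Sum>d<l. T d * (real j + a) ^ d)" for j
  proof -
    have deg: "degree (gchoose_poly (real l - 1 - a) (l - 1)) < l"
      using l by (simp add: gchoose_poly_degree)
    have e: "real j + a + (real l - 1 - a) = real (j + l - 1)" using l by (simp add: of_nat_diff)
    show ?thesis
      unfolding T_def poly_eq_sum_lessThan[OF deg, symmetric] poly_gchoose_poly e binomial_gbinomial ..
  qed
  define D where "D = (\<Sum>d<l. of_real (T d) * deriv (hurwitz_zeta a) (- of_nat d))"
  let ?t = "\<lambda>j w. of_nat ((j + l - 1) choose (l - 1)) * complex_of_real (real j + a) powr (- w)"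
  let ?L = "\<lambda>j. {ms :: nat list. length ms = l \<and> sum_list ms = j}"
  have D: "zeta_reg ?t UNIV D"
    using zeta_reg_polynomial[OF a, where n = l and T = T] unfolding T[symmetric] D_def[symmetric] of_real_of_nat_eq .
  obtain F c where F: "F meromorphic_on UNIV" "F analytic_on {0}"
    "\<And>c'. c' \<ge> c \<Longrightarrow> F analytic_on {w. Re w > c'}"
    "\<And>w. Re w > c \<Longrightarrow> ((\<lambda>j. ?t j w) has_sum F w) UNIV" "deriv F 0 = D"
    by (rule zeta_regE[OF D]) blast
  have card: "card (?L j) = (j + l - 1) choose (l - 1)" for j
    using binomial_symmetric[of j "j + l - 1"] l by (simp add: card_length_sum_list)
  have fin: "finite (?L j)" for j
    using card[of j] l by (intro card_ge_0_finite) (simp add: zero_less_binomial_iff)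
  have bij: "bij_betw snd (Sigma UNIV ?L) {ms. length ms = l}"
    unfolding bij_betw_def by (auto simp: inj_on_def image_iff)
  have S: "((\<lambda>ms. (of_nat (sum_list ms) + complex_of_real a) powr (- w)) has_sum F w) {ms. length ms = l}"
    if w: "Re w > c" for w
  proof -
    let ?f = "\<lambda>(j, ms :: nat list). complex_of_real (real j + a) powr (- w)"
    have pos: "real j + a > 0" for j using a by (simp add: add_nonneg_pos)
    have nrm: "norm (complex_of_real (real j + a) powr (- w)) = (real j + a) powr (- Re w)" for j
      using pos[of j] by (subst norm_powr_real_powr) simp_all
    have sumf: "(\<Sum>ms\<in>?L j. ?f (j, ms)) = ?t j w" for j
      by (simp add: card)
    have "(\<lambda>j. norm (?t j w)) summable_on UNIV"
      by (rule summable_on_iff_abs_summable_on_complex[THEN iffD1, OF has_sum_imp_summable[OF F(4)[OF w]]])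
    \<comment> \<open>All summands of one fibre are equal, so the norm of the grouped term is the
      sum of the norms. Absolute convergence of the one-dimensional series then gives that over the
      lattice.\<close>
    moreover have nt: "norm (?t j w) = norm (\<Sum>\<^sub>\<infinity>ms\<in>?L j. norm (?f (j, ms)))" for j
      using fin[of j] by (simp add: card norm_mult)
    ultimately have "(\<lambda>j. norm (\<Sum>\<^sub>\<infinity>ms\<in>?L j. norm (?f (j, ms)))) summable_on UNIV"
      by (simp only:)
    then have "(\<lambda>p. norm (?f p)) summable_on Sigma UNIV ?L"
      unfolding Infinite_Sum.abs_summable_on_Sigma_iff by (intro conjI ballI summable_on_finite[OF fin])
    then have summable: "?f summable_on Sigma UNIV ?L"
      unfolding summable_on_iff_abs_summable_on_complex .
    have "(?f has_sum F w) (Sigma UNIV ?L)"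
    proof (rule has_sum_SigmaI[OF _ F(4)[OF w] summable])
      fix j :: nat
      show "((\<lambda>ms. ?f (j, ms)) has_sum ?t j w) (?L j)"
        by (rule has_sum_finiteI[OF fin sumf[symmetric]])
    qed
    then have "((\<lambda>p. (of_nat (sum_list (snd p)) + complex_of_real a) powr (- w)) has_sum F w) (Sigma UNIV ?L)"
      by (rule has_sum_cong[THEN iffD1, rotated]) auto
    then show ?thesis
      by (rule has_sum_reindex_bij_betw[OF bij, where f = "\<lambda>ms. (of_nat (sum_list ms) + complex_of_real a) powr (- w)", THEN iffD1])
  qed
  have "zeta_reg (\<lambda>ms w. (of_nat (sum_list ms) + complex_of_real a) powr (- w)) {ms. length ms = l} D"
    by (rule zeta_regI[OF F(1,2) F(3)[OF order_refl] S F(5)])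
  then have "deriv (barnes_zeta l (of_real a)) 0 = D"
    unfolding barnes_zeta_def by (rule zeta_reg_continued_sum)
  then show ?thesis using D by simp
qed

definition barnes_sum :: "nat \<Rightarrow> complex \<Rightarrow> complex" where
  "barnes_sum n z = deriv (barnes_zeta n z) 0 + (\<Sum>l=1..n. deriv (barnes_zeta l z) 0)"

lemma zeta_reg_barnes_sum:
  assumes n: "n \<ge> 1" and a: "a > 0"
  shows "zeta_reg (\<lambda>j w. of_nat (sphere_mult n (Suc j)) * of_real (real j + a) powr (- w)) UNIV (barnes_sum n (of_real a))"
proof -
  have "zeta_reg (\<lambda>j w. of_nat ((j + n - 1) choose (n - 1)) * of_real (real j + a) powr (- w) +
      (\<Sum>l=1..n. of_nat ((j + l - 1) choose (l - 1)) * of_real (real j + a) powr (- w))) UNIV (barnes_sum n (of_real a))"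
    unfolding barnes_sum_def using n by (intro zeta_reg_add zeta_reg_sum zeta_reg_barnes a) auto
  then show ?thesis
    by (rule zeta_reg_cong[THEN iffD1, rotated 3])
       (simp_all only: sphere_mult_eq_sum[OF n] of_nat_add of_nat_sum distrib_right sum_distrib_right)
qed

lemma exp_barnes_sum:
  assumes "n \<ge> 1"
  shows "exp (- (barnes_sum n a + barnes_sum n b)) =
    (\<Prod>l=1..n - 1. inverse (barnes_Gamma l a * barnes_Gamma l b)) * inverse ((barnes_Gamma n a * barnes_Gamma n b)\<^sup>2)"
proof -
  obtain m where m: "n = Suc m" using assms by (cases n) auto
  have s: "exp (- barnes_sum n z) = (\<Prod>l=1..m. inverse (barnes_Gamma l z)) * inverse ((barnes_Gamma n z)\<^sup>2)" for z
  proof -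
    have "barnes_sum n z = 2 * deriv (barnes_zeta n z) 0 + (\<Sum>l=1..m. deriv (barnes_zeta l z) 0)"
      unfolding barnes_sum_def m by simp
    then have e: "- barnes_sum n z = - deriv (barnes_zeta n z) 0 + - deriv (barnes_zeta n z) 0 + (\<Sum>l=1..m. - deriv (barnes_zeta l z) 0)"
      by (simp add: sum_negf)
    show ?thesis
      unfolding e exp_add by (simp add: exp_sum exp_minus barnes_Gamma_def power2_eq_square mult_ac)
  qed
  have "exp (- (barnes_sum n a + barnes_sum n b)) = exp (- barnes_sum n a) * exp (- barnes_sum n b)"
    by (simp add: exp_add[symmetric])
  also have "\<dots> = ((\<Prod>l=1..m. inverse (barnes_Gamma l a)) * (\<Prod>l=1..m. inverse (barnes_Gamma l b))) *
      (inverse ((barnes_Gamma n a)\<^sup>2) * inverse ((barnes_Gamma n b)\<^sup>2))"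
    unfolding s by (simp only: mult_ac)
  finally show ?thesis
    unfolding prod.distrib[symmetric] by (simp add: m power_mult_distrib)
qed

text \<open>The condition on \<open>2 * a + b\<close> puts the midpoint of the two factors where
  \<open>P_fun\<close> gives the multiplicity, with \<open>s = b / 2\<close>. It holds for
  \<open>a = 1\<close>, \<open>b = n - 1\<close> and for \<open>a = n / 2\<close>,
  \<open>b = 1\<close>.\<close>

lemma zeta_reg_sphere_product:
  assumes n: "n \<ge> 1" and a: "a > 0" "a + b > 0" and ab: "2 * a + b = real n + 1"
    and D1: "zeta_reg (\<lambda>j w. of_nat (sphere_mult n (Suc j)) * of_real (real j + a) powr (- w)) UNIV D1"
    and D2: "zeta_reg (\<lambda>j w. of_nat (sphere_mult n (Suc j)) * of_real (real j + a + b) powr (- w)) UNIV D2"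
  shows "zeta_reg (\<lambda>j w. of_nat (sphere_mult n (Suc j)) * of_real ((real j + a) * (real j + a + b)) powr (- w)) UNIV
    (D1 + D2 - of_real (f1 n (b / 2)))"
proof -
  have Q: "(\<Sum>d<n. T_coeff n (b / 2) d * (real j + a) ^ d) = real (sphere_mult n (Suc j))" for j
  proof -
    have e: "real j + a + b / 2 + n_check n + 1 = real (j + n + 1)"
      using ab by (simp add: n_check_def field_simps)
    show ?thesis
      unfolding P_fun_T_coeff[OF n, symmetric] P_fun_gap real_sphere_mult[OF n] e ..
  qed
  have f: "of_real (\<Sum>d<n. T_coeff n (b / 2) d * (b ^ (d + 1) * ((- 1) ^ d * harm d / real (d + 1)) / 2)) =
      - complex_of_real (f1 n (b / 2))"
    unfolding f1_eq[OF n] by simp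
  have "zeta_reg (\<lambda>j w. of_real (\<Sum>d<n. T_coeff n (b / 2) d * (real j + a) ^ d) * of_real ((real j + a) * (real j + a + b)) powr (- w)) UNIV
    (D1 + D2 + of_real (\<Sum>d<n. T_coeff n (b / 2) d * (b ^ (d + 1) * ((- 1) ^ d * harm d / real (d + 1)) / 2)))"
    by (rule zeta_reg_product[OF a]) (unfold Q of_real_of_nat_eq, rule D1, rule D2)
  then show ?thesis unfolding Q f of_real_of_nat_eq by simp
qed

lemma bij_betw_Suc: "bij_betw Suc UNIV {1..}"
  unfolding bij_betw_def by (auto simp: image_iff Suc_le_D intro: Suc_pred[symmetric])

lemma zeta_det_laplacian_eq:
  assumes n: "n \<ge> 1" and dim: "DIM('a::euclidean_space) = n + 1"
    and D1: "zeta_reg (\<lambda>j w. of_nat (sphere_mult n (Suc j)) * of_real (real j + 1) powr (- w)) UNIV D1"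
    and D2: "zeta_reg (\<lambda>j w. of_nat (sphere_mult n (Suc j)) * of_real (real j + real n) powr (- w)) UNIV D2"
  shows "zeta_det (smooth_sphere_functions :: ('a \<Rightarrow> real) set) sphere_laplacian =
    exp (of_real (f1 n (n_check n)) - (D1 + D2))"
proof -
  have e: "real j + 1 + (real n - 1) = real j + real n" for j by simp
  have "zeta_reg (\<lambda>j w. of_nat (sphere_mult n (Suc j)) * of_real ((real j + 1) * (real j + real n)) powr (- w)) UNIV
      (D1 + D2 - of_real (f1 n ((real n - 1) / 2)))"
    using zeta_reg_sphere_product[OF n, of 1 "real n - 1" D1 D2] D1 D2 n unfolding e by simp
  then have "zeta_reg (\<lambda>j w. of_nat (sphere_mult n (Suc j)) * of_real (real (Suc j) * (real (Suc j) + real n - 1)) powr (- w)) UNIV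
      (D1 + D2 - of_real (f1 n (n_check n)))"
    by (simp add: n_check_def add.commute)
  then have "zeta_reg (\<lambda>k w. of_nat (sphere_mult n k) * of_real (real k * (real k + real n - 1)) powr (- w)) {1..}
      (D1 + D2 - of_real (f1 n (n_check n)))"
    by (rule zeta_reg_reindex[OF bij_betw_Suc, THEN iffD1])
  from zeta_det_laplacian[OF n dim this] show ?thesis by simp
qed

lemma zeta_det_conformal_eq:
  assumes n: "n \<ge> 1" and dim: "DIM('a::euclidean_space) = n + 1"
    and D1: "zeta_reg (\<lambda>j w. of_nat (sphere_mult n (Suc j)) * of_real (real j + real n / 2) powr (- w)) UNIV D1"
    and D2: "zeta_reg (\<lambda>j w. of_nat (sphere_mult n (Suc j)) * of_real (real j + (real n / 2 + 1)) powr (- w)) UNIV D2"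
  shows "zeta_det (smooth_sphere_functions :: ('a \<Rightarrow> real) set) (conformal_laplacian n) =
    of_real (real n * (real n - 2) / 4) ^ (if n \<ge> 3 then 1 else 0) * exp (of_real (f1 n (1 / 2)) - (D1 + D2))"
proof -
  let ?t = "\<lambda>k w. of_nat (sphere_mult n k) * complex_of_real ((real k + real n / 2 - 1) * (real k + real n / 2)) powr (- w)"
  let ?D = "D1 + D2 - of_real (f1 n (1 / 2))"
  have "zeta_reg (\<lambda>j w. of_nat (sphere_mult n (Suc j)) * of_real ((real j + real n / 2) * (real j + real n / 2 + 1)) powr (- w)) UNIV ?D"
    by (rule zeta_reg_sphere_product[OF n _ _ _ D1 D2[folded add.assoc]]) (use n in auto)
  then have "zeta_reg (\<lambda>j w. ?t (Suc j) w) UNIV ?D"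
    by (rule zeta_reg_cong[THEN iffD1, rotated 3]) (simp_all add: add_ac)
  then have D: "zeta_reg ?t {1..} ?D"
    by (rule zeta_reg_reindex[OF bij_betw_Suc, THEN iffD1])
  show ?thesis
  proof (cases "n \<ge> 3")
    case False
    then show ?thesis using zeta_det_conformal[OF n dim, of ?D] D by simp
  next
    \<comment> \<open>Degree 0 lies outside the series over \<open>Suc j\<close>. Its eigenvalue, of
      multiplicity 1, enters the determinant as the prefactor.\<close>
    case True
    let ?c = "real n * (real n - 2) / 4"
    have c: "?c > 0" using True by simp
    have c': "(real 0 + real n / 2 - 1) * (real 0 + real n / 2) = ?c" by (simp add: field_simps)
    have "zeta_reg ?t {0} (- (of_nat (sphere_mult n 0) * of_real (ln ((real 0 + real n / 2 - 1) * (real 0 + real n / 2)))))"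
      using zeta_reg_single[OF c[folded c'], of "\<lambda>k. of_nat (sphere_mult n k)" 0]
      by (rule zeta_reg_cong[THEN iffD1, rotated 3]) (simp_all only: singleton_iff)
    then have 0: "zeta_reg ?t {0} (- of_real (ln ?c))" unfolding c' by (simp add: sphere_mult_def)
    have "zeta_reg ?t ({0} \<union> {1..}) (- of_real (ln ?c) + ?D)"
      by (rule zeta_reg_Un_disjoint[OF 0 D]) auto
    moreover have I: "{0} \<union> {1..} = {if n \<ge> 3 then 0 else 1 :: nat..}" using True by auto
    ultimately have "zeta_reg ?t {if n \<ge> 3 then 0 else 1 :: nat..} (- of_real (ln ?c) + ?D)" by (simp only:)
    then have "zeta_det (smooth_sphere_functions :: ('a \<Rightarrow> real) set) (conformal_laplacian n) = exp (- (- of_real (ln ?c) + ?D))"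
      by (rule zeta_det_conformal[OF n dim])
    also have "- (- of_real (ln ?c) + ?D) = of_real (ln ?c) + (of_real (f1 n (1 / 2)) - (D1 + D2))" by simp
    also have "exp \<dots> = exp (of_real (ln ?c)) * exp (of_real (f1 n (1 / 2)) - (D1 + D2))" by (rule exp_add)
    also have "exp (complex_of_real (ln ?c)) = of_real ?c" using c by (simp only: exp_of_real exp_ln)
    finally show ?thesis using True by simp
  qed
qed

section \<open>Closed forms by shifting both progressions\<close>

lemma zeta_reg_prepend:
  fixes g x :: "nat \<Rightarrow> real"
  assumes "zeta_reg (\<lambda>j w. of_real (g (j + r)) * of_real (x (j + r)) powr (- w)) UNIV D" "\<And>i. x i > 0"
  shows "zeta_reg (\<lambda>i w. of_real (g i) * of_real (x i) powr (- w)) UNIV (D - of_real (\<Sum>i<r. g i * ln (x i)))"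
  using assms
proof (induction r arbitrary: D)
  case (Suc r)
  let ?t = "\<lambda>j w. complex_of_real (g (j + r)) * complex_of_real (x (j + r)) powr (- w)"
  have "zeta_reg (\<lambda>j w. ?t (Suc j) w) UNIV D" using Suc.prems(1) by simp
  then have 1: "zeta_reg ?t {1..} D" by (rule zeta_reg_reindex[OF bij_betw_Suc, THEN iffD1])
  have 0: "zeta_reg ?t {0} (- (of_real (g r) * of_real (ln (x r))))"
    using zeta_reg_single[OF Suc.prems(2), of "\<lambda>k. of_real (g r)" r 0]
    by (rule zeta_reg_cong[THEN iffD1, rotated 3]) auto
  have "zeta_reg ?t ({0} \<union> {1..}) (- (of_real (g r) * of_real (ln (x r))) + D)"
    by (rule zeta_reg_Un_disjoint[OF 0 1]) auto
  moreover have "{0} \<union> {1..} = (UNIV :: nat set)" by auto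
  ultimately have "zeta_reg ?t UNIV (- (of_real (g r) * of_real (ln (x r))) + D)" by simp
  from Suc.IH[OF this Suc.prems(2)] show ?case by (simp add: algebra_simps)
qed simp

text \<open>The polynomial \<open>gchoose_gap n\<close> vanishes at the integers from 2 to \<open>n - 1\<close>, so that prepending
  the missing terms to a shifted series costs a single logarithm.\<close>

lemma zeta_reg_prepend_gap:
  assumes n: "n \<ge> 1" and q: "q \<ge> 2" "r + q = n + 1" and \<alpha>: "\<alpha> > 0"
    and D: "zeta_reg (\<lambda>j w. of_nat (sphere_mult n (Suc j)) * of_real (real (j + r) + \<alpha>) powr (- w)) UNIV D"
  shows "zeta_reg (\<lambda>i w. of_real (gchoose_gap n (real (i + q))) * of_real (real i + \<alpha>) powr (- w)) UNIV
    (D - of_real (if r = 0 then 0 else ln (real r - 1 + \<alpha>)))"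
proof -
  have "real (sphere_mult n (Suc j)) = gchoose_gap n (real (j + r + q))" for j
    using q(2) by (simp add: real_sphere_mult[OF n] add.assoc)
  then have "zeta_reg (\<lambda>j w. of_real (gchoose_gap n (real (j + r + q))) * of_real (real (j + r) + \<alpha>) powr (- w)) UNIV D"
    using D by (metis (no_types, lifting) of_real_of_nat_eq zeta_reg_cong)
  then have "zeta_reg (\<lambda>i w. of_real (gchoose_gap n (real (i + q))) * of_real (real i + \<alpha>) powr (- w)) UNIV
    (D - of_real (\<Sum>i<r. gchoose_gap n (real (i + q)) * ln (real i + \<alpha>)))"
    by (rule zeta_reg_prepend) (simp add: \<alpha> add_nonneg_pos)
  moreover have "(\<Sum>i<r. gchoose_gap n (real (i + q)) * ln (real i + \<alpha>)) = (if r = 0 then 0 else ln (real r - 1 + \<alpha>))"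
  proof (cases r)
    case (Suc k)
    have "(\<Sum>i<r. gchoose_gap n (real (i + q)) * ln (real i + \<alpha>)) = (\<Sum>i<r. if i = k then ln (real k + \<alpha>) else 0)"
    proof (intro sum.cong refl)
      fix i assume "i \<in> {..<r}"
      then have "2 \<le> i + q" "i + q \<le> n" "i + q = n \<longleftrightarrow> i = k" using q Suc by auto
      then show "gchoose_gap n (real (i + q)) * ln (real i + \<alpha>) = (if i = k then ln (real k + \<alpha>) else 0)"
        using gchoose_gap_of_nat[where 'a = real, of "i + q" n] by auto
    qed
    then show ?thesis using Suc by (simp add: sum.delta)
  qed simp
  ultimately show ?thesis by (simp only:)
qed

text \<open>Both progressions are extended down to the same start \<open>\<alpha>\<close> by
  prepending \<open>r1\<close> and \<open>r2\<close> terms, each at the price of at most one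
  logarithm. With common base points the two multiplicities add up to one polynomial, with
  coefficients \<open>c\<close>.\<close>

lemma shifted_sum_eq_hurwitz:
  assumes n: "n \<ge> 1" and \<alpha>: "\<alpha> > 0"
    and q1: "q1 \<ge> 2" "r1 + q1 = n + 1" and q2: "q2 \<ge> 2" "r2 + q2 = n + 1"
    and D1: "zeta_reg (\<lambda>j w. of_nat (sphere_mult n (Suc j)) * of_real (real (j + r1) + \<alpha>) powr (- w)) UNIV D1"
    and D2: "zeta_reg (\<lambda>j w. of_nat (sphere_mult n (Suc j)) * of_real (real (j + r2) + \<alpha>) powr (- w)) UNIV D2"
    and c: "\<And>i. (\<Sum>k<n. c k * (real i + \<alpha>) ^ k) = gchoose_gap n (real (i + q1)) + gchoose_gap n (real (i + q2))"
  shows "D1 + D2 = of_real (if r1 = 0 then 0 else ln (real r1 - 1 + \<alpha>)) + of_real (if r2 = 0 then 0 else ln (real r2 - 1 + \<alpha>))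
    + (\<Sum>k<n. of_real (c k) * deriv (hurwitz_zeta \<alpha>) (- of_nat k))"
proof -
  let ?l = "\<lambda>r. complex_of_real (if r = 0 then 0 else ln (real r - 1 + \<alpha>))"
  have "zeta_reg (\<lambda>i w. of_real (gchoose_gap n (real (i + q1))) * of_real (real i + \<alpha>) powr (- w) +
      of_real (gchoose_gap n (real (i + q2))) * of_real (real i + \<alpha>) powr (- w)) UNIV ((D1 - ?l r1) + (D2 - ?l r2))"
    by (intro zeta_reg_add zeta_reg_prepend_gap[OF n q1 \<alpha> D1] zeta_reg_prepend_gap[OF n q2 \<alpha> D2])
  then have "zeta_reg (\<lambda>i w. of_real (\<Sum>k<n. c k * (real i + \<alpha>) ^ k) * of_real (real i + \<alpha>) powr (- w)) UNIV ((D1 - ?l r1) + (D2 - ?l r2))"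
    unfolding c of_real_add distrib_right .
  then have "(D1 - ?l r1) + (D2 - ?l r2) = (\<Sum>k<n. of_real (c k) * deriv (hurwitz_zeta \<alpha>) (- of_nat k))"
    using zeta_reg_polynomial[OF \<alpha>] by (rule zeta_reg_unique)
  then show ?thesis by (simp add: algebra_simps)
qed

lemma of_real_of_rat: "complex_of_real (of_rat q) = of_rat q"
  by (cases q) (simp add: of_rat_rat)

lemma gap_sum_of_rat:
  assumes "\<And>z. (\<Sum>k<n. c k * z ^ k) = - (gchoose_gap n (z + a) + gchoose_gap n (z + b))"
  shows "(\<Sum>k<n. - real_of_rat (c k) * of_rat z ^ k) = gchoose_gap n (of_rat z + of_rat a) + gchoose_gap n (of_rat z + of_rat b)"
proof -
  have "real_of_rat (\<Sum>k<n. c k * z ^ k) = of_rat (- (gchoose_gap n (z + a) + gchoose_gap n (z + b)))"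
    unfolding assms ..
  then show ?thesis
    by (simp add: of_rat_sum of_rat_mult of_rat_power of_rat_minus of_rat_add of_rat_diff of_rat_gchoose_gap sum_negf)
qed

lemma gchoose_gap_1: "gchoose_gap (Suc 0) (a :: real) = 2"
  by (simp add: gchoose_gap_def)

lemma gchoose_gap_2: "gchoose_gap 2 (a :: real) = 2 * a - 3"
  unfolding numeral_2_eq_2 gchoose_gap_Suc by simp

lemma f1_2_half: "f1 2 (1 / 2) = 1 / 2"
proof -
  have T: "T_coeff 2 (1 / 2) 0 + T_coeff 2 (1 / 2) 1 * x = 2 * x + 1" for x
  proof -
    have "{..<2 :: nat} = {0, 1}" by auto
    then show ?thesis
      using P_fun_T_coeff[of 2 x "1 / 2"] by (simp add: P_fun_gap gchoose_gap_2 n_check_def)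
  qed
  have "T_coeff 2 (1 / 2) 1 = 2" using T[of 0] T[of 1] by simp
  then show ?thesis by (simp add: f1_def)
qed

text \<open>Only the progression starting at \<open>n\<close> is shifted, by \<open>n - 1\<close>
  steps; its last prepended point is \<open>n - 1\<close>, which gives the logarithm. For
  \<open>n = 1\<close> there is no shift and no logarithm, and the polynomial is the constant
  4.\<close>

lemma barnes_sum_laplacian:
  assumes n: "n \<ge> 1"
  shows "n \<ge> 2 \<Longrightarrow> barnes_sum n 1 + barnes_sum n (of_nat n) =
      of_real (ln (real n - 1)) - (\<Sum>k=0..n - 1. of_rat (d_coeff n k) * deriv riemann_zeta (- of_nat k))"
    and "n = 1 \<Longrightarrow> barnes_sum n 1 + barnes_sum n (of_nat n) = - of_real (2 * ln (2 * pi))"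
proof -
  have D1: "zeta_reg (\<lambda>j w. of_nat (sphere_mult n (Suc j)) * of_real (real (j + 0) + 1) powr (- w)) UNIV (barnes_sum n 1)"
    using zeta_reg_barnes_sum[OF n, of 1] by simp
  have e: "real (j + (n - 1)) + 1 = real j + real n" for j using n by (simp add: of_nat_diff)
  have D2: "zeta_reg (\<lambda>j w. of_nat (sphere_mult n (Suc j)) * of_real (real (j + (n - 1)) + 1) powr (- w)) UNIV (barnes_sum n (of_nat n))"
    using zeta_reg_barnes_sum[OF n, of "real n"] n unfolding e by simp
  have pos: "(1 :: real) > 0" by simp
  show "barnes_sum n 1 + barnes_sum n (of_nat n) =
      of_real (ln (real n - 1)) - (\<Sum>k=0..n - 1. of_rat (d_coeff n k) * deriv riemann_zeta (- of_nat k))" if n2: "n \<ge> 2"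
  proof -
    have q: "n + 1 \<ge> 2" "0 + (n + 1) = n + 1" "(2 :: nat) \<ge> 2" "(n - 1) + 2 = n + 1" using n2 by auto
    have c: "(\<Sum>k<n. - real_of_rat (d_coeff n k) * (real i + 1) ^ k) = gchoose_gap n (real (i + (n + 1))) + gchoose_gap n (real (i + 2))" for i
      using gap_sum_of_rat[OF d_coeff_sum(1)[OF n], of "of_nat i + 1"] by (simp add: of_rat_add add_ac)
    have l: "n - 1 \<noteq> 0" "real (n - 1) - 1 + 1 = real n - 1" using n2 by (auto simp: of_nat_diff)
    show ?thesis
      unfolding atMost_minus_1[OF n] using shifted_sum_eq_hurwitz[OF n pos q D1 D2 c] l
      by (simp add: of_real_of_rat deriv_riemann_zeta sum_negf)
  qed
  show "barnes_sum n 1 + barnes_sum n (of_nat n) = - of_real (2 * ln (2 * pi))" if n1: "n = 1"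
  proof -
    have q: "(2 :: nat) \<ge> 2" "0 + 2 = n + 1" "(n - 1) + 2 = n + 1" using n1 by auto
    have c: "(\<Sum>k<n. 4 * (real i + 1) ^ k) = gchoose_gap n (real (i + 2)) + gchoose_gap n (real (i + 2))" for i
      by (simp add: n1 gchoose_gap_1)
    show ?thesis
      using shifted_sum_eq_hurwitz[OF n pos q(1,2) q(1,3) D1 D2 c] by (simp add: n1 deriv_hurwitz_zeta_1_0)
  qed
qed

lemma barnes_sum_conformal_1: "barnes_sum 1 (of_nat 1 / 2) + barnes_sum 1 (of_nat 1 / 2 + 1) = - of_real (4 * ln 2)"
proof -
  have m: "sphere_mult 1 (Suc j) = 2" for j by (simp add: sphere_mult_def)
  have D: "barnes_sum 1 (of_real a) = 2 * deriv (hurwitz_zeta a) 0" if a: "a > 0" for a :: real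
  proof -
    have "zeta_reg (\<lambda>j w. of_real (\<Sum>d<1. 2 * (real j + a) ^ d) * of_real (real j + a) powr (- w)) UNIV
        (\<Sum>d<1. of_real 2 * deriv (hurwitz_zeta a) (- of_nat d))"
      by (rule zeta_reg_polynomial[OF a])
    then have "zeta_reg (\<lambda>j w. of_nat 2 * of_real (real j + a) powr (- w)) UNIV (2 * deriv (hurwitz_zeta a) 0)" by simp
    then show ?thesis using zeta_reg_barnes_sum[OF order_refl a] unfolding m by (rule zeta_reg_unique[rotated])
  qed
  show ?thesis
    using D[of "1 / 2"] D[of "3 / 2"] by (simp add: deriv_hurwitz_zeta_half_0)
qed

text \<open>For even \<open>n\<close> the progressions consist of integers and are shifted to 1, for
  odd \<open>n\<close> of half-integers and are shifted to \<open>1 / 2\<close>. The logarithms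
  belong to the last prepended points, which for \<open>n \<ge> 3\<close> are
  \<open>n / 2 - 1\<close> and \<open>n / 2\<close>.\<close>

lemma barnes_sum_conformal:
  assumes n: "n \<ge> 1"
  shows "n = 2 \<Longrightarrow> barnes_sum n (of_nat n / 2) + barnes_sum n (of_nat n / 2 + 1) = 4 * deriv riemann_zeta (- 1)"
    and "m \<ge> 1 \<Longrightarrow> n = 2 * m + 1 \<Longrightarrow> barnes_sum n (of_nat n / 2) + barnes_sum n (of_nat n / 2 + 1) =
      of_real (ln (real m - 1 / 2)) + of_real (ln (real m + 1 / 2)) +
      (of_real (ln 2) * of_rat (y_coeff n 0) / 2
        - (\<Sum>k=0..2 * m. (1 / 2 ^ k - 1) * of_rat (y_coeff (2 * m + 1) k) * deriv riemann_zeta (- of_nat k)))"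
    and "m \<ge> 2 \<Longrightarrow> n = 2 * m \<Longrightarrow> barnes_sum n (of_nat n / 2) + barnes_sum n (of_nat n / 2 + 1) =
      of_real (ln (real m - 1)) + of_real (ln (real m)) -
      (\<Sum>k=0..2 * m - 1. of_rat (y_coeff (2 * m) k) * deriv riemann_zeta (- of_nat k))"
proof -
  let ?B = "barnes_sum n (of_nat n / 2)" and ?B' = "barnes_sum n (of_nat n / 2 + 1)"
  have D: "zeta_reg (\<lambda>j w. of_nat (sphere_mult n (Suc j)) * of_real (real (j + r) + \<alpha>) powr (- w)) UNIV ?B"
    if r: "real r + \<alpha> = real n / 2" for r \<alpha>
  proof -
    have "real (j + r) + \<alpha> = real j + real n / 2" for j using r by simp
    then show ?thesis using zeta_reg_barnes_sum[OF n, of "real n / 2"] n by (simp only:) simp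
  qed
  have D': "zeta_reg (\<lambda>j w. of_nat (sphere_mult n (Suc j)) * of_real (real (j + r) + \<alpha>) powr (- w)) UNIV ?B'"
    if r: "real r + \<alpha> = real n / 2 + 1" for r \<alpha>
  proof -
    have "real (j + r) + \<alpha> = real j + (real n / 2 + 1)" for j using r by simp
    then show ?thesis using zeta_reg_barnes_sum[OF n, of "real n / 2 + 1"] n by (simp only:) simp
  qed
  have p1: "(1 :: real) > 0" and p2: "(1 / 2 :: real) > 0" by simp_all
  show "?B + ?B' = 4 * deriv riemann_zeta (- 1)" if n2: "n = 2"
  proof -
    have q: "(3 :: nat) \<ge> 2" "0 + 3 = n + 1" "(2 :: nat) \<ge> 2" "1 + 2 = n + 1" using n2 by auto
    \<comment> \<open>For \<open>n = 2\<close> the two gaps are added directly and give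
      \<open>4 * (i + 1)\<close>; the one prepended point is 1, whose logarithm is 0.\<close>
    have c: "(\<Sum>k<n. (if k = 1 then 4 else 0) * (real i + 1) ^ k) = gchoose_gap n (real (i + 3)) + gchoose_gap n (real (i + 2))" for i
      unfolding n2 gchoose_gap_2 by (simp add: numeral_2_eq_2)
    have d: "zeta_reg (\<lambda>j w. of_nat (sphere_mult n (Suc j)) * of_real (real (j + 0) + 1) powr (- w)) UNIV ?B"
      "zeta_reg (\<lambda>j w. of_nat (sphere_mult n (Suc j)) * of_real (real (j + 1) + 1) powr (- w)) UNIV ?B'"
      by (rule D D', simp add: n2)+
    have s: "(\<Sum>k<n. of_real (if k = 1 then 4 else 0) * deriv (hurwitz_zeta 1) (- of_nat k)) = 4 * deriv riemann_zeta (- 1)"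
      using deriv_riemann_zeta[of 1] unfolding n2 by (simp add: numeral_2_eq_2)
    show ?thesis
      using shifted_sum_eq_hurwitz[OF n p1 q d c] unfolding s by simp
  qed
  show "?B + ?B' = of_real (ln (real m - 1)) + of_real (ln (real m)) -
      (\<Sum>k=0..2 * m - 1. of_rat (y_coeff (2 * m) k) * deriv riemann_zeta (- of_nat k))" if m: "m \<ge> 2" and nm: "n = 2 * m"
  proof -
    have n3: "n \<ge> 3" using m nm by simp
    have q: "m + 2 \<ge> 2" "(m - 1) + (m + 2) = n + 1" "m + 1 \<ge> 2" "m + (m + 1) = n + 1" using m nm by auto
    have e: "(of_nat n / 2 :: real) = real m" unfolding nm by simp
    have c: "(\<Sum>k<n. - real_of_rat (y_coeff n k) * (real i + 1) ^ k) = gchoose_gap n (real (i + (m + 2))) + gchoose_gap n (real (i + (m + 1)))" for i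
      using gap_sum_of_rat[OF y_coeff_sum(1)[OF n3], of "of_nat i + 1"] by (simp add: of_rat_add of_rat_divide e add_ac)
    have d: "zeta_reg (\<lambda>j w. of_nat (sphere_mult n (Suc j)) * of_real (real (j + (m - 1)) + 1) powr (- w)) UNIV ?B"
      "zeta_reg (\<lambda>j w. of_nat (sphere_mult n (Suc j)) * of_real (real (j + m) + 1) powr (- w)) UNIV ?B'"
      by (rule D D', use m in \<open>simp add: nm of_nat_diff\<close>)+
    have l: "m - 1 \<noteq> 0" "m \<noteq> 0" "real (m - 1) - 1 + 1 = real m - 1" "real m - 1 + 1 = real m"
      using m by (auto simp: of_nat_diff)
    have s: "(\<Sum>k<n. of_real (- real_of_rat (y_coeff n k)) * deriv (hurwitz_zeta 1) (- of_nat k)) =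
        - (\<Sum>k=0..2 * m - 1. of_rat (y_coeff (2 * m) k) * deriv riemann_zeta (- of_nat k))"
      using atMost_minus_1[OF n] by (simp add: nm of_real_of_rat deriv_riemann_zeta sum_negf)
    show ?thesis
      using shifted_sum_eq_hurwitz[OF n p1 q d c] unfolding s l if_not_P[OF l(1)] if_not_P[OF l(2)] by simp
  qed
  show "?B + ?B' = of_real (ln (real m - 1 / 2)) + of_real (ln (real m + 1 / 2)) +
      (of_real (ln 2) * of_rat (y_coeff n 0) / 2
        - (\<Sum>k=0..2 * m. (1 / 2 ^ k - 1) * of_rat (y_coeff (2 * m + 1) k) * deriv riemann_zeta (- of_nat k)))"
    if m: "m \<ge> 1" and nm: "n = 2 * m + 1"
  proof -
    have n3: "n \<ge> 3" using m nm by simp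
    have q: "m + 2 \<ge> 2" "m + (m + 2) = n + 1" "m + 1 \<ge> 2" "(m + 1) + (m + 1) = n + 1" using m nm by auto
    have e: "(of_nat n / 2 :: real) = real m + 1 / 2" unfolding nm by (simp add: field_simps)
    have c: "(\<Sum>k<n. - real_of_rat (y_coeff n k) * (real i + 1 / 2) ^ k) = gchoose_gap n (real (i + (m + 2))) + gchoose_gap n (real (i + (m + 1)))" for i
      using gap_sum_of_rat[OF y_coeff_sum(1)[OF n3], of "of_nat i + 1 / 2"] by (simp add: of_rat_add of_rat_divide e add_ac)
    have d: "zeta_reg (\<lambda>j w. of_nat (sphere_mult n (Suc j)) * of_real (real (j + m) + 1 / 2) powr (- w)) UNIV ?B"
      "zeta_reg (\<lambda>j w. of_nat (sphere_mult n (Suc j)) * of_real (real (j + (m + 1)) + 1 / 2) powr (- w)) UNIV ?B'"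
      by (rule D D', simp add: nm field_simps)+
    have l: "m + 1 \<noteq> 0" "m \<noteq> 0" "real (m + 1) - 1 + 1 / 2 = real m + 1 / 2" "real m - 1 + 1 / 2 = real m - 1 / 2"
      using m by auto
    \<comment> \<open>The zeta values, as opposed to derivatives, produced by the half-integer base
      point. For even \<open>k > 0\<close> the zeta value vanishes, for odd \<open>k\<close> the
      coefficient does, so only \<open>k = 0\<close> remains.\<close>
    define u where "u k = of_rat (y_coeff n k) * ((1 / 2) ^ k * hurwitz_zeta 1 (- of_nat k))" for k
    have u: "u k = 0" if k: "k \<noteq> 0" for k
    proof (cases "even k")
      case True
      then obtain i where i: "k = 2 * i" by (metis evenE)
      then have "hurwitz_zeta 1 (- of_nat k) = 0" using hurwitz_zeta_neg_even[of i] k by simp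
      then show ?thesis by (simp add: u_def)
    next
      case False
      then have "y_coeff n k = 0" using y_coeff_sum(2)[OF n3] nm by simp
      then show ?thesis by (simp add: u_def)
    qed
    have "(\<Sum>k<n. u k) = u 0" using n u by (simp add: sum.remove[of "{..<n}" 0])
    also have "u 0 = - (of_rat (y_coeff n 0) / 2)" by (simp add: u_def hurwitz_zeta_1_0)
    finally have su: "(\<Sum>k<n. u k) = - (of_rat (y_coeff n 0) / 2)" .
    have "(\<Sum>k<n. of_real (- real_of_rat (y_coeff n k)) * deriv (hurwitz_zeta (1 / 2)) (- of_nat k)) =
        (\<Sum>k<n. - (of_real (ln 2) * u k) - (1 / 2 ^ k - 1) * of_rat (y_coeff n k) * deriv riemann_zeta (- of_nat k))"
      by (intro sum.cong refl)
         (simp add: deriv_hurwitz_zeta_half u_def of_real_of_rat deriv_riemann_zeta power_one_over algebra_simps)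
    also have "\<dots> = - (of_real (ln 2) * (\<Sum>k<n. u k)) - (\<Sum>k<n. (1 / 2 ^ k - 1) * of_rat (y_coeff n k) * deriv riemann_zeta (- of_nat k))"
      by (simp only: sum_subtractf sum_negf sum_distrib_left)
    finally have s: "(\<Sum>k<n. of_real (- real_of_rat (y_coeff n k)) * deriv (hurwitz_zeta (1 / 2)) (- of_nat k)) =
        of_real (ln 2) * of_rat (y_coeff n 0) / 2 - (\<Sum>k<n. (1 / 2 ^ k - 1) * of_rat (y_coeff n k) * deriv riemann_zeta (- of_nat k))"
      unfolding su by simp
    have I: "{0..2 * m} = {..<n}" using nm by auto
    show ?thesis
      using shifted_sum_eq_hurwitz[OF n p2 q d c] unfolding I s l if_not_P[OF l(1)] if_not_P[OF l(2)] nm[symmetric] by simp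
  qed
qed

text \<open>Applied with the arguments of the logarithms from the shift: for the conformal Laplacian
  \<open>n * (n - 2) / 4\<close> is exactly the product of \<open>n / 2 - 1\<close> and
  \<open>n / 2\<close>.\<close>

lemma exp_cancel_ln:
  fixes f S :: complex and x y C :: real
  assumes "x > 0" "y > 0" "C = x * y"
  shows "of_real C * exp (f - (of_real (ln x) + of_real (ln y) + S)) = exp (f - S)"
proof -
  have "exp (f - S) = exp (of_real (ln x)) * exp (of_real (ln y)) * exp (f - (of_real (ln x) + of_real (ln y) + S))"
    unfolding exp_add[symmetric] by simp
  also have "exp (complex_of_real (ln x)) = of_real x" using assms(1) by (simp only: exp_of_real exp_ln)
  also have "exp (complex_of_real (ln y)) = of_real y" using assms(2) by (simp only: exp_of_real exp_ln)
  finally show ?thesis unfolding assms(3) by simp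
qed

text \<open>The identities for \<open>d_genfun\<close> and \<open>y_genfun\<close> belong to the
  conclusion because they certify that the definite descriptions behind \<open>d_coeff\<close> and
  \<open>y_coeff\<close> denote the coefficients meant.\<close>

theorem corollary5p1:
  fixes n :: nat and \<Delta> Y :: "('a::euclidean_space \<Rightarrow> real) \<Rightarrow> 'a \<Rightarrow> real"
  assumes n: "n \<ge> 1" and dim: "DIM('a) = n + 1"
    and \<Delta>: "\<Delta> = sphere_laplacian" and Y: "Y = conformal_laplacian n"
  shows
    "(zeta_det smooth_sphere_functions \<Delta> =
        exp (of_real (f1 n (n_check n)))
        * (\<Prod>l=1..n-1. inverse (barnes_Gamma l (of_nat n) * barnes_Gamma l 1))
        * inverse ((barnes_Gamma n (of_nat n) * barnes_Gamma n 1) ^ 2) \<and>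
      (n = 1 \<longrightarrow> zeta_det smooth_sphere_functions \<Delta> = of_real (4 * pi ^ 2)) \<and>
      (n \<ge> 2 \<longrightarrow> zeta_det smooth_sphere_functions \<Delta> =
        1 / (of_nat n - 1)
        * exp (of_real (f1 n (n_check n))
               + (\<Sum>k=0..n-1. of_rat (d_coeff n k) * deriv riemann_zeta (- of_nat k)))) \<and>
      (\<forall>z. z \<noteq> 0 \<longrightarrow> (\<Sum>k=0..n-1. d_coeff n k * z ^ k) = d_genfun n z) \<and>
      (\<forall>k\<le>n-1. even k = even n \<longrightarrow> d_coeff n k = 0))
     \<and>
     (zeta_det smooth_sphere_functions Y =
        of_real (real n * (real n - 2) / 4) ^ (if n \<ge> 3 then 1 else 0)
        * exp (of_real (f1 n (1 / 2)))
        * (\<Prod>l=1..n-1. inverse (barnes_Gamma l (of_nat n / 2 + 1) * barnes_Gamma l (of_nat n / 2)))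
        * inverse ((barnes_Gamma n (of_nat n / 2 + 1) * barnes_Gamma n (of_nat n / 2)) ^ 2) \<and>
      (n = 1 \<longrightarrow> zeta_det smooth_sphere_functions Y = 16) \<and>
      (n = 2 \<longrightarrow> zeta_det smooth_sphere_functions Y = exp (1 / 2 - 4 * deriv riemann_zeta (- 1))) \<and>
      (\<forall>m. m \<ge> 1 \<and> n = 2 * m + 1 \<longrightarrow> zeta_det smooth_sphere_functions Y =
        of_real (2 powr ((-1) ^ (m + 1) * of_int (double_fact (2 * int m - 3))
                         / (2 ^ (2 * m - 1) * of_int (double_fact (2 * int m)))))
        * exp (\<Sum>k=0..2*m. (1 / 2 ^ k - 1) * of_rat (y_coeff (2 * m + 1) k)
                             * deriv riemann_zeta (- of_nat k))) \<and>
      (\<forall>m. m \<ge> 2 \<and> n = 2 * m \<longrightarrow> zeta_det smooth_sphere_functions Y =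
        exp (of_real (f1 (2 * m) (1 / 2))
             + (\<Sum>k=0..2*m-1. of_rat (y_coeff (2 * m) k) * deriv riemann_zeta (- of_nat k)))) \<and>
      (n \<ge> 3 \<longrightarrow> (\<forall>z. z \<noteq> 0 \<longrightarrow> (\<Sum>k=0..n-1. y_coeff n k * z ^ k) = y_genfun n z)) \<and>
      (n \<ge> 3 \<longrightarrow> (\<forall>k\<le>n-1. even k = even n \<longrightarrow> y_coeff n k = 0)))"
proof (intro conjI)
  let ?V = "smooth_sphere_functions :: ('a \<Rightarrow> real) set"
  note B = zeta_reg_barnes_sum[OF n]
  have pos: "real n > 0" "real n / 2 > 0" "real n / 2 + 1 > 0" using n by auto
  have L: "zeta_det ?V \<Delta> = exp (of_real (f1 n (n_check n)) - (barnes_sum n 1 + barnes_sum n (of_nat n)))"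
    unfolding \<Delta> using zeta_det_laplacian_eq[OF n dim B[of 1] B[OF pos(1)]] by simp
  have C: "zeta_det ?V Y = of_real (real n * (real n - 2) / 4) ^ (if n \<ge> 3 then 1 else 0) *
      exp (of_real (f1 n (1 / 2)) - (barnes_sum n (of_nat n / 2) + barnes_sum n (of_nat n / 2 + 1)))"
    unfolding Y using zeta_det_conformal_eq[OF n dim B[OF pos(2)] B[OF pos(3)]] by simp
  show "zeta_det ?V \<Delta> = exp (of_real (f1 n (n_check n)))
      * (\<Prod>l=1..n-1. inverse (barnes_Gamma l (of_nat n) * barnes_Gamma l 1))
      * inverse ((barnes_Gamma n (of_nat n) * barnes_Gamma n 1) ^ 2)"
    unfolding L add.commute[of "barnes_sum n 1"] diff_conv_add_uminus exp_add exp_barnes_sum[OF n] mult.assoc ..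
  show "n = 1 \<longrightarrow> zeta_det ?V \<Delta> = of_real (4 * pi ^ 2)"
  proof
    assume n1: "n = 1"
    have "f1 n (n_check n) = 0" by (simp add: f1_def n1)
    then have "zeta_det ?V \<Delta> = exp (of_real (2 * ln (2 * pi)))"
      unfolding L barnes_sum_laplacian(2)[OF n n1] by simp
    also have "\<dots> = of_real (exp (ln (2 * pi)) * exp (ln (2 * pi)))"
      unfolding exp_of_real exp_add[symmetric] by simp
    also have "\<dots> = of_real (4 * pi ^ 2)" by (simp add: power2_eq_square)
    finally show "zeta_det ?V \<Delta> = of_real (4 * pi ^ 2)" .
  qed
  show "n \<ge> 2 \<longrightarrow> zeta_det ?V \<Delta> = 1 / (of_nat n - 1)
      * exp (of_real (f1 n (n_check n)) + (\<Sum>k=0..n-1. of_rat (d_coeff n k) * deriv riemann_zeta (- of_nat k)))"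
  proof
    assume n2: "n \<ge> 2"
    let ?S = "\<Sum>k=0..n-1. of_rat (d_coeff n k) * deriv riemann_zeta (- of_nat k)"
    have "of_real ((real n - 1) * 1) * zeta_det ?V \<Delta> = exp (of_real (f1 n (n_check n)) - (- ?S))"
      unfolding L barnes_sum_laplacian(1)[OF n n2]
      using exp_cancel_ln[of "real n - 1" 1 "(real n - 1) * 1" "of_real (f1 n (n_check n))" "- ?S"] n2 by simp
    moreover have "complex_of_real (real n - 1) \<noteq> 0" using n2 unfolding of_real_eq_0_iff by simp
    ultimately show "zeta_det ?V \<Delta> = 1 / (of_nat n - 1) * exp (of_real (f1 n (n_check n)) + ?S)"
      by (simp add: field_simps)
  qed
  show "\<forall>z. z \<noteq> 0 \<longrightarrow> (\<Sum>k=0..n-1. d_coeff n k * z ^ k) = d_genfun n z"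
    unfolding atMost_minus_1[OF n] d_coeff_sum(1)[OF n] using d_genfun_gap[OF n] by simp
  show "\<forall>k\<le>n-1. even k = even n \<longrightarrow> d_coeff n k = 0"
    using d_coeff_sum(2)[OF n] by blast
  show "zeta_det ?V Y = of_real (real n * (real n - 2) / 4) ^ (if n \<ge> 3 then 1 else 0)
      * exp (of_real (f1 n (1 / 2)))
      * (\<Prod>l=1..n-1. inverse (barnes_Gamma l (of_nat n / 2 + 1) * barnes_Gamma l (of_nat n / 2)))
      * inverse ((barnes_Gamma n (of_nat n / 2 + 1) * barnes_Gamma n (of_nat n / 2)) ^ 2)"
    unfolding C add.commute[of "barnes_sum n (of_nat n / 2)"] diff_conv_add_uminus exp_add exp_barnes_sum[OF n] mult.assoc ..
  show "n = 1 \<longrightarrow> zeta_det ?V Y = 16"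
  proof
    assume n1: "n = 1"
    have "f1 n (1 / 2) = 0" by (simp add: f1_def n1)
    then have "zeta_det ?V Y = exp (of_real (4 * ln 2))"
      using C[unfolded n1, unfolded barnes_sum_conformal_1] by (simp add: n1)
    also have "4 * ln (2 :: real) = ln (2 ^ 4)" by (subst ln_realpow) simp_all
    also have "exp (complex_of_real (ln (2 ^ 4))) = of_real (2 ^ 4)" by (simp only: exp_of_real exp_ln zero_less_power zero_less_numeral)
    finally show "zeta_det ?V Y = 16" by simp
  qed
  show "n = 2 \<longrightarrow> zeta_det ?V Y = exp (1 / 2 - 4 * deriv riemann_zeta (- 1))"
  proof
    assume n2: "n = 2"
    show "zeta_det ?V Y = exp (1 / 2 - 4 * deriv riemann_zeta (- 1))"
      unfolding C barnes_sum_conformal(1)[OF n n2] unfolding n2 f1_2_half by simp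
  qed
  show "\<forall>m. m \<ge> 1 \<and> n = 2 * m + 1 \<longrightarrow> zeta_det ?V Y =
      of_real (2 powr ((-1) ^ (m + 1) * of_int (double_fact (2 * int m - 3))
                       / (2 ^ (2 * m - 1) * of_int (double_fact (2 * int m)))))
      * exp (\<Sum>k=0..2*m. (1 / 2 ^ k - 1) * of_rat (y_coeff (2 * m + 1) k) * deriv riemann_zeta (- of_nat k))"
  proof (intro allI impI)
    fix m assume "m \<ge> 1 \<and> n = 2 * m + 1"
    then have m: "m \<ge> 1" and nm: "n = 2 * m + 1" by auto
    let ?S = "\<Sum>k=0..2*m. (1 / 2 ^ k - 1) * of_rat (y_coeff (2 * m + 1) k) * deriv riemann_zeta (- of_nat k)"
    let ?e = "(-1) ^ (m + 1) * of_int (double_fact (2 * int m - 3)) / (2 ^ (2 * m - 1) * of_int (double_fact (2 * int m))) :: real"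
    have f: "f1 n (1 / 2) = 0" by (rule f1_half_odd) (simp add: nm)
    have p: "(if n \<ge> 3 then 1 else 0) = (1 :: nat)" using m nm by simp
    have c: "real n * (real n - 2) / 4 = (real m - 1 / 2) * (real m + 1 / 2)" unfolding nm by (simp add: field_simps)
    have g: "real m - 1 / 2 > 0" "real m + 1 / 2 > 0" using m by simp_all
    \<comment> \<open>The exponent of 2 is the constant coefficient times the zeta value
      \<open>-1 / 2\<close> at 0.\<close>
    have y: "complex_of_real ?e = - of_rat (y_coeff n 0) / 2"
    proof -
      obtain j where j: "m = Suc j" using m by (cases m) auto
      have pw: "(2 :: real) ^ (2 * m - 1) = 2 * 4 ^ (m - 1)" unfolding j by (simp add: power_mult)
      have "real_of_rat (y_coeff n 0) = (- 1) ^ m * of_int (double_fact (2 * int m - 3)) / (4 ^ (m - 1) * of_int (double_fact (2 * int m)))"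
        unfolding nm y_coeff_odd_0[OF m] by (simp add: of_rat_divide of_rat_mult of_rat_power of_rat_minus)
      then have "?e = - real_of_rat (y_coeff n 0) / 2" unfolding pw by simp
      then have "complex_of_real ?e = of_real (- real_of_rat (y_coeff n 0) / 2)" by (rule arg_cong)
      then show ?thesis by (simp only: of_real_minus of_real_divide of_real_of_rat of_real_numeral)
    qed
    have "zeta_det ?V Y = exp (of_real 0 - (of_real (ln 2) * of_rat (y_coeff n 0) / 2 - ?S))"
      unfolding C p f barnes_sum_conformal(2)[OF n m nm] power_one_right by (rule exp_cancel_ln[OF g c])
    also have "of_real 0 - (of_real (ln 2) * of_rat (y_coeff n 0) / 2 - ?S) = complex_of_real (?e * ln 2) + ?S"
      unfolding of_real_mult y by (simp add: algebra_simps)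
    also have "exp \<dots> = of_real (exp (?e * ln 2)) * exp ?S" unfolding exp_add exp_of_real ..
    also have "exp (?e * ln 2) = 2 powr ?e" by (simp add: powr_def)
    finally show "zeta_det ?V Y = of_real (2 powr ?e) * exp ?S" .
  qed
  show "\<forall>m. m \<ge> 2 \<and> n = 2 * m \<longrightarrow> zeta_det ?V Y = exp (of_real (f1 (2 * m) (1 / 2))
      + (\<Sum>k=0..2*m-1. of_rat (y_coeff (2 * m) k) * deriv riemann_zeta (- of_nat k)))"
  proof (intro allI impI)
    fix m assume "m \<ge> 2 \<and> n = 2 * m"
    then have m: "m \<ge> 2" and nm: "n = 2 * m" by auto
    let ?S = "\<Sum>k=0..2*m-1. of_rat (y_coeff (2 * m) k) * deriv riemann_zeta (- of_nat k)"
    have p: "(if n \<ge> 3 then 1 else 0) = (1 :: nat)" using m nm by simp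
    have c: "real n * (real n - 2) / 4 = (real m - 1) * real m" unfolding nm by (simp add: field_simps)
    have g: "real m - 1 > 0" "real m > 0" using m by simp_all
    have "zeta_det ?V Y = exp (of_real (f1 n (1 / 2)) - (- ?S))"
      unfolding C p barnes_sum_conformal(3)[OF n m nm] power_one_right
      by (subst diff_conv_add_uminus) (rule exp_cancel_ln[OF g c])
    then show "zeta_det ?V Y = exp (of_real (f1 (2 * m) (1 / 2)) + ?S)" by (simp add: nm)
  qed
  show "n \<ge> 3 \<longrightarrow> (\<forall>z. z \<noteq> 0 \<longrightarrow> (\<Sum>k=0..n-1. y_coeff n k * z ^ k) = y_genfun n z)"
    unfolding atMost_minus_1[OF n] using y_coeff_sum(1) y_genfun_gap by simp
  show "n \<ge> 3 \<longrightarrow> (\<forall>k\<le>n-1. even k = even n \<longrightarrow> y_coeff n k = 0)"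
    using y_coeff_sum(2) by blast
qed

end
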